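(* Let $\kappa\ge 1$ and let $f:\mathcal I\to\mathbb{C}$ be multiplicative, with Dirichlet series $F(s):=\sum_{\mathfrak a\in\mathcal I} f(\mathfrak a)(\mathrm{N}\mathfrak a)^{-s}$ for $\Re(s)>1$. Assume that the associated von Mangoldt coefficients $\Lambda_f$ of $f$ satisfy $|\Lambda_f(\mathfrak a)|\le \kappa\Lambda(\mathfrak a)$ for all $\mathfrak a\in\mathcal I$. For $x\ge 3$ define $M=M(x)$ by \[ \max_{|t|\le (\log x)^{\kappa}}\left|\frac{F\bigl(1+\frac1{\log x}+it\bigr)}{1+\frac1{\log x}+it}\right| = e^{-M}(\log x)^{\kappa}, \] and put $M_+(x):=\max(M(x),0)$. Then for all $x\ge 3$, \[ \sum_{\mathrm{N}\mathfrak a\le x} f(\mathfrak a)\ \ll_{\kappa}\ (1+M_+(x))e^{-M_+(x)}\,x(\log x)^{\kappa-1}+\frac{x}{\log x}(\log\log x)^{\kappa}. \]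
   Context: $\mathcal I$ is the set of nonzero ideals of $\mathbb{Z}[i]$, $\mathrm{N}$ the ideal norm. $f:\mathcal I\to\mathbb{C}$ is multiplicative if $f(\mathbb{Z}[i])=1$ and $f(\mathfrak a\mathfrak b)=f(\mathfrak a)f(\mathfrak b)$ for coprime $\mathfrak a,\mathfrak b$. The ideal von Mangoldt function is $\Lambda(\mathfrak a)=\log\mathrm{N}\mathfrak p$ if $\mathfrak a=\mathfrak p^m$ for a prime ideal $\mathfrak p$ and $m\ge1$, and $\Lambda(\mathfrak a)=0$ otherwise. Assuming $F$ converges absolutely for $\Re(s)>1$, the associated von Mangoldt coefficients $\Lambda_f(\mathfrak a)$ are defined by $-\frac{F'}{F}(s)=\sum_{\mathfrak a\in\mathcal I}\Lambda_f(\mathfrak a)(\mathrm{N}\mathfrak a)^{-s}$ for $\Re(s)>1$ (they are supported on prime-power ideals). *)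

theory Defs
  imports "HOL-Analysis.Analysis" "HOL-Algebra.QuotRing" "HOL-Algebra.Ideal_Product"
begin

section \<open>Ideals of the ring of Gaussian integers\<close>

definition gauss_int_ring :: "complex ring" where
  "gauss_int_ring =
     \<lparr>carrier = {z. Re z \<in> \<int> \<and> Im z \<in> \<int>}, monoid.mult = (*), one = 1, zero = 0, add = (+)\<rparr>"

lemma cring_gauss_int_ring: "cring gauss_int_ring"
proof (rule cringI)
  show "abelian_group gauss_int_ring"
  proof (rule abelian_groupI)
    fix x assume x: "x \<in> carrier gauss_int_ring"
    show "\<exists>y\<in>carrier gauss_int_ring. y \<oplus>\<^bsub>gauss_int_ring\<^esub> x = \<zero>\<^bsub>gauss_int_ring\<^esub>"
      by (rule bexI[of _ "- x"]) (use x in \<open>auto simp: gauss_int_ring_def\<close>)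
  qed (auto simp: gauss_int_ring_def)
  show "comm_monoid gauss_int_ring"
    by (rule comm_monoidI) (auto simp: gauss_int_ring_def)
qed (auto simp: gauss_int_ring_def algebra_simps)

definition nonzero_ideals :: "complex set set" where
  "nonzero_ideals = {\<aa>. ideal \<aa> gauss_int_ring \<and> \<aa> \<noteq> {0}}"

text \<open>The quotient by a nonzero ideal is finite, so the cardinality below is the ideal norm.\<close>

definition ideal_norm :: "complex set \<Rightarrow> nat" where
  "ideal_norm \<aa> = order (gauss_int_ring Quot \<aa>)"

text \<open>
  Functions on the nonzero ideals are total functions of type \<^typ>\<open>complex set \<Rightarrow> complex\<close>;
  only their values on \<open>nonzero_ideals\<close> are ever used.
\<close>

definition multiplicative_on_ideals :: "(complex set \<Rightarrow> complex) \<Rightarrow> bool" where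
  "multiplicative_on_ideals f \<longleftrightarrow>
     f (carrier gauss_int_ring) = 1 \<and>
     (\<forall>\<aa>\<in>nonzero_ideals. \<forall>\<bb>\<in>nonzero_ideals.
        \<aa> <+>\<^bsub>gauss_int_ring\<^esub> \<bb> = carrier gauss_int_ring \<longrightarrow>
        f (\<aa> \<cdot>\<^bsub>gauss_int_ring\<^esub> \<bb>) = f \<aa> * f \<bb>)"

definition is_prime_power_of :: "complex set \<Rightarrow> complex set \<Rightarrow> bool" where
  "is_prime_power_of \<aa> \<pp> \<longleftrightarrow>
     \<pp> \<in> nonzero_ideals \<and> primeideal \<pp> gauss_int_ring \<and>
     (\<exists>m::nat. m \<ge> 1 \<and> \<aa> = \<pp> [^]\<^bsub>ideals_set gauss_int_ring\<^esub> m)"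

text \<open>By unique factorisation the prime ideal selected by \<open>THE\<close> is unique.\<close>

definition ideal_mangoldt :: "complex set \<Rightarrow> real" where
  "ideal_mangoldt \<aa> =
     (if \<exists>\<pp>. is_prime_power_of \<aa> \<pp>
      then ln (real (ideal_norm (THE \<pp>. is_prime_power_of \<aa> \<pp>))) else 0)"


section \<open>Dirichlet series\<close>

definition dirichlet_term :: "(complex set \<Rightarrow> complex) \<Rightarrow> complex \<Rightarrow> complex set \<Rightarrow> complex" where
  "dirichlet_term f s \<aa> = f \<aa> * of_nat (ideal_norm \<aa>) powr (- s)"

definition dirichlet_abs_conv :: "(complex set \<Rightarrow> complex) \<Rightarrow> bool" where
  "dirichlet_abs_conv f \<longleftrightarrow> (\<forall>s. Re s > 1 \<longrightarrow> (\<lambda>\<aa>. cmod (dirichlet_term f s \<aa>)) summable_on nonzero_ideals)"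

definition dirichlet_series :: "(complex set \<Rightarrow> complex) \<Rightarrow> complex \<Rightarrow> complex" where
  "dirichlet_series f s = infsum (dirichlet_term f s) nonzero_ideals"

text \<open>
  A relation rather than a function: distinct ideals may have the same norm, so the identity
  for \<open>- F' / F\<close> alone does not determine the coefficients \<open>L\<close>.
\<close>

definition mangoldt_coeffs ::
    "(complex set \<Rightarrow> complex) \<Rightarrow> (complex set \<Rightarrow> complex) \<Rightarrow> bool" where
  "mangoldt_coeffs f L \<longleftrightarrow>
     (\<forall>s. Re s > 1 \<longrightarrow>
        (dirichlet_term L s has_sum
           (- (deriv (dirichlet_series f) s / dirichlet_series f s))) nonzero_ideals)"


section \<open>The exponent \<open>M(x)\<close>\<close>

text \<open>
  The supremum is that of a continuous function over a compact interval, i.e. a maximum.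
  It is positive: \<open>F\<close> is not identically zero and, when \<open>-F'/F\<close> is an absolutely convergent
  Dirichlet series for \<open>Re s > 1\<close>, has no zeros there. So the equation defining \<open>M\<close>
  has exactly one solution.
\<close>

definition halasz_max :: "real \<Rightarrow> (complex set \<Rightarrow> complex) \<Rightarrow> real \<Rightarrow> real" where
  "halasz_max \<kappa> f x =
     (SUP t\<in>{t::real. \<bar>t\<bar> \<le> ln x powr \<kappa>}.
        cmod (dirichlet_series f (Complex (1 + 1 / ln x) t) / Complex (1 + 1 / ln x) t))"

definition halasz_M :: "real \<Rightarrow> (complex set \<Rightarrow> complex) \<Rightarrow> real \<Rightarrow> real" where
  "halasz_M \<kappa> f x = (THE M. halasz_max \<kappa> f x = exp (- M) * ln x powr \<kappa>)"

definition halasz_M_plus :: "real \<Rightarrow> (complex set \<Rightarrow> complex) \<Rightarrow> real \<Rightarrow> real" where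
  "halasz_M_plus \<kappa> f x = max (halasz_M \<kappa> f x) 0"

end

theory Submission
  imports Defs "HOL-Number_Theory.Number_Theory" "HOL-Probability.Sinc_Integral"
    "HOL-Complex_Analysis.Complex_Analysis" "HOL-Computational_Algebra.Squarefree" "HOL-Real_Asymp.Real_Asymp"
begin

text \<open>
  Let \<open>a(n)\<close> be the sum of \<open>f\<close> over the ideals of norm \<open>n\<close>, let \<open>l(n)\<close> be that of \<open>\<Lambda>\<^sub>f\<close>, and
  \<open>S(n) = \<Sum>\<^bsub>k \<le> n\<^esub> a(k)\<close>. Uniqueness of Dirichlet coefficients turns the hypothesis on \<open>F' / F\<close> into
  \<open>a \<cdot> log = l * a\<close>, so \<open>S(n) log n\<close> is \<open>\<Sum>\<^bsub>d \<le> n\<^esub> l(d) S(n div d)\<close> up to a small error. Put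
  \<open>y = (log x) powr (4 \<kappa>)\<close>. The \<open>d \<le> y\<close> are absorbed by self-improvement, and for \<open>d > y\<close> the
  Brun-Titchmarsh inequality replaces \<open>\<Lambda>(d)\<close> by its average; hence \<open>|S(x)| \<lesssim> x (1 + J) / log x\<close> with
  \<open>J = \<Sum>\<^bsub>m \<le> x\<^esub> |S(m)| / m\<^sup>2\<close>. To bound \<open>J\<close>, split it dyadically in \<open>log m\<close>, apply Cauchy-Schwarz
  and Parseval on the line \<open>Re s = 1 + 2 ^ (- j)\<close>, and estimate \<open>F(s) / s\<close> there by its maximum
  (through the maximum modulus principle, or trivially), leaving the mean square of
  \<open>\<Sum>\<^bsub>d > y\<^esub> l(d) d powr (- s)\<close>, which is again controlled by Brun-Titchmarsh. The sum over the blocks is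
  \<open>\<Sum> min (e ^ (- M)) (2 ^ (- i)) \<lesssim> (1 + M) e ^ (- M)\<close>.
\<close>

section \<open>The Selberg sieve and the Brun-Titchmarsh inequality\<close>

text \<open>The parameter \<open>T = (log x) powr \<kappa>\<close> serves three purposes. Up to a
  constant it is the trivial bound for F on Re s >= 1 + 1 / log x, so |F(s) / s| is bounded once |Im
  s| >= T. It is the number of bins per factor e into which the d > y are cut, so that the error of
  averaging |S(n div d)| over a bin, essentially the sum of |a(n)| / n divided by T, is bounded. And
  a bin at g has length about g / T, which reaches the range g^(3/4) of the Brun-Titchmarsh
  inequality when g >= T^4; hence the choice of y. The d <= y carry a logarithmic mass of order log
  y, that is log log x, and can be absorbed in J only where log n exceeds a multiple of it. The
  remaining n are estimated trivially and produce the term with (log log x)^\<kappa>. The trivial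
  bound must have exponent \<kappa>, although \<open>l\<close> is only bounded by 2 \<kappa>
  \<Lambda> in terms of rational primes. The exponent is saved by keeping the weight 1 + \<chi>(n):
  the comparison series is then a power of the Dedekind zeta function, whose factor L(\<sigma>,
  \<chi>) stays below 1.\<close>

lemma sum_alternating_between:
  assumes "finite L" "K \<subseteq> L"
  shows "(\<Sum>D | K \<subseteq> D \<and> D \<subseteq> L. (-1::real) ^ card (L - D)) = (if K = L then 1 else 0)"
proof -
  have fin: "finite (L - K)" using assms by auto
  have bij: "bij_betw (\<lambda>X. L - X) (Pow (L - K)) {D. K \<subseteq> D \<and> D \<subseteq> L}"
    by (rule bij_betwI[where g = "\<lambda>D. L - D"]) (use assms in auto)
  have "(\<Sum>D | K \<subseteq> D \<and> D \<subseteq> L. (-1::real) ^ card (L - D))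
      = (\<Sum>X\<in>Pow (L - K). (-1) ^ card (L - (L - X)))"
    by (rule sum.reindex_bij_betw[OF bij, symmetric])
  \<comment> \<open>The signs are written as products so that \<open>prod_add\<close> recognises the
    expansion of the product of -1 + 1 over L - K, which is 0 unless L - K is empty. This is Moebius
    inversion on the lattice of subsets.\<close>
  also have "\<dots> = (\<Sum>X\<in>Pow (L - K). (\<Prod>x\<in>X. (-1)) * (\<Prod>x\<in>L - K - X. 1))"
  proof (rule sum.cong[OF refl])
    fix X assume "X \<in> Pow (L - K)"
    then have "L - (L - X) = X" by auto
    then show "(-1::real) ^ card (L - (L - X)) = (\<Prod>x\<in>X. (-1)) * (\<Prod>x\<in>L - K - X. 1)"
      by simp
  qed
  also have "\<dots> = (\<Prod>x\<in>L - K. (-1) + 1)"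
    by (rule prod_add[OF fin, symmetric])
  also have "\<dots> = (if K = L then 1 else 0)"
    using assms fin by (auto simp: power_0_left card_eq_0_iff)
  finally show ?thesis .
qed

locale selberg_sieve =
  fixes z :: nat
  assumes z: "z \<ge> 1"
begin

text \<open>Squarefree moduli are represented by their sets of prime factors: divisibility becomes
  inclusion, the least common multiple becomes union, the greatest common divisor becomes
  intersection, and the Moebius function becomes (-1) ^ card.\<close>

definition \<D> :: "nat set set" where "\<D> = {D. D \<subseteq> {p. prime p \<and> p \<le> z} \<and> \<Prod>D \<le> z}"
definition \<phi> :: "nat set \<Rightarrow> real" where "\<phi> D = (\<Prod>p\<in>D. real p - 1)"
definition G :: real where "G = (\<Sum>D\<in>\<D>. 1 / \<phi> D)"
text \<open>The variables that diagonalise the quadratic form of the sieve, at the point where it is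
  minimal subject to \<open>\<rho> {} = 1\<close>.\<close>

definition Y :: "nat set \<Rightarrow> real" where "Y D = (-1) ^ card D / (\<phi> D * G)"
text \<open>Selberg's weights, usually called lambda, recovered from the diagonal variables by
  Moebius inversion.\<close>

definition \<rho> :: "nat set \<Rightarrow> real" where
  "\<rho> D = real (\<Prod>D) * (\<Sum>L | L \<in> \<D> \<and> D \<subseteq> L. (-1) ^ card (L - D) * Y L)"

lemma finite_primes: "finite {p::nat. prime p \<and> p \<le> z}"
  by (rule finite_subset[of _ "{..z}"]) auto

lemma finite_\<D>: "finite \<D>"
  by (rule finite_subset[of _ "Pow {p. prime p \<and> p \<le> z}"]) (auto simp: \<D>_def finite_primes)

lemma \<D>_finite: "D \<in> \<D> \<Longrightarrow> finite D"
  using finite_primes unfolding \<D>_def by (auto intro: finite_subset)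

lemma \<D>_prime: "D \<in> \<D> \<Longrightarrow> p \<in> D \<Longrightarrow> prime p"
  unfolding \<D>_def by auto

lemma \<D>_prod_pos: "D \<in> \<D> \<Longrightarrow> \<Prod>D > 0"
  using \<D>_prime by (intro prod_pos) (auto simp: prime_gt_0_nat)

lemma \<D>_prod_le: "D \<in> \<D> \<Longrightarrow> \<Prod>D \<le> z"
  unfolding \<D>_def by auto

lemma empty_in_\<D>: "{} \<in> \<D>" using z unfolding \<D>_def by auto

lemma \<D>_subset:
  assumes "D \<in> \<D>" "K \<subseteq> D" shows "K \<in> \<D>"
proof -
  have "\<Prod>K dvd \<Prod>D" using assms \<D>_finite by (intro prod_dvd_prod_subset) auto
  then have "\<Prod>K \<le> \<Prod>D" using \<D>_prod_pos[OF assms(1)] by (auto intro: dvd_imp_le)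
  then show ?thesis using assms unfolding \<D>_def by auto
qed

lemma \<phi>_ge_1: "D \<in> \<D> \<Longrightarrow> \<phi> D \<ge> 1"
proof -
  assume "D \<in> \<D>"
  then have "2 \<le> p" if "p \<in> D" for p using that \<D>_prime prime_ge_2_nat by blast
  then show ?thesis unfolding \<phi>_def by (intro prod_ge_1) force
qed

lemma \<phi>_le: "D \<in> \<D> \<Longrightarrow> \<phi> D \<le> real (\<Prod>D)"
proof -
  assume "D \<in> \<D>"
  then have "2 \<le> p" if "p \<in> D" for p using that \<D>_prime prime_ge_2_nat by blast
  then show ?thesis unfolding \<phi>_def of_nat_prod by (intro prod_mono) force
qed

lemma G_pos: "G \<ge> 1"
proof -
  have "1 / \<phi> {} \<le> G" unfolding G_def
    using empty_in_\<D> finite_\<D> by (intro member_le_sum) (auto dest: \<phi>_ge_1)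
  then show ?thesis by (simp add: \<phi>_def)
qed

lemma \<rho>_empty: "\<rho> {} = 1"
proof -
  have "\<rho> {} = (\<Sum>L\<in>\<D>. 1 / \<phi> L / G)"
    unfolding \<rho>_def Y_def by (simp flip: power_add mult_2)
  also have "\<dots> = G / G" by (simp only: G_def flip: sum_divide_distrib)
  finally show ?thesis using G_pos by simp
qed

text \<open>Bounding every sign by 1 leaves at most the sum of \<open>|Y L|\<close> over
  \<open>\<D>\<close>, which is G / G = 1, so only the factor \<open>\<Prod>D\<close> remains. The
  crude bound costs a power of z in the error term of the sieve, affordable because z will be a
  small power of the interval length.\<close>

lemma abs_\<rho>_le:
  assumes "D \<in> \<D>" shows "\<bar>\<rho> D\<bar> \<le> real z"
proof -
  have "\<bar>\<Sum>L | L \<in> \<D> \<and> D \<subseteq> L. (-1) ^ card (L - D) * Y L\<bar> \<le> (\<Sum>L | L \<in> \<D> \<and> D \<subseteq> L. \<bar>Y L\<bar>)"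
    by (rule order_trans[OF sum_abs]) (simp add: abs_mult power_abs)
  also have "\<dots> \<le> (\<Sum>L\<in>\<D>. \<bar>Y L\<bar>)"
    by (rule sum_mono2) (auto simp: finite_\<D>)
  also have "\<dots> = (\<Sum>L\<in>\<D>. 1 / \<phi> L / G)"
    unfolding Y_def using G_pos \<phi>_ge_1
    by (intro sum.cong refl) (auto simp: abs_mult power_abs abs_of_pos dest!: \<phi>_ge_1)
  also have "\<dots> = G / G" by (simp only: G_def flip: sum_divide_distrib)
  also have "\<dots> = 1" using G_pos by simp
  finally have *: "\<bar>\<Sum>L | L \<in> \<D> \<and> D \<subseteq> L. (-1) ^ card (L - D) * Y L\<bar> \<le> 1" .
  have "\<bar>\<rho> D\<bar> \<le> real (\<Prod>D) * 1"
    unfolding \<rho>_def abs_mult using * by (intro mult_mono) (auto simp del: of_nat_prod)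
  also have "\<dots> \<le> real z" using \<D>_prod_le[OF assms] by (simp del: of_nat_prod)
  finally show ?thesis .
qed

text \<open>Inserting the definition of \<open>\<rho>\<close> and exchanging the sums leaves the
  alternating sum over the sets between K and L, so the Moebius inversion is undone.\<close>

lemma sum_\<rho>_above:
  assumes K: "K \<in> \<D>"
  shows "(\<Sum>D | D \<in> \<D> \<and> K \<subseteq> D. \<rho> D / real (\<Prod>D)) = Y K"
proof -
  have "(\<Sum>D | D \<in> \<D> \<and> K \<subseteq> D. \<rho> D / real (\<Prod>D))
      = (\<Sum>D | D \<in> \<D> \<and> K \<subseteq> D. \<Sum>L | L \<in> \<D> \<and> D \<subseteq> L. (-1) ^ card (L - D) * Y L)"
    by (intro sum.cong refl) (use \<D>_prod_pos in \<open>force simp: \<rho>_def simp del: of_nat_prod\<close>)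
  also have "\<dots> = (\<Sum>D | D \<in> \<D> \<and> K \<subseteq> D. \<Sum>L\<in>\<D>. if D \<subseteq> L then (-1) ^ card (L - D) * Y L else 0)"
    by (intro sum.cong refl sum.mono_neutral_cong_left) (auto simp: finite_\<D>)
  also have "\<dots> = (\<Sum>L\<in>\<D>. \<Sum>D | D \<in> \<D> \<and> K \<subseteq> D. if D \<subseteq> L then (-1) ^ card (L - D) * Y L else 0)"
    by (rule sum.swap)
  also have "\<dots> = (\<Sum>L\<in>\<D>. if L = K then Y L else 0)"
  proof (rule sum.cong[OF refl])
    fix L assume L: "L \<in> \<D>"
    have "(\<Sum>D | D \<in> \<D> \<and> K \<subseteq> D. if D \<subseteq> L then (-1) ^ card (L - D) * Y L else 0)
       = (\<Sum>D | K \<subseteq> D \<and> D \<subseteq> L. (-1) ^ card (L - D) * Y L)"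
      using L \<D>_subset by (intro sum.mono_neutral_cong_right) (auto simp: finite_\<D>)
    also have "\<dots> = (\<Sum>D | K \<subseteq> D \<and> D \<subseteq> L. (-1) ^ card (L - D)) * Y L"
      by (simp add: sum_distrib_right)
    also have "\<dots> = (if L = K then Y L else 0)"
    proof (cases "K \<subseteq> L")
      case True
      then show ?thesis using sum_alternating_between[OF \<D>_finite[OF L] True] by auto
    next
      case False
      then have "{D. K \<subseteq> D \<and> D \<subseteq> L} = {}" "L \<noteq> K" by auto
      then show ?thesis by (simp only: sum.empty if_False mult_zero_left)
    qed
    finally show "(\<Sum>D | D \<in> \<D> \<and> K \<subseteq> D. if D \<subseteq> L then (-1) ^ card (L - D) * Y L else 0)
       = (if L = K then Y L else 0)" .
  qed
  also have "\<dots> = Y K" using K finite_\<D> by simp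
  finally show ?thesis .
qed

text \<open>A number is the sum of Euler's totient over its divisors, here for the gcd of the two
  moduli. This separates the variables D and E in the quadratic form.\<close>

lemma prod_Int_eq_sum_\<phi>:
  assumes "D \<in> \<D>" "E \<in> \<D>"
  shows "real (\<Prod>(D \<inter> E)) = (\<Sum>K\<in>\<D>. if K \<subseteq> D \<and> K \<subseteq> E then \<phi> K else 0)"
proof -
  have fin: "finite (D \<inter> E)" using assms \<D>_finite by auto
  have "real (\<Prod>(D \<inter> E)) = (\<Prod>p\<in>D \<inter> E. (real p - 1) + 1)" by simp
  also have "\<dots> = (\<Sum>K\<in>Pow (D \<inter> E). \<phi> K)" by (subst prod_add[OF fin]) (simp add: \<phi>_def)
  also have "\<dots> = (\<Sum>K\<in>\<D>. if K \<subseteq> D \<and> K \<subseteq> E then \<phi> K else 0)"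
    using assms(1) \<D>_subset by (intro sum.mono_neutral_cong_left) (auto simp: finite_\<D>)
  finally show ?thesis .
qed

lemma prod_Un_inverse:
  assumes "D \<in> \<D>" "E \<in> \<D>"
  shows "1 / real (\<Prod>(D \<union> E)) = real (\<Prod>(D \<inter> E)) / (real (\<Prod>D) * real (\<Prod>E))"
proof -
  have "\<Prod>(D \<union> E) * \<Prod>(D \<inter> E) = \<Prod>D * \<Prod>E"
    using assms \<D>_finite by (intro prod.union_inter) auto
  then have "real (\<Prod>(D \<union> E)) * real (\<Prod>(D \<inter> E)) = real (\<Prod>D) * real (\<Prod>E)"
    by (metis of_nat_mult)
  moreover have "real (\<Prod>D) \<noteq> 0" "real (\<Prod>E) \<noteq> 0" using \<D>_prod_pos[OF assms(1)] \<D>_prod_pos[OF assms(2)] by (simp_all del: of_nat_prod)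
  moreover from calculation have "real (\<Prod>(D \<union> E)) \<noteq> 0" by (metis mult_eq_0_iff)
  ultimately show ?thesis by (simp add: field_simps)
qed

text \<open>Writing 1 / lcm as the gcd over the product, and the gcd as a sum of totients,
  diagonalises the form into the sum of \<open>\<phi> K * (Y K)\<^sup>2\<close>; by the choice of
  \<open>Y\<close> each term is \<open>1 / (\<phi> K * G\<^sup>2)\<close>.\<close>

lemma quadratic_form:
  "(\<Sum>D\<in>\<D>. \<Sum>E\<in>\<D>. \<rho> D * \<rho> E / real (\<Prod>(D \<union> E))) = 1 / G"
proof -
  define r where "r D = \<rho> D / real (\<Prod>D)" for D
  have "(\<Sum>D\<in>\<D>. \<Sum>E\<in>\<D>. \<rho> D * \<rho> E / real (\<Prod>(D \<union> E)))
     = (\<Sum>D\<in>\<D>. \<Sum>E\<in>\<D>. \<Sum>K\<in>\<D>. \<phi> K * (if K \<subseteq> D then r D else 0) * (if K \<subseteq> E then r E else 0))"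
  proof (intro sum.cong refl)
    fix D E assume DE: "D \<in> \<D>" "E \<in> \<D>"
    have "\<rho> D * \<rho> E / real (\<Prod>(D \<union> E)) = \<rho> D * \<rho> E * (1 / real (\<Prod>(D \<union> E)))" by simp
    also have "\<dots> = r D * r E * real (\<Prod>(D \<inter> E))"
      unfolding prod_Un_inverse[OF DE] r_def by simp
    also have "\<dots> = (\<Sum>K\<in>\<D>. r D * r E * (if K \<subseteq> D \<and> K \<subseteq> E then \<phi> K else 0))"
      unfolding prod_Int_eq_sum_\<phi>[OF DE] by (simp add: sum_distrib_left)
    also have "\<dots> = (\<Sum>K\<in>\<D>. \<phi> K * (if K \<subseteq> D then r D else 0) * (if K \<subseteq> E then r E else 0))"
      by (intro sum.cong refl) auto
    finally show "\<rho> D * \<rho> E / real (\<Prod>(D \<union> E)) = \<dots>" .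
  qed
  also have "\<dots> = (\<Sum>D\<in>\<D>. \<Sum>K\<in>\<D>. \<Sum>E\<in>\<D>. \<phi> K * (if K \<subseteq> D then r D else 0) * (if K \<subseteq> E then r E else 0))"
    by (intro sum.cong refl sum.swap)
  also have "\<dots> = (\<Sum>K\<in>\<D>. \<Sum>D\<in>\<D>. \<Sum>E\<in>\<D>. \<phi> K * (if K \<subseteq> D then r D else 0) * (if K \<subseteq> E then r E else 0))"
    by (rule sum.swap)
  also have "\<dots> = (\<Sum>K\<in>\<D>. \<phi> K * (\<Sum>D\<in>\<D>. if K \<subseteq> D then r D else 0)\<^sup>2)"
    by (intro sum.cong refl) (simp add: power2_eq_square sum_product[of _ \<D> _ \<D>] sum_distrib_left[of "\<phi> _"] mult.assoc)
  also have "\<dots> = (\<Sum>K\<in>\<D>. 1 / \<phi> K / (G * G))"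
  proof (intro sum.cong refl)
    fix K assume K: "K \<in> \<D>"
    have "(\<Sum>D\<in>\<D>. if K \<subseteq> D then r D else 0) = (\<Sum>D | D \<in> \<D> \<and> K \<subseteq> D. r D)"
      by (intro sum.mono_neutral_cong_right) (auto simp: finite_\<D>)
    also have "\<dots> = Y K" unfolding r_def by (rule sum_\<rho>_above[OF K])
    finally have *: "(\<Sum>D\<in>\<D>. if K \<subseteq> D then r D else 0) = Y K" .
    show "\<phi> K * (\<Sum>D\<in>\<D>. if K \<subseteq> D then r D else 0)\<^sup>2 = 1 / \<phi> K / (G * G)"
      unfolding * Y_def using \<phi>_ge_1[OF K] G_pos
      by (simp add: power2_eq_square field_simps flip: power_add mult_2)
  qed
  also have "\<dots> = G / (G * G)" by (simp only: G_def flip: sum_divide_distrib)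
  finally show ?thesis using G_pos by simp
qed

lemma inj_prod_\<D>: "inj_on (\<lambda>D. \<Prod>D) \<D>"
proof (rule inj_onI)
  have "prime_factors (\<Prod>D) = D" if "D \<in> \<D>" for D
    using that \<D>_prime \<D>_finite
    by (subst prime_factors_prod) (auto simp: prime_factorization_prime dest: \<D>_prime)
  then show "D = E" if "D \<in> \<D>" "E \<in> \<D>" "\<Prod>D = \<Prod>E" for D E using that by metis
qed

lemma card_\<D>: "card \<D> \<le> z"
proof -
  have "card ((\<lambda>D. \<Prod>D) ` \<D>) \<le> card {1..z}"
    using \<D>_prod_pos \<D>_prod_le by (intro card_mono) (auto simp: Suc_le_eq)
  then show ?thesis by (simp add: card_image[OF inj_prod_\<D>])
qed

text \<open>Every n <= z is a squarefree number times a square. The prime set of the squarefree part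
  lies in \<open>\<D>\<close>, where 1 over the product is at most \<open>1 / \<phi> D\<close>, and
  the factor 2 bounds the sum of the inverse squares.\<close>

lemma G_ge_harmonic: "(\<Sum>n=1..z. 1 / real n) \<le> 2 * G"
proof -
  define f where "f n = (prime_factors (squarefree_part n), square_part n)" for n :: nat
  have sq: "\<Prod>(prime_factors (squarefree_part n)) = squarefree_part n" if "n > 0" for n :: nat
  proof -
    have "squarefree_part n > 0" using squarefree_part_nonzero[of n] by (simp only: neq0_conv)
    then have "squarefree_part n = (\<Prod>p\<in>prime_factors (squarefree_part n). p ^ multiplicity p (squarefree_part n))"
      by (rule prime_factorization_nat)
    also have "\<dots> = \<Prod>(prime_factors (squarefree_part n))"
    proof (intro prod.cong refl)
      fix p assume "p \<in> prime_factors (squarefree_part n)"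
      then have "multiplicity p (squarefree_part n) = 1"
        using squarefree_factorial_semiring'[of "squarefree_part n"] squarefree_part_nonzero squarefree_squarefree_part
        by blast
      then show "p ^ multiplicity p (squarefree_part n) = p" by (simp only: power_one_right)
    qed
    finally show ?thesis by (rule sym)
  qed
  have n_eq: "n = \<Prod>(fst (f n)) * (snd (f n))\<^sup>2" if "n > 0" for n
    unfolding f_def fst_conv snd_conv sq[OF that] by (rule squarefree_decompose)
  have range: "fst (f n) \<in> \<D> \<and> snd (f n) \<in> {1..z}" if "n \<in> {1..z}" for n
  proof -
    have n: "n > 0" "n \<le> z" using that by auto
    have sp: "square_part n > 0"
    proof (rule ccontr)
      assume "\<not> square_part n > 0"
      then have "snd (f n) = 0" by (simp add: f_def)
      then have "n = 0" using n_eq[OF n(1)] by (metis mult_0_right power_zero_numeral)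
      then show False using n by simp
    qed
    have d: "\<Prod>(fst (f n)) dvd n" "snd (f n) dvd n"
      using n_eq[OF n(1)] by (metis dvd_triv_left, metis dvd_mult dvd_triv_left power2_eq_square)
    then have "\<Prod>(fst (f n)) \<le> z" "snd (f n) \<le> z"
      using n by (meson dvd_imp_le le_trans)+
    moreover have "p \<le> z" if "p \<in> fst (f n)" for p
    proof -
      have "p dvd n" using that squarefree_decompose[of n] unfolding f_def
        by (metis dvd_mult2 fst_conv in_prime_factors_imp_dvd)
      then show ?thesis using n by (meson dvd_imp_le le_trans)
    qed
    ultimately show ?thesis using sp unfolding \<D>_def f_def by auto
  qed
  have inj: "inj_on f {1..z}"
  proof (rule inj_onI)
    fix m n assume mn: "m \<in> {1..z}" "n \<in> {1..z}" "f m = f n"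
    have "m > 0" "n > 0" using mn by auto
    show "m = n" using n_eq[OF \<open>m > 0\<close>] n_eq[OF \<open>n > 0\<close>] unfolding mn(3) by (rule trans[OF _ sym])
  qed
  have "(\<Sum>n=1..z. 1 / real n) = (\<Sum>n=1..z. 1 / real (\<Prod>(fst (f n))) * (1 / (real (snd (f n)))\<^sup>2))"
  proof (intro sum.cong refl)
    fix n assume "n \<in> {1..z}"
    then have "n > 0" by simp
    from n_eq[OF this] have "real n = real (\<Prod>(fst (f n))) * (real (snd (f n)))\<^sup>2"
      by (metis of_nat_mult of_nat_power)
    then show "1 / real n = 1 / real (\<Prod>(fst (f n))) * (1 / (real (snd (f n)))\<^sup>2)"
      by (metis mult.right_neutral times_divide_times_eq)
  qed
  also have "\<dots> = (\<Sum>(D,m)\<in>f ` {1..z}. 1 / real (\<Prod>D) * (1 / (real m)\<^sup>2))"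
    by (subst sum.reindex[OF inj]) (simp add: case_prod_unfold)
  also have "\<dots> \<le> (\<Sum>(D,m)\<in>\<D> \<times> {1..z}. 1 / real (\<Prod>D) * (1 / (real m)\<^sup>2))"
  proof (rule sum_mono2)
    show "f ` {1..z} \<subseteq> \<D> \<times> {1..z}"
    proof
      fix q assume "q \<in> f ` {1..z}"
      then obtain n where "n \<in> {1..z}" "q = f n" by auto
      then show "q \<in> \<D> \<times> {1..z}" using range[of n] by (simp add: mem_Times_iff)
    qed
  qed (auto simp: finite_\<D> prod_nonneg)
  also have "\<dots> = (\<Sum>D\<in>\<D>. 1 / real (\<Prod>D)) * (\<Sum>m=1..z. 1 / (real m)\<^sup>2)"
    by (simp add: sum_product sum.cartesian_product)
  also have "\<dots> \<le> G * 2"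
  proof (rule mult_mono)
    show "(\<Sum>D\<in>\<D>. 1 / real (\<Prod>D)) \<le> G" unfolding G_def
    proof (intro sum_mono divide_left_mono)
      fix D assume D: "D \<in> \<D>"
      show "\<phi> D \<le> real (\<Prod>D)" by (rule \<phi>_le[OF D])
      show "0 < real (\<Prod>D) * \<phi> D" using \<phi>_ge_1[OF D] \<D>_prod_pos[OF D]
        by (intro mult_pos_pos) (auto simp del: of_nat_prod)
    qed simp
    have "(\<Sum>m=1..k. 1 / (real m)\<^sup>2) \<le> 2 - 1 / real k" if "k \<ge> 1" for k
      using that
    proof (induction k rule: nat_induct_at_least)
      case base then show ?case by simp
    next
      case (Suc n)
      have "1 / (real (Suc n))\<^sup>2 \<le> 1 / real n - 1 / real (Suc n)"
      proof -
        have "1 / (real (Suc n))\<^sup>2 \<le> 1 / (real n * real (Suc n))"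
          unfolding power2_eq_square using Suc.hyps by (intro divide_left_mono mult_right_mono mult_pos_pos) auto
        also have "\<dots> = 1 / real n - 1 / real (Suc n)" using Suc.hyps by (simp add: field_simps)
        finally show ?thesis .
      qed
      then show ?case using Suc.IH by simp
    qed
    from this[OF z] show "(\<Sum>m=1..z. 1 / (real m)\<^sup>2) \<le> 2"
      by (smt (verit) divide_nonneg_nonneg of_nat_0_le_iff)
    show "0 \<le> G" using G_pos by simp
  qed (auto intro: sum_nonneg)
  finally show ?thesis by simp
qed

lemma G_ge_ln: "ln (real z) \<le> 2 * G"
proof -
  have "ln (real k + 1) \<le> (\<Sum>n=1..k. 1 / real n)" for k
  proof (induction k)
    case (Suc k)
    have "ln (real (Suc k) + 1) - ln (real k + 1) = ln ((real k + 2) / (real k + 1))"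
      by (simp add: ln_div add.commute)
    also have "\<dots> \<le> (real k + 2) / (real k + 1) - 1" by (intro ln_le_minus_one) auto
    also have "\<dots> = 1 / real (Suc k)" by (simp add: field_simps)
    finally show ?case using Suc by simp
  qed simp
  moreover have "ln (real z) \<le> ln (real z + 1)" using z by simp
  ultimately show ?thesis using G_ge_harmonic by (meson order_trans)
qed

lemma card_multiples_interval:
  fixes t h :: real
  assumes "t \<ge> 0" "h \<ge> 0" "m > 0"
  shows "\<bar>real (card {n::nat. t < real n \<and> real n \<le> t + h \<and> m dvd n}) - h / real m\<bar> \<le> 1"
proof -
  define a b where "a = nat \<lfloor>t / real m\<rfloor>" and "b = nat \<lfloor>(t + h) / real m\<rfloor>"
  have ab: "a \<le> b" unfolding a_def b_def using assms by (intro nat_mono floor_mono divide_right_mono) auto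
  have le_iff: "real n \<le> u / real m \<longleftrightarrow> n \<le> nat \<lfloor>u / real m\<rfloor>" if "u \<ge> 0" for n and u :: real
    using that by (simp add: le_nat_floor nat_le_iff le_nat_iff le_floor_iff)
  have "{n::nat. t < real n \<and> real n \<le> t + h \<and> m dvd n} = (\<lambda>k. m * k) ` {a<..b}"
  proof (intro equalityI subsetI)
    fix n assume "n \<in> {n::nat. t < real n \<and> real n \<le> t + h \<and> m dvd n}"
    then obtain k where "n = m * k" "t < real n" "real n \<le> t + h" by blast
    then have k: "n = m * k" "t < real m * real k" "real m * real k \<le> t + h" by auto
    then have "\<not> real k \<le> t / real m" "real k \<le> (t + h) / real m"
      using assms by (auto simp: field_simps)
    then have "k \<in> {a<..b}" using le_iff[of t] le_iff[of "t + h"] assms unfolding a_def b_def by auto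
    then show "n \<in> (\<lambda>k. m * k) ` {a<..b}" using k by auto
  next
    fix n assume "n \<in> (\<lambda>k. m * k) ` {a<..b}"
    then obtain k where "k \<in> {a<..b}" and k: "n = m * k" by (rule imageE)
    then have k: "n = m * k" "k > a" "k \<le> b" by auto
    then have "\<not> real k \<le> t / real m" "real k \<le> (t + h) / real m"
      using le_iff[of t] le_iff[of "t + h"] assms unfolding a_def b_def by auto
    then show "n \<in> {n::nat. t < real n \<and> real n \<le> t + h \<and> m dvd n}"
      using k assms by (auto simp: field_simps)
  qed
  then have "card {n::nat. t < real n \<and> real n \<le> t + h \<and> m dvd n} = card {a<..b}"
    using assms by (simp add: card_image inj_on_def)
  then have c: "real (card {n::nat. t < real n \<and> real n \<le> t + h \<and> m dvd n}) = real b - real a"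
    using ab by (simp add: of_nat_diff)
  have "real a = of_int \<lfloor>t / real m\<rfloor>" "real b = of_int \<lfloor>(t + h) / real m\<rfloor>"
    unfolding a_def b_def using assms by auto
  moreover have "(t + h) / real m = t / real m + h / real m" by (simp add: add_divide_distrib)
  ultimately show ?thesis unfolding c by linarith
qed

text \<open>Selberg's upper bound. The square of \<open>w n\<close> is nonnegative everywhere and
  equals 1 at the primes above z, so it majorises their indicator. Summed over the interval, its
  main part is h times the quadratic form, that is h / G. The rounding errors of at most z^2 pairs
  of moduli, each weighted by at most z^2, give z^4, and the primes up to z are counted one by
  one.\<close>

lemma card_primes_interval:
  fixes t h :: real
  assumes "t \<ge> 0" "h \<ge> 0"
  shows "real (card {p. prime p \<and> t < real p \<and> real p \<le> t + h}) \<le> real z + h / G + real z ^ 4"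
proof -
  define I where "I = {n::nat. t < real n \<and> real n \<le> t + h}"
  have fI: "finite I" unfolding I_def
    by (rule finite_subset[of _ "{..nat \<lfloor>t + h\<rfloor>}"]) (auto simp: le_nat_floor)
  define w where "w n = (\<Sum>D\<in>\<D>. if \<Prod>D dvd n then \<rho> D else 0)" for n
  have "card {p. prime p \<and> t < real p \<and> real p \<le> t + h} \<le> card ({..z} - {0} \<union> {p \<in> I. prime p \<and> p > z})"
    by (intro card_mono finite_UnI) (auto intro: finite_subset[OF _ fI] simp: I_def prime_gt_0_nat)
  also have "\<dots> \<le> card ({..z} - {0}) + card {p \<in> I. prime p \<and> p > z}" by (rule card_Un_le)
  also have "card ({..z} - {0}) = z" by simp
  finally have 1: "real (card {p. prime p \<and> t < real p \<and> real p \<le> t + h})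
      \<le> real z + real (card {p \<in> I. prime p \<and> p > z})" by linarith
  have "real (card {p \<in> I. prime p \<and> p > z}) = (\<Sum>p\<in>{p \<in> I. prime p \<and> p > z}. (w p)\<^sup>2)"
  proof -
    \<comment> \<open>A product over a set in \<open>\<D>\<close> is at most z, so the only one that
      divides a prime p > z is the empty product.\<close>
    have "w p = 1" if "prime p" "p > z" for p
    proof -
      have "\<Prod>D dvd p \<longleftrightarrow> D = {}" if "D \<in> \<D>" for D
      proof
        assume "\<Prod>D dvd p"
        then have "\<Prod>D = 1 \<or> \<Prod>D = p" using \<open>prime p\<close> by (auto simp: prime_nat_iff)
        then have "\<Prod>D = \<Prod>{}" using \<D>_prod_le[OF that] \<open>p > z\<close> by auto
        then show "D = {}" using inj_prod_\<D> that empty_in_\<D> by (metis inj_onD)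
      qed auto
      then have "w p = (\<Sum>D\<in>\<D>. if D = {} then \<rho> D else 0)" unfolding w_def by (intro sum.cong) auto
      then show ?thesis using empty_in_\<D> finite_\<D> \<rho>_empty by simp
    qed
    then show ?thesis by simp
  qed
  also have "\<dots> \<le> (\<Sum>n\<in>I. (w n)\<^sup>2)" using fI by (intro sum_mono2) auto
  also have "\<dots> = (\<Sum>n\<in>I. \<Sum>D\<in>\<D>. \<Sum>E\<in>\<D>. \<rho> D * \<rho> E * (if \<Prod>(D \<union> E) dvd n then 1 else 0))"
  proof (intro sum.cong refl)
    fix n :: nat
    have dvd: "\<Prod>D dvd n \<longleftrightarrow> (\<forall>p\<in>D. p dvd n)" if "finite D" "\<forall>p\<in>D. prime p" for D
    proof
      assume "\<Prod>D dvd n" then show "\<forall>p\<in>D. p dvd n"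
        using that by (meson dvd_prodI dvd_trans)
    next
      assume "\<forall>p\<in>D. p dvd n"
      with that show "\<Prod>D dvd n"
      proof (induction D rule: finite_induct)
        case (insert p D)
        have "coprime p (\<Prod>D)" 
        proof (rule prod_coprime_right[where f = "\<lambda>x. x"])
          fix q assume "q \<in> D"
          then have "p \<noteq> q" "prime p" "prime q" using insert by auto
          then show "coprime p q" by (intro primes_coprime)
        qed
        then have "p * \<Prod>D dvd n" using insert by (intro divides_mult) auto
        then show ?case using insert by simp
      qed simp
    qed
    have "(w n)\<^sup>2 = (\<Sum>D\<in>\<D>. \<Sum>E\<in>\<D>. (if \<Prod>D dvd n then \<rho> D else 0) * (if \<Prod>E dvd n then \<rho> E else 0))"
      unfolding w_def power2_eq_square by (rule sum_product)
    also have "\<dots> = (\<Sum>D\<in>\<D>. \<Sum>E\<in>\<D>. \<rho> D * \<rho> E * (if \<Prod>(D \<union> E) dvd n then 1 else 0))"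
    proof (intro sum.cong refl)
      fix D E assume "D \<in> \<D>" "E \<in> \<D>"
      then have "\<Prod>(D \<union> E) dvd n \<longleftrightarrow> \<Prod>D dvd n \<and> \<Prod>E dvd n"
        using dvd[of D] dvd[of E] dvd[of "D \<union> E"] \<D>_prime[of D] \<D>_prime[of E] \<D>_finite[of D] \<D>_finite[of E]
        by (simp add: ball_Un)
      then show "(if \<Prod>D dvd n then \<rho> D else 0) * (if \<Prod>E dvd n then \<rho> E else 0)
          = \<rho> D * \<rho> E * (if \<Prod>(D \<union> E) dvd n then 1 else 0)" by auto
    qed
    finally show "(w n)\<^sup>2 = \<dots>" .
  qed
  also have "\<dots> = (\<Sum>D\<in>\<D>. \<Sum>n\<in>I. \<Sum>E\<in>\<D>. \<rho> D * \<rho> E * (if \<Prod>(D \<union> E) dvd n then 1 else 0))"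
    by (rule sum.swap)
  also have "\<dots> = (\<Sum>D\<in>\<D>. \<Sum>E\<in>\<D>. \<Sum>n\<in>I. \<rho> D * \<rho> E * (if \<Prod>(D \<union> E) dvd n then 1 else 0))"
    by (intro sum.cong refl sum.swap)
  also have "\<dots> = (\<Sum>D\<in>\<D>. \<Sum>E\<in>\<D>. \<rho> D * \<rho> E * real (card {n \<in> I. \<Prod>(D \<union> E) dvd n}))"
    using fI by (simp add: sum_distrib_left[symmetric] sum.If_cases Int_def)
  also have "\<dots> \<le> (\<Sum>D\<in>\<D>. \<Sum>E\<in>\<D>. \<rho> D * \<rho> E * (h / real (\<Prod>(D \<union> E))) + real z * real z)"
  proof (intro sum_mono)
    fix D E assume DE: "D \<in> \<D>" "E \<in> \<D>"
    have pos: "\<Prod>(D \<union> E) > 0" using DE \<D>_prime by (intro prod_pos) (auto simp: prime_gt_0_nat)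
    define c where "c = real (card {n \<in> I. \<Prod>(D \<union> E) dvd n}) - h / real (\<Prod>(D \<union> E))"
    have "\<bar>c\<bar> \<le> 1" using card_multiples_interval[OF assms pos]
      unfolding c_def I_def by (simp add: conj_assoc)
    moreover have "\<bar>\<rho> D * \<rho> E\<bar> \<le> real z * real z"
      unfolding abs_mult using abs_\<rho>_le DE by (intro mult_mono) auto
    ultimately have "\<bar>\<rho> D * \<rho> E * c\<bar> \<le> real z * real z * 1"
      unfolding abs_mult[of _ c] by (intro mult_mono) auto
    then have "\<rho> D * \<rho> E * c \<le> real z * real z" by simp
    then show "\<rho> D * \<rho> E * real (card {n \<in> I. \<Prod>(D \<union> E) dvd n})
       \<le> \<rho> D * \<rho> E * (h / real (\<Prod>(D \<union> E))) + real z * real z"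
      unfolding c_def by (simp add: algebra_simps del: of_nat_prod)
  qed
  also have "\<dots> = h * (\<Sum>D\<in>\<D>. \<Sum>E\<in>\<D>. \<rho> D * \<rho> E / real (\<Prod>(D \<union> E))) + (real (card \<D>) * real z)\<^sup>2"
    by (simp add: sum.distrib sum_distrib_left power2_eq_square mult_ac)
  also have "\<dots> = h / G + (real (card \<D>) * real z)\<^sup>2" by (simp only: quadratic_form) simp
  also have "(real (card \<D>) * real z)\<^sup>2 \<le> (real z * real z)\<^sup>2"
    using card_\<D> by (intro power_mono mult_mono) auto
  also have "(real z * real z)\<^sup>2 = real z ^ 4" by (simp add: power2_eq_square power4_eq_xxxx)
  finally show ?thesis using 1 by linarith
qed

end

section \<open>From counting primes to the von Mangoldt function\<close>

lemma finite_nat_le_real: "finite {n::nat. real n \<le> u}"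
  by (rule finite_subset[of _ "{..nat \<lfloor>u\<rfloor>}"]) (auto simp: le_nat_floor)

text \<open>A non-prime n with nonzero \<Lambda>(n) is p^k with k >= 2, so p <= sqrt u and 2^k <= u.
  This leaves at most (sqrt u) (2 log u) pairs, each of weight at most log u.\<close>

lemma sum_mangoldt_nonprime_le:
  fixes u :: real
  assumes "u \<ge> 2"
  shows "(\<Sum>n | real n \<le> u \<and> \<not> prime n. mangoldt n) \<le> sqrt u * (2 * ln u) * ln u"
proof -
  define A where "A = {1..nat \<lfloor>sqrt u\<rfloor>} \<times> {1..nat \<lfloor>2 * ln u\<rfloor>}"
  note fin = finite_nat_le_real[of u]
  have lnu: "0 \<le> ln u" using assms by simp
  define B where "B = {n. real n \<le> u \<and> \<not> prime n \<and> primepow n}"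
  have "B \<subseteq> (\<lambda>(p, k). p ^ k) ` A"
  proof
    fix n assume "n \<in> B"
    then obtain p k where pk: "prime p" "k > 0" "n = p ^ k" and n: "real n \<le> u" "\<not> prime n"
      unfolding B_def primepow_def by auto
    have p2: "p \<ge> 2" using pk(1) by (rule prime_ge_2_nat)
    have "k \<noteq> 1" using n pk by (metis power_one_right)
    then have k2: "k \<ge> 2" using pk by simp
    have "p ^ 2 \<le> p ^ k" using k2 p2 by (intro power_increasing) auto
    then have "(real p)\<^sup>2 \<le> u" using n pk by (metis of_nat_le_iff of_nat_power order_trans)
    then have p: "real p \<le> sqrt u" by (simp add: real_le_rsqrt)
    have "2 ^ k \<le> p ^ k" using p2 by (intro power_mono) auto
    then have "2 ^ k \<le> u" using n pk by (metis of_nat_le_iff of_nat_numeral of_nat_power order_trans)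
    then have "ln (2 ^ k) \<le> ln u" using assms by (intro ln_mono) auto
    then have "real k * ln 2 \<le> ln u" by (simp add: ln_realpow)
    moreover have "1 / 2 \<le> ln (2::real)" using ln2_ge_two_thirds by simp
    ultimately have "real k * (1 / 2) \<le> ln u" by (smt (verit) mult_left_mono of_nat_0_le_iff)
    then have k: "real k \<le> 2 * ln u" by simp
    have "(p, k) \<in> A" unfolding A_def using p k p2 k2 by (auto simp: le_nat_floor)
    then show "n \<in> (\<lambda>(p, k). p ^ k) ` A" using pk by force
  qed
  then have "card B \<le> card A" using surj_card_le[of A B] unfolding A_def by auto
  also have "card A = nat \<lfloor>sqrt u\<rfloor> * nat \<lfloor>2 * ln u\<rfloor>" unfolding A_def by simp
  finally have "real (card B) \<le> real (nat \<lfloor>sqrt u\<rfloor>) * real (nat \<lfloor>2 * ln u\<rfloor>)"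
    by (metis of_nat_le_iff of_nat_mult)
  also have "\<dots> \<le> sqrt u * (2 * ln u)"
    using lnu assms by (intro mult_mono of_nat_floor) auto
  finally have cB: "real (card B) \<le> sqrt u * (2 * ln u)" .
  have "(\<Sum>n | real n \<le> u \<and> \<not> prime n. mangoldt n) = (\<Sum>n\<in>B. mangoldt n :: real)"
    by (intro sum.mono_neutral_right) (auto simp: B_def mangoldt_def intro: finite_subset[OF _ fin])
  also have "\<dots> \<le> (\<Sum>n\<in>B. ln u)"
  proof (intro sum_mono)
    fix n assume n: "n \<in> B"
    then have "n > 0" unfolding B_def by (auto intro: Nat.gr0I)
    then have "mangoldt n \<le> ln (real n)" by (rule mangoldt_le)
    also have "\<dots> \<le> ln u" using n \<open>n > 0\<close> unfolding B_def by (intro ln_mono) auto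
    finally show "mangoldt n \<le> ln u" .
  qed
  also have "\<dots> = real (card B) * ln u" by simp
  also have "\<dots> \<le> sqrt u * (2 * ln u) * ln u" using cB lnu by (intro mult_right_mono)
  finally show ?thesis .
qed

lemma ln_le_root:
  fixes u :: real
  assumes "u > 0" "c > 0"
  shows "ln u \<le> u powr c / c"
proof -
  have "c * ln u = ln (u powr c)" using assms by (simp add: ln_powr)
  also have "\<dots> \<le> u powr c" using ln_le_minus_one[of "u powr c"] assms by simp
  finally show ?thesis using assms by (simp add: field_simps)
qed

text \<open>The sieve is applied with z about h^(1/8), so that z^4 <= sqrt h is negligible and G >=
  log h / 32. As t <= h^(4/3), the weight log p is at most 3 log h and is cancelled by the logarithm
  that the sieve saves. The constant is 3 * 36 for the primes plus 2048 for the proper prime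
  powers.\<close>

lemma brun_titchmarsh_large:
  fixes t h :: real
  assumes t: "t \<ge> 1" and h: "h \<ge> t powr (3/4)" and hh: "h \<ge> 3 ^ 8"
  shows "(\<Sum>n | t < real n \<and> real n \<le> t + h. mangoldt n) \<le> 2156 * h"
proof -
  have h1: "h \<ge> 1" using hh by simp
  have t_le: "t \<le> h powr (4/3)"
  proof -
    have "t = (t powr (3/4)) powr (4/3)" using t by (simp add: powr_powr)
    also have "\<dots> \<le> h powr (4/3)" using h by (intro powr_mono2) auto
    finally show ?thesis .
  qed
  have fin: "finite {n. t < real n \<and> real n \<le> t + h}"
    using finite_nat_le_real by (rule rev_finite_subset) auto
  have bound: "mangoldt n \<le> ln (t + h)" if "t < real n \<and> real n \<le> t + h" for n
  proof -
    have "n > 0" using that t by (auto intro: Nat.gr0I)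
    then have "mangoldt n \<le> ln (real n)" by (rule mangoldt_le)
    also have "\<dots> \<le> ln (t + h)" using that \<open>n > 0\<close> by (intro ln_mono) auto
    finally show ?thesis .
  qed
  define z where "z = nat \<lfloor>h powr (1/8)\<rfloor>"
  have r3: "h powr (1/8) \<ge> 3"
  proof -
    have "(3::real) = (3 powr 8) powr (1/8)" by (simp only: powr_powr) simp
    also have "\<dots> \<le> h powr (1/8)" using hh by (intro powr_mono2) auto
    finally show ?thesis .
  qed
  have z_le: "real z \<le> h powr (1/8)" unfolding z_def by (intro of_nat_floor) auto
  have z_ge: "real z \<ge> h powr (1/8) - 1" unfolding z_def by linarith
  have z1: "z \<ge> 1" using z_ge r3 by linarith
  interpret selberg_sieve z by standard (rule z1)
  define lh where "lh = ln h"
  have lh_pos: "lh \<ge> 1"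
  proof -
    have "exp 1 \<le> (3::real)" by (rule exp_le)
    then have "exp 1 \<le> h" using hh by simp
    then show ?thesis unfolding lh_def by (subst ln_ge_iff) (use h1 in auto)
  qed
  have lnz: "lh / 16 \<le> ln (real z)"
  proof -
    define r where "r = h powr (1/16)"
    have r2: "r * r = h powr (1/8)" unfolding r_def by (simp flip: powr_add)
    \<comment> \<open>As r^2 >= 3 exceeds 1.7^2 = 2.89, r is at least 1.7, and then r^2 - 1 >= r. So
      z, which is at least r^2 - 1 after rounding down, is at least r = h^(1/16).\<close>
    have "r \<ge> 17/10"
    proof (rule ccontr)
      assume "\<not> r \<ge> 17/10"
      then have "r * r \<le> 17/10 * (17/10)" unfolding r_def by (intro mult_mono) auto
      then show False using r2 r3 by simp
    qed
    then have "17/10 * r \<le> r * r" by (intro mult_right_mono) auto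
    then have "r \<le> r * r - 1" using \<open>r \<ge> 17/10\<close> by linarith
    then have "r \<le> real z" using r2 z_ge by linarith
    then have "ln r \<le> ln (real z)" using \<open>r \<ge> 17/10\<close> by (intro ln_mono) auto
    moreover have "ln r = lh / 16" unfolding r_def lh_def using h1 by (simp add: ln_powr)
    ultimately show ?thesis by simp
  qed
  then have G: "G \<ge> lh / 32" using G_ge_ln by linarith
  have lnt: "ln (t + h) \<le> 3 * lh"
  proof -
    have "t + h \<le> h powr (4/3) + h powr (4/3)"
      using t_le powr_mono[of 1 "4/3" h] h1 by simp
    also have "\<dots> = 2 * h powr (4/3)" by simp
    also have "\<dots> \<le> h * h powr (4/3)" using hh by (intro mult_right_mono) auto
    also have "\<dots> = h powr (7/3)" using h1 by (simp add: powr_mult_base)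
    finally have "ln (t + h) \<le> ln (h powr (7/3))" using t h1 by (intro ln_mono) auto
    also have "\<dots> = 7/3 * lh" using h1 unfolding lh_def by (simp add: ln_powr)
    finally show ?thesis using lh_pos by linarith
  qed
  have lh_le: "lh \<le> 2 * sqrt h"
    using ln_le_root[of h "1/2"] h1 unfolding lh_def by (simp add: powr_half_sqrt)
  have z4: "real z ^ 4 \<le> sqrt h"
  proof -
    have "real z ^ 4 \<le> (h powr (1/8)) ^ 4" using z_le by (intro power_mono) auto
    also have "\<dots> = (h powr (1/8)) powr (real 4)" using h1 by (subst powr_realpow) auto
    also have "\<dots> = h powr (1/2)" using h1 by (simp add: powr_powr)
    finally show ?thesis using h1 by (simp add: powr_half_sqrt)
  qed
  have zz: "real z \<le> sqrt h"
  proof -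
    have "real z ^ 1 \<le> real z ^ 4" using z1 by (intro power_increasing) auto
    then show ?thesis using z4 by (metis power_one_right order_trans)
  qed
  define PP where "PP = {p. prime p \<and> t < real p \<and> real p \<le> t + h}"
  have "real (card PP) * lh \<le> (real z + h / G + real z ^ 4) * lh"
    unfolding PP_def using t h1 lh_pos by (intro mult_right_mono card_primes_interval) auto
  also have "\<dots> \<le> (2 * sqrt h + h / (lh / 32)) * lh"
  proof -
    have "h / G \<le> h / (lh / 32)" using G lh_pos h1 G_pos by (intro divide_left_mono mult_pos_pos) auto
    then show ?thesis using zz z4 lh_pos by (intro mult_right_mono) auto
  qed
  also have "\<dots> = 2 * sqrt h * lh + 32 * h" using lh_pos by (simp add: field_simps)
  also have "2 * sqrt h * lh \<le> 2 * sqrt h * (2 * sqrt h)" using lh_le h1 by (intro mult_left_mono) auto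
  also have "2 * sqrt h * (2 * sqrt h) = 4 * h" using h1 by (simp add: algebra_simps)
  finally have PP: "real (card PP) * lh \<le> 36 * h" by simp
  define u where "u = t + h"
  have u2: "u \<ge> 2" using t h1 unfolding u_def by simp
  have "sqrt u * (2 * ln u) * ln u \<le> 2048 * h"
  proof -
    have u_le: "u \<le> 2 * h powr (4/3)"
      using t_le powr_mono[of 1 "4/3" h] h1 unfolding u_def by simp
    \<comment> \<open>Each logarithm is traded for u^(1/16), so the exponent 1/2 grows to 5/8; since
      u is at most 2 h^(4/3), this becomes h^(5/6), which is below h.\<close>
    have "ln u \<le> 16 * u powr (1/16)" using ln_le_root[of u "1/16"] u2 by simp
    then have "sqrt u * (2 * ln u) * ln u \<le> sqrt u * (2 * (16 * u powr (1/16))) * (16 * u powr (1/16))"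
      using u2 by (intro mult_mono mult_left_mono mult_nonneg_nonneg) auto
    also have "\<dots> = 512 * (u powr (1/2) * u powr (1/16) * u powr (1/16))"
      using u2 by (simp add: powr_half_sqrt)
    also have "\<dots> = 512 * u powr (5/8)" by (simp flip: powr_add)
    also have "\<dots> \<le> 512 * (2 * h powr (4/3)) powr (5/8)"
      using u_le u2 by (intro mult_left_mono powr_mono2) auto
    also have "(2 * h powr (4/3)) powr (5/8) = 2 powr (5/8) * h powr (5/6)"
      using h1 by (simp add: powr_mult powr_powr)
    also have "2 powr (5/8) * h powr (5/6) \<le> 2 powr 1 * h powr 1"
      using h1 by (intro mult_mono powr_mono) auto
    finally show ?thesis using h1 by simp
  qed
  then have nonprimes: "(\<Sum>n | real n \<le> u \<and> \<not> prime n. mangoldt n) \<le> 2048 * h"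
    using sum_mangoldt_nonprime_le[OF u2] by linarith
  have finu: "finite {n. real n \<le> u \<and> \<not> prime n}"
    using finite_nat_le_real by (rule rev_finite_subset) auto
  have finPP: "finite PP" unfolding PP_def using fin by (rule rev_finite_subset) auto
  have "(\<Sum>n | t < real n \<and> real n \<le> t + h. mangoldt n)
      \<le> (\<Sum>n\<in>PP \<union> {n. real n \<le> u \<and> \<not> prime n}. mangoldt n :: real)"
    using finPP finu by (intro sum_mono2) (auto simp: PP_def u_def mangoldt_nonneg)
  also have "\<dots> = (\<Sum>n\<in>PP. mangoldt n) + (\<Sum>n | real n \<le> u \<and> \<not> prime n. mangoldt n)"
    using finPP finu by (intro sum.union_disjoint) (auto simp: PP_def)
  finally have split: "(\<Sum>n | t < real n \<and> real n \<le> t + h. mangoldt n)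
     \<le> (\<Sum>n\<in>PP. mangoldt n) + (\<Sum>n | real n \<le> u \<and> \<not> prime n. mangoldt n :: real)" .
  have "(\<Sum>n\<in>PP. mangoldt n) \<le> real (card PP) * ln (t + h)"
  proof (rule sum_bounded_above)
    fix p assume "p \<in> PP"
    then show "mangoldt p \<le> ln (t + h)" by (intro bound) (simp add: PP_def)
  qed
  also have "\<dots> \<le> real (card PP) * (3 * lh)" using lnt by (intro mult_left_mono) auto
  also have "\<dots> = 3 * (real (card PP) * lh)" by simp
  also have "\<dots> \<le> 3 * (36 * h)" using PP by (intro mult_left_mono) auto
  finally show ?thesis using nonprimes split by linarith
qed

text \<open>In the bounded range of h the condition h >= t^(3/4) also bounds t, and counting all
  integers with weight log (t + h) suffices; beyond it the sieve applies.\<close>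

lemma brun_titchmarsh:
  obtains C :: real where "C > 0"
    "\<And>t h. t \<ge> 1 \<Longrightarrow> h \<ge> t powr (3/4) \<Longrightarrow> (\<Sum>n | t < real n \<and> real n \<le> t + h. mangoldt n) \<le> C * h"
proof -
  define h0 :: real where "h0 = 3 ^ 8"
  define C1 :: real where "C1 = (h0 + 1) * ln (h0 powr (4/3) + h0)"
  define C where "C = max C1 2156"
  have "C > 0" unfolding C_def by simp
  moreover have "(\<Sum>n | t < real n \<and> real n \<le> t + h. mangoldt n) \<le> C * h"
    if t: "t \<ge> 1" and h: "h \<ge> t powr (3/4)" for t h :: real
  proof (cases "h < h0")
    case True
    have h1: "h \<ge> 1" using t h ge_one_powr_ge_zero[of t "3/4"] by linarith
    have "t = (t powr (3/4)) powr (4/3)" using t by (simp add: powr_powr)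
    also have "\<dots> \<le> h0 powr (4/3)" using h True by (intro powr_mono2) auto
    finally have t_le: "t \<le> h0 powr (4/3)" .
    have bound: "mangoldt n \<le> ln (t + h)" if "t < real n \<and> real n \<le> t + h" for n
    proof -
      have "n > 0" using that t by (auto intro: Nat.gr0I)
      then have "mangoldt n \<le> ln (real n)" by (rule mangoldt_le)
      also have "\<dots> \<le> ln (t + h)" using that \<open>n > 0\<close> by (intro ln_mono) auto
      finally show ?thesis .
    qed
    have lnth: "0 \<le> ln (t + h)" using t h1 by simp
    \<comment> \<open>The divisor 1 turns the count of multiples into the count of all integers in
      the interval.\<close>
    have "card {n. t < real n \<and> real n \<le> t + h} = card {n. t < real n \<and> real n \<le> t + h \<and> 1 dvd n}" by simp
    then have card: "real (card {n. t < real n \<and> real n \<le> t + h}) \<le> h + 1"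
      using selberg_sieve.card_multiples_interval[of 1 t h 1] t h1 unfolding selberg_sieve_def by auto
    have "(\<Sum>n | t < real n \<and> real n \<le> t + h. mangoldt n) \<le> real (card {n. t < real n \<and> real n \<le> t + h}) * ln (t + h)"
      using bound by (intro sum_bounded_above) auto
    also have "\<dots> \<le> (h + 1) * ln (t + h)" using card lnth by (rule mult_right_mono)
    also have "\<dots> \<le> C1"
      unfolding C1_def using True t h1 t_le by (intro mult_mono ln_mono) (auto simp: h0_def)
    also have "\<dots> \<le> C * 1" unfolding C_def by simp
    also have "\<dots> \<le> C * h" using \<open>C > 0\<close> h1 by (intro mult_left_mono) auto
    finally show ?thesis .
  next
    case False
    then have hh: "h \<ge> 3 ^ 8" unfolding h0_def by simp
    have "2156 * h \<le> C * h" unfolding C_def using hh by (intro mult_right_mono) auto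
    then show ?thesis using brun_titchmarsh_large[OF t h hh] by linarith
  qed
  ultimately show ?thesis by (rule that)
qed

section \<open>Ideals of the Gaussian integers\<close>

definition gauss_ints :: "complex set" where "gauss_ints = {z. Re z \<in> \<int> \<and> Im z \<in> \<int>}"

definition gmult :: "complex \<Rightarrow> complex set" where "gmult z = (\<lambda>g. z * g) ` gauss_ints"

text \<open>The floor only changes the type: the squared modulus of a Gaussian integer is already an
  integer.\<close>

definition gnorm :: "complex \<Rightarrow> nat" where "gnorm z = nat \<lfloor>(cmod z)\<^sup>2\<rfloor>"

lemma carrier_gauss [simp]: "carrier gauss_int_ring = gauss_ints"
  by (simp add: gauss_int_ring_def gauss_ints_def)

lemma gauss_ring_simps [simp]:
  "mult gauss_int_ring = (*)" "add gauss_int_ring = (+)" "one gauss_int_ring = 1" "zero gauss_int_ring = 0"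
  by (simp_all add: gauss_int_ring_def)

interpretation gauss: cring gauss_int_ring by (rule cring_gauss_int_ring)

lemma gauss_ints_closed [simp, intro]:
  "0 \<in> gauss_ints" "1 \<in> gauss_ints" "\<i> \<in> gauss_ints" "of_nat n \<in> gauss_ints" "numeral m \<in> gauss_ints"
  "x \<in> gauss_ints \<Longrightarrow> y \<in> gauss_ints \<Longrightarrow> x + y \<in> gauss_ints"
  "x \<in> gauss_ints \<Longrightarrow> y \<in> gauss_ints \<Longrightarrow> x - y \<in> gauss_ints"
  "x \<in> gauss_ints \<Longrightarrow> y \<in> gauss_ints \<Longrightarrow> x * y \<in> gauss_ints"
  "x \<in> gauss_ints \<Longrightarrow> - x \<in> gauss_ints"
  "x \<in> gauss_ints \<Longrightarrow> cnj x \<in> gauss_ints"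
  "x \<in> gauss_ints \<Longrightarrow> x ^ n \<in> gauss_ints"
proof -
  show *: "x \<in> gauss_ints \<Longrightarrow> y \<in> gauss_ints \<Longrightarrow> x * y \<in> gauss_ints" for x y
    by (auto simp: gauss_ints_def)
  show "1 \<in> gauss_ints" by (auto simp: gauss_ints_def)
  then show "x \<in> gauss_ints \<Longrightarrow> x ^ n \<in> gauss_ints" by (induction n) (auto intro: *)
qed (auto simp: gauss_ints_def)

lemma cmod2_gnorm: "z \<in> gauss_ints \<Longrightarrow> real (gnorm z) = (cmod z)\<^sup>2"
proof -
  assume "z \<in> gauss_ints"
  then have "(cmod z)\<^sup>2 \<in> \<int>" by (auto simp: gauss_ints_def cmod_power2)
  then show ?thesis unfolding gnorm_def by (auto elim!: Ints_cases)
qed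

lemma gnorm_cnj_mult: "z \<in> gauss_ints \<Longrightarrow> z * cnj z = of_nat (gnorm z)"
  by (metis cmod2_gnorm complex_norm_square of_real_of_nat_eq)

lemma gnorm_mult: "z \<in> gauss_ints \<Longrightarrow> w \<in> gauss_ints \<Longrightarrow> gnorm (z * w) = gnorm z * gnorm w"
proof -
  assume "z \<in> gauss_ints" "w \<in> gauss_ints"
  then have "real (gnorm (z * w)) = real (gnorm z) * real (gnorm w)"
    by (simp add: cmod2_gnorm norm_mult power_mult_distrib)
  then show ?thesis by (simp only: of_nat_mult[symmetric] of_nat_eq_iff)
qed

lemma gnorm_cnj [simp]: "gnorm (cnj z) = gnorm z" by (simp add: gnorm_def)
lemma gnorm_of_nat [simp]: "gnorm (of_nat n) = n\<^sup>2"
  by (simp add: gnorm_def flip: of_nat_power)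
lemma gnorm_1 [simp]: "gnorm 1 = 1" by (simp add: gnorm_def)
lemma gnorm_power: "z \<in> gauss_ints \<Longrightarrow> gnorm (z ^ n) = gnorm z ^ n"
  by (induction n) (auto simp: gnorm_mult)
lemma gnorm_pos: "z \<in> gauss_ints \<Longrightarrow> z \<noteq> 0 \<Longrightarrow> gnorm z > 0"
  using cmod2_gnorm[of z] by (metis neq0_conv norm_eq_zero of_nat_0 power_eq_0_iff zero_neq_numeral)

text \<open>The conjugate of \<open>u\<close> is its inverse, so multiplication by \<open>u\<close>
  permutes the multiples of \<open>z\<close>.\<close>

lemma gnorm_unit:
  assumes "u \<in> gauss_ints" "gnorm u = 1"
  shows "gmult (z * u) = gmult z"
proof -
  have uu: "u * cnj u = 1" using gnorm_cnj_mult[OF assms(1)] assms(2) by simp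
  show ?thesis
  proof (intro equalityI subsetI)
    fix x assume "x \<in> gmult (z * u)"
    then show "x \<in> gmult z" using assms(1) by (auto simp: gmult_def mult.assoc)
  next
    fix x assume "x \<in> gmult z"
    then obtain g where g: "g \<in> gauss_ints" "x = z * g" by (auto simp: gmult_def)
    have "z * u * (cnj u * g) = z * (u * cnj u) * g" by (simp only: mult_ac)
    then have "x = z * u * (cnj u * g)" using uu g by simp
    then show "x \<in> gmult (z * u)" unfolding gmult_def using g assms by blast
  qed
qed

lemma ideal_gaussD:
  assumes "ideal I gauss_int_ring"
  shows "I \<subseteq> gauss_ints" "0 \<in> I" "x \<in> I \<Longrightarrow> y \<in> I \<Longrightarrow> x + y \<in> I" "x \<in> I \<Longrightarrow> - x \<in> I"
    "x \<in> I \<Longrightarrow> g \<in> gauss_ints \<Longrightarrow> x * g \<in> I"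
proof -
  interpret ideal I gauss_int_ring by fact
  show "I \<subseteq> gauss_ints" using a_subset by simp
  show "0 \<in> I" using zero_closed by simp
  show "x \<in> I \<Longrightarrow> y \<in> I \<Longrightarrow> x + y \<in> I" using a_closed by simp
  show *: "x \<in> I \<Longrightarrow> g \<in> gauss_ints \<Longrightarrow> x * g \<in> I" for x g using I_r_closed by simp
  show "x \<in> I \<Longrightarrow> - x \<in> I" using *[of x "- 1"] by simp
qed

lemma ideal_gmult: "z \<in> gauss_ints \<Longrightarrow> ideal (gmult z) gauss_int_ring"
proof (rule idealI)
  assume z: "z \<in> gauss_ints"
  show "ring gauss_int_ring" by (rule gauss.ring_axioms)
  have minus: "inv\<^bsub>add_monoid gauss_int_ring\<^esub> x = - x" if "x \<in> gauss_ints" for x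
    using gauss.add.inv_equality[of "- x" x] that by (simp add: a_inv_def)
  show "subgroup (gmult z) (add_monoid gauss_int_ring)"
  proof (rule subgroup.intro)
    show "gmult z \<subseteq> carrier (add_monoid gauss_int_ring)" using z by (auto simp: gmult_def)
    show "x \<otimes>\<^bsub>add_monoid gauss_int_ring\<^esub> y \<in> gmult z" if "x \<in> gmult z" "y \<in> gmult z" for x y
      using that by (auto simp: gmult_def simp flip: distrib_left)
    show "\<one>\<^bsub>add_monoid gauss_int_ring\<^esub> \<in> gmult z" by (auto simp: gmult_def image_iff intro: bexI[of _ 0])
    show "inv\<^bsub>add_monoid gauss_int_ring\<^esub> x \<in> gmult z" if xz: "x \<in> gmult z" for x
    proof -
      obtain g where g: "g \<in> gauss_ints" "x = z * g" using xz by (auto simp: gmult_def)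
      then have "inv\<^bsub>add_monoid gauss_int_ring\<^esub> x = z * (- g)" using minus[of x] z by simp
      moreover have "- g \<in> gauss_ints" using g by simp
      ultimately show ?thesis unfolding gmult_def by (rule image_eqI)
    qed
  qed
qed (auto simp: gmult_def mult.assoc mult.left_commute)

text \<open>Rounding both coordinates leaves a distance of at most sqrt (1/2). The strict inequality
  is what makes Euclidean division by a Gaussian integer work.\<close>

lemma gauss_ints_round:
  obtains g where "g \<in> gauss_ints" "cmod (w - g) < 1"
proof
  show "Complex (of_int (round (Re w))) (of_int (round (Im w))) \<in> gauss_ints" by (auto simp: gauss_ints_def)
  have r: "\<bar>Re w - of_int (round (Re w))\<bar> \<le> 1/2" "\<bar>Im w - of_int (round (Im w))\<bar> \<le> 1/2"
    using of_int_round_abs_le[of "Re w"] of_int_round_abs_le[of "Im w"] by (simp_all add: abs_minus_commute)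
  have "(cmod (w - Complex (of_int (round (Re w))) (of_int (round (Im w)))))\<^sup>2 \<le> (1/2)\<^sup>2 + (1/2)\<^sup>2"
    unfolding cmod_power2 using r by (intro add_mono) (auto simp: abs_le_square_iff[symmetric])
  also have "\<dots> < 1\<^sup>2" by (simp add: power2_eq_square)
  finally show "cmod (w - Complex (of_int (round (Re w))) (of_int (round (Im w)))) < 1"
    by (rule power2_less_imp_less) simp
qed

text \<open>Euclidean division by a nonzero element of least norm: the remainder lies in the ideal
  and has smaller norm, so it is zero.\<close>

lemma gauss_ideal_principal:
  assumes "ideal I gauss_int_ring"
  obtains z where "z \<in> gauss_ints" "I = gmult z"
proof (cases "I = {0}")
  case True
  have "gmult 0 = {0}" by (auto simp: gmult_def)
  then show ?thesis using that[of 0] True by auto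
next
  case False
  note I = ideal_gaussD[OF assms]
  then obtain x where "x \<in> I" "x \<noteq> 0" using False by auto
  define z where "z = (ARG_MIN gnorm z. z \<in> I \<and> z \<noteq> 0)"
  have z: "z \<in> I \<and> z \<noteq> 0" unfolding z_def by (rule arg_min_natI) (use \<open>x \<in> I\<close> \<open>x \<noteq> 0\<close> in auto)
  have min: "gnorm z \<le> gnorm w" if "w \<in> I" "w \<noteq> 0" for w
    unfolding z_def by (rule arg_min_nat_le) (use that in auto)
  have zg: "z \<in> gauss_ints" using z I by auto
  have "I = gmult z"
  proof (intro equalityI subsetI)
    fix w assume w: "w \<in> I"
    obtain g where g: "g \<in> gauss_ints" "cmod (w / z - g) < 1" by (rule gauss_ints_round)
    have r: "w - z * g \<in> I" using I(3)[OF w I(4)[OF I(5)[of z g]]] z g by simp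
    have "w - z * g = 0"
    proof (rule ccontr)
      assume ne: "w - z * g \<noteq> 0"
      have "cmod (w - z * g) = cmod z * cmod (w / z - g)" using z by (simp add: norm_mult[symmetric] right_diff_distrib)
      also have "\<dots> < cmod z * 1" using g z by (intro mult_strict_left_mono) auto
      finally have "(cmod (w - z * g))\<^sup>2 < (cmod z)\<^sup>2" by (intro power_strict_mono) auto
      then have "gnorm (w - z * g) < gnorm z"
        using cmod2_gnorm[OF zg] cmod2_gnorm[of "w - z * g"] r I(1) by (metis of_nat_less_iff subsetD)
      then show False using min[OF r ne] by simp
    qed
    then show "w \<in> gmult z" using g by (auto simp: gmult_def)
  qed (use I z in \<open>auto simp: gmult_def\<close>)
  then show ?thesis using that zg by blast
qed

text \<open>The coset of \<open>a\<close> modulo \<open>gmult z\<close>, written through congruence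
  rather than as a set of sums.\<close>

definition gclass :: "complex \<Rightarrow> complex \<Rightarrow> complex set" where
  "gclass z a = {b \<in> gauss_ints. a - b \<in> gmult z}"

definition gindex :: "complex \<Rightarrow> nat" where "gindex z = card (gclass z ` gauss_ints)"

lemma gmult_iff: "x \<in> gmult z \<longleftrightarrow> (\<exists>g\<in>gauss_ints. x = z * g)"
  by (auto simp: gmult_def)

lemma gmult_add:
  assumes "x \<in> gmult z" "y \<in> gmult z" shows "x + y \<in> gmult z"
proof -
  obtain g h where "g \<in> gauss_ints" "h \<in> gauss_ints" "x = z * g" "y = z * h"
    using assms unfolding gmult_iff by blast
  then show ?thesis unfolding gmult_iff by (intro bexI[of _ "g + h"]) (auto simp: distrib_left)
qed

lemma gmult_minus:
  assumes "x \<in> gmult z" shows "- x \<in> gmult z"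
proof -
  obtain g where "g \<in> gauss_ints" "x = z * g" using assms unfolding gmult_iff by blast
  then show ?thesis unfolding gmult_iff by (intro bexI[of _ "- g"]) auto
qed

lemma gmult_0: "0 \<in> gmult z" unfolding gmult_iff by (intro bexI[of _ 0]) auto

lemma gclass_eq_iff:
  assumes "a \<in> gauss_ints" "b \<in> gauss_ints"
  shows "gclass z a = gclass z b \<longleftrightarrow> a - b \<in> gmult z"
proof
  assume eq: "gclass z a = gclass z b"
  have "b \<in> gclass z b" using assms gmult_0 by (simp add: gclass_def)
  then have "b \<in> gclass z a" by (simp only: eq)
  then show "a - b \<in> gmult z" by (simp only: gclass_def mem_Collect_eq)
next
  assume *: "a - b \<in> gmult z"
  have "a - c \<in> gmult z \<longleftrightarrow> b - c \<in> gmult z" for c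
  proof
    assume "a - c \<in> gmult z"
    then have "- (a - b) + (a - c) \<in> gmult z" by (intro gmult_add gmult_minus *)
    then show "b - c \<in> gmult z" by simp
  next
    assume "b - c \<in> gmult z"
    then have "(a - b) + (b - c) \<in> gmult z" by (intro gmult_add *)
    then show "a - c \<in> gmult z" by simp
  qed
  then show "gclass z a = gclass z b" unfolding gclass_def by blast
qed

lemma order_Quot_gmult:
  assumes z: "z \<in> gauss_ints"
  shows "order (gauss_int_ring Quot gmult z) = gindex z"
proof -
  have "gmult z +>\<^bsub>gauss_int_ring\<^esub> a = gclass z a" if "a \<in> gauss_ints" for a
  proof (intro equalityI subsetI)
    fix b assume "b \<in> gmult z +>\<^bsub>gauss_int_ring\<^esub> a"
    then obtain x where x: "x \<in> gmult z" "b = x + a" by (auto simp: a_r_coset_def')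
    then have "a - b \<in> gmult z" using gmult_minus[of x] by simp
    then show "b \<in> gclass z a" using x that z by (auto simp: gclass_def gmult_def)
  next
    fix b assume b: "b \<in> gclass z a"
    then have "b - a \<in> gmult z" using gmult_minus[of "a - b"] by (auto simp: gclass_def)
    moreover have "b = (b - a) + a" by simp
    ultimately show "b \<in> gmult z +>\<^bsub>gauss_int_ring\<^esub> a"
      unfolding a_r_coset_def' gauss_ring_simps by blast
  qed
  then have "carrier (gauss_int_ring Quot gmult z) = gclass z ` gauss_ints"
    by (auto simp: FactRing_def A_RCOSETS_def')
  then show ?thesis by (simp add: order_def gindex_def)
qed

text \<open>Division with remainder in two stages: modulo z w every element is uniquely r + z r',
  with r a chosen representative modulo z and r' one modulo w.\<close>

lemma gindex_mult:
  assumes z: "z \<in> gauss_ints" "z \<noteq> 0" and w: "w \<in> gauss_ints"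
  shows "gindex (z * w) = gindex z * gindex w"
proof -
  define r where "r u C = (SOME a. a \<in> gauss_ints \<and> C = gclass u a)" for u C
  have r: "r u C \<in> gauss_ints" "C = gclass u (r u C)" if "C \<in> gclass u ` gauss_ints" for u C
    using someI_ex[of "\<lambda>a. a \<in> gauss_ints \<and> C = gclass u a"] that unfolding r_def by auto
  define h where "h = (\<lambda>(C, D). gclass (z * w) (r z C + z * r w D))"
  have "bij_betw h (gclass z ` gauss_ints \<times> gclass w ` gauss_ints) (gclass (z * w) ` gauss_ints)"
  proof (rule bij_betw_imageI)
    show "inj_on h (gclass z ` gauss_ints \<times> gclass w ` gauss_ints)"
    proof (rule inj_onI, clarify)
      fix a b a' b'
      assume "a \<in> gauss_ints" "b \<in> gauss_ints" "a' \<in> gauss_ints" "b' \<in> gauss_ints"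
        and h: "h (gclass z a, gclass w b) = h (gclass z a', gclass w b')"
      define C D C' D' where CD: "C = gclass z a" "D = gclass w b" "C' = gclass z a'" "D' = gclass w b'"
      have in_: "C \<in> gclass z ` gauss_ints" "D \<in> gclass w ` gauss_ints"
        "C' \<in> gclass z ` gauss_ints" "D' \<in> gclass w ` gauss_ints"
        unfolding CD using \<open>a \<in> gauss_ints\<close> \<open>b \<in> gauss_ints\<close> \<open>a' \<in> gauss_ints\<close> \<open>b' \<in> gauss_ints\<close> by auto
      note rr = r(1)[OF in_(1)] r(1)[OF in_(2)] r(1)[OF in_(3)] r(1)[OF in_(4)]
      have "(r z C + z * r w D) - (r z C' + z * r w D') \<in> gmult (z * w)"
        using h z rr unfolding CD[symmetric] h_def by (simp add: gclass_eq_iff)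
      then obtain g where g: "g \<in> gauss_ints" "(r z C + z * r w D) - (r z C' + z * r w D') = z * w * g"
        by (auto simp: gmult_def)
      then have "r z C - r z C' = z * (w * g + r w D' - r w D)" by (simp add: algebra_simps)
      then have "r z C - r z C' \<in> gmult z" using g rr w by (auto simp: gmult_def)
      then have C: "C = C'" using r(2)[OF in_(1)] r(2)[OF in_(3)] rr by (metis gclass_eq_iff)
      then have "z * (r w D - r w D') = z * (w * g)" using g by (simp add: algebra_simps)
      then have "r w D - r w D' = w * g" using z by simp
      then have "r w D - r w D' \<in> gmult w" using g by (auto simp: gmult_def)
      then have D: "D = D'" using r(2)[OF in_(2)] r(2)[OF in_(4)] rr by (metis gclass_eq_iff)
      show "gclass z a = gclass z a' \<and> gclass w b = gclass w b'" using C D unfolding CD by auto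
    qed
    show "h ` (gclass z ` gauss_ints \<times> gclass w ` gauss_ints) = gclass (z * w) ` gauss_ints"
    proof (intro equalityI subsetI)
      fix x assume "x \<in> h ` (gclass z ` gauss_ints \<times> gclass w ` gauss_ints)"
      then obtain C D where "C \<in> gclass z ` gauss_ints" "D \<in> gclass w ` gauss_ints" "x = h (C, D)" by blast
      then show "x \<in> gclass (z * w) ` gauss_ints" using r z unfolding h_def by auto
    next
      fix x assume "x \<in> gclass (z * w) ` gauss_ints"
      then obtain a where a: "a \<in> gauss_ints" "x = gclass (z * w) a" by auto
      define C where "C = gclass z a"
      have C: "C \<in> gclass z ` gauss_ints" using a C_def by auto
      have "a - r z C \<in> gmult z" using r[OF C] a C_def by (metis gclass_eq_iff)
      then obtain k where k: "k \<in> gauss_ints" "a - r z C = z * k" by (auto simp: gmult_def)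
      define D where "D = gclass w k"
      have D: "D \<in> gclass w ` gauss_ints" using k D_def by auto
      have "k - r w D \<in> gmult w" using r[OF D] k D_def by (metis gclass_eq_iff)
      then obtain l where l: "l \<in> gauss_ints" "k - r w D = w * l" by (auto simp: gmult_def)
      have "a - (r z C + z * r w D) = z * w * l" using k l by (simp add: algebra_simps)
      then have "x = h (C, D)" unfolding a h_def using r(1)[OF C] r(1)[OF D] a z l
        by (simp add: gclass_eq_iff) (auto simp: gmult_def)
      then show "x \<in> h ` (gclass z ` gauss_ints \<times> gclass w ` gauss_ints)" using C D by auto
    qed
  qed
  then show ?thesis unfolding gindex_def by (metis bij_betw_same_card card_cartesian_product)
qed

lemma gindex_cnj: "gindex (cnj z) = gindex z"
proof -
  have cg: "cnj ` gauss_ints = gauss_ints" by (auto simp: image_iff) (metis complex_cnj_cnj gauss_ints_closed(10))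
  have mem: "cnj x \<in> gmult (cnj z) \<longleftrightarrow> x \<in> gmult z" for x z
  proof -
    have *: "x \<in> gmult z \<Longrightarrow> cnj x \<in> gmult (cnj z)" for x z by (auto simp: gmult_def)
    show ?thesis using *[of x z] *[of "cnj x" "cnj z"] by auto
  qed
  have cl: "gclass (cnj z) (cnj a) = cnj ` gclass z a" for a
  proof (intro equalityI subsetI)
    fix b assume "b \<in> gclass (cnj z) (cnj a)"
    then have "cnj b \<in> gclass z a" unfolding gclass_def using mem[of "a - cnj b" z] by auto
    then show "b \<in> cnj ` gclass z a" by (metis complex_cnj_cnj image_eqI)
  next
    fix b assume "b \<in> cnj ` gclass z a"
    then show "b \<in> gclass (cnj z) (cnj a)" unfolding gclass_def using mem[of _ z] by (force simp flip: complex_cnj_diff)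
  qed
  have "gclass (cnj z) ` gauss_ints = gclass (cnj z) ` cnj ` gauss_ints" by (simp add: cg)
  also have "\<dots> = (\<lambda>X. cnj ` X) ` gclass z ` gauss_ints" by (simp add: image_image cl)
  finally have "gclass (cnj z) ` gauss_ints = (\<lambda>X. cnj ` X) ` gclass z ` gauss_ints" .
  moreover have "inj_on (\<lambda>X. cnj ` X) (gclass z ` gauss_ints)"
    by (rule inj_on_subset[OF inj_image_eq_iff[THEN iffD1, THEN injI]]) (auto simp: inj_def)
  ultimately show ?thesis unfolding gindex_def by (simp add: card_image)
qed

text \<open>Congruence modulo a rational integer is congruence of both coordinates, so the points
  with coordinates in [0, n) represent each class once.\<close>

lemma gindex_of_nat:
  assumes "n > 0"
  shows "gindex (of_nat n) = n\<^sup>2"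
proof -
  define h where "h = (\<lambda>(i, j). gclass (of_nat n) (Complex (real i) (real j)))"
  have mem: "Complex (of_int a) (of_int b) \<in> gmult (of_nat n) \<longleftrightarrow> int n dvd a \<and> int n dvd b" for a b
  proof
    assume "Complex (of_int a) (of_int b) \<in> gmult (of_nat n)"
    then obtain g where g: "g \<in> gauss_ints" "Complex (of_int a) (of_int b) = of_nat n * g" by (auto simp: gmult_def)
    then obtain c d where cd: "Re g = of_int c" "Im g = of_int d" by (auto simp: gauss_ints_def elim!: Ints_cases)
    have "real_of_int a = real_of_int (int n * c)" "real_of_int b = real_of_int (int n * d)"
      using arg_cong[OF g(2), of Re] arg_cong[OF g(2), of Im] cd by auto
    then show "int n dvd a \<and> int n dvd b" by (metis dvd_triv_left of_int_eq_iff)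
  next
    assume "int n dvd a \<and> int n dvd b"
    then obtain c d where "a = int n * c" "b = int n * d" by (auto elim!: dvdE)
    then have "Complex (of_int a) (of_int b) = of_nat n * Complex (of_int c) (of_int d)"
      by (simp add: complex_eq_iff)
    then show "Complex (of_int a) (of_int b) \<in> gmult (of_nat n)" by (auto simp: gmult_def gauss_ints_def)
  qed
  have "bij_betw h ({..<n} \<times> {..<n}) (gclass (of_nat n) ` gauss_ints)"
  proof (rule bij_betw_imageI)
    show "inj_on h ({..<n} \<times> {..<n})"
    proof (rule inj_onI, safe)
      fix i j i' j' assume ij: "i < n" "j < n" "i' < n" "j' < n" and "h (i, j) = h (i', j')"
      then have "Complex (of_int (int i - int i')) (of_int (int j - int j')) \<in> gmult (of_nat n)"
        unfolding h_def using gclass_eq_iff[of "Complex (real i) (real j)" "Complex (real i') (real j')"]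
        by (auto simp: gauss_ints_def complex_diff)
      then have "int n dvd int i - int i'" "int n dvd int j - int j'" unfolding mem by auto
      then show "i = i'" "j = j'" using ij by (metis mod_eq_dvd_iff mod_less nat_int_comparison(1) of_nat_mod)+
    qed
    show "h ` ({..<n} \<times> {..<n}) = gclass (of_nat n) ` gauss_ints"
    proof (intro equalityI subsetI)
      fix x assume "x \<in> gclass (of_nat n) ` gauss_ints"
      then obtain g where g: "g \<in> gauss_ints" "x = gclass (of_nat n) g" by auto
      then obtain c d where cd: "g = Complex (of_int c) (of_int d)"
        by (auto simp: gauss_ints_def complex_eq_iff elim!: Ints_cases)
      define i j where "i = nat (c mod int n)" and "j = nat (d mod int n)"
      have ij: "i < n" "j < n" "int i = c mod int n" "int j = d mod int n"
        using assms by (auto simp: i_def j_def nat_less_iff)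
      have "Complex (of_int (c - int i)) (of_int (d - int j)) \<in> gmult (of_nat n)"
        unfolding mem using ij by (simp add: minus_mod_eq_mult_div)
      then have "g - Complex (real i) (real j) \<in> gmult (of_nat n)" unfolding cd by (simp add: complex_diff)
      then have "x = h (i, j)" unfolding g(2) h_def using g(1)
        by (simp, subst gclass_eq_iff) (auto simp: gauss_ints_def)
      then show "x \<in> h ` ({..<n} \<times> {..<n})" using ij by auto
    qed (auto simp: h_def gauss_ints_def)
  qed
  then have "card (gclass (of_nat n) ` gauss_ints) = card ({..<n} \<times> {..<n})" by (simp add: bij_betw_same_card)
  then show ?thesis by (simp add: gindex_def power2_eq_square)
qed

declare gauss_ints_closed [rule del]

text \<open>No volume of a lattice has to be computed: the index is multiplicative and invariant
  under conjugation, so its square is the index of the rational integer \<open>z * cnj z\<close>,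
  which is the square of the norm.\<close>

lemma gindex_eq_gnorm:
  assumes "z \<in> gauss_ints" "z \<noteq> 0"
  shows "gindex z = gnorm z"
proof -
  have "gindex z * gindex (cnj z) = gindex (z * cnj z)"
    using assms by (subst gindex_mult) auto
  also have "\<dots> = (gnorm z)\<^sup>2"
    unfolding gnorm_cnj_mult[OF assms(1)] by (rule gindex_of_nat) (use assms gnorm_pos in auto)
  finally have "(gindex z)\<^sup>2 = (gnorm z)\<^sup>2" by (simp add: gindex_cnj power2_eq_square)
  then show ?thesis by (simp add: power2_eq_iff_nonneg)
qed

lemma ideal_norm_gmult:
  assumes "z \<in> gauss_ints" "z \<noteq> 0"
  shows "ideal_norm (gmult z) = gnorm z"
  unfolding ideal_norm_def using assms by (simp add: order_Quot_gmult gindex_eq_gnorm)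

lemma gmult_eq_0_iff: "z \<in> gauss_ints \<Longrightarrow> gmult z = {0} \<longleftrightarrow> z = 0"
proof
  assume "gmult z = {0}"
  moreover have "z \<in> gmult z" unfolding gmult_iff by (intro bexI[of _ 1]) auto
  ultimately show "z = 0" by simp
next
  assume "z = 0"
  then show "gmult z = {0}" using image_constant[OF gauss_ints_closed(1), of "0::complex"]
    by (simp only: gmult_def mult_zero_left)
qed

lemma nonzero_ideals_eq: "nonzero_ideals = gmult ` (gauss_ints - {0})"
proof (intro equalityI subsetI)
  fix \<aa> assume a: "\<aa> \<in> nonzero_ideals"
  then have id: "ideal \<aa> gauss_int_ring" "\<aa> \<noteq> {0}" by (simp_all add: nonzero_ideals_def)
  then obtain z where z: "z \<in> gauss_ints" "\<aa> = gmult z" using gauss_ideal_principal by blast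
  have "z \<noteq> 0" using id(2) unfolding z(2) gmult_eq_0_iff[OF z(1)] .
  then show "\<aa> \<in> gmult ` (gauss_ints - {0})" using z by blast
next
  fix \<aa> assume "\<aa> \<in> gmult ` (gauss_ints - {0})"
  then obtain z where z: "z \<in> gauss_ints" "z \<noteq> 0" "\<aa> = gmult z" by blast
  then have "\<aa> \<noteq> {0}" unfolding z(3) gmult_eq_0_iff[OF z(1)] by blast
  then show "\<aa> \<in> nonzero_ideals" using ideal_gmult[OF z(1)] z(3) by (simp add: nonzero_ideals_def)
qed

lemma nonzero_idealE:
  assumes "\<aa> \<in> nonzero_ideals"
  obtains z where "z \<in> gauss_ints" "z \<noteq> 0" "\<aa> = gmult z" "ideal_norm \<aa> = gnorm z"
proof -
  obtain z where z: "z \<in> gauss_ints" "z \<noteq> 0" "\<aa> = gmult z"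
    using assms unfolding nonzero_ideals_eq by blast
  then show ?thesis using ideal_norm_gmult[OF z(1,2)] that by simp
qed

lemma ideal_norm_pos: "\<aa> \<in> nonzero_ideals \<Longrightarrow> ideal_norm \<aa> > 0"
  by (erule nonzero_idealE) (simp add: gnorm_pos)

text \<open>Every such ideal has a generator in a bounded box of the lattice, since |c| <= c^2 for
  integers c bounds both coordinates by the norm.\<close>

lemma finite_ideals_norm_le: "finite {\<aa> \<in> nonzero_ideals. real (ideal_norm \<aa>) \<le> x}"
proof -
  define B where "B = nat \<lceil>x\<rceil>"
  have "finite ((\<lambda>(a, b). Complex (of_int a) (of_int b)) ` ({- int B..int B} \<times> {- int B..int B}))" by simp
  moreover have "{z \<in> gauss_ints. real (gnorm z) \<le> x} \<subseteq>
      (\<lambda>(a, b). Complex (of_int a) (of_int b)) ` ({- int B..int B} \<times> {- int B..int B})"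
  proof
    fix z assume "z \<in> {z \<in> gauss_ints. real (gnorm z) \<le> x}"
    then have z: "z \<in> gauss_ints" "real (gnorm z) \<le> x" by auto
    then obtain a b where ab: "z = Complex (of_int a) (of_int b)"
      by (auto simp: gauss_ints_def complex_eq_iff elim!: Ints_cases)
    have sq: "\<bar>c\<bar> \<le> c\<^sup>2" for c :: int 
    proof (cases "c = 0")
      case False
      then have "\<bar>c\<bar> * 1 \<le> \<bar>c\<bar> * \<bar>c\<bar>" by (intro mult_left_mono) auto
      then show ?thesis by (simp add: power2_eq_square)
    qed simp
    have "real_of_int (a\<^sup>2 + b\<^sup>2) \<le> x" using z cmod2_gnorm[OF z(1)] unfolding ab by (simp add: cmod_power2)
    then have "a\<^sup>2 + b\<^sup>2 \<le> int B" unfolding B_def by linarith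
    then have "\<bar>a\<bar> \<le> int B" "\<bar>b\<bar> \<le> int B" using sq[of a] sq[of b] by (smt (verit) zero_le_power2)+
    then show "z \<in> (\<lambda>(a, b). Complex (of_int a) (of_int b)) ` ({- int B..int B} \<times> {- int B..int B})"
      unfolding ab by (intro image_eqI[of _ _ "(a, b)"]) auto
  qed
  ultimately have "finite (gmult ` {z \<in> gauss_ints. real (gnorm z) \<le> x})" by (intro finite_imageI) (rule finite_subset)
  then show ?thesis
  proof (rule rev_finite_subset)
    show "{\<aa> \<in> nonzero_ideals. real (ideal_norm \<aa>) \<le> x} \<subseteq> gmult ` {z \<in> gauss_ints. real (gnorm z) \<le> x}"
    proof
      fix \<aa> assume "\<aa> \<in> {\<aa> \<in> nonzero_ideals. real (ideal_norm \<aa>) \<le> x}"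
      then have a: "\<aa> \<in> nonzero_ideals" "real (ideal_norm \<aa>) \<le> x" by simp_all
      from a(1) obtain z where "z \<in> gauss_ints" "\<aa> = gmult z" "ideal_norm \<aa> = gnorm z" by (rule nonzero_idealE)
      then show "\<aa> \<in> gmult ` {z \<in> gauss_ints. real (gnorm z) \<le> x}" using a by simp
    qed
  qed
qed

lemma ideal_norm_eq_1: "\<aa> \<in> nonzero_ideals \<Longrightarrow> ideal_norm \<aa> = 1 \<longleftrightarrow> \<aa> = gauss_ints"
proof -
  assume "\<aa> \<in> nonzero_ideals"
  then obtain z where z: "z \<in> gauss_ints" "z \<noteq> 0" "\<aa> = gmult z" by (rule nonzero_idealE)
  have one: "gmult 1 = gauss_ints" by (simp add: gmult_def)
  show ?thesis
  proof
    assume "ideal_norm \<aa> = 1"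
    then have "gnorm z = 1" using z ideal_norm_gmult by simp
    then show "\<aa> = gauss_ints" using gnorm_unit[OF z(1), of 1] z one by simp
  next
    assume "\<aa> = gauss_ints"
    then show "ideal_norm \<aa> = 1" using ideal_norm_gmult[of 1] one by simp
  qed
qed

section \<open>The von Mangoldt function on ideals\<close>

text \<open>The non-principal Dirichlet character modulo 4.\<close>

definition chi4 :: "nat \<Rightarrow> real" where
  "chi4 n = (if n mod 4 = 1 then 1 else if n mod 4 = 3 then - 1 else 0)"

text \<open>The coefficients of minus the logarithmic derivative of the Dedekind zeta function of
  Q(\<i>), which is the product \<zeta>(s) L(s, \<chi>).\<close>

definition gauss_mangoldt :: "nat \<Rightarrow> real" where
  "gauss_mangoldt n = (1 + chi4 n) * mangoldt n"

lemma gauss_mangoldt_nonneg: "gauss_mangoldt n \<ge> 0"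
  by (simp add: gauss_mangoldt_def chi4_def mangoldt_nonneg)

lemma gauss_mangoldt_le: "gauss_mangoldt n \<le> 2 * mangoldt n"
  unfolding gauss_mangoldt_def by (intro mult_right_mono) (auto simp: chi4_def mangoldt_nonneg)

definition gprime :: "complex set \<Rightarrow> bool" where
  "gprime P \<longleftrightarrow> P \<in> nonzero_ideals \<and> primeideal P gauss_int_ring"

lemma gprimeD:
  assumes "gprime P"
  shows "1 \<notin> P" "x \<in> gauss_ints \<Longrightarrow> y \<in> gauss_ints \<Longrightarrow> x * y \<in> P \<Longrightarrow> x \<in> P \<or> y \<in> P"
    "ideal P gauss_int_ring"
proof -
  have P: "primeideal P gauss_int_ring" using assms by (simp add: gprime_def)
  interpret primeideal P gauss_int_ring by (rule P)
  show "x \<in> gauss_ints \<Longrightarrow> y \<in> gauss_ints \<Longrightarrow> x * y \<in> P \<Longrightarrow> x \<in> P \<or> y \<in> P"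
    using I_prime[of x y] by simp
  show id: "ideal P gauss_int_ring" by (rule is_ideal)
  show "1 \<notin> P"
  proof
    assume "1 \<in> P"
    then have "gauss_ints \<subseteq> P" using ideal_gaussD(5)[OF id, of 1] by auto
    then show False using I_notcarr ideal_gaussD(1)[OF id] by simp
  qed
qed

lemma gprime_power_mem:
  assumes "gprime P" "x \<in> gauss_ints" "x ^ m \<in> P"
  shows "x \<in> P"
  using assms(3)
proof (induction m)
  case 0
  then show ?case using gprimeD(1)[OF assms(1)] by simp
next
  case (Suc m)
  then show ?case using gprimeD(2)[OF assms(1), of x "x ^ m"] assms(2) by auto
qed

text \<open>Keeps elements such as 1 + \<i> and y + \<i> out of the ideal generated by a rational
  prime.\<close>

lemma Im_gmult_of_nat:
  assumes "x \<in> gmult (of_nat p)" "\<bar>Im x\<bar> = 1"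
  shows "p = 1"
proof -
  obtain g where g: "g \<in> gauss_ints" "x = of_nat p * g" using assms(1) unfolding gmult_iff by blast
  obtain d where d: "Im g = of_int d" using g(1) by (auto simp: gauss_ints_def elim!: Ints_cases)
  have "\<bar>real p * of_int d\<bar> = 1" using assms(2) g(2) d by simp
  then have "\<bar>real_of_int (int p * d)\<bar> = 1" by simp
  then have "\<bar>int p * d\<bar> = 1" by linarith
  moreover have "int p dvd \<bar>int p * d\<bar>" by simp
  ultimately have "int p dvd 1" by metis
  then show ?thesis by simp
qed

text \<open>Euler's criterion: the exponent (p - 1) / 2 is even, so -1 is a quadratic
  residue.\<close>

lemma minus_one_square_mod:
  assumes "prime p" "p mod 4 = 1"
  obtains y :: int where "int p dvd y\<^sup>2 + 1"
proof -
  have "p > 2" using assms prime_ge_2_nat[of p] by (cases "p = 2") auto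
  have "even ((int p - 1) div 2)" and ev: "even ((p - 1) div 2)" using assms(2) by presburger+
  then have "[Legendre (-1) (int p) = (-1) ^ ((p - 1) div 2)] (mod int p)"
    using euler_criterion[OF assms(1) \<open>p > 2\<close>, of "-1"] by simp
  then have "[Legendre (-1) (int p) = 1] (mod int p)" using ev by simp
  then have d: "int p dvd Legendre (-1) (int p) - 1" by (simp add: cong_iff_dvd_diff)
  have "Legendre (-1) (int p) \<noteq> -1"
  proof
    assume "Legendre (-1) (int p) = -1"
    then have "int p dvd 2" using d by simp
    then show False using \<open>p > 2\<close> zdvd_imp_le[of "int p" 2] by simp
  qed
  moreover have "Legendre (-1) (int p) \<noteq> 0" using d \<open>p > 2\<close> by (intro notI) simp
  ultimately have "QuadRes (int p) (-1)" unfolding Legendre_def by (auto split: if_splits)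
  then obtain y where "[y\<^sup>2 = - 1] (mod int p)" unfolding QuadRes_def by auto
  then have "int p dvd y\<^sup>2 + 1" by (simp add: cong_iff_dvd_diff)
  then show ?thesis by (rule that)
qed

text \<open>The least positive integer in the ideal is a prime p, and a generator divides p, so its
  norm is p or p^2. Norm p makes p a sum of two squares, which excludes 3 modulo 4. Norm p^2 means
  that p itself generates the ideal; this excludes 2 = (1 + \<i>) (1 - \<i>) and, because p divides
  some (y + \<i>) (y - \<i>), the primes that are 1 modulo 4.\<close>

lemma gprime_cases:
  assumes P: "gprime P"
  obtains p \<pi> where "prime p" "\<pi> \<in> gauss_ints" "\<pi> \<noteq> 0" "P = gmult \<pi>" "of_nat p \<in> P"
    "gnorm \<pi> = p \<and> p mod 4 \<noteq> 3 \<or> gnorm \<pi> = p\<^sup>2 \<and> P = gmult (of_nat p) \<and> p mod 4 = 3"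
proof -
  note PD = gprimeD[OF P]
  obtain \<pi> where \<pi>: "\<pi> \<in> gauss_ints" "\<pi> \<noteq> 0" "P = gmult \<pi>"
    using P nonzero_idealE unfolding gprime_def by metis
  have "of_nat (gnorm \<pi>) \<in> P" unfolding \<pi>(3) gmult_iff gnorm_cnj_mult[OF \<pi>(1), symmetric]
    using \<pi>(1) by (intro bexI[of _ "cnj \<pi>"]) auto
  then have ex: "gnorm \<pi> > 0 \<and> of_nat (gnorm \<pi>) \<in> P" using gnorm_pos \<pi> by simp
  define p where "p = (LEAST n. n > 0 \<and> of_nat n \<in> P)"
  have p: "p > 0" "of_nat p \<in> P" using LeastI[of "\<lambda>n. n > 0 \<and> of_nat n \<in> P", OF ex] unfolding p_def by auto
  have least: "p \<le> n" if "n > 0" "of_nat n \<in> P" for n unfolding p_def using that by (intro Least_le) auto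
  have prime: "prime p" unfolding prime_nat_iff
  proof (intro conjI allI impI)
    show "1 < p" using p PD(1) by (cases "p = 1") auto
    fix m assume "m dvd p"
    then obtain k where k: "p = m * k" by (auto elim!: dvdE)
    then have mk: "m > 0" "k > 0" using p by auto
    have "of_nat m * of_nat k \<in> P" using p k by simp
    then have "of_nat m \<in> P \<or> of_nat k \<in> P" by (intro PD(2)) auto
    then have "p \<le> m \<or> p \<le> k" using least mk by blast
    moreover have "m \<le> p" "k \<le> p" using \<open>p > 0\<close> k by (auto intro: dvd_imp_le)
    ultimately have "m = p \<or> k = p" by auto
    then show "m = 1 \<or> m = p" using k mk by auto
  qed
  obtain \<gamma> where \<gamma>: "\<gamma> \<in> gauss_ints" "of_nat p = \<pi> * \<gamma>" using p unfolding \<pi>(3) gmult_iff by blast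
  have norm_eq: "p\<^sup>2 = gnorm \<pi> * gnorm \<gamma>" using gnorm_mult[OF \<pi>(1) \<gamma>(1)] \<gamma>(2) by (metis gnorm_of_nat)
  then have "gnorm \<pi> dvd p ^ 2" by simp
  then obtain i where i: "i \<le> 2" "gnorm \<pi> = p ^ i" using prime by (auto simp: divides_primepow_nat)
  have "gnorm \<pi> \<noteq> 1"
  proof
    assume "gnorm \<pi> = 1"
    then have "P = gmult 1" using gnorm_unit[OF \<pi>(1), of 1] \<pi>(3) by simp
    then have "1 \<in> P" by (simp add: gmult_iff)
    then show False using PD(1) by simp
  qed
  then have "i \<noteq> 0" using i by (intro notI) simp
  with i consider "gnorm \<pi> = p" | "gnorm \<pi> = p\<^sup>2" by (cases "i = 1"; cases "i = 2") auto
  then show ?thesis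
  proof cases
    case 1
    obtain a b where ab: "\<pi> = Complex (of_int a) (of_int b)"
      using \<pi>(1) by (auto simp: gauss_ints_def complex_eq_iff elim!: Ints_cases)
    have "real_of_int (int p) = real_of_int (a\<^sup>2 + b\<^sup>2)"
      using cmod2_gnorm[OF \<pi>(1)] 1 unfolding ab by (simp add: cmod_power2)
    then have pab: "int p = a\<^sup>2 + b\<^sup>2" by (simp only: of_int_eq_iff)
    have sq4: "c\<^sup>2 mod 4 = 0 \<or> c\<^sup>2 mod 4 = 1" for c :: int
    proof (cases "even c")
      case True
      then obtain k where "c = 2 * k" by (auto elim!: evenE)
      then show ?thesis by (simp add: power2_eq_square)
    next
      case False
      then obtain k where "c = 2 * k + 1" by (auto elim!: oddE)
      then have "c\<^sup>2 = 4 * (k * k + k) + 1" by (simp add: power2_eq_square algebra_simps)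
      moreover have "(4 * m + 1) mod 4 = 1" for m :: int by presburger
      ultimately have "c\<^sup>2 mod 4 = 1" by metis
      then show ?thesis by simp
    qed
    have "int p mod 4 \<noteq> 3" unfolding pab using sq4[of a] sq4[of b] by presburger
    then have "p mod 4 \<noteq> 3" by presburger
    then show ?thesis using that[OF prime \<pi> p(2)] 1 by simp
  next
    case 2
    have "p\<^sup>2 * gnorm \<gamma> = p\<^sup>2 * 1" using norm_eq unfolding 2 by (rule sym[THEN trans]) (rule mult_1_right[symmetric])
    then have "gnorm \<gamma> = 1" using p(1) by (simp only: mult_cancel1) auto
    then have Pp: "P = gmult (of_nat p)" using gnorm_unit[OF \<gamma>(1), of \<pi>] \<gamma>(2) \<pi>(3) by simp
    have p1: "p \<noteq> 1" using prime by (metis not_prime_1)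
    have "p \<noteq> 2"
    proof
      assume "p = 2"
      have "(1 + \<i>) * (1 - \<i>) = 2" by (simp add: algebra_simps)
      then have "(1 + \<i>) * (1 - \<i>) \<in> P" using p(2) \<open>p = 2\<close> by simp
      then have "1 + \<i> \<in> P \<or> 1 - \<i> \<in> P" by (intro PD(2)) auto
      then show False using Im_gmult_of_nat[of "1 + \<i>" p] Im_gmult_of_nat[of "1 - \<i>" p] p1 unfolding Pp by auto
    qed
    moreover have "p mod 4 \<noteq> 1"
    proof
      assume "p mod 4 = 1"
      then obtain y :: int where y: "int p dvd y\<^sup>2 + 1" using prime minus_one_square_mod by blast
      then obtain k where k: "y\<^sup>2 + 1 = int p * k" by (auto elim!: dvdE)
      have yG: "of_int y \<in> gauss_ints" "of_int k \<in> gauss_ints" by (auto simp: gauss_ints_def)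
      have "(of_int y + \<i>) * (of_int y - \<i>) = of_int (y\<^sup>2 + 1)" by (simp add: algebra_simps power2_eq_square)
      also have "\<dots> = of_nat p * of_int k" unfolding k by simp
      finally have "(of_int y + \<i>) * (of_int y - \<i>) \<in> P" unfolding Pp gmult_iff using yG by blast
      then have "of_int y + \<i> \<in> P \<or> of_int y - \<i> \<in> P" using yG by (intro PD(2)) auto
      then show False using Im_gmult_of_nat[of "of_int y + \<i>" p] Im_gmult_of_nat[of "of_int y - \<i>" p] p1
        unfolding Pp by auto
    qed
    moreover have "odd p" using prime \<open>p \<noteq> 2\<close> by (metis primes_dvd_imp_eq two_is_prime_nat)
    ultimately have "p mod 4 = 3" by presburger
    then show ?thesis using that[OF prime \<pi> p(2)] 2 Pp by simp
  qed
qed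

lemma gmult_cong_unit:
  assumes "\<pi> \<in> gauss_ints" "\<rho> \<in> gauss_ints" "\<rho> \<noteq> 0" "\<rho> \<in> gmult \<pi>" "gnorm \<rho> = gnorm \<pi>"
  shows "gmult \<rho> = gmult \<pi>"
proof -
  obtain u where u: "u \<in> gauss_ints" "\<rho> = \<pi> * u" using assms(4) unfolding gmult_iff by blast
  have "gnorm \<rho> * gnorm u = gnorm \<rho> * 1" using gnorm_mult[OF assms(1) u(1)] u(2) assms(5) by (metis mult_1_right)
  then have "gnorm u = 1" using gnorm_pos[OF assms(2,3)] by (simp only: mult_cancel1) auto
  then show ?thesis using gnorm_unit[OF u(1)] u(2) by simp
qed

text \<open>The prime ideal contains \<open>\<pi> * cnj \<pi>\<close>, hence one of the factors, and
  an element with the norm of a generator is itself a generator. So at most two prime ideals have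
  this norm over p.\<close>

lemma gprime_same_norm:
  assumes "gprime (gmult \<rho>)" "\<pi> \<in> gauss_ints" "\<pi> \<noteq> 0" "\<rho> \<in> gauss_ints" "gnorm \<rho> = gnorm \<pi>" "of_nat (gnorm \<pi>) \<in> gmult \<rho>"
  shows "gmult \<rho> = gmult \<pi> \<or> gmult \<rho> = gmult (cnj \<pi>)"
proof -
  have "\<pi> * cnj \<pi> \<in> gmult \<rho>" using assms(6) gnorm_cnj_mult[OF assms(2)] by simp
  then have "\<pi> \<in> gmult \<rho> \<or> cnj \<pi> \<in> gmult \<rho>" using assms(2) by (intro gprimeD(2)[OF assms(1)]) auto
  then show ?thesis using gmult_cong_unit[of \<rho> \<pi>] gmult_cong_unit[of \<rho> "cnj \<pi>"] assms by auto
qed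

text \<open>The prime 2 ramifies: (1 + \<i>)^2 = 2 \<i>. Hence only one prime ideal lies over it,
  where \<open>gprime_same_norm\<close> alone would allow two.\<close>

lemma gprime_norm_2:
  assumes "gprime (gmult \<rho>)" "\<rho> \<in> gauss_ints" "gnorm \<rho> = 2" "2 \<in> gmult \<rho>"
  shows "gmult \<rho> = gmult (1 + \<i>)"
proof -
  have "2 * \<i> \<in> gmult \<rho>" using ideal_gaussD(5)[OF gprimeD(3)[OF assms(1)] assms(4)] by simp
  moreover have "(1 + \<i>) * (1 + \<i>) = 2 * \<i>" by (simp add: algebra_simps)
  ultimately have "(1 + \<i>) * (1 + \<i>) \<in> gmult \<rho>" by simp
  then have "1 + \<i> \<in> gmult \<rho>" using gprimeD(2)[OF assms(1), of "1 + \<i>" "1 + \<i>"] by auto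
  moreover have "gnorm (1 + \<i>) = 2" by (simp add: gnorm_def cmod_power2)
  moreover have "1 + \<i> \<noteq> 0" by (simp add: complex_eq_iff)
  ultimately show ?thesis using gmult_cong_unit[of \<rho> "1 + \<i>"] assms by simp
qed

lemma ideal_prod_gmult:
  assumes "u \<in> gauss_ints" "v \<in> gauss_ints"
  shows "gmult u \<cdot>\<^bsub>gauss_int_ring\<^esub> gmult v = gmult (u * v)"
proof (intro equalityI subsetI)
  fix x assume "x \<in> gmult u \<cdot>\<^bsub>gauss_int_ring\<^esub> gmult v"
  then show "x \<in> gmult (u * v)"
  proof (induction rule: ideal_prod.induct)
    case (prod i j)
    then obtain g h where "g \<in> gauss_ints" "h \<in> gauss_ints" "i = u * g" "j = v * h" unfolding gmult_iff by blast
    then show ?case unfolding gmult_iff by (intro bexI[of _ "g * h"]) auto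
  next
    case (sum s1 s2)
    then show ?case using gmult_add by simp
  qed
next
  fix x assume "x \<in> gmult (u * v)"
  then obtain g where g: "g \<in> gauss_ints" "x = u * (v * g)" unfolding gmult_iff by (auto simp: mult.assoc)
  have "u \<in> gmult u" unfolding gmult_iff by (intro bexI[of _ 1]) auto
  moreover have "v * g \<in> gmult v" using g unfolding gmult_iff by blast
  ultimately have "u \<otimes>\<^bsub>gauss_int_ring\<^esub> (v * g) \<in> gmult u \<cdot>\<^bsub>gauss_int_ring\<^esub> gmult v"
    by (rule ideal_prod.prod)
  then show "x \<in> gmult u \<cdot>\<^bsub>gauss_int_ring\<^esub> gmult v" using g by simp
qed

lemma ideal_pow_gmult:
  assumes "u \<in> gauss_ints"
  shows "gmult u [^]\<^bsub>ideals_set gauss_int_ring\<^esub> (m::nat) = gmult (u ^ m)"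
proof (induction m)
  case 0
  have "gmult 1 = gauss_ints" by (simp add: gmult_def)
  then show ?case by (simp add: nat_pow_def ideals_set_def)
next
  case (Suc m)
  have "gmult u [^]\<^bsub>ideals_set gauss_int_ring\<^esub> Suc m
     = (gmult u [^]\<^bsub>ideals_set gauss_int_ring\<^esub> m) \<cdot>\<^bsub>gauss_int_ring\<^esub> gmult u"
    by (simp add: nat_pow_def ideals_set_def)
  also have "\<dots> = gmult (u ^ m * u)" unfolding Suc using assms by (intro ideal_prod_gmult) auto
  finally show ?case by (simp add: mult.commute)
qed

lemma is_prime_power_of_iff:
  "is_prime_power_of \<aa> P \<longleftrightarrow> gprime P \<and> (\<exists>m\<ge>1. \<aa> = P [^]\<^bsub>ideals_set gauss_int_ring\<^esub> (m::nat))"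
  by (auto simp: is_prime_power_of_def gprime_def)

text \<open>A power of a generator of P lies in a positive power of Q, hence in Q, hence so does the
  generator. With the roles exchanged the prime ideal is unique, and the \<open>THE\<close> in
  \<open>ideal_mangoldt\<close> is well defined.\<close>

lemma is_prime_power_of_subset:
  assumes "is_prime_power_of \<aa> P" "is_prime_power_of \<aa> Q"
  shows "P \<subseteq> Q"
proof -
  obtain \<pi> where \<pi>: "\<pi> \<in> gauss_ints" "P = gmult \<pi>"
    using assms(1) gprime_cases unfolding is_prime_power_of_iff by metis
  obtain \<rho> where \<rho>: "\<rho> \<in> gauss_ints" "Q = gmult \<rho>"
    using assms(2) gprime_cases unfolding is_prime_power_of_iff by metis
  obtain m k where mk: "gmult (\<pi> ^ m) = gmult (\<rho> ^ k)" "k \<ge> 1"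
    using assms unfolding is_prime_power_of_iff \<pi> \<rho> ideal_pow_gmult[OF \<pi>(1)] ideal_pow_gmult[OF \<rho>(1)] by auto
  have "\<pi> ^ m \<in> gmult (\<rho> ^ k)" unfolding mk(1)[symmetric] gmult_iff by (intro bexI[of _ 1]) auto
  then obtain g where g: "g \<in> gauss_ints" "\<pi> ^ m = \<rho> ^ k * g" unfolding gmult_iff by blast
  then have "\<pi> ^ m = \<rho> * (\<rho> ^ (k - 1) * g)" using mk(2) by (cases k) auto
  then have "\<pi> ^ m \<in> Q" unfolding \<rho> gmult_iff using g \<rho>(1) by (intro bexI[of _ "\<rho> ^ (k - 1) * g"]) auto
  have Q: "gprime Q" using assms(2) unfolding is_prime_power_of_iff by simp
  have "\<pi> \<in> Q" using \<open>\<pi> ^ m \<in> Q\<close> by (rule gprime_power_mem[OF Q \<pi>(1)])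
  then show ?thesis unfolding \<pi>(2) using ideal_gaussD(5)[OF gprimeD(3)[OF Q]] by (auto simp: gmult_def)
qed

lemma ideal_mangoldt_eq:
  assumes "is_prime_power_of \<aa> P"
  shows "ideal_mangoldt \<aa> = ln (real (ideal_norm P))"
proof -
  have "(THE P. is_prime_power_of \<aa> P) = P"
    using assms is_prime_power_of_subset by (intro the_equality) (blast intro: equalityI)+
  then show ?thesis using assms unfolding ideal_mangoldt_def by auto
qed

lemma prime_power_ideal_cases:
  assumes "is_prime_power_of \<aa> P"
  obtains p \<pi> m where "prime p" "\<pi> \<in> gauss_ints" "\<pi> \<noteq> 0" "gprime (gmult \<pi>)" "of_nat p \<in> gmult \<pi>" "m \<ge> 1"
    "\<aa> = gmult (\<pi> ^ m)" "gnorm \<pi> = p" "p mod 4 \<noteq> 3" "ideal_norm \<aa> = p ^ m" "ideal_mangoldt \<aa> = ln (real p)"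
  | p m where "prime p" "m \<ge> 1" "\<aa> = gmult (of_nat p ^ m)" "p mod 4 = 3"
    "ideal_norm \<aa> = p ^ (2 * m)" "ideal_mangoldt \<aa> = 2 * ln (real p)"
proof -
  obtain m where P: "gprime P" and m: "m \<ge> 1" "\<aa> = P [^]\<^bsub>ideals_set gauss_int_ring\<^esub> (m::nat)"
    using assms unfolding is_prime_power_of_iff by auto
  obtain p \<pi> where p: "prime p" "\<pi> \<in> gauss_ints" "\<pi> \<noteq> 0" "P = gmult \<pi>" "of_nat p \<in> P"
    "gnorm \<pi> = p \<and> p mod 4 \<noteq> 3 \<or> gnorm \<pi> = p\<^sup>2 \<and> P = gmult (of_nat p) \<and> p mod 4 = 3"
    using P by (rule gprime_cases)
  have a: "\<aa> = gmult (\<pi> ^ m)" using m ideal_pow_gmult[OF p(2)] p(4) by simp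
  have na: "ideal_norm \<aa> = gnorm \<pi> ^ m" unfolding a using p by (simp add: ideal_norm_gmult gnorm_power)
  have L: "ideal_mangoldt \<aa> = ln (real (gnorm \<pi>))"
    using ideal_mangoldt_eq[OF assms] ideal_norm_gmult[OF p(2,3)] p(4) by simp
  from p(6) show ?thesis
  proof
    assume "gnorm \<pi> = p \<and> p mod 4 \<noteq> 3"
    then show ?thesis using that(1)[of p \<pi> m] p P m a na L by simp
  next
    assume *: "gnorm \<pi> = p\<^sup>2 \<and> P = gmult (of_nat p) \<and> p mod 4 = 3"
    have "\<aa> = gmult (of_nat p ^ m)" using m * ideal_pow_gmult[of "of_nat p"] by simp
    moreover have "ideal_mangoldt \<aa> = 2 * ln (real p)" using L * prime_gt_0_nat[OF p(1)] by (simp add: ln_realpow)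
    moreover have "ideal_norm \<aa> = p ^ (2 * m)" using na * by (simp add: power_mult)
    ultimately show ?thesis using that(2)[of p m] p m * by simp
  qed
qed

lemma mod4_power:
  assumes "p mod 4 = (1::nat)" shows "p ^ m mod 4 = 1"
  using power_mod[of p 4 m] assms by simp

lemma mod4_power_even:
  assumes "p mod 4 = (3::nat)" shows "p ^ (2 * m) mod 4 = 1"
proof -
  have "p\<^sup>2 mod 4 = 1" using power_mod[of p 4 2] assms by simp
  then show ?thesis using mod4_power[of "p\<^sup>2" m] by (simp add: power_mult)
qed

lemma prime_power_eq_iff:
  assumes "prime p" "prime (q::nat)" "i \<ge> 1" "p ^ i = q ^ j"
  shows "p = q" "i = j"
proof -
  have "p dvd q ^ j" using assms by (metis dvd_power gr0I less_one linorder_not_less)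
  then show pq: "p = q" using assms by (metis prime_dvd_power primes_dvd_imp_eq)
  show "i = j" using assms unfolding pq by (metis nat_neq_iff power_inject_exp prime_gt_1_nat)
qed

text \<open>One prime power ideal of norm n fixes the rational prime p and the exponent, and then
  all of them can be listed: at most two conjugate ones of weight log p if p is 1 modulo 4, one of
  weight log 2 if p = 2, and one of weight 2 log p if p is 3 modulo 4, where n is an even power of
  p. Each time (1 + \<chi>(n)) log p is at least the total.\<close>

lemma sum_ideal_mangoldt_le:
  "(\<Sum>\<aa> | \<aa> \<in> nonzero_ideals \<and> ideal_norm \<aa> = n. ideal_mangoldt \<aa>) \<le> gauss_mangoldt n"
proof -
  define X where "X = {\<aa>. \<aa> \<in> nonzero_ideals \<and> ideal_norm \<aa> = n}"
  define Y where "Y = {\<aa> \<in> X. \<exists>P. is_prime_power_of \<aa> P}"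
  have finX: "finite X" unfolding X_def
    by (rule finite_subset[OF _ finite_ideals_norm_le[of "real n"]]) auto
  have eq: "(\<Sum>\<aa>\<in>X. ideal_mangoldt \<aa>) = (\<Sum>\<aa>\<in>Y. ideal_mangoldt \<aa>)"
    using finX by (intro sum.mono_neutral_right) (auto simp: Y_def ideal_mangoldt_def)
  have Yc: "Y \<subseteq> X" by (auto simp: Y_def)
  have "(\<Sum>\<aa>\<in>Y. ideal_mangoldt \<aa>) \<le> gauss_mangoldt n"
  proof (cases "Y = {}")
    case True
    then show ?thesis by (simp add: gauss_mangoldt_nonneg)
  next
    case False
    then obtain \<aa>0 P0 where a0: "\<aa>0 \<in> Y" "is_prime_power_of \<aa>0 P0" by (auto simp: Y_def)
    have n0: "ideal_norm \<aa>0 = n" using a0 by (auto simp: Y_def X_def)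
    from a0(2) show ?thesis
    proof (cases rule: prime_power_ideal_cases)
      case (1 p \<pi> m)
      have lnp: "ln (real p) \<ge> 0" using prime_gt_0_nat[OF 1(1)] by simp
      have n: "n = p ^ m" using n0 1 by simp
      have each: "\<aa> \<in> {gmult (\<pi> ^ m), gmult (cnj \<pi> ^ m)} \<and> ideal_mangoldt \<aa> = ln (real p) \<and>
        (p = 2 \<longrightarrow> \<aa> = gmult ((1 + \<i>) ^ m))" if aY: "\<aa> \<in> Y" for \<aa>
      proof -
        obtain P where P: "is_prime_power_of \<aa> P" "ideal_norm \<aa> = n" using aY by (auto simp: Y_def X_def)
        from P(1) show ?thesis
        proof (cases rule: prime_power_ideal_cases)
          case (1 q \<rho> k)
          have "p ^ m = q ^ k" using n P(2) 1(10) by simp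
          then have qk: "p = q" "m = k" by (rule prime_power_eq_iff[OF \<open>prime p\<close> 1(1) \<open>m \<ge> 1\<close>])+
          have "gmult \<rho> = gmult \<pi> \<or> gmult \<rho> = gmult (cnj \<pi>)"
            using gprime_same_norm[of \<rho> \<pi>] 1 qk \<open>gnorm \<pi> = p\<close> \<open>\<pi> \<in> gauss_ints\<close> \<open>\<pi> \<noteq> 0\<close> by simp
          then have "gmult \<rho> [^]\<^bsub>ideals_set gauss_int_ring\<^esub> m = gmult \<pi> [^]\<^bsub>ideals_set gauss_int_ring\<^esub> m
             \<or> gmult \<rho> [^]\<^bsub>ideals_set gauss_int_ring\<^esub> m = gmult (cnj \<pi>) [^]\<^bsub>ideals_set gauss_int_ring\<^esub> m" by auto
          then have A: "gmult (\<rho> ^ m) = gmult (\<pi> ^ m) \<or> gmult (\<rho> ^ m) = gmult (cnj \<pi> ^ m)"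
            using \<open>\<pi> \<in> gauss_ints\<close> 1(2) by (simp add: ideal_pow_gmult)
          have B: "gmult (\<rho> ^ m) = gmult ((1 + \<i>) ^ m)" if "p = 2"
          proof -
            have "gmult \<rho> = gmult (1 + \<i>)" using gprime_norm_2[of \<rho>] 1 qk that by simp
            then have "gmult \<rho> [^]\<^bsub>ideals_set gauss_int_ring\<^esub> m = gmult (1 + \<i>) [^]\<^bsub>ideals_set gauss_int_ring\<^esub> m" by simp
            then show ?thesis using 1(2) by (simp add: ideal_pow_gmult)
          qed
          show ?thesis using A B 1 qk by auto
        next
          case (2 q k)
          have "p ^ m = q ^ (2 * k)" using n P(2) 2(5) by simp
          then have "p = q" by (rule prime_power_eq_iff[OF \<open>prime p\<close> 2(1) \<open>m \<ge> 1\<close>])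
          then show ?thesis using 2 \<open>p mod 4 \<noteq> 3\<close> by simp
        qed
      qed
      have LK: "gauss_mangoldt n = (1 + chi4 (p ^ m)) * ln (real p)"
        unfolding n gauss_mangoldt_def using 1 by simp
      have "(\<Sum>\<aa>\<in>Y. ideal_mangoldt \<aa>) = real (card Y) * ln (real p)" using each by simp
      also have "\<dots> \<le> (1 + chi4 (p ^ m)) * ln (real p)"
      proof (cases "p = 2")
        case True
        then have "Y \<subseteq> {gmult ((1 + \<i>) ^ m)}" using each by auto
        then have "card Y \<le> 1" using card_mono[of "{gmult ((1 + \<i>) ^ m)}" Y] by simp
        moreover have "chi4 (p ^ m) \<ge> 0"
        proof -
          have "even (p ^ m)" using True 1 by simp
          then have "p ^ m mod 4 \<noteq> 3" by presburger
          then show ?thesis by (simp add: chi4_def)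
        qed
        ultimately show ?thesis using lnp by (intro mult_right_mono) auto
      next
        case False
        have "Y \<subseteq> {gmult (\<pi> ^ m), gmult (cnj \<pi> ^ m)}" using each by blast
        then have "card Y \<le> card {gmult (\<pi> ^ m), gmult (cnj \<pi> ^ m)}" by (intro card_mono) auto
        also have "\<dots> \<le> 2" by (simp add: card_insert_if)
        finally have "card Y \<le> 2" .
        moreover have "odd p" using False \<open>prime p\<close> by (metis primes_dvd_imp_eq two_is_prime_nat)
        then have "p mod 4 = 1" using \<open>p mod 4 \<noteq> 3\<close> by presburger
        then have "chi4 (p ^ m) = 1" using mod4_power[of p m] by (simp add: chi4_def)
        ultimately show ?thesis using lnp by (intro mult_right_mono) auto
      qed
      finally show ?thesis unfolding LK .
    next
      case (2 p m)
      have n: "n = p ^ (2 * m)" using n0 2 by simp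
      have m2: "2 * m \<ge> 1" using 2 by simp
      have each: "\<aa> = gmult (of_nat p ^ m) \<and> ideal_mangoldt \<aa> = 2 * ln (real p)" if aY: "\<aa> \<in> Y" for \<aa>
      proof -
        obtain P where P: "is_prime_power_of \<aa> P" "ideal_norm \<aa> = n" using aY by (auto simp: Y_def X_def)
        from P(1) show ?thesis
        proof (cases rule: prime_power_ideal_cases)
          case (1 q \<rho> k)
          have "p ^ (2 * m) = q ^ k" using n P(2) 1(10) by simp
          then have "p = q" by (rule prime_power_eq_iff[OF \<open>prime p\<close> 1(1) m2])
          then show ?thesis using 1 \<open>p mod 4 = 3\<close> by simp
        next
          case (2 q k)
          have "p ^ (2 * m) = q ^ (2 * k)" using n P(2) 2(5) by simp
          then have "p = q" "2 * m = 2 * k" by (rule prime_power_eq_iff[OF \<open>prime p\<close> 2(1) m2])+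
          then show ?thesis using 2 by simp
        qed
      qed
      have "card Y \<le> 1" using each card_mono[of "{gmult (of_nat p ^ m)}" Y] by auto
      have "(\<Sum>\<aa>\<in>Y. ideal_mangoldt \<aa>) = real (card Y) * (2 * ln (real p))" using each by simp
      also have "\<dots> \<le> 1 * (2 * ln (real p))"
        using \<open>card Y \<le> 1\<close> prime_gt_0_nat[OF 2(1)] by (intro mult_right_mono) auto
      also have "\<dots> = gauss_mangoldt n"
        unfolding n gauss_mangoldt_def using 2 mod4_power_even[of p m] by (simp add: chi4_def)
      finally show ?thesis .
    qed
  qed
  then show ?thesis using eq unfolding X_def by simp
qed

section \<open>Dirichlet series\<close>

text \<open>At n = 0 every d is a divisor, so the index set is infinite and the sum is 0 by
  convention.\<close>

definition dconv :: "(nat \<Rightarrow> 'a::comm_semiring_1) \<Rightarrow> (nat \<Rightarrow> 'a) \<Rightarrow> nat \<Rightarrow> 'a" where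
  "dconv c e n = (\<Sum>d | d dvd n. c d * e (n div d))"

text \<open>The index 0 contributes nothing, because 0 powr anything is 0; this is why later
  conditions on coefficients concern n > 0 only.\<close>

definition dser :: "(nat \<Rightarrow> complex) \<Rightarrow> complex \<Rightarrow> complex" where
  "dser c s = (\<Sum>\<^sub>\<infinity>n. c n * of_nat n powr (- s))"

definition dabs :: "(nat \<Rightarrow> complex) \<Rightarrow> real \<Rightarrow> bool" where
  "dabs c \<sigma> \<longleftrightarrow> (\<lambda>n. cmod (c n) * real n powr (- \<sigma>)) summable_on UNIV"

definition dnorm :: "(nat \<Rightarrow> complex) \<Rightarrow> real \<Rightarrow> real" where
  "dnorm c \<sigma> = (\<Sum>\<^sub>\<infinity>n. cmod (c n) * real n powr (- \<sigma>))"

lemma dconv_0 [simp]: "dconv c e 0 = 0"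
  by (simp add: dconv_def)

lemma norm_dterm: "cmod (c n * of_nat n powr (- s)) = cmod (c n) * real n powr (- Re s)"
  by (cases "n = 0") (simp_all add: norm_mult norm_powr_real_powr)

lemma powr_of_real_eq: "(of_nat n :: complex) powr (- of_real \<sigma>) = of_real (real n powr (- \<sigma>))"
  by (metis of_nat_0_le_iff of_real_minus of_real_of_nat_eq powr_of_real)

text \<open>The weight \<open>m\<close> is abstract so that one proof serves both the complex series
  with n powr (- s) and the series of absolute values with n powr (- \<sigma>). The double series
  over pairs (d, k) of positive integers is absolutely summable and is regrouped by the product n =
  d k.\<close>

lemma has_sum_dconv:
  fixes c e m :: "nat \<Rightarrow> 'a :: {real_normed_field,banach}"
  assumes m: "\<And>d k. d > 0 \<Longrightarrow> k > 0 \<Longrightarrow> m (d * k) = m d * m k" and m0: "m 0 = 0"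
    and c: "(\<lambda>n. norm (c n * m n)) summable_on UNIV" and e: "(\<lambda>n. norm (e n * m n)) summable_on UNIV"
  shows "((\<lambda>n. dconv c e n * m n) has_sum (infsum (\<lambda>n. c n * m n) UNIV * infsum (\<lambda>n. e n * m n) UNIV)) UNIV"
proof -
  define f where "f = (\<lambda>(d, k). (c d * m d) * (e k * m k))"
  define P :: "nat set" where "P = {0<..}"
  have cP: "(\<lambda>n. norm (c n * m n)) summable_on P" "(\<lambda>n. norm (e n * m n)) summable_on P"
    using c e by (auto intro: summable_on_subset_banach)
  have eqP: "infsum (\<lambda>n. g n * m n) UNIV = infsum (\<lambda>n. g n * m n) P" for g :: "nat \<Rightarrow> 'a"
    by (rule infsum_cong_neutral) (auto simp: P_def m0)
  have "(\<lambda>p. norm (f p)) summable_on P \<times> P"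
  proof -
    have eq: "norm (f (x, y)) = norm (c x * m x) * norm (e y * m y)" for x y
      by (simp only: f_def case_prod_conv norm_mult)
    have A: "\<forall>x\<in>P. (\<lambda>y. norm (f (x, y))) summable_on P"
      unfolding eq by (intro ballI summable_on_cmult_right cP)
    have inf: "(\<Sum>\<^sub>\<infinity>y\<in>P. norm (f (x, y))) = norm (c x * m x) * (\<Sum>\<^sub>\<infinity>y\<in>P. norm (e y * m y))" for x
      unfolding eq by (rule infsum_cmult_right')
    have "(\<lambda>x. norm (c x * m x) * (\<Sum>\<^sub>\<infinity>y\<in>P. norm (e y * m y))) summable_on P"
      by (intro summable_on_cmult_left cP)
    then have "(\<lambda>x. \<Sum>\<^sub>\<infinity>y\<in>P. norm (f (x, y))) summable_on P"
      by (simp only: inf)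
    moreover have nrm: "norm (\<Sum>\<^sub>\<infinity>y\<in>P. norm (f (x, y))) = (\<Sum>\<^sub>\<infinity>y\<in>P. norm (f (x, y)))" for x
      by (subst real_norm_def, rule abs_of_nonneg, rule infsum_nonneg, rule norm_ge_zero)
    ultimately have B: "(\<lambda>x. norm (\<Sum>\<^sub>\<infinity>y\<in>P. norm (f (x, y)))) summable_on P"
      by (simp only: nrm)
    show ?thesis using Infinite_Sum.abs_summable_on_Sigma_iff[of f P "\<lambda>_. P"] A B by (simp only: simp_thms)
  qed
  then have fs: "f summable_on P \<times> P" by (rule abs_summable_summable)
  have "infsum f (P \<times> P) = infsum (\<lambda>d. infsum (\<lambda>k. f (d, k)) P) P"
    using fs by (rule infsum_Sigma_banach[symmetric])
  also have "\<dots> = infsum (\<lambda>n. c n * m n) P * infsum (\<lambda>n. e n * m n) P"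
  proof -
    have "infsum (\<lambda>k. f (d, k)) P = (c d * m d) * infsum (\<lambda>n. e n * m n) P" for d
      unfolding f_def case_prod_conv by (rule infsum_cmult_right')
    then show ?thesis by (simp only: infsum_cmult_left')
  qed
  finally have hs: "(f has_sum (infsum (\<lambda>n. c n * m n) P * infsum (\<lambda>n. e n * m n) P)) (P \<times> P)"
    using fs by (metis has_sum_infsum)
  have bij: "bij_betw (\<lambda>(n, d). (d, n div d)) (SIGMA n:P. {d. d dvd n}) (P \<times> P)"
    by (rule bij_betwI[where g = "\<lambda>(d, k). (d * k, d)"]) (auto simp: P_def intro: Nat.gr0I)
  have "((\<lambda>p. f ((\<lambda>(n, d). (d, n div d)) p)) has_sum
      (infsum (\<lambda>n. c n * m n) P * infsum (\<lambda>n. e n * m n) P)) (SIGMA n:P. {d. d dvd n})"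
    using hs by (subst has_sum_reindex_bij_betw[OF bij])
  then have "((\<lambda>n. dconv c e n * m n) has_sum (infsum (\<lambda>n. c n * m n) P * infsum (\<lambda>n. e n * m n) P)) P"
  proof (rule has_sum_SigmaD)
    fix n assume n: "n \<in> P"
    have "dconv c e n * m n = (\<Sum>d | d dvd n. f (d, n div d))"
      unfolding dconv_def sum_distrib_right
    proof (intro sum.cong refl)
      fix d assume "d \<in> {d. d dvd n}"
      then have "d > 0" "n div d > 0" "d * (n div d) = n" using n by (auto simp: P_def intro: Nat.gr0I)
      then have "m n = m d * m (n div d)" using m by metis
      then show "c d * e (n div d) * m n = f (d, n div d)" by (simp add: f_def mult_ac)
    qed
    moreover have "finite {d. d dvd n}" using n by (simp add: P_def)
    ultimately show "((\<lambda>d. f (case (n, d) of (n, d) \<Rightarrow> (d, n div d))) has_sum dconv c e n * m n) {d. d dvd n}"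
      using has_sum_finite[of "{d. d dvd n}" "\<lambda>d. f (d, n div d)"] by simp
  qed
  then have "((\<lambda>n. dconv c e n * m n) has_sum (infsum (\<lambda>n. c n * m n) P * infsum (\<lambda>n. e n * m n) P)) UNIV"
    by (rule has_sum_cong_neutral[THEN iffD1, rotated -1]) (auto simp: P_def m0)
  then show ?thesis unfolding eqP .
qed

lemma dabs_mono: "dabs c \<sigma> \<Longrightarrow> \<sigma> \<le> \<tau> \<Longrightarrow> dabs c \<tau>"
  unfolding dabs_def
proof (erule summable_on_comparison_test)
  fix n :: nat assume "\<sigma> \<le> \<tau>"
  then show "cmod (c n) * real n powr (- \<tau>) \<le> cmod (c n) * real n powr (- \<sigma>)"
    by (cases "n = 0") (auto intro!: mult_left_mono powr_mono)
qed auto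

lemma dabs_comparison: "dabs c \<sigma> \<Longrightarrow> (\<And>n. n > 0 \<Longrightarrow> cmod (e n) \<le> cmod (c n)) \<Longrightarrow> dabs e \<sigma>"
  unfolding dabs_def
proof (erule summable_on_comparison_test)
  fix n :: nat assume "\<And>n. n > 0 \<Longrightarrow> cmod (e n) \<le> cmod (c n)"
  then show "cmod (e n) * real n powr (- \<sigma>) \<le> cmod (c n) * real n powr (- \<sigma>)"
    by (cases "n = 0") (auto intro!: mult_right_mono)
qed auto

lemma dabs_abs_summable: "dabs c (Re s) \<longleftrightarrow> (\<lambda>n. cmod (c n * of_nat n powr (- s))) summable_on UNIV"
  by (simp only: dabs_def norm_dterm)

lemma has_sum_dser: "dabs c (Re s) \<Longrightarrow> ((\<lambda>n. c n * of_nat n powr (- s)) has_sum dser c s) UNIV"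
  unfolding dabs_abs_summable dser_def by (rule has_sum_infsum) (rule abs_summable_summable)

lemma sums_dser: "dabs c (Re s) \<Longrightarrow> (\<lambda>n. c n * of_nat n powr (- s)) sums dser c s"
  by (intro has_sum_imp_sums has_sum_dser)

lemma norm_dser_le: "dabs c (Re s) \<Longrightarrow> cmod (dser c s) \<le> dnorm c (Re s)"
  unfolding dser_def dnorm_def norm_dterm[symmetric] dabs_abs_summable by (rule norm_infsum_bound)

lemma dnorm_nonneg: "dnorm c \<sigma> \<ge> 0" unfolding dnorm_def by (intro infsum_nonneg) auto

lemma sum_le_dnorm: "dabs c \<sigma> \<Longrightarrow> finite A \<Longrightarrow> (\<Sum>n\<in>A. cmod (c n) * real n powr (- \<sigma>)) \<le> dnorm c \<sigma>"
  unfolding dabs_def dnorm_def by (intro finite_sum_le_infsum) auto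

lemma dnorm_le: 
  assumes "\<And>A. finite A \<Longrightarrow> (\<Sum>n\<in>A. cmod (c n) * real n powr (- \<sigma>)) \<le> B"
  shows "dabs c \<sigma>" "dnorm c \<sigma> \<le> B"
proof -
  show *: "dabs c \<sigma>" unfolding dabs_def
    by (rule nonneg_bdd_above_summable_on) (use assms in \<open>auto intro!: bdd_aboveI2[of _ _ B]\<close>)
  show "dnorm c \<sigma> \<le> B" using * unfolding dnorm_def dabs_def
    by (intro infsum_le_finite_sums) (use assms in auto)
qed

lemma dnorm_mono_coeffs:
  "dabs c \<sigma> \<Longrightarrow> (\<And>n. n > 0 \<Longrightarrow> cmod (e n) \<le> cmod (c n)) \<Longrightarrow> dnorm e \<sigma> \<le> dnorm c \<sigma>"
  unfolding dnorm_def
proof (rule infsum_mono)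
  assume *: "dabs c \<sigma>" "\<And>n. n > 0 \<Longrightarrow> cmod (e n) \<le> cmod (c n)"
  then show "(\<lambda>n. cmod (c n) * real n powr - \<sigma>) summable_on UNIV" "(\<lambda>n. cmod (e n) * real n powr - \<sigma>) summable_on UNIV"
    using dabs_comparison[OF *] unfolding dabs_def by auto
  fix n :: nat show "cmod (e n) * real n powr (- \<sigma>) \<le> cmod (c n) * real n powr (- \<sigma>)"
    using *(2)[of n] by (cases "n = 0") (auto intro!: mult_right_mono)
qed

lemma dabs_add: "dabs c \<sigma> \<Longrightarrow> dabs e \<sigma> \<Longrightarrow> dabs (\<lambda>n. c n + e n) \<sigma>"
proof -
  assume "dabs c \<sigma>" "dabs e \<sigma>"
  then have "(\<lambda>n. cmod (c n) * real n powr (- \<sigma>) + cmod (e n) * real n powr (- \<sigma>)) summable_on UNIV"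
    unfolding dabs_def by (rule summable_on_add)
  then show ?thesis unfolding dabs_def
    by (rule summable_on_comparison_test) (auto simp: distrib_right[symmetric] intro!: mult_right_mono norm_triangle_ineq)
qed

lemma dser_add: "dabs c (Re s) \<Longrightarrow> dabs e (Re s) \<Longrightarrow> dser (\<lambda>n. c n + e n) s = dser c s + dser e s"
  unfolding dser_def dabs_abs_summable
  by (simp add: distrib_right infsum_add abs_summable_summable)

lemma dabs_cmult: "dabs c \<sigma> \<Longrightarrow> dabs (\<lambda>n. k * c n) \<sigma>"
  unfolding dabs_def by (simp add: norm_mult mult.assoc summable_on_cmult_right)

lemma dser_cmult: "dser (\<lambda>n. k * c n) s = k * dser c s"
  unfolding dser_def by (simp add: mult.assoc infsum_cmult_right')

lemma dconv_norm_le: "cmod (dconv c e n) \<le> dconv (\<lambda>n. cmod (c n)) (\<lambda>n. cmod (e n)) n"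
  unfolding dconv_def by (rule order_trans[OF norm_sum]) (simp add: norm_mult)

lemma has_sum_dconv_norm:
  assumes "dabs c \<sigma>" "dabs e \<sigma>"
  shows "((\<lambda>n. dconv (\<lambda>n. cmod (c n)) (\<lambda>n. cmod (e n)) n * real n powr (- \<sigma>)) has_sum (dnorm c \<sigma> * dnorm e \<sigma>)) UNIV"
  unfolding dnorm_def
  by (rule has_sum_dconv) (use assms in \<open>auto simp: powr_mult dabs_def\<close>)

lemma dabs_dconv:
  assumes "dabs c \<sigma>" "dabs e \<sigma>"
  shows "dabs (dconv c e) \<sigma>" "dnorm (dconv c e) \<sigma> \<le> dnorm c \<sigma> * dnorm e \<sigma>"
proof -
  note hs = has_sum_dconv_norm[OF assms]
  have le: "cmod (dconv c e n) * real n powr (- \<sigma>)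
    \<le> dconv (\<lambda>n. cmod (c n)) (\<lambda>n. cmod (e n)) n * real n powr (- \<sigma>)" for n
    by (intro mult_right_mono dconv_norm_le) auto
  show *: "dabs (dconv c e) \<sigma>" unfolding dabs_def
    using has_sum_imp_summable[OF hs] by (rule summable_on_comparison_test) (use le in auto)
  have "dnorm (dconv c e) \<sigma> \<le> (\<Sum>\<^sub>\<infinity>n. dconv (\<lambda>n. cmod (c n)) (\<lambda>n. cmod (e n)) n * real n powr (- \<sigma>))"
    unfolding dnorm_def using *[unfolded dabs_def] has_sum_imp_summable[OF hs] le by (rule infsum_mono)
  then show "dnorm (dconv c e) \<sigma> \<le> dnorm c \<sigma> * dnorm e \<sigma>"
    unfolding infsumI[OF hs] .
qed

lemma dser_dconv:
  assumes "dabs c (Re s)" "dabs e (Re s)"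
  shows "dser (dconv c e) s = dser c s * dser e s"
  unfolding dser_def
  by (rule infsumI, rule has_sum_dconv)
     (use assms in \<open>auto simp: powr_times_real dabs_abs_summable\<close>)

text \<open>The logarithm is at most n^\<epsilon> / \<epsilon>; spending half of the distance from
  \<sigma> to 1 keeps the exponent above 1.\<close>

lemma dabs_ln:
  assumes "\<And>\<sigma>. \<sigma> > 1 \<Longrightarrow> dabs c \<sigma>" and "\<sigma> > 1"
  shows "dabs (\<lambda>n. of_real (ln (real n)) * c n) \<sigma>"
proof -
  define \<epsilon> where "\<epsilon> = (\<sigma> - 1) / 2"
  have \<epsilon>: "\<epsilon> > 0" "\<sigma> - \<epsilon> > 1" using assms(2) by (auto simp: \<epsilon>_def field_simps)
  have "(\<lambda>n. (1 / \<epsilon>) * (cmod (c n) * real n powr (- (\<sigma> - \<epsilon>)))) summable_on UNIV"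
    using assms(1)[OF \<epsilon>(2)] unfolding dabs_def by (rule summable_on_cmult_right)
  then show ?thesis unfolding dabs_def
  proof (rule summable_on_comparison_test)
    fix n :: nat
    show "cmod (of_real (ln (real n)) * c n) * real n powr - \<sigma>
       \<le> (1 / \<epsilon>) * (cmod (c n) * real n powr (- (\<sigma> - \<epsilon>)))"
    proof (cases "n = 0")
      case False
      have "\<epsilon> * ln (real n) = ln (real n powr \<epsilon>)" using False by (simp add: ln_powr)
      also have "\<dots> \<le> real n powr \<epsilon>" using ln_le_minus_one[of "real n powr \<epsilon>"] False by simp
      finally have "ln (real n) \<le> (1 / \<epsilon>) * real n powr \<epsilon>" using \<epsilon> by (simp add: field_simps)
      moreover have "ln (real n) \<ge> 0" using False by simp
      ultimately have "cmod (of_real (ln (real n)) * c n) \<le> (1 / \<epsilon>) * real n powr \<epsilon> * cmod (c n)"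
        unfolding norm_mult norm_of_real by (intro mult_right_mono) auto
      then have "cmod (of_real (ln (real n)) * c n) * real n powr - \<sigma>
         \<le> ((1 / \<epsilon>) * real n powr \<epsilon> * cmod (c n)) * real n powr - \<sigma>"
        by (intro mult_right_mono) auto
      also have "\<dots> = (1 / \<epsilon>) * (cmod (c n) * (real n powr \<epsilon> * real n powr - \<sigma>))" by simp
      also have "real n powr \<epsilon> * real n powr - \<sigma> = real n powr (- (\<sigma> - \<epsilon>))" by (simp flip: powr_add)
      finally show ?thesis .
    qed simp
  qed auto
qed

text \<open>Termwise differentiation: on a disc of radius (Re s - 1) / 2 around s the series is
  dominated by the absolute series at the real part diminished by that radius.\<close>

lemma has_field_derivative_dser:
  assumes c: "\<And>\<sigma>. \<sigma> > 1 \<Longrightarrow> dabs c \<sigma>" and s: "Re s > 1"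
  shows "(dser c has_field_derivative - dser (\<lambda>n. of_real (ln (real n)) * c n) s) (at s)"
proof -
  define S where "S = {s. Re s > 1}"
  define f where "f = (\<lambda>n s. c n * of_nat n powr (- s))"
  define f' where "f' = (\<lambda>n s. - (of_real (ln (real n)) * c n * of_nat n powr (- s)))"
  have opn: "open S" unfolding S_def by (rule open_halfspace_Re_gt)
  have "\<exists>g g'. \<forall>x\<in>S. ((\<lambda>n. f n x) sums g x) \<and> ((\<lambda>n. f' n x) sums g' x) \<and> (g has_field_derivative g' x) (at x)"
  proof (rule series_and_derivative_comparison_local[OF opn])
    fix n x assume "x \<in> S"
    show "(f n has_field_derivative f' n x) (at x)"
    proof (cases "n = 0")
      case False
      have "((\<lambda>s. of_nat n powr (- s)) has_field_derivative (Ln (of_nat n) * of_nat n powr (- x)) * (- 1)) (at x)"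
        by (rule DERIV_chain2[where f = "\<lambda>z. of_nat n powr z", OF has_field_derivative_powr_right])
           (use False in \<open>auto intro!: derivative_eq_intros\<close>)
      then have "(f n has_field_derivative c n * ((Ln (of_nat n) * of_nat n powr (- x)) * (- 1))) (at x)"
        unfolding f_def by (rule DERIV_cmult)
      then show ?thesis using False unfolding f'_def by (simp add: Ln_of_nat mult_ac)
    qed (auto simp: f_def f'_def)
  next
    fix x assume x: "x \<in> S"
    define d where "d = (Re x - 1) / 2"
    have d: "d > 0" "Re x - d > 1" using x by (auto simp: d_def S_def field_simps)
    have "summable (\<lambda>n. cmod (c n) * real n powr (- (Re x - d)))"
      using c[OF d(2)] unfolding dabs_def by (rule summable_on_UNIV_nonneg_real_iff[THEN iffD1, rotated]) auto
    moreover have "norm (f n y) \<le> cmod (c n) * real n powr (- (Re x - d))" if "y \<in> ball x d \<inter> S" for n y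
    proof (cases "n = 0")
      case False
      have "\<bar>Re (x - y)\<bar> < d" using that abs_Re_le_cmod[of "x - y"] by (simp add: dist_norm)
      then have "Re x - d \<le> Re y" by auto
      then show ?thesis unfolding f_def norm_dterm using False by (intro mult_left_mono powr_mono) auto
    qed (simp add: f_def)
    ultimately show "\<exists>d h. 0 < d \<and> summable h \<and> (\<forall>\<^sub>F n in sequentially. \<forall>y\<in>ball x d \<inter> S. norm (f n y) \<le> h n)"
      using d(1) by (intro exI[of _ d] exI conjI always_eventually allI ballI) auto
  qed
  then obtain g g' where g: "\<And>x. x \<in> S \<Longrightarrow> (\<lambda>n. f n x) sums g x" "\<And>x. x \<in> S \<Longrightarrow> (\<lambda>n. f' n x) sums g' x"
    "\<And>x. x \<in> S \<Longrightarrow> (g has_field_derivative g' x) (at x)" by blast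
  have geq: "g x = dser c x" if "x \<in> S" for x
    using g(1)[OF that] sums_dser[of c x] c that unfolding f_def S_def by (auto intro: sums_unique2)
  have sS: "s \<in> S" using s by (simp add: S_def)
  have "(\<lambda>n. - f' n s) sums dser (\<lambda>n. of_real (ln (real n)) * c n) s"
    unfolding f'_def using sums_dser[of "\<lambda>n. of_real (ln (real n)) * c n" s] dabs_ln[OF c s] by simp
  then have "g' s = - dser (\<lambda>n. of_real (ln (real n)) * c n) s"
    using sums_minus[OF g(2)[OF sS]] sums_unique2 by fastforce
  then have "(g has_field_derivative - dser (\<lambda>n. of_real (ln (real n)) * c n) s) (at s)"
    using g(3)[OF sS] by simp
  then show ?thesis
    by (rule has_field_derivative_transform_within_open[OF _ opn sS]) (rule geq)
qed

text \<open>If the coefficients below \<open>N\<close> vanish, the term with index \<open>N\<close> dominates as \<open>\<sigma> \<rightarrow> \<infinity>\<close>.\<close>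

lemma dser_tail:
  assumes c: "dabs c \<sigma>0" and N: "N \<ge> 1" and z: "\<And>n. 0 < n \<Longrightarrow> n < N \<Longrightarrow> c n = 0" and \<sigma>: "\<sigma> \<ge> \<sigma>0"
  shows "cmod (dser c (of_real \<sigma>) * of_nat N powr (of_real \<sigma>) - c N)
     \<le> dnorm c \<sigma>0 * real N powr \<sigma>0 * (real N / real (N + 1)) powr (\<sigma> - \<sigma>0)"
proof -
  define e where "e n = (if n \<le> N then 0 else c n)" for n
  have c\<sigma>: "dabs c \<sigma>" using c \<sigma> by (rule dabs_mono)
  have e0: "dabs e \<sigma>0" using c by (rule dabs_comparison) (auto simp: e_def)
  have e\<sigma>: "dabs e \<sigma>" using e0 \<sigma> by (rule dabs_mono)
  have hs: "((\<lambda>n. c n * of_nat n powr (- of_real \<sigma>)) has_sum dser c (of_real \<sigma>)) UNIV"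
    using has_sum_dser[of c "of_real \<sigma>"] c\<sigma> by simp
  have "((\<lambda>n. if n = N then c n * of_nat n powr (- of_real \<sigma>) else 0) has_sum c N * of_nat N powr (- of_real \<sigma>)) UNIV"
    using has_sum_finite[of "{N}" "\<lambda>n. c n * of_nat n powr (- of_real \<sigma>)"]
    by (subst has_sum_cong_neutral[of "{N}" UNIV]) auto
  then have "((\<lambda>n. (if n = N then c n * of_nat n powr (- of_real \<sigma>) else 0) + e n * of_nat n powr (- of_real \<sigma>))
      has_sum (c N * of_nat N powr (- of_real \<sigma>) + dser e (of_real \<sigma>))) UNIV"
    using has_sum_dser[of e "of_real \<sigma>"] e\<sigma> by (intro has_sum_add) auto
  also have "(\<lambda>n. (if n = N then c n * of_nat n powr (- of_real \<sigma>) else 0) + e n * of_nat n powr (- of_real \<sigma>))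
     = (\<lambda>n. c n * of_nat n powr (- of_real \<sigma>))"
  proof
    fix n show "(if n = N then c n * of_nat n powr (- of_real \<sigma>) else 0) + e n * of_nat n powr (- of_real \<sigma>)
       = c n * of_nat n powr (- of_real \<sigma>)"
      using z[of n] by (cases "n = 0"; cases "n = N"; cases "n < N") (auto simp: e_def)
  qed
  finally have eq: "dser c (of_real \<sigma>) = c N * of_nat N powr (- of_real \<sigma>) + dser e (of_real \<sigma>)"
    using hs has_sum_unique by blast
  have pw: "of_nat N powr (- of_real \<sigma>) * of_nat N powr (of_real \<sigma>) = (1::complex)"
    using N by (simp flip: powr_add)
  have "dser c (of_real \<sigma>) * of_nat N powr (of_real \<sigma>)
     = c N * (of_nat N powr (- of_real \<sigma>) * of_nat N powr (of_real \<sigma>)) + dser e (of_real \<sigma>) * of_nat N powr (of_real \<sigma>)"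
    unfolding eq by (simp add: algebra_simps)
  then have "cmod (dser c (of_real \<sigma>) * of_nat N powr (of_real \<sigma>) - c N) = cmod (dser e (of_real \<sigma>)) * real N powr \<sigma>"
    unfolding pw using N by (simp add: norm_mult norm_powr_real_powr)
  also have "\<dots> \<le> dnorm e \<sigma> * real N powr \<sigma>"
    using norm_dser_le[of e "of_real \<sigma>"] e\<sigma> by (intro mult_right_mono) auto
  also have "dnorm e \<sigma> \<le> (\<Sum>\<^sub>\<infinity>n. (cmod (c n) * real n powr (- \<sigma>0)) * real (N + 1) powr (- (\<sigma> - \<sigma>0)))"
    unfolding dnorm_def
  proof (rule infsum_mono)
    show "(\<lambda>n. cmod (e n) * real n powr - \<sigma>) summable_on UNIV" using e\<sigma> unfolding dabs_def .
    show "(\<lambda>n. cmod (c n) * real n powr - \<sigma>0 * real (N + 1) powr - (\<sigma> - \<sigma>0)) summable_on UNIV"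
      using c unfolding dabs_def by (rule summable_on_cmult_left)
    fix n :: nat
    show "cmod (e n) * real n powr - \<sigma> \<le> cmod (c n) * real n powr - \<sigma>0 * real (N + 1) powr - (\<sigma> - \<sigma>0)"
    proof (cases "n \<le> N")
      case False
      have "real n powr - \<sigma> = real n powr - \<sigma>0 * real n powr - (\<sigma> - \<sigma>0)" using False by (simp flip: powr_add)
      also have "real n powr - (\<sigma> - \<sigma>0) \<le> real (N + 1) powr - (\<sigma> - \<sigma>0)"
        using False \<sigma> by (intro powr_mono2') auto
      finally show ?thesis using False by (simp add: e_def mult.assoc mult_left_mono)
    qed (simp add: e_def)
  qed
  also have "\<dots> = dnorm c \<sigma>0 * real (N + 1) powr (- (\<sigma> - \<sigma>0))"
    unfolding dnorm_def by (rule infsum_cmult_left')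
  also have "dnorm c \<sigma>0 * real (N + 1) powr (- (\<sigma> - \<sigma>0)) * real N powr \<sigma>
    = dnorm c \<sigma>0 * real N powr \<sigma>0 * (real N / real (N + 1)) powr (\<sigma> - \<sigma>0)"
  proof -
    have "real N powr \<sigma> = real N powr \<sigma>0 * real N powr (\<sigma> - \<sigma>0)" using N by (simp flip: powr_add)
    then show ?thesis unfolding powr_minus_divide by (simp add: powr_divide)
  qed
  finally show ?thesis by (simp add: mult_right_mono)
qed

lemma dser_leading:
  assumes c: "dabs c \<sigma>0" and N: "N \<ge> 1" and z: "\<And>n. 0 < n \<Longrightarrow> n < N \<Longrightarrow> c n = 0"
  shows "((\<lambda>\<sigma>. dser c (of_real \<sigma>) * of_nat N powr (of_real \<sigma>)) \<longlongrightarrow> c N) at_top"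
proof (rule Lim_null[THEN iffD2], rule Lim_null_comparison)
  show "\<forall>\<^sub>F \<sigma> in at_top. cmod (dser c (of_real \<sigma>) * of_nat N powr (of_real \<sigma>) - c N)
     \<le> dnorm c \<sigma>0 * real N powr \<sigma>0 * (real N / real (N + 1)) powr (\<sigma> - \<sigma>0)"
    using dser_tail[OF assms] by (intro eventually_at_top_linorderI[of \<sigma>0])
  define r where "r = real N / real (N + 1)"
  have r: "0 < r" "r < 1" using N by (auto simp: r_def)
  have "((\<lambda>\<sigma>. r powr (\<sigma> - \<sigma>0)) \<longlongrightarrow> 0) at_top"
  proof -
    have "((\<lambda>\<sigma>. exp ((\<sigma> - \<sigma>0) * ln r)) \<longlongrightarrow> 0) at_top"
    proof (rule filterlim_compose[OF exp_at_bot])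
      show "filterlim (\<lambda>\<sigma>. (\<sigma> - \<sigma>0) * ln r) at_bot at_top"
        unfolding filterlim_at_bot
      proof
        fix Z :: real
        have lr: "ln r < 0" using r by simp
        show "\<forall>\<^sub>F \<sigma> in at_top. (\<sigma> - \<sigma>0) * ln r \<le> Z"
        proof (rule eventually_at_top_linorderI)
          fix \<sigma> assume "\<sigma>0 + Z / ln r \<le> \<sigma>"
          then have "(\<sigma> - \<sigma>0) * ln r \<le> (Z / ln r) * ln r" using lr by (intro mult_right_mono_neg) auto
          then show "(\<sigma> - \<sigma>0) * ln r \<le> Z" using lr by simp
        qed
      qed
    qed
    then show ?thesis using r by (simp add: powr_def)
  qed
  then show "((\<lambda>\<sigma>. dnorm c \<sigma>0 * real N powr \<sigma>0 * (real N / real (N + 1)) powr (\<sigma> - \<sigma>0)) \<longlongrightarrow> 0) at_top"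
    unfolding r_def by (rule tendsto_mult_right_zero)
qed

text \<open>If the coefficients between 0 and N vanish, the coefficient at N is the limit of the
  series times N^\<sigma>, which is 0. Values on a real half-line determine everything.\<close>

lemma dser_unique:
  assumes c: "dabs c \<sigma>0" and z: "\<And>\<sigma>. \<sigma> \<ge> \<sigma>0 \<Longrightarrow> dser c (of_real \<sigma>) = 0" and n: "n > 0"
  shows "c n = 0"
  using n
proof (induction n rule: less_induct)
  case (less N)
  have "((\<lambda>\<sigma>. dser c (of_real \<sigma>) * of_nat N powr (of_real \<sigma>)) \<longlongrightarrow> c N) at_top"
    using c less by (intro dser_leading) auto
  moreover have "((\<lambda>\<sigma>. dser c (of_real \<sigma>) * of_nat N powr (of_real \<sigma>)) \<longlongrightarrow> 0) at_top"
    using z by (intro tendsto_eventually eventually_at_top_linorderI[of \<sigma>0]) auto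
  ultimately show ?case using tendsto_unique by force
qed

lemma dser_at_top:
  assumes "dabs c \<sigma>0"
  shows "((\<lambda>\<sigma>. dser c (of_real \<sigma>)) \<longlongrightarrow> c 1) at_top"
  using dser_leading[OF assms, of 1] by simp

text \<open>By the convolution identity the series has derivative \<open>- dser l\<close> times
  itself, and \<open>- dser l\<close> is also the derivative of the exponent. So the quotient of
  both sides is constant on the half-plane, with limit 1 at infinity. In particular the series has
  no zeros there. At n = 1 the exponent has the coefficient 0 / 0, which is 0.\<close>

lemma dser_eq_exp:
  assumes c: "\<And>\<sigma>. \<sigma> > 1 \<Longrightarrow> dabs c \<sigma>" and l: "\<And>\<sigma>. \<sigma> > 1 \<Longrightarrow> dabs l \<sigma>"
    and c1: "c 1 = 1" and l1: "l 1 = 0"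
    and conv: "\<And>n. n > 0 \<Longrightarrow> of_real (ln (real n)) * c n = dconv l c n"
    and s: "Re s > 1"
  shows "dser c s = exp (dser (\<lambda>n. l n / of_real (ln (real n))) s)"
proof -
  define p where "p = (\<lambda>n. l n / of_real (ln (real n)))"
  have p: "dabs p \<sigma>" if "\<sigma> > 1" for \<sigma>
  proof -
    have "dabs (\<lambda>n. 2 * l n) \<sigma>" using l[OF that] by (rule dabs_cmult)
    then show ?thesis
    proof (rule dabs_comparison)
      fix n :: nat assume n: "n > 0"
      show "cmod (p n) \<le> cmod (2 * l n)"
      proof (cases "n = 1")
        case False
        then have "ln 2 \<le> ln (real n)" using n by (intro ln_mono) auto
        then have "1 / 2 \<le> ln (real n)" using ln2_ge_two_thirds by linarith
        then have "cmod (l n) / ln (real n) \<le> cmod (l n) / (1 / 2)" by (intro divide_left_mono) auto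
        moreover have "\<bar>ln (real n)\<bar> = ln (real n)" using n by simp
        ultimately show ?thesis unfolding p_def norm_divide norm_of_real norm_mult by simp
      qed (simp add: p_def)
    qed
  qed
  define H where "H = (\<lambda>s. dser c s * exp (- dser p s))"
  have lnp: "dser (\<lambda>n. of_real (ln (real n)) * p n) s = dser l s" for s
    unfolding dser_def
  proof (intro infsum_cong)
    fix n :: nat
    show "of_real (ln (real n)) * p n * of_nat n powr - s = l n * of_nat n powr - s"
      using l1 by (cases "n = 0"; cases "n = 1") (auto simp: p_def)
  qed
  have lnc: "dser (\<lambda>n. of_real (ln (real n)) * c n) s = dser l s * dser c s" if "Re s > 1" for s
  proof -
    have "dser (\<lambda>n. of_real (ln (real n)) * c n) s = dser (dconv l c) s"
      unfolding dser_def
    proof (intro infsum_cong)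
      fix n :: nat
      show "of_real (ln (real n)) * c n * of_nat n powr - s = dconv l c n * of_nat n powr - s"
        using conv[of n] by (cases "n = 0") auto
    qed
    then show ?thesis using that c l by (simp add: dser_dconv)
  qed
  have "(H has_field_derivative 0) (at s within {s. Re s > 1})" if "s \<in> {s. Re s > 1}" for s
  proof (rule has_field_derivative_at_within)
    have "Re s > 1" using that by simp
    then show "(H has_field_derivative 0) (at s)" unfolding H_def
      by (auto intro!: derivative_eq_intros has_field_derivative_dser[OF c] has_field_derivative_dser[OF p]
          simp: lnp lnc)
  qed
  then obtain k where k: "\<And>s. Re s > 1 \<Longrightarrow> H s = k"
    using has_field_derivative_zero_constant[of "{s. Re s > 1}" H] convex_halfspace_Re_gt by auto
  have "((\<lambda>\<sigma>. dser c (of_real \<sigma>) * exp (- dser p (of_real \<sigma>))) \<longlongrightarrow> c 1 * exp (- p 1)) at_top"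
    by (intro tendsto_intros dser_at_top[of _ 2] c p) auto
  then have "((\<lambda>\<sigma>. H (of_real \<sigma>)) \<longlongrightarrow> 1) at_top" using c1 l1 by (simp add: H_def p_def)
  moreover have "((\<lambda>\<sigma>. H (of_real \<sigma>)) \<longlongrightarrow> k) at_top"
    using k by (intro tendsto_eventually eventually_at_top_linorderI[of 2]) auto
  ultimately have "k = 1" using tendsto_unique by force
  then have "H s = 1" using k s by simp
  then show ?thesis unfolding H_def p_def[symmetric] by (simp add: exp_minus field_simps)
qed

text \<open>Comparison of the sum with the integral of z^(- \<sigma>), through the mean value
  theorem for z^(1 - \<sigma>) on [n, n + 1].\<close>

lemma powr_telescope_bounds:
  fixes \<sigma> :: real
  assumes "\<sigma> > 1" "n \<ge> 1"
  shows "real (Suc n) powr (- \<sigma>) \<le> (real n powr (1 - \<sigma>) - real (Suc n) powr (1 - \<sigma>)) / (\<sigma> - 1)"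
    "(real n powr (1 - \<sigma>) - real (Suc n) powr (1 - \<sigma>)) / (\<sigma> - 1) \<le> real n powr (- \<sigma>)"
proof -
  have "\<exists>z. real n < z \<and> z < real (Suc n) \<and>
      real (Suc n) powr (1 - \<sigma>) - real n powr (1 - \<sigma>) = (real (Suc n) - real n) * ((1 - \<sigma>) * z powr (- \<sigma>))"
  proof (rule MVT2)
    fix x assume "real n \<le> x" "x \<le> real (Suc n)"
    then have "x > 0" using assms by linarith
    then show "((\<lambda>x. x powr (1 - \<sigma>)) has_real_derivative (1 - \<sigma>) * x powr (- \<sigma>)) (at x)"
      using has_real_derivative_powr[of x "1 - \<sigma>"] by simp
  qed simp
  then obtain z where z: "real n < z" "z < real (Suc n)"
      "real (Suc n) powr (1 - \<sigma>) - real n powr (1 - \<sigma>) = (1 - \<sigma>) * z powr (- \<sigma>)" by auto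
  have eq: "(real n powr (1 - \<sigma>) - real (Suc n) powr (1 - \<sigma>)) / (\<sigma> - 1) = z powr (- \<sigma>)"
    using z(3) assms(1) by (simp add: field_simps)
  show "real (Suc n) powr (- \<sigma>) \<le> (real n powr (1 - \<sigma>) - real (Suc n) powr (1 - \<sigma>)) / (\<sigma> - 1)"
    unfolding eq using z assms by (intro powr_mono2') auto
  show "(real n powr (1 - \<sigma>) - real (Suc n) powr (1 - \<sigma>)) / (\<sigma> - 1) \<le> real n powr (- \<sigma>)"
    unfolding eq using z assms by (intro powr_mono2') auto
qed

lemma zeta_bounds:
  assumes "\<sigma> > 1"
  shows "dabs (\<lambda>_. 1) \<sigma>" "dnorm (\<lambda>_. 1) \<sigma> \<le> 1 + 1 / (\<sigma> - 1)" "1 / (\<sigma> - 1) \<le> dnorm (\<lambda>_. 1) \<sigma>"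
proof -
  have up: "(\<Sum>n=1..N. real n powr (- \<sigma>)) \<le> 1 + (1 - real N powr (1 - \<sigma>)) / (\<sigma> - 1)" if "N \<ge> 1" for N
    using that
  proof (induction N rule: nat_induct_at_least)
    case (Suc n)
    then show ?case using powr_telescope_bounds(1)[OF assms, of n] by (simp add: diff_divide_distrib)
  qed simp
  have lo: "(1 - real (Suc N) powr (1 - \<sigma>)) / (\<sigma> - 1) \<le> (\<Sum>n=1..N. real n powr (- \<sigma>))" for N
  proof (induction N)
    case (Suc n)
    then show ?case using powr_telescope_bounds(2)[OF assms, of "Suc n"] by (simp add: diff_divide_distrib)
  qed simp
  have fin: "(\<Sum>n\<in>A. cmod 1 * real n powr (- \<sigma>)) \<le> 1 + 1 / (\<sigma> - 1)" if "finite A" for A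
  proof -
    define N where "N = Suc (Max (insert 0 A))"
    have "A \<subseteq> insert 0 {1..N}"
    proof
      fix a assume "a \<in> A"
      then have "a \<le> Max (insert 0 A)" using that by (intro Max_ge) auto
      then have "a \<le> N" unfolding N_def by (rule le_SucI)
      then show "a \<in> insert 0 {1..N}" by (cases "a = 0") auto
    qed
    then have "(\<Sum>n\<in>A. cmod 1 * real n powr (- \<sigma>)) \<le> (\<Sum>n\<in>insert 0 {1..N}. cmod 1 * real n powr (- \<sigma>))"
      by (intro sum_mono2) auto
    also have "\<dots> = (\<Sum>n=1..N. real n powr (- \<sigma>))" by simp
    also have "\<dots> \<le> 1 + (1 - real N powr (1 - \<sigma>)) / (\<sigma> - 1)" by (rule up) (simp add: N_def)
    also have "\<dots> \<le> 1 + 1 / (\<sigma> - 1)" using assms by (intro add_left_mono divide_right_mono) auto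
    finally show ?thesis .
  qed
  show *: "dabs (\<lambda>_. 1) \<sigma>" "dnorm (\<lambda>_. 1) \<sigma> \<le> 1 + 1 / (\<sigma> - 1)"
    by (rule dnorm_le[OF fin], assumption)+
  have "(1 - real (Suc N) powr (1 - \<sigma>)) / (\<sigma> - 1) \<le> dnorm (\<lambda>_. 1) \<sigma>" for N
    using lo[of N] sum_le_dnorm[OF *(1), of "{1..N}"] by simp
  moreover have "(\<lambda>N. (1 - real (Suc N) powr (1 - \<sigma>)) / (\<sigma> - 1)) \<longlonglongrightarrow> (1 - 0) / (\<sigma> - 1)"
    using assms by (intro tendsto_intros tendsto_neg_powr filterlim_compose[OF filterlim_real_sequentially filterlim_Suc]) auto
  ultimately show "1 / (\<sigma> - 1) \<le> dnorm (\<lambda>_. 1) \<sigma>"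
    by (intro LIMSEQ_le_const2[where X = "\<lambda>N. (1 - real (Suc N) powr (1 - \<sigma>)) / (\<sigma> - 1)"]) auto
qed

lemma dabs_mangoldt:
  assumes "\<sigma> > 1" shows "dabs mangoldt \<sigma>"
  using dabs_ln[OF zeta_bounds(1) assms]
proof (rule dabs_comparison)
  fix n :: nat assume "n > 0"
  then show "cmod (mangoldt n) \<le> cmod (of_real (ln (real n)) * 1)" using mangoldt_le[of n] by simp
qed

lemma dconv_mangoldt_1: "n > 0 \<Longrightarrow> dconv mangoldt (\<lambda>_. 1) n = (of_real (ln (real n)) :: 'a :: {real_algebra_1,comm_semiring_1})"
  using mangoldt_sum[of n, where ?'a = 'a] by (simp add: dconv_def)

text \<open>Since \<Lambda> convolved with 1 is log, multiplying by \<zeta>(1 + \<alpha>) gives the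
  series of log n, which is at most (2 / \<alpha>) \<zeta>(1 + \<alpha> / 2). Division by \<zeta>(1
  + \<alpha>) >= 1 / \<alpha> then leaves the order 1 / \<alpha>.\<close>

lemma dnorm_mangoldt_le:
  assumes \<alpha>: "\<alpha> > 0"
  shows "dnorm mangoldt (1 + \<alpha>) \<le> 2 + 4 / \<alpha>"
proof -
  have d1: "dabs mangoldt (1 + \<alpha>)" "dabs (\<lambda>_. 1) (1 + \<alpha>)" "dabs (\<lambda>_. 1) (1 + \<alpha> / 2)"
    using \<alpha> by (auto intro!: dabs_mangoldt zeta_bounds)
  have hs: "((\<lambda>n. dconv mangoldt (\<lambda>_. 1) n * real n powr (- (1 + \<alpha>))) has_sum (dnorm mangoldt (1 + \<alpha>) * dnorm (\<lambda>_. 1) (1 + \<alpha>))) UNIV"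
    using has_sum_dconv_norm[OF d1(1,2)] by simp
  have "dnorm mangoldt (1 + \<alpha>) * dnorm (\<lambda>_. 1) (1 + \<alpha>) \<le> (\<Sum>\<^sub>\<infinity>n. (2 / \<alpha>) * (cmod 1 * real n powr (- (1 + \<alpha> / 2))))"
    unfolding infsumI[OF hs, symmetric]
  proof (rule infsum_mono)
    show "(\<lambda>n. dconv mangoldt (\<lambda>_. 1) n * real n powr - (1 + \<alpha>)) summable_on UNIV" using hs by (rule has_sum_imp_summable)
    show "(\<lambda>n. (2 / \<alpha>) * (cmod 1 * real n powr (- (1 + \<alpha> / 2)))) summable_on UNIV"
      using d1(3) unfolding dabs_def by (rule summable_on_cmult_right)
    fix n :: nat
    show "dconv mangoldt (\<lambda>_. 1) n * real n powr - (1 + \<alpha>) \<le> (2 / \<alpha>) * (cmod 1 * real n powr (- (1 + \<alpha> / 2)))"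
    proof (cases "n = 0")
      case False
      then have n: "n > 0" by simp
      have "dconv mangoldt (\<lambda>_. 1) n * real n powr - (1 + \<alpha>) = ln (real n) * real n powr - (1 + \<alpha>)"
        using dconv_mangoldt_1[OF n, where ?'a = real] by simp
      also have "\<dots> \<le> (real n powr (\<alpha> / 2) / (\<alpha> / 2)) * real n powr - (1 + \<alpha>)"
        using ln_le_root[of "real n" "\<alpha> / 2"] n \<alpha> by (intro mult_right_mono) auto
      also have "\<dots> = (2 / \<alpha>) * (real n powr (\<alpha> / 2) * real n powr - (1 + \<alpha>))" using \<alpha> by simp
      also have "real n powr (\<alpha> / 2) * real n powr - (1 + \<alpha>) = real n powr (\<alpha> / 2 + - (1 + \<alpha>))"
        by (rule powr_add[symmetric])
      also have "\<alpha> / 2 + - (1 + \<alpha>) = - (1 + \<alpha> / 2)" by (simp add: field_simps)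
      finally show ?thesis by simp
    qed simp
  qed
  also have "\<dots> = (2 / \<alpha>) * dnorm (\<lambda>_. 1) (1 + \<alpha> / 2)" unfolding dnorm_def by (rule infsum_cmult_right')
  also have "\<dots> \<le> (2 / \<alpha>) * (1 + 1 / (\<alpha> / 2))"
    using zeta_bounds(2)[of "1 + \<alpha> / 2"] \<alpha> by (intro mult_left_mono) auto
  finally have *: "dnorm mangoldt (1 + \<alpha>) * dnorm (\<lambda>_. 1) (1 + \<alpha>) \<le> (2 / \<alpha>) * (1 + 2 / \<alpha>)" by simp
  have "dnorm mangoldt (1 + \<alpha>) * (1 / \<alpha>) \<le> dnorm mangoldt (1 + \<alpha>) * dnorm (\<lambda>_. 1) (1 + \<alpha>)"
    using zeta_bounds(3)[of "1 + \<alpha>"] \<alpha> by (intro mult_left_mono dnorm_nonneg) auto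
  with * have "dnorm mangoldt (1 + \<alpha>) * (1 / \<alpha>) \<le> (2 / \<alpha>) * (1 + 2 / \<alpha>)" by linarith
  then have "dnorm mangoldt (1 + \<alpha>) * (1 / \<alpha>) * \<alpha> \<le> (2 / \<alpha>) * (1 + 2 / \<alpha>) * \<alpha>"
    using \<alpha> by (intro mult_right_mono) auto
  moreover have "dnorm mangoldt (1 + \<alpha>) * (1 / \<alpha>) * \<alpha> = dnorm mangoldt (1 + \<alpha>)" using \<alpha> by simp
  moreover have "(2 / \<alpha>) * (1 + 2 / \<alpha>) * \<alpha> = 2 + 4 / \<alpha>" using \<alpha> by (simp add: field_simps)
  ultimately show ?thesis by simp
qed

lemma chi4_mult: "chi4 (a * b) = chi4 a * chi4 b"
proof -
  have r: "n mod 4 = 0 \<or> n mod 4 = 1 \<or> n mod 4 = 2 \<or> n mod 4 = (3::nat)" for n by presburger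
  have "(a * b) mod 4 = (a mod 4) * (b mod 4) mod 4" by (simp add: mod_mult_eq)
  then show ?thesis using r[of a] r[of b] unfolding chi4_def by (elim disjE) simp_all
qed

lemma chi4_abs_le: "\<bar>chi4 n\<bar> \<le> 1" by (simp add: chi4_def)

lemma dabs_chi4: "\<sigma> > 1 \<Longrightarrow> dabs (\<lambda>n. of_real (chi4 n)) \<sigma>"
  by (rule dabs_comparison[OF zeta_bounds(1)]) (auto simp: chi4_abs_le)

text \<open>An alternating series with decreasing terms. The induction follows the partial sums up
  to multiples of 4 and leaves room below 1 for the next positive term.\<close>

lemma norm_L_chi4_le:
  assumes \<sigma>: "\<sigma> > 1"
  shows "cmod (dser (\<lambda>n. of_real (chi4 n)) (of_real \<sigma>)) \<le> 1"
proof -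
  define S where "S N = (\<Sum>n<N. of_real (chi4 n) * of_nat n powr (- of_real \<sigma>) :: complex)" for N
  have lim: "S \<longlonglongrightarrow> dser (\<lambda>n. of_real (chi4 n)) (of_real \<sigma>)"
    using sums_dser[of "\<lambda>n. of_real (chi4 n)" "of_real \<sigma>"] dabs_chi4[OF \<sigma>] unfolding sums_def S_def by simp
  define R where "R N = (\<Sum>n<N. chi4 n * real n powr (- \<sigma>))" for N
  have SR: "S N = of_real (R N)" for N unfolding S_def R_def by (simp add: powr_of_real_eq)
  have step: "R (4 * Suc K) = R (4 * K) + real (4 * K + 1) powr (- \<sigma>) - real (4 * K + 3) powr (- \<sigma>)" for K
  proof -
    have e: "4 * K + 1 = Suc (4 * K)" "4 * K + 3 = Suc (Suc (Suc (4 * K)))" "4 * Suc K = Suc (Suc (Suc (Suc (4 * K))))"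
      by simp_all
    have "chi4 (4 * K) = 0" "chi4 (Suc (4 * K)) = 1" "chi4 (Suc (Suc (4 * K))) = 0" "chi4 (Suc (Suc (Suc (4 * K)))) = -1"
    proof -
      have "4 * K mod 4 = 0" "Suc (4 * K) mod 4 = 1" "Suc (Suc (4 * K)) mod 4 = 2" "Suc (Suc (Suc (4 * K))) mod 4 = 3"
        by presburger+
      then show "chi4 (4 * K) = 0" "chi4 (Suc (4 * K)) = 1" "chi4 (Suc (Suc (4 * K))) = 0" "chi4 (Suc (Suc (Suc (4 * K)))) = -1"
        by (simp_all only: chi4_def) simp_all
    qed
    then show ?thesis unfolding e R_def sum.lessThan_Suc by (simp del: of_nat_Suc)
  qed
  have "0 \<le> R (4 * K) \<and> R (4 * K) \<le> 1 - real (4 * K + 1) powr (- \<sigma>)" for K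
  proof (induction K)
    case 0
    then show ?case by (simp add: R_def)
  next
    case (Suc K)
    have "real (4 * K + 3) powr (- \<sigma>) \<le> real (4 * K + 1) powr (- \<sigma>)" using \<sigma> by (intro powr_mono2') auto
    moreover have "real (4 * Suc K + 1) powr (- \<sigma>) \<le> real (4 * K + 3) powr (- \<sigma>)" using \<sigma> by (intro powr_mono2') auto
    ultimately show ?case using Suc step[of K] by linarith
  qed
  then have "cmod (S (4 * K)) \<le> 1" for K unfolding SR using powr_ge_zero[of "real (4 * K + 1)" "- \<sigma>"]
    by (smt (verit) norm_of_real)
  moreover have "(\<lambda>K. S (4 * K)) \<longlonglongrightarrow> dser (\<lambda>n. of_real (chi4 n)) (of_real \<sigma>)"
    using LIMSEQ_subseq_LIMSEQ[OF lim, of "\<lambda>K. 4 * K"] by (simp add: strict_mono_def o_def)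
  ultimately show ?thesis
    by (intro LIMSEQ_le_const2[OF tendsto_norm]) auto
qed

lemma dabs_gauss_mangoldt: "\<sigma> > 1 \<Longrightarrow> dabs (\<lambda>n. of_real (gauss_mangoldt n)) \<sigma>"
  by (rule dabs_comparison[OF dabs_cmult[OF dabs_mangoldt, of \<sigma> 2]])
     (auto simp: norm_mult gauss_mangoldt_nonneg gauss_mangoldt_le)

lemma dabs_div_ln:
  assumes "dabs l \<sigma>"
  shows "dabs (\<lambda>n. l n / of_real (ln (real n))) \<sigma>"
  using dabs_cmult[OF assms, of 2]
proof (rule dabs_comparison)
  fix n :: nat assume n: "n > 0"
  show "cmod (l n / of_real (ln (real n))) \<le> cmod (2 * l n)"
  proof (cases "n = 1")
    case False
    then have "ln 2 \<le> ln (real n)" using n by (intro ln_mono) auto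
    then have "1 / 2 \<le> ln (real n)" using ln2_ge_two_thirds by linarith
    then have "cmod (l n) / ln (real n) \<le> cmod (l n) / (1 / 2)" by (intro divide_left_mono) auto
    moreover have "\<bar>ln (real n)\<bar> = ln (real n)" using n by simp
    ultimately show ?thesis unfolding norm_divide norm_of_real norm_mult by simp
  qed simp
qed

text \<open>\<open>exp (\<Sum> \<Lambda>(\<aa>) / log N\<aa> \<cdot> N\<aa> ^ (- \<sigma>)) = \<zeta>(\<sigma>) L(\<sigma>, \<chi>)\<close>, and \<open>L(\<sigma>, \<chi>) \<le> 1\<close> as an alternating series.\<close>

lemma exp_gauss_mangoldt_le:
  assumes \<sigma>: "\<sigma> > 1"
  shows "exp (Re (dser (\<lambda>n. of_real (gauss_mangoldt n) / of_real (ln (real n))) (of_real \<sigma>))) \<le> 1 + 1 / (\<sigma> - 1)"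
proof -
  define l where "l = (\<lambda>n. mangoldt n * of_real (chi4 n) :: complex)"
  have l: "dabs l \<sigma>" if "\<sigma> > 1" for \<sigma>
    using dabs_mangoldt[OF that]
    by (rule dabs_comparison) (auto simp: l_def norm_mult mangoldt_nonneg chi4_abs_le intro: mult_left_le)
  have s: "Re (of_real \<sigma>) > 1" using \<sigma> by simp
  have l1: "l 1 = 0" and chi1: "chi4 1 = 1" by (simp_all add: l_def chi4_def)
  have A: "dser (\<lambda>_. 1) (of_real \<sigma>) = exp (dser (\<lambda>n. mangoldt n / of_real (ln (real n))) (of_real \<sigma>))"
    by (rule dser_eq_exp) (use s in \<open>auto intro: zeta_bounds dabs_mangoldt simp: dconv_mangoldt_1\<close>)
  have B: "dser (\<lambda>n. of_real (chi4 n)) (of_real \<sigma>) = exp (dser (\<lambda>n. l n / of_real (ln (real n))) (of_real \<sigma>))"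
  proof (rule dser_eq_exp)
    fix n :: nat assume n: "n > 0"
    have "dconv l (\<lambda>n. of_real (chi4 n)) n = (\<Sum>d | d dvd n. mangoldt d * of_real (chi4 n))"
      unfolding dconv_def l_def
      by (intro sum.cong refl) (auto simp: mult.assoc chi4_mult[symmetric] simp flip: of_real_mult)
    also have "\<dots> = of_real (ln (real n)) * of_real (chi4 n)"
      using n mangoldt_sum[of n, where ?'a = complex] by (simp add: sum_distrib_right[symmetric])
    finally show "of_real (ln (real n)) * of_real (chi4 n) = dconv l (\<lambda>n. of_real (chi4 n)) n" by (rule sym)
  qed (use s l l1 chi1 dabs_chi4 in simp_all)
  have "dser (\<lambda>n. of_real (gauss_mangoldt n) / of_real (ln (real n))) (of_real \<sigma>)
     = dser (\<lambda>n. mangoldt n / of_real (ln (real n)) + l n / of_real (ln (real n))) (of_real \<sigma>)"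
  proof -
    have "of_real (gauss_mangoldt n) = mangoldt n + l n" for n
      by (simp add: gauss_mangoldt_def l_def algebra_simps)
    then show ?thesis by (simp only: add_divide_distrib)
  qed
  also have "\<dots> = dser (\<lambda>n. mangoldt n / of_real (ln (real n))) (of_real \<sigma>) + dser (\<lambda>n. l n / of_real (ln (real n))) (of_real \<sigma>)"
    using s by (intro dser_add dabs_div_ln l dabs_mangoldt) auto
  finally have "exp (dser (\<lambda>n. of_real (gauss_mangoldt n) / of_real (ln (real n))) (of_real \<sigma>))
     = dser (\<lambda>_. 1) (of_real \<sigma>) * dser (\<lambda>n. of_real (chi4 n)) (of_real \<sigma>)"
    unfolding A B by (simp add: exp_add)
  then have "exp (Re (dser (\<lambda>n. of_real (gauss_mangoldt n) / of_real (ln (real n))) (of_real \<sigma>)))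
     = cmod (dser (\<lambda>_. 1) (of_real \<sigma>)) * cmod (dser (\<lambda>n. of_real (chi4 n)) (of_real \<sigma>))"
    by (metis norm_exp_eq_Re norm_mult)
  also have "\<dots> \<le> (1 + 1 / (\<sigma> - 1)) * 1"
    using norm_dser_le[of "\<lambda>_. 1" "of_real \<sigma>"] zeta_bounds[OF \<sigma>] norm_L_chi4_le[OF \<sigma>] \<sigma>
    by (intro mult_mono) auto
  finally show ?thesis by simp
qed

text \<open>If the series of absolute values diverges, both sides are 0 by the convention for
  infinite sums.\<close>

lemma dser_of_norm: "dser (\<lambda>n. of_real (cmod (c n))) (of_real \<sigma>) = of_real (dnorm c \<sigma>)"
proof -
  define h where "h n = cmod (c n) * real n powr (- \<sigma>)" for n
  have "(\<Sum>\<^sub>\<infinity>n. complex_of_real (h n)) = of_real (\<Sum>\<^sub>\<infinity>n. h n)"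
  proof (cases "h summable_on UNIV")
    case True
    then show ?thesis by (intro infsumI has_sum_of_real has_sum_infsum)
  next
    case False
    moreover have "\<not> (\<lambda>n. complex_of_real (h n)) summable_on UNIV"
    proof
      assume "(\<lambda>n. complex_of_real (h n)) summable_on UNIV"
      then have "((\<lambda>n. Re (complex_of_real (h n))) has_sum Re (\<Sum>\<^sub>\<infinity>n. complex_of_real (h n))) UNIV"
        by (intro has_sum_Re has_sum_infsum)
      then show False using False by (auto dest: has_sum_imp_summable)
    qed
    ultimately show ?thesis by (simp add: infsum_not_exists)
  qed
  then show ?thesis unfolding dser_def dnorm_def h_def powr_of_real_eq of_real_mult .
qed

lemma dabs_of_norm: "dabs (\<lambda>n. of_real (cmod (c n))) \<sigma> \<longleftrightarrow> dabs c \<sigma>"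
  by (simp add: dabs_def)

text \<open>The complex derivative, taken along the real axis, of the series with coefficients
  \<open>cmod (c n)\<close>, whose values there are real.\<close>

lemma has_real_derivative_dnorm:
  assumes c: "\<And>\<sigma>. \<sigma> > 1 \<Longrightarrow> dabs c \<sigma>" and \<sigma>: "\<sigma> > 1"
  shows "(dnorm c has_real_derivative - dnorm (\<lambda>n. of_real (ln (real n)) * c n) \<sigma>) (at \<sigma>)"
proof -
  define b where "b = (\<lambda>n. of_real (cmod (c n)) :: complex)"
  have "(dser b has_field_derivative - dser (\<lambda>n. of_real (ln (real n)) * b n) (of_real \<sigma>)) (at (of_real \<sigma>))"
    using c \<sigma> by (intro has_field_derivative_dser) (auto simp: b_def dabs_of_norm)
  also have "dser (\<lambda>n. of_real (ln (real n)) * b n) (of_real \<sigma>) = of_real (dnorm (\<lambda>n. of_real (ln (real n)) * c n) \<sigma>)"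
  proof -
    have "of_real (ln (real n)) * b n = of_real (cmod (of_real (ln (real n)) * c n))" for n
      by (cases "n = 0") (auto simp: b_def norm_mult)
    then show ?thesis using dser_of_norm[of "\<lambda>n. of_real (ln (real n)) * c n"] by simp
  qed
  finally have "((\<lambda>x. dser b (of_real x)) has_vector_derivative - of_real (dnorm (\<lambda>n. of_real (ln (real n)) * c n) \<sigma>)) (at \<sigma>)"
    by (rule has_vector_derivative_real_field)
  then have "((\<lambda>x. Re (dser b (of_real x))) has_vector_derivative Re (- of_real (dnorm (\<lambda>n. of_real (ln (real n)) * c n) \<sigma>))) (at \<sigma>)"
    by (rule bounded_linear.has_vector_derivative[OF bounded_linear_Re])
  then show ?thesis
    unfolding b_def dser_of_norm by (simp add: has_real_derivative_iff_has_vector_derivative eta_contract_eq)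
qed

lemma dnorm_at_top:
  assumes "dabs c \<sigma>0"
  shows "(dnorm c \<longlongrightarrow> cmod (c 1)) at_top"
proof -
  have "((\<lambda>\<sigma>. Re (dser (\<lambda>n. of_real (cmod (c n))) (of_real \<sigma>))) \<longlongrightarrow> Re (of_real (cmod (c 1)))) at_top"
    using assms by (intro tendsto_Re dser_at_top) (auto simp: dabs_of_norm)
  then show ?thesis by (simp add: dser_of_norm)
qed

text \<open>The quotient of \<open>\<Sum> |c(n)| n ^ (- \<sigma>)\<close> by \<open>(\<zeta>(\<sigma>) L(\<sigma>, \<chi>)) powr \<kappa>\<close> is nondecreasing and tends to 1.\<close>

lemma dnorm_le_powr:
  assumes c: "\<And>\<sigma>. \<sigma> > 1 \<Longrightarrow> dabs c \<sigma>" and c1: "c 1 = 1"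
    and l: "\<And>n. cmod (l n) \<le> \<kappa> * gauss_mangoldt n" and \<kappa>: "\<kappa> \<ge> 0"
    and conv: "\<And>n. n > 0 \<Longrightarrow> of_real (ln (real n)) * c n = dconv l c n"
    and \<sigma>: "\<sigma> > 1"
  shows "dnorm c \<sigma> \<le> (1 + 1 / (\<sigma> - 1)) powr \<kappa>"
proof -
  define g where "g = (\<lambda>n. of_real (gauss_mangoldt n) :: complex)"
  define p where "p = (\<lambda>n. g n / of_real (ln (real n)))"
  have g: "dabs g \<sigma>" if "\<sigma> > 1" for \<sigma> unfolding g_def by (rule dabs_gauss_mangoldt[OF that])
  have p: "dabs p \<sigma>" if "\<sigma> > 1" for \<sigma> unfolding p_def by (rule dabs_div_ln[OF g[OF that]])
  have lk: "dabs l \<sigma>" if "\<sigma> > 1" for \<sigma>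
    using dabs_cmult[OF g[OF that], of "of_real \<kappa>"]
    by (rule dabs_comparison) (use l \<kappa> in \<open>auto simp: g_def norm_mult gauss_mangoldt_nonneg\<close>)
  have p1: "p 1 = 0" by (simp add: p_def)
  have lnp: "(\<lambda>n. of_real (ln (real n)) * p n) = g"
  proof
    fix n :: nat
    have "gauss_mangoldt 0 = 0" "gauss_mangoldt (Suc 0) = 0" by (simp_all add: gauss_mangoldt_def)
    then show "of_real (ln (real n)) * p n = g n"
      by (cases "n = 0"; cases "n = 1") (auto simp: p_def g_def)
  qed
  \<comment> \<open>The derivative of \<open>dnorm c\<close> is at least
    \<open>- \<kappa> * dnorm g * dnorm c\<close>, by the convolution identity and the triangle
    inequality; the derivative of the exponential contributes exactly the opposite, so H is
    nondecreasing.\<close>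
  define H where "H = (\<lambda>\<sigma>. dnorm c \<sigma> * exp (- (\<kappa> * dnorm p \<sigma>)))"
  have deriv: "\<exists>D. (H has_real_derivative D) (at \<tau>) \<and> D \<ge> 0" if \<tau>: "\<tau> > 1" for \<tau>
  proof -
    have "dnorm (\<lambda>n. of_real (ln (real n)) * c n) \<tau> = dnorm (dconv l c) \<tau>"
      unfolding dnorm_def
    proof (rule infsum_cong)
      fix n :: nat
      show "cmod (of_real (ln (real n)) * c n) * real n powr - \<tau> = cmod (dconv l c n) * real n powr - \<tau>"
        using conv[of n] by (cases "n = 0") auto
    qed
    also have "\<dots> \<le> dnorm l \<tau> * dnorm c \<tau>" by (rule dabs_dconv(2)[OF lk[OF \<tau>] c[OF \<tau>]])
    also have "\<dots> \<le> (\<kappa> * dnorm g \<tau>) * dnorm c \<tau>"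
    proof (rule mult_right_mono[OF _ dnorm_nonneg])
      have "dnorm l \<tau> \<le> dnorm (\<lambda>n. of_real \<kappa> * g n) \<tau>"
        using dabs_cmult[OF g[OF \<tau>], of "of_real \<kappa>"]
        by (rule dnorm_mono_coeffs) (use l \<kappa> in \<open>auto simp: g_def norm_mult gauss_mangoldt_nonneg\<close>)
      also have "\<dots> = \<kappa> * dnorm g \<tau>" unfolding dnorm_def norm_mult using \<kappa> by (simp add: mult.assoc infsum_cmult_right')
      finally show "dnorm l \<tau> \<le> \<kappa> * dnorm g \<tau>" .
    qed
    finally have le: "dnorm (\<lambda>n. of_real (ln (real n)) * c n) \<tau> \<le> \<kappa> * dnorm g \<tau> * dnorm c \<tau>" .
    have "(H has_real_derivative - dnorm (\<lambda>n. of_real (ln (real n)) * c n) \<tau> * exp (- (\<kappa> * dnorm p \<tau>))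
         + (exp (- (\<kappa> * dnorm p \<tau>)) * (- (\<kappa> * (- dnorm (\<lambda>n. of_real (ln (real n)) * p n) \<tau>)))) * dnorm c \<tau>) (at \<tau>)"
      unfolding H_def
      by (intro DERIV_mult DERIV_fun_exp DERIV_minus DERIV_cmult has_real_derivative_dnorm c p \<tau>)
    moreover have "- dnorm (\<lambda>n. of_real (ln (real n)) * c n) \<tau> * exp (- (\<kappa> * dnorm p \<tau>))
         + (exp (- (\<kappa> * dnorm p \<tau>)) * (- (\<kappa> * (- dnorm (\<lambda>n. of_real (ln (real n)) * p n) \<tau>)))) * dnorm c \<tau>
        = exp (- (\<kappa> * dnorm p \<tau>)) * (\<kappa> * dnorm g \<tau> * dnorm c \<tau> - dnorm (\<lambda>n. of_real (ln (real n)) * c n) \<tau>)"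
      unfolding lnp by (simp add: algebra_simps)
    ultimately show ?thesis using le by (metis diff_ge_0_iff_ge exp_ge_zero mult_nonneg_nonneg)
  qed
  have mono: "H \<sigma> \<le> H \<tau>" if "\<sigma> \<le> \<tau>" for \<tau>
  proof (rule DERIV_nonneg_imp_nondecreasing[OF that])
    fix x assume "\<sigma> \<le> x"
    then show "\<exists>D. (H has_real_derivative D) (at x) \<and> D \<ge> 0" using \<sigma> by (intro deriv) linarith
  qed
  have "(H \<longlongrightarrow> cmod (c 1) * exp (- (\<kappa> * cmod (p 1)))) at_top"
    unfolding H_def by (intro tendsto_intros dnorm_at_top[of _ 2] c p) auto
  then have "(H \<longlongrightarrow> 1) at_top" by (simp only: c1 p1 norm_one norm_zero) simp
  then have "H \<sigma> \<le> 1"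
    
    by (rule tendsto_lowerbound) (use mono in \<open>auto intro!: eventually_at_top_linorderI[of \<sigma>]\<close>)
  then have "dnorm c \<sigma> \<le> exp (\<kappa> * dnorm p \<sigma>)" unfolding H_def by (simp add: exp_minus field_simps)
  also have "\<dots> = exp (dnorm p \<sigma>) powr \<kappa>" by (simp add: powr_def)
  also have "\<dots> \<le> (1 + 1 / (\<sigma> - 1)) powr \<kappa>"
  proof (rule powr_mono2[OF \<kappa>])
    have "cmod (p n) = gauss_mangoldt n / ln (real n)" for n
      by (cases "n = 0") (auto simp: p_def g_def norm_divide gauss_mangoldt_nonneg)
    then have "p n = of_real (cmod (p n))" for n by (simp add: p_def g_def)
    then have "dser p (of_real \<sigma>) = of_real (dnorm p \<sigma>)" using dser_of_norm[of p \<sigma>] by simp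
    then show "exp (dnorm p \<sigma>) \<le> 1 + 1 / (\<sigma> - 1)"
      using exp_gauss_mangoldt_le[OF \<sigma>] unfolding p_def g_def by simp
  qed simp
  finally show ?thesis .
qed

section \<open>The Cauchy kernel and its Fourier transform\<close>

lemma cauchy_kernel_integral:
  fixes \<sigma> :: real
  assumes \<sigma>: "\<sigma> > 0"
  shows "integrable lborel (\<lambda>t. 1 / (\<sigma>\<^sup>2 + t\<^sup>2))" "(\<integral>t. 1 / (\<sigma>\<^sup>2 + t\<^sup>2) \<partial>lborel) = pi / \<sigma>"
proof -
  define f where "f = (\<lambda>x::real. inverse (1 + x\<^sup>2))"
  have i0: "integrable lborel f"
    using integrable_inverse_1_plus_square unfolding set_integrable_def f_def by simp
  have e0: "(\<integral>x. f x \<partial>lborel) = pi"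
    using LBINT_inverse_1_plus_square
    unfolding interval_lebesgue_integral_def set_lebesgue_integral_def f_def by simp
  have eq: "f (0 + (1 / \<sigma>) * t) = \<sigma>\<^sup>2 * (1 / (\<sigma>\<^sup>2 + t\<^sup>2))" for t
  proof -
    have "1 + (t / \<sigma>)\<^sup>2 = (\<sigma>\<^sup>2 + t\<^sup>2) / \<sigma>\<^sup>2" using \<sigma> by (simp add: power_divide add_divide_distrib)
    then show ?thesis by (simp add: f_def)
  qed
  have "integrable lborel (\<lambda>t. f (0 + (1 / \<sigma>) * t))"
    using \<sigma> by (intro lborel_integrable_real_affine i0) auto
  then have "integrable lborel (\<lambda>t. (1 / \<sigma>\<^sup>2) * (\<sigma>\<^sup>2 * (1 / (\<sigma>\<^sup>2 + t\<^sup>2))))"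
    unfolding eq by (rule integrable_mult_right)
  then show i: "integrable lborel (\<lambda>t. 1 / (\<sigma>\<^sup>2 + t\<^sup>2))" using \<sigma> by simp
  have "pi = \<bar>1 / \<sigma>\<bar> *\<^sub>R (\<integral>t. f (0 + (1 / \<sigma>) * t) \<partial>lborel)"
    unfolding e0[symmetric] using \<sigma> by (intro lborel_integral_real_affine) auto
  also have "\<dots> = (1 / \<sigma>) * (\<sigma>\<^sup>2 * (\<integral>t. 1 / (\<sigma>\<^sup>2 + t\<^sup>2) \<partial>lborel))"
    unfolding eq integral_mult_right_zero using \<sigma> by simp
  also have "\<dots> = \<sigma> * (\<integral>t. 1 / (\<sigma>\<^sup>2 + t\<^sup>2) \<partial>lborel)" using \<sigma> by (simp add: power2_eq_square)
  finally show "(\<integral>t. 1 / (\<sigma>\<^sup>2 + t\<^sup>2) \<partial>lborel) = pi / \<sigma>" using \<sigma> by (simp add: field_simps)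
qed

lemma cauchy_kernel_pos: "(\<sigma>::real) > 0 \<Longrightarrow> \<sigma>\<^sup>2 + t\<^sup>2 > 0"
  by (intro add_pos_nonneg) auto

lemma integrable_kernel_mult:
  fixes g :: "real \<Rightarrow> complex"
  assumes \<sigma>: "\<sigma> > 0" and g: "g \<in> borel_measurable lborel" and b: "\<And>t. cmod (g t) \<le> B"
  shows "integrable lborel (\<lambda>t. g t / of_real (\<sigma>\<^sup>2 + t\<^sup>2))"
proof (rule Bochner_Integration.integrable_bound)
  show "integrable lborel (\<lambda>t. B * (1 / (\<sigma>\<^sup>2 + t\<^sup>2)))"
    by (intro integrable_mult_right cauchy_kernel_integral \<sigma>)
  show "(\<lambda>t. g t / complex_of_real (\<sigma>\<^sup>2 + t\<^sup>2)) \<in> borel_measurable lborel"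
    using g by measurable
  show "AE t in lborel. cmod (g t / of_real (\<sigma>\<^sup>2 + t\<^sup>2)) \<le> norm (B * (1 / (\<sigma>\<^sup>2 + t\<^sup>2)))"
  proof (rule AE_I2)
    fix t
    have p: "\<sigma>\<^sup>2 + t\<^sup>2 > 0" using \<sigma> by (rule cauchy_kernel_pos)
    have "0 \<le> B" using b[of 0] norm_ge_zero order_trans by blast
    then show "cmod (g t / of_real (\<sigma>\<^sup>2 + t\<^sup>2)) \<le> norm (B * (1 / (\<sigma>\<^sup>2 + t\<^sup>2)))"
      using p b[of t] by (simp only: norm_divide norm_of_real abs_of_pos real_norm_def abs_mult abs_divide abs_one)
        (simp add: divide_right_mono)
  qed
qed

text \<open>The integrand has a removable singularity at \<open>\<i> \<sigma>\<close>; the integral over the upper half circle tends to 0.\<close>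

lemma cauchy_kernel_contour:
  assumes \<sigma>: "\<sigma> > 0" and \<theta>: "\<theta> \<ge> 0" and R: "R > \<sigma>"
  shows "\<exists>I. ((\<lambda>t. (exp (\<i> * of_real (\<theta> * t)) - of_real (exp (- \<theta> * \<sigma>))) / of_real (\<sigma>\<^sup>2 + t\<^sup>2)) has_integral I) {-R..R}
     \<and> cmod I \<le> 2 / (R\<^sup>2 - \<sigma>\<^sup>2) * R * pi"
proof -
  define S where "S = {z. Im z > - \<sigma>}"
  define k where "k = (\<lambda>z. exp (\<i> * of_real \<theta> * z) - of_real (exp (- \<theta> * \<sigma>)))"
  define a where "a = \<i> * of_real \<sigma>"
  define q where "q = (\<lambda>z. if z = a then deriv k a else k z / (z - a))"
  define h where "h = (\<lambda>z. q z / (z + a))"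
  have opn: "open S" unfolding S_def by (rule open_halfspace_Im_gt)
  have conv: "convex S" unfolding S_def by (rule convex_halfspace_Im_gt)
  have ka: "k a = 0"
  proof -
    have "\<i> * of_real \<theta> * a = of_real (- \<theta> * \<sigma>)" by (simp add: a_def complex_eq_iff)
    then have "exp (\<i> * of_real \<theta> * a) = of_real (exp (- \<theta> * \<sigma>))" by (simp only: exp_of_real)
    then show ?thesis by (simp only: k_def diff_self)
  qed
  have kh: "k holomorphic_on S" unfolding k_def by (intro holomorphic_intros)
  have "(\<lambda>z. if z = a then deriv k a else k z / (z - a) - k a / (z - a)) holomorphic_on S"
    by (rule pole_theorem_open[OF kh opn]) auto
  also have "(\<lambda>z. if z = a then deriv k a else k z / (z - a) - k a / (z - a)) = q"
    by (rule ext) (simp add: q_def ka)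
  finally have qh: "q holomorphic_on S" .
  have hh: "h holomorphic_on S" unfolding h_def
    using qh by (rule holomorphic_on_divide) (auto intro!: holomorphic_intros simp: S_def a_def complex_eq_iff)
  have hval: "h z = k z / (of_real (\<sigma>\<^sup>2) + z\<^sup>2)" if "z \<noteq> a" for z
  proof -
    have "(z - a) * (z + a) = of_real (\<sigma>\<^sup>2) + z\<^sup>2" by (simp add: a_def algebra_simps power2_eq_square)
    then show ?thesis using that by (simp add: h_def q_def)
  qed
  have R0: "R > 0" using R \<sigma> by simp
  define L where "L = linepath (- of_real R :: complex) (of_real R)"
  define P where "P = part_circlepath 0 R 0 pi"
  have ends: "pathstart P = of_real R" "pathfinish P = - of_real R"
    by (simp_all add: P_def pathstart_part_circlepath pathfinish_part_circlepath)
  have LS: "path_image L \<subseteq> S"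
  proof -
    have "closed_segment (- of_real R :: complex) (of_real R) \<subseteq> S"
      using conv \<sigma> by (intro closed_segment_subset) (auto simp: S_def)
    then show ?thesis by (simp add: L_def)
  qed
  have Pim: "Im z \<ge> 0 \<and> cmod z = R" if zP: "z \<in> path_image P" for z
  proof -
    obtain x where x: "0 \<le> x" "x \<le> pi" "z = of_real R * exp (\<i> * of_real x)"
      using zP unfolding P_def path_image_part_circlepath[OF pi_ge_zero] by auto
    have z: "z = of_real R * cis x" using x(3) by (simp only: cis_conv_exp)
    have "Im z = R * sin x" unfolding z by simp
    moreover have "cmod z = R" unfolding z using R0 by (simp add: norm_mult)
    ultimately show ?thesis using x R0 sin_ge_zero[of x] by simp
  qed
  have PS: "path_image P \<subseteq> S" using Pim \<sigma> unfolding S_def by force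
  have contL: "h contour_integrable_on L" unfolding L_def
    using holomorphic_on_imp_continuous_on[OF hh] LS unfolding L_def
    by (intro contour_integrable_continuous_linepath) (auto intro: continuous_on_subset)
  have contP: "h contour_integrable_on P"
    using holomorphic_on_imp_continuous_on[OF hh] PS unfolding P_def
    by (intro contour_integrable_continuous_part_circlepath) (auto intro: continuous_on_subset)
  have cl: "(h has_contour_integral 0) (L +++ P)"
    by (rule Cauchy_theorem_convex_simple[OF hh conv])
       (use LS PS ends in \<open>auto simp: L_def P_def path_image_join intro!: valid_path_join\<close>)
  have vp: "valid_path L" "valid_path P" by (simp_all add: L_def P_def)
  define I where "I = contour_integral L h"
  have IL: "(h has_contour_integral I) L" unfolding I_def using contL by (rule has_contour_integral_integral)
  have IP: "(h has_contour_integral (contour_integral P h)) P" using contP by (rule has_contour_integral_integral)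
  have "I + contour_integral P h = 0"
    using has_contour_integral_join[OF IL IP vp] cl contour_integral_unique by metis
  moreover have "cmod (contour_integral P h) \<le> 2 / (R\<^sup>2 - \<sigma>\<^sup>2) * R * (pi - 0)"
    unfolding P_def
  proof (rule has_contour_integral_bound_part_circlepath[OF IP[unfolded P_def]])
    have d: "R\<^sup>2 - \<sigma>\<^sup>2 > 0" using R \<sigma> by (simp add: power_strict_mono)
    then show "0 \<le> 2 / (R\<^sup>2 - \<sigma>\<^sup>2)" by simp
    fix z assume "z \<in> path_image (part_circlepath 0 R 0 pi)"
    then have z: "Im z \<ge> 0" "cmod z = R" using Pim unfolding P_def by auto
    have za: "z \<noteq> a"
    proof
      assume "z = a"
      then have "cmod z = \<sigma>" using \<sigma> by (simp add: a_def norm_mult)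
      then show False using z R by simp
    qed
    have "cmod (k z) \<le> cmod (exp (\<i> * of_real \<theta> * z)) + cmod (of_real (exp (- \<theta> * \<sigma>)))"
      unfolding k_def by (rule norm_triangle_ineq4)
    also have "\<dots> \<le> 1 + 1"
      using z \<theta> \<sigma> by (intro add_mono) (auto simp: mult_nonneg_nonneg)
    finally have k2: "cmod (k z) \<le> 2" by simp
    have "R\<^sup>2 - \<sigma>\<^sup>2 = cmod (z\<^sup>2) - cmod (- of_real (\<sigma>\<^sup>2))" using z by (simp add: norm_power norm_mult)
    also have "\<dots> \<le> cmod (z\<^sup>2 - (- of_real (\<sigma>\<^sup>2)))" by (rule norm_triangle_ineq2)
    finally have "R\<^sup>2 - \<sigma>\<^sup>2 \<le> cmod (of_real (\<sigma>\<^sup>2) + z\<^sup>2)" by (simp add: add.commute)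
    then show "cmod (h z) \<le> 2 / (R\<^sup>2 - \<sigma>\<^sup>2)"
      unfolding hval[OF za] norm_divide using k2 d by (intro frac_le) auto
  qed (use R0 in auto)
  ultimately have Ib: "cmod I \<le> 2 / (R\<^sup>2 - \<sigma>\<^sup>2) * R * pi" by (simp add: eq_neg_iff_add_eq_0[symmetric])
  have "((\<lambda>t. h (of_real t)) has_integral I) {Re (- of_real R)..Re (of_real R)}"
    using IL R0 unfolding L_def by (subst (asm) has_contour_integral_linepath_Reals_iff) auto
  then have "((\<lambda>t. h (of_real t)) has_integral I) {-R..R}" by simp
  then have "((\<lambda>t. (exp (\<i> * of_real (\<theta> * t)) - of_real (exp (- \<theta> * \<sigma>))) / of_real (\<sigma>\<^sup>2 + t\<^sup>2)) has_integral I) {-R..R}"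
  proof (rule has_integral_eq[rotated])
    fix t
    have "complex_of_real t \<noteq> a" using \<sigma> by (auto simp: a_def complex_eq_iff)
    then show "h (of_real t) = (exp (\<i> * of_real (\<theta> * t)) - of_real (exp (- \<theta> * \<sigma>))) / of_real (\<sigma>\<^sup>2 + t\<^sup>2)"
      by (simp add: hval k_def mult.assoc)
  qed
  then show ?thesis using Ib by blast
qed

text \<open>The contour estimate shows that the integral vanishes once exp (- \<theta> \<sigma>) is
  subtracted from the exponential. So the Fourier integral is exp (- \<theta> \<sigma>) times the
  integral of the kernel. The sign of \<theta> matters because the exponential must be bounded in
  the upper half-plane.\<close>

lemma cauchy_kernel_fourier_nonneg:
  assumes \<sigma>: "\<sigma> > 0" and \<theta>: "\<theta> \<ge> 0"
  shows "(\<integral>t. exp (\<i> * of_real (\<theta> * t)) / of_real (\<sigma>\<^sup>2 + t\<^sup>2) \<partial>lborel) = of_real (pi / \<sigma> * exp (- \<sigma> * \<theta>))"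
proof -
  define F where "F = (\<lambda>t. (exp (\<i> * of_real (\<theta> * t)) - of_real (exp (- \<theta> * \<sigma>))) / complex_of_real (\<sigma>\<^sup>2 + t\<^sup>2))"
  have i1: "integrable lborel (\<lambda>t. exp (\<i> * of_real (\<theta> * t)) / of_real (\<sigma>\<^sup>2 + t\<^sup>2))"
    by (rule integrable_kernel_mult[OF \<sigma>, of _ 1]) auto
  have i2: "integrable lborel (\<lambda>t. of_real (exp (- \<theta> * \<sigma>)) / complex_of_real (\<sigma>\<^sup>2 + t\<^sup>2))"
    by (rule integrable_kernel_mult[OF \<sigma>, of _ "exp (- \<theta> * \<sigma>)"]) auto
  have Feq: "F = (\<lambda>t. exp (\<i> * of_real (\<theta> * t)) / of_real (\<sigma>\<^sup>2 + t\<^sup>2) - of_real (exp (- \<theta> * \<sigma>)) / complex_of_real (\<sigma>\<^sup>2 + t\<^sup>2))"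
    unfolding F_def by (simp only: diff_divide_distrib)
  have iF: "integrable lborel F" unfolding Feq using i1 i2 by (rule Bochner_Integration.integrable_diff)
  define s where "s n = (\<lambda>t. indicator {- real n..real n} t *\<^sub>R F t)" for n :: nat
  have "(\<lambda>n. integral\<^sup>L lborel (s n)) \<longlonglongrightarrow> integral\<^sup>L lborel F"
  proof (rule integral_dominated_convergence)
    show "F \<in> borel_measurable lborel" using iF by (rule borel_measurable_integrable)
    then show "s n \<in> borel_measurable lborel" for n unfolding s_def by measurable
    show "integrable lborel (\<lambda>t. norm (F t))" using iF by (rule integrable_norm)
    show "AE t in lborel. (\<lambda>n. s n t) \<longlonglongrightarrow> F t"
    proof (rule AE_I2)
      fix t :: real
      obtain N :: nat where N: "\<bar>t\<bar> \<le> real N" using real_arch_simple by blast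
      have "s n t = F t" if "n \<ge> N" for n
      proof -
        have "real N \<le> real n" using that by simp
        then have "t \<in> {- real n..real n}" using N by auto
        then show ?thesis by (simp add: s_def)
      qed
      then have "\<forall>\<^sub>F n in sequentially. s n t = F t" unfolding eventually_sequentially by blast
      then show "(\<lambda>n. s n t) \<longlonglongrightarrow> F t" by (rule tendsto_eventually)
    qed
    show "AE t in lborel. norm (s n t) \<le> norm (F t)" for n
      by (rule AE_I2) (simp add: s_def indicator_def)
  qed
  moreover have "(\<lambda>n. integral\<^sup>L lborel (s n)) \<longlonglongrightarrow> 0"
  proof (rule Lim_null_comparison)
    show "\<forall>\<^sub>F n in sequentially. norm (integral\<^sup>L lborel (s n)) \<le> 2 / ((real n)\<^sup>2 - \<sigma>\<^sup>2) * real n * pi"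
    proof (rule eventually_sequentiallyI[of "nat \<lceil>\<sigma>\<rceil> + 1"])
      fix n :: nat assume "nat \<lceil>\<sigma>\<rceil> + 1 \<le> n"
      then have n: "real n > \<sigma>" by linarith
      obtain I where I: "(F has_integral I) {-real n..real n}" "cmod I \<le> 2 / ((real n)\<^sup>2 - \<sigma>\<^sup>2) * real n * pi"
        using cauchy_kernel_contour[OF \<sigma> \<theta> n] unfolding F_def by blast
      have si: "set_integrable lborel {- real n..real n} F"
        unfolding set_integrable_def using iF by (intro integrable_mult_indicator) auto
      have "integral\<^sup>L lborel (s n) = integral {- real n..real n} F"
        using set_borel_integral_eq_integral(2)[OF si] unfolding set_lebesgue_integral_def s_def .
      also have "\<dots> = I" using I(1) by (rule integral_unique)
      finally show "norm (integral\<^sup>L lborel (s n)) \<le> 2 / ((real n)\<^sup>2 - \<sigma>\<^sup>2) * real n * pi" using I(2) by simp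
    qed
    show "(\<lambda>n. 2 / ((real n)\<^sup>2 - \<sigma>\<^sup>2) * real n * pi) \<longlonglongrightarrow> 0" by real_asymp
  qed
  ultimately have F0: "integral\<^sup>L lborel F = 0" using LIMSEQ_unique by blast
  have "(\<integral>t. of_real (exp (- \<theta> * \<sigma>)) / complex_of_real (\<sigma>\<^sup>2 + t\<^sup>2) \<partial>lborel)
     = (\<integral>t. complex_of_real (exp (- \<theta> * \<sigma>) * (1 / (\<sigma>\<^sup>2 + t\<^sup>2))) \<partial>lborel)"
    by (intro Bochner_Integration.integral_cong refl) simp
  also have "\<dots> = of_real (exp (- \<theta> * \<sigma>) * (pi / \<sigma>))"
    by (simp only: integral_complex_of_real integral_mult_right_zero cauchy_kernel_integral(2)[OF \<sigma>])
  finally have "integral\<^sup>L lborel F = (\<integral>t. exp (\<i> * of_real (\<theta> * t)) / of_real (\<sigma>\<^sup>2 + t\<^sup>2) \<partial>lborel) - of_real (exp (- \<theta> * \<sigma>) * (pi / \<sigma>))"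
    unfolding Feq Bochner_Integration.integral_diff[OF i1 i2] by simp
  then show ?thesis using F0 by (simp add: mult.commute)
qed

lemma cauchy_kernel_fourier:
  assumes \<sigma>: "\<sigma> > 0"
  shows "(\<integral>t. exp (\<i> * of_real (\<theta> * t)) / of_real (\<sigma>\<^sup>2 + t\<^sup>2) \<partial>lborel) = of_real (pi / \<sigma> * exp (- \<sigma> * \<bar>\<theta>\<bar>))"
proof (cases "\<theta> \<ge> 0")
  case True
  then show ?thesis using cauchy_kernel_fourier_nonneg[OF \<sigma> True] by simp
next
  case False
  have "(\<integral>t. exp (\<i> * of_real (\<theta> * t)) / of_real (\<sigma>\<^sup>2 + t\<^sup>2) \<partial>lborel)
     = \<bar>- 1\<bar> *\<^sub>R (\<integral>t. exp (\<i> * of_real (\<theta> * (0 + (- 1) * t))) / of_real (\<sigma>\<^sup>2 + (0 + (- 1) * t)\<^sup>2) \<partial>lborel)"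
    by (rule lborel_integral_real_affine) simp
  also have "\<dots> = (\<integral>t. exp (\<i> * of_real ((- \<theta>) * t)) / of_real (\<sigma>\<^sup>2 + t\<^sup>2) \<partial>lborel)" by simp
  also have "\<dots> = of_real (pi / \<sigma> * exp (- \<sigma> * (- \<theta>)))" using False by (intro cauchy_kernel_fourier_nonneg \<sigma>) auto
  finally show ?thesis using False by simp
qed

section \<open>Mean squares of Dirichlet series on vertical lines\<close>

definition dpoly :: "nat set \<Rightarrow> (nat \<Rightarrow> complex) \<Rightarrow> real \<Rightarrow> complex" where
  "dpoly A c t = (\<Sum>n\<in>A. c n * exp (- (\<i> * of_real (t * ln (real n)))))"

lemma dpoly_measurable [measurable]: "dpoly A c \<in> borel_measurable borel"
  unfolding dpoly_def by measurable

lemma norm_dpoly_le: "cmod (dpoly A c t) \<le> (\<Sum>n\<in>A. cmod (c n))"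
  unfolding dpoly_def by (rule order_trans[OF norm_sum]) (simp add: norm_mult)

text \<open>Expanding the square leaves the Fourier transform of the kernel at the frequencies log m
  - log n. Its exponential decay is what later confines n and m to neighbouring bins.\<close>

lemma dpoly_mean_square:
  assumes \<sigma>: "\<sigma> > 0" and A: "finite A"
  shows "integrable lborel (\<lambda>t. (cmod (dpoly A c t))\<^sup>2 / (\<sigma>\<^sup>2 + t\<^sup>2))"
    "of_real (\<integral>t. (cmod (dpoly A c t))\<^sup>2 / (\<sigma>\<^sup>2 + t\<^sup>2) \<partial>lborel) =
     (\<Sum>n\<in>A. \<Sum>m\<in>A. c n * cnj (c m) * of_real (pi / \<sigma> * exp (- \<sigma> * \<bar>ln (real n) - ln (real m)\<bar>)))"
proof -
  define e where "e n m t = exp (\<i> * of_real ((ln (real m) - ln (real n)) * t)) / complex_of_real (\<sigma>\<^sup>2 + t\<^sup>2)" for n m :: nat and t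
  have ie: "integrable lborel (e n m)" for n m
    unfolding e_def by (rule integrable_kernel_mult[OF \<sigma>, of _ 1]) auto
  have eq: "complex_of_real ((cmod (dpoly A c t))\<^sup>2 / (\<sigma>\<^sup>2 + t\<^sup>2)) = (\<Sum>n\<in>A. \<Sum>m\<in>A. (c n * cnj (c m)) * e n m t)" for t
  proof -
    have "complex_of_real ((cmod (dpoly A c t))\<^sup>2) = dpoly A c t * cnj (dpoly A c t)"
      by (metis complex_norm_square of_real_power)
    also have "\<dots> = (\<Sum>n\<in>A. \<Sum>m\<in>A. (c n * exp (- (\<i> * of_real (t * ln (real n))))) * (cnj (c m) * exp (\<i> * of_real (t * ln (real m)))))"
      unfolding dpoly_def cnj_sum sum_product by (intro sum.cong refl) (simp add: exp_cnj)
    also have "\<dots> = (\<Sum>n\<in>A. \<Sum>m\<in>A. (c n * cnj (c m)) * exp (\<i> * of_real ((ln (real m) - ln (real n)) * t)))"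
    proof (intro sum.cong refl)
      fix n m
      have "exp (- (\<i> * of_real (t * ln (real n)))) * exp (\<i> * of_real (t * ln (real m)))
         = exp (\<i> * of_real ((ln (real m) - ln (real n)) * t))"
        unfolding exp_add[symmetric] by (rule arg_cong[of _ _ exp]) (simp add: algebra_simps)
      then show "(c n * exp (- (\<i> * of_real (t * ln (real n))))) * (cnj (c m) * exp (\<i> * of_real (t * ln (real m))))
         = (c n * cnj (c m)) * exp (\<i> * of_real ((ln (real m) - ln (real n)) * t))"
        by (metis mult.assoc mult.left_commute)
    qed
    finally have "complex_of_real ((cmod (dpoly A c t))\<^sup>2) / of_real (\<sigma>\<^sup>2 + t\<^sup>2) = (\<Sum>n\<in>A. \<Sum>m\<in>A. (c n * cnj (c m)) * e n m t)"
      unfolding e_def by (simp only: sum_divide_distrib times_divide_eq_right)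
    then show ?thesis by (simp only: of_real_divide)
  qed
  have isum: "integrable lborel (\<lambda>t. \<Sum>n\<in>A. \<Sum>m\<in>A. (c n * cnj (c m)) * e n m t)"
    by (intro Bochner_Integration.integrable_sum integrable_mult_right ie)
  then have "integrable lborel (\<lambda>t. complex_of_real ((cmod (dpoly A c t))\<^sup>2 / (\<sigma>\<^sup>2 + t\<^sup>2)))" by (simp only: eq)
  then show "integrable lborel (\<lambda>t. (cmod (dpoly A c t))\<^sup>2 / (\<sigma>\<^sup>2 + t\<^sup>2))"
    by (rule complex_of_real_integrable_eq[THEN iffD1])
  have "of_real (\<integral>t. (cmod (dpoly A c t))\<^sup>2 / (\<sigma>\<^sup>2 + t\<^sup>2) \<partial>lborel) = (\<integral>t. complex_of_real ((cmod (dpoly A c t))\<^sup>2 / (\<sigma>\<^sup>2 + t\<^sup>2)) \<partial>lborel)"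
    by (rule integral_complex_of_real[symmetric])
  also have "\<dots> = (\<Sum>n\<in>A. \<Sum>m\<in>A. (c n * cnj (c m)) * integral\<^sup>L lborel (e n m))"
  proof -
    have s2: "(\<integral>t. (\<Sum>m\<in>A. (c n * cnj (c m)) * e n m t) \<partial>lborel) = (\<Sum>m\<in>A. (c n * cnj (c m)) * integral\<^sup>L lborel (e n m))" for n
      by (subst Bochner_Integration.integral_sum) (intro integrable_mult_right ie, simp only: integral_mult_right_zero)
    have "(\<integral>t. (\<Sum>n\<in>A. \<Sum>m\<in>A. (c n * cnj (c m)) * e n m t) \<partial>lborel)
       = (\<Sum>n\<in>A. \<integral>t. (\<Sum>m\<in>A. (c n * cnj (c m)) * e n m t) \<partial>lborel)"
      by (rule Bochner_Integration.integral_sum) (intro Bochner_Integration.integrable_sum integrable_mult_right ie)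
    then show ?thesis by (simp only: eq s2)
  qed
  also have "\<dots> = (\<Sum>n\<in>A. \<Sum>m\<in>A. c n * cnj (c m) * of_real (pi / \<sigma> * exp (- \<sigma> * \<bar>ln (real n) - ln (real m)\<bar>)))"
  proof -
    have "integral\<^sup>L lborel (e n m) = of_real (pi / \<sigma> * exp (- \<sigma> * \<bar>ln (real n) - ln (real m)\<bar>))" for n m
      unfolding e_def cauchy_kernel_fourier[OF \<sigma>] by (simp only: abs_minus_commute)
    then show ?thesis by (simp only:)
  qed
  finally show "of_real (\<integral>t. (cmod (dpoly A c t))\<^sup>2 / (\<sigma>\<^sup>2 + t\<^sup>2) \<partial>lborel) =
     (\<Sum>n\<in>A. \<Sum>m\<in>A. c n * cnj (c m) * of_real (pi / \<sigma> * exp (- \<sigma> * \<bar>ln (real n) - ln (real m)\<bar>)))" .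
qed

lemma dpoly_mean_square_le:
  assumes \<sigma>: "\<sigma> > 0" and A: "finite A"
  shows "(\<integral>t. (cmod (dpoly A c t))\<^sup>2 / (\<sigma>\<^sup>2 + t\<^sup>2) \<partial>lborel)
     \<le> pi / \<sigma> * (\<Sum>n\<in>A. \<Sum>m\<in>A. cmod (c n) * cmod (c m) * exp (- \<sigma> * \<bar>ln (real n) - ln (real m)\<bar>))"
proof -
  have "(\<integral>t. (cmod (dpoly A c t))\<^sup>2 / (\<sigma>\<^sup>2 + t\<^sup>2) \<partial>lborel) \<le> cmod (of_real (\<integral>t. (cmod (dpoly A c t))\<^sup>2 / (\<sigma>\<^sup>2 + t\<^sup>2) \<partial>lborel))"
    by (simp only: norm_of_real abs_ge_self)
  also have "\<dots> \<le> (\<Sum>n\<in>A. \<Sum>m\<in>A. cmod (c n) * cmod (c m) * (pi / \<sigma> * exp (- \<sigma> * \<bar>ln (real n) - ln (real m)\<bar>)))"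
    unfolding dpoly_mean_square(2)[OF assms]
  proof (rule order_trans[OF norm_sum sum_mono], rule order_trans[OF norm_sum sum_mono])
    fix n m
    have "0 \<le> pi / \<sigma> * exp (- \<sigma> * \<bar>ln (real n) - ln (real m)\<bar>)" using \<sigma> by simp
    then show "cmod (c n * cnj (c m) * of_real (pi / \<sigma> * exp (- \<sigma> * \<bar>ln (real n) - ln (real m)\<bar>)))
      \<le> cmod (c n) * cmod (c m) * (pi / \<sigma> * exp (- \<sigma> * \<bar>ln (real n) - ln (real m)\<bar>))"
      by (simp only: norm_mult norm_of_real abs_of_nonneg complex_mod_cnj)
  qed
  also have "\<dots> = pi / \<sigma> * (\<Sum>n\<in>A. \<Sum>m\<in>A. cmod (c n) * cmod (c m) * exp (- \<sigma> * \<bar>ln (real n) - ln (real m)\<bar>))"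
    unfolding sum_distrib_left by (intro sum.cong refl) (simp only: mult_ac)
  finally show ?thesis .
qed

lemma dterm_Complex:
  assumes "n > 0"
  shows "c n * of_nat n powr (- Complex \<sigma> t) = (c n * of_real (real n powr - \<sigma>)) * exp (- (\<i> * of_real (t * ln (real n))))"
proof -
  have "of_nat n powr (- Complex \<sigma> t) = exp (- Complex \<sigma> t * of_real (ln (real n)))"
    using assms by (simp add: powr_def Ln_of_nat)
  also have "- Complex \<sigma> t * of_real (ln (real n)) = of_real (- \<sigma> * ln (real n)) + - (\<i> * of_real (t * ln (real n)))"
    by (simp add: complex_eq_iff)
  also have "exp \<dots> = of_real (exp (- \<sigma> * ln (real n))) * exp (- (\<i> * of_real (t * ln (real n))))"
    by (simp only: exp_add exp_of_real)
  also have "exp (- \<sigma> * ln (real n)) = real n powr - \<sigma>" using assms by (simp add: powr_def)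
  finally show ?thesis by (simp only: mult.assoc)
qed

lemma dpoly_tendsto_dser:
  assumes "dabs c \<sigma>"
  shows "(\<lambda>N. dpoly {1..N} (\<lambda>n. c n * of_real (real n powr - \<sigma>)) t) \<longlonglongrightarrow> dser c (Complex \<sigma> t)"
proof -
  have "(\<lambda>N. \<Sum>n<N. c n * of_nat n powr (- Complex \<sigma> t)) \<longlonglongrightarrow> dser c (Complex \<sigma> t)"
    using sums_dser[of c "Complex \<sigma> t"] assms unfolding sums_def by simp
  then have "(\<lambda>N. \<Sum>n<Suc N. c n * of_nat n powr (- Complex \<sigma> t)) \<longlonglongrightarrow> dser c (Complex \<sigma> t)"
    by (rule LIMSEQ_Suc)
  moreover have "(\<Sum>n<Suc N. c n * of_nat n powr (- Complex \<sigma> t)) = dpoly {1..N} (\<lambda>n. c n * of_real (real n powr - \<sigma>)) t" for N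
  proof -
    have "(\<Sum>n<Suc N. c n * of_nat n powr (- Complex \<sigma> t)) = (\<Sum>n=1..N. c n * of_nat n powr (- Complex \<sigma> t))"
    proof (rule sum.mono_neutral_right)
      show "\<forall>i\<in>{..<Suc N} - {1..N}. c i * of_nat i powr (- Complex \<sigma> t) = 0"
      proof
        fix i assume "i \<in> {..<Suc N} - {1..N}"
        then have "i = 0" by auto
        then show "c i * of_nat i powr (- Complex \<sigma> t) = 0" by simp
      qed
    qed auto
    also have "\<dots> = dpoly {1..N} (\<lambda>n. c n * of_real (real n powr - \<sigma>)) t"
      unfolding dpoly_def by (intro sum.cong refl dterm_Complex) simp
    finally show ?thesis .
  qed
  ultimately show ?thesis by (simp only:)
qed

lemma norm_dpoly_le_dnorm:
  assumes "dabs c \<sigma>"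
  shows "cmod (dpoly {1..N} (\<lambda>n. c n * of_real (real n powr - \<sigma>)) t) \<le> dnorm c \<sigma>"
proof -
  have "cmod (dpoly {1..N} (\<lambda>n. c n * of_real (real n powr - \<sigma>)) t) \<le> (\<Sum>n=1..N. cmod (c n * of_real (real n powr - \<sigma>)))"
    by (rule norm_dpoly_le)
  also have "\<dots> = (\<Sum>n=1..N. cmod (c n) * real n powr - \<sigma>)" by (simp add: norm_mult)
  also have "\<dots> \<le> dnorm c \<sigma>" by (rule sum_le_dnorm[OF assms]) simp
  finally show ?thesis .
qed

text \<open>Dominated convergence: all partial sums are bounded by \<open>dnorm c \<sigma>\<close>,
  and the kernel is integrable.\<close>

lemma dser_mean_square:
  assumes c: "dabs c \<sigma>" and \<tau>: "\<tau> > 0"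
  shows "integrable lborel (\<lambda>t. (cmod (dser c (Complex \<sigma> t)))\<^sup>2 / (\<tau>\<^sup>2 + t\<^sup>2))"
    "(\<lambda>N. \<integral>t. (cmod (dpoly {1..N} (\<lambda>n. c n * of_real (real n powr - \<sigma>)) t))\<^sup>2 / (\<tau>\<^sup>2 + t\<^sup>2) \<partial>lborel)
      \<longlonglongrightarrow> (\<integral>t. (cmod (dser c (Complex \<sigma> t)))\<^sup>2 / (\<tau>\<^sup>2 + t\<^sup>2) \<partial>lborel)"
proof -
  define p where "p N t = dpoly {1..N} (\<lambda>n. c n * of_real (real n powr - \<sigma>)) t" for N t
  have lim: "(\<lambda>N. p N t) \<longlonglongrightarrow> dser c (Complex \<sigma> t)" for t unfolding p_def by (rule dpoly_tendsto_dser[OF c])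
  have pm [measurable]: "p N \<in> borel_measurable borel" for N unfolding p_def by measurable
  have dm [measurable]: "(\<lambda>t. dser c (Complex \<sigma> t)) \<in> borel_measurable borel"
    by (rule borel_measurable_LIMSEQ_metric[of p]) (use lim pm in auto)
  have w: "integrable lborel (\<lambda>t. (dnorm c \<sigma>)\<^sup>2 * (1 / (\<tau>\<^sup>2 + t\<^sup>2)))"
    by (intro integrable_mult_right cauchy_kernel_integral \<tau>)
  have m1: "(\<lambda>t. (cmod (dser c (Complex \<sigma> t)))\<^sup>2 / (\<tau>\<^sup>2 + t\<^sup>2)) \<in> borel_measurable lborel" by measurable
  have m2: "(\<lambda>t. (cmod (p N t))\<^sup>2 / (\<tau>\<^sup>2 + t\<^sup>2)) \<in> borel_measurable lborel" for N by measurable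
  have l: "AE t in lborel. (\<lambda>N. (cmod (p N t))\<^sup>2 / (\<tau>\<^sup>2 + t\<^sup>2)) \<longlonglongrightarrow> (cmod (dser c (Complex \<sigma> t)))\<^sup>2 / (\<tau>\<^sup>2 + t\<^sup>2)"
  proof (rule AE_I2)
    fix t
    have "\<tau>\<^sup>2 + t\<^sup>2 \<noteq> 0" using cauchy_kernel_pos[OF \<tau>, of t] by linarith
    then show "(\<lambda>N. (cmod (p N t))\<^sup>2 / (\<tau>\<^sup>2 + t\<^sup>2)) \<longlonglongrightarrow> (cmod (dser c (Complex \<sigma> t)))\<^sup>2 / (\<tau>\<^sup>2 + t\<^sup>2)"
      by (intro tendsto_intros lim)
  qed
  have b: "AE t in lborel. norm ((cmod (p N t))\<^sup>2 / (\<tau>\<^sup>2 + t\<^sup>2)) \<le> (dnorm c \<sigma>)\<^sup>2 * (1 / (\<tau>\<^sup>2 + t\<^sup>2))" for N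
  proof (rule AE_I2)
    fix t
    have k: "\<tau>\<^sup>2 + t\<^sup>2 > 0" using cauchy_kernel_pos[OF \<tau>, of t] .
    have "(cmod (p N t))\<^sup>2 \<le> (dnorm c \<sigma>)\<^sup>2" unfolding p_def by (intro power_mono norm_dpoly_le_dnorm c) simp
    then have "(cmod (p N t))\<^sup>2 / (\<tau>\<^sup>2 + t\<^sup>2) \<le> (dnorm c \<sigma>)\<^sup>2 / (\<tau>\<^sup>2 + t\<^sup>2)" using k by (intro divide_right_mono) auto
    moreover have "0 \<le> (cmod (p N t))\<^sup>2 / (\<tau>\<^sup>2 + t\<^sup>2)" using k by simp
    ultimately show "norm ((cmod (p N t))\<^sup>2 / (\<tau>\<^sup>2 + t\<^sup>2)) \<le> (dnorm c \<sigma>)\<^sup>2 * (1 / (\<tau>\<^sup>2 + t\<^sup>2))" by simp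
  qed
  show "integrable lborel (\<lambda>t. (cmod (dser c (Complex \<sigma> t)))\<^sup>2 / (\<tau>\<^sup>2 + t\<^sup>2))"
    by (rule integrable_dominated_convergence[OF m1 m2 w l b])
  show "(\<lambda>N. \<integral>t. (cmod (dpoly {1..N} (\<lambda>n. c n * of_real (real n powr - \<sigma>)) t))\<^sup>2 / (\<tau>\<^sup>2 + t\<^sup>2) \<partial>lborel)
      \<longlonglongrightarrow> (\<integral>t. (cmod (dser c (Complex \<sigma> t)))\<^sup>2 / (\<tau>\<^sup>2 + t\<^sup>2) \<partial>lborel)"
    unfolding p_def[symmetric] by (rule integral_dominated_convergence[OF m1 m2 w l b])
qed

text \<open>Abel summation for a quadratic form whose kernel depends only on the larger index. Such
  a kernel arises because k^(- \<sigma>) l^(- \<sigma>) exp (- \<sigma> |log k - log l|) equals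
  max(k, l)^(- 2 \<sigma>).\<close>

lemma sum_square_max_kernel:
  fixes c :: "nat \<Rightarrow> complex" and u :: "nat \<Rightarrow> real"
  shows "(\<Sum>k=1..N. \<Sum>l=1..N. c k * cnj (c l) * of_real (u (max k l)))
     = of_real ((\<Sum>n=1..N. (cmod (\<Sum>k=1..n. c k))\<^sup>2 * (u n - u (Suc n))) + (cmod (\<Sum>k=1..N. c k))\<^sup>2 * u (Suc N))"
proof (induction N)
  case (Suc N)
  have nsq: "complex_of_real ((cmod z)\<^sup>2) = z * cnj z" for z by (metis complex_norm_square of_real_power)
  define T where "T = (\<Sum>k=1..N. c k)"
  define d where "d = c (Suc N)"
  have inner: "(\<Sum>l=1..Suc N. c k * cnj (c l) * of_real (u (max k l)))
      = (\<Sum>l=1..N. c k * cnj (c l) * of_real (u (max k l))) + c k * cnj d * of_real (u (Suc N))" if "k \<le> Suc N" for k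
    using that by (simp add: d_def max_def)
  have "(\<Sum>k=1..Suc N. \<Sum>l=1..Suc N. c k * cnj (c l) * of_real (u (max k l)))
     = (\<Sum>k=1..Suc N. (\<Sum>l=1..N. c k * cnj (c l) * of_real (u (max k l))) + c k * cnj d * of_real (u (Suc N)))"
    by (intro sum.cong refl inner) simp
  also have "\<dots> = (\<Sum>k=1..N. (\<Sum>l=1..N. c k * cnj (c l) * of_real (u (max k l))) + c k * cnj d * of_real (u (Suc N)))
     + ((\<Sum>l=1..N. d * cnj (c l) * of_real (u (max (Suc N) l))) + d * cnj d * of_real (u (Suc N)))"
    by (simp add: d_def)
  also have "(\<Sum>l=1..N. d * cnj (c l) * of_real (u (max (Suc N) l))) = (\<Sum>l=1..N. d * cnj (c l) * of_real (u (Suc N)))"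
    by (intro sum.cong refl) (simp add: max_def)
  also have "\<dots> = d * cnj T * of_real (u (Suc N))"
    unfolding T_def cnj_sum sum_distrib_left sum_distrib_right ..
  also have "(\<Sum>k=1..N. (\<Sum>l=1..N. c k * cnj (c l) * of_real (u (max k l))) + c k * cnj d * of_real (u (Suc N)))
      = (\<Sum>k=1..N. \<Sum>l=1..N. c k * cnj (c l) * of_real (u (max k l))) + T * cnj d * of_real (u (Suc N))"
    unfolding T_def sum.distrib sum_distrib_right ..
  also have "(\<Sum>k=1..N. \<Sum>l=1..N. c k * cnj (c l) * of_real (u (max k l)))
      = of_real ((\<Sum>n=1..N. (cmod (\<Sum>k=1..n. c k))\<^sup>2 * (u n - u (Suc n))) + (cmod T)\<^sup>2 * u (Suc N))"
    unfolding Suc T_def ..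
  finally have eq: "(\<Sum>k=1..Suc N. \<Sum>l=1..Suc N. c k * cnj (c l) * of_real (u (max k l)))
     = of_real (\<Sum>n=1..N. (cmod (\<Sum>k=1..n. c k))\<^sup>2 * (u n - u (Suc n)))
       + (T * cnj T + T * cnj d + d * cnj T + d * cnj d) * of_real (u (Suc N))"
    by (simp only: of_real_add of_real_mult nsq ring_distribs ac_simps)
  have "T * cnj T + T * cnj d + d * cnj T + d * cnj d = (T + d) * cnj (T + d)" by (simp add: algebra_simps)
  also have "\<dots> = of_real ((cmod (T + d))\<^sup>2)" by (simp only: nsq)
  also have "T + d = (\<Sum>k=1..Suc N. c k)" by (simp add: T_def d_def)
  finally have sq: "T * cnj T + T * cnj d + d * cnj T + d * cnj d = of_real ((cmod (\<Sum>k=1..Suc N. c k))\<^sup>2)" .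
  have "(\<Sum>k=1..Suc N. \<Sum>l=1..Suc N. c k * cnj (c l) * of_real (u (max k l)))
     = of_real ((\<Sum>n=1..N. (cmod (\<Sum>k=1..n. c k))\<^sup>2 * (u n - u (Suc n))) + (cmod (\<Sum>k=1..Suc N. c k))\<^sup>2 * u (Suc N))"
    unfolding eq sq by (simp only: of_real_add of_real_mult)
  also have "(\<Sum>n=1..N. (cmod (\<Sum>k=1..n. c k))\<^sup>2 * (u n - u (Suc n))) + (cmod (\<Sum>k=1..Suc N. c k))\<^sup>2 * u (Suc N)
     = (\<Sum>n=1..Suc N. (cmod (\<Sum>k=1..n. c k))\<^sup>2 * (u n - u (Suc n))) + (cmod (\<Sum>k=1..Suc N. c k))\<^sup>2 * u (Suc (Suc N))"
  proof -
    have "A + B * v = A + B * (v - w) + B * w" for A B v w :: real by (simp add: algebra_simps)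
    then show ?thesis by (simp only: sum.nat_ivl_Suc' le_add1 sum.atLeast_Suc_atMost_Suc_shift sum.cl_ivl_Suc) simp
  qed
  finally show ?case .
qed simp

text \<open>Parseval for Dirichlet series: with \<open>T(n) = \<Sum>\<^bsub>k \<le> n\<^esub> c(k)\<close>, the left-hand side is
  \<open>2 \<sigma> \<integral>\<^sub>1 |T(v)|\<^sup>2 v ^ (- 1 - 2 \<sigma>) dv\<close>, cut off at \<open>N + 1\<close>.\<close>

lemma dser_parseval_le:
  assumes c: "dabs c \<sigma>" and \<sigma>: "\<sigma> > 0"
  shows "(\<Sum>n=1..N. (cmod (\<Sum>k=1..n. c k))\<^sup>2 * (real n powr (- 2 * \<sigma>) - real (Suc n) powr (- 2 * \<sigma>)))
    \<le> \<sigma> / pi * (\<integral>t. (cmod (dser c (Complex \<sigma> t)))\<^sup>2 / (\<sigma>\<^sup>2 + t\<^sup>2) \<partial>lborel)"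
proof -
  define u where "u n = real n powr (- 2 * \<sigma>)" for n
  define T where "T n = (\<Sum>k=1..n. c k)" for n
  define J where "J M = (\<integral>t. (cmod (dpoly {1..M} (\<lambda>n. c n * of_real (real n powr - \<sigma>)) t))\<^sup>2 / (\<sigma>\<^sup>2 + t\<^sup>2) \<partial>lborel)" for M
  have umono: "u (Suc n) \<le> u n" if "n \<ge> 1" for n
    unfolding u_def using that \<sigma> by (intro powr_mono2') auto
  have nonneg: "0 \<le> (cmod (T n))\<^sup>2 * (u n - u (Suc n))" if "n \<in> {1..M}" for n M
    using that umono[of n] by (intro mult_nonneg_nonneg) auto
  \<comment> \<open>The mean square has a closed form for polynomials, so the sum up to N is
    compared with polynomials of every length M >= N before M tends to infinity; the terms between N
    and M and the boundary term are nonnegative.\<close>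
  have le: "(\<Sum>n=1..N. (cmod (T n))\<^sup>2 * (u n - u (Suc n))) \<le> \<sigma> / pi * J M" if NM: "N \<le> M" for M
  proof -
    have "complex_of_real (J M) = (\<Sum>n=1..M. \<Sum>m=1..M. (c n * of_real (real n powr - \<sigma>)) * cnj (c m * of_real (real m powr - \<sigma>))
         * of_real (pi / \<sigma> * exp (- \<sigma> * \<bar>ln (real n) - ln (real m)\<bar>)))"
      unfolding J_def by (rule dpoly_mean_square(2)[OF \<sigma>]) simp
    also have "\<dots> = (\<Sum>n=1..M. \<Sum>m=1..M. of_real (pi / \<sigma>) * (c n * cnj (c m) * of_real (u (max n m))))"
    proof (intro sum.cong refl)
      fix n m assume nm: "n \<in> {1..M}" "m \<in> {1..M}"
      have "real n powr - \<sigma> * real m powr - \<sigma> * exp (- \<sigma> * \<bar>ln (real n) - ln (real m)\<bar>) = exp (- 2 * \<sigma> * ln (real (max n m)))"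
      proof -
        have "max (ln (real n)) (ln (real m)) = ln (real (max n m))" using nm by (auto simp: max_def)
        moreover have "- \<sigma> * a + - \<sigma> * b + - \<sigma> * \<bar>a - b\<bar> = - 2 * \<sigma> * max a b" for a b :: real
        proof (cases "a \<le> b")
          case True
          then have "\<bar>a - b\<bar> = b - a" "max a b = b" by auto
          then show ?thesis by (simp only:) (simp add: algebra_simps)
        next
          case False
          then have "\<bar>a - b\<bar> = a - b" "max a b = a" by auto
          then show ?thesis by (simp only:) (simp add: algebra_simps)
        qed
        ultimately have "- \<sigma> * ln (real n) + - \<sigma> * ln (real m) + - \<sigma> * \<bar>ln (real n) - ln (real m)\<bar> = - 2 * \<sigma> * ln (real (max n m))"
          by metis
        moreover have "real n powr - \<sigma> = exp (- \<sigma> * ln (real n))" "real m powr - \<sigma> = exp (- \<sigma> * ln (real m))"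
          using nm by (simp_all add: powr_def)
        ultimately show ?thesis by (simp only: exp_add[symmetric])
      qed
      also have "\<dots> = u (max n m)" unfolding u_def using nm by (simp add: powr_def max_def)
      finally have k: "real n powr - \<sigma> * real m powr - \<sigma> * exp (- \<sigma> * \<bar>ln (real n) - ln (real m)\<bar>) = u (max n m)" .
      show "(c n * of_real (real n powr - \<sigma>)) * cnj (c m * of_real (real m powr - \<sigma>)) * of_real (pi / \<sigma> * exp (- \<sigma> * \<bar>ln (real n) - ln (real m)\<bar>))
         = of_real (pi / \<sigma>) * (c n * cnj (c m) * of_real (u (max n m)))"
        unfolding k[symmetric] by (simp add: mult_ac)
    qed
    also have "\<dots> = of_real (pi / \<sigma>) * (\<Sum>n=1..M. \<Sum>m=1..M. c n * cnj (c m) * of_real (u (max n m)))"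
      by (simp only: sum_distrib_left)
    also have "\<dots> = of_real (pi / \<sigma> * ((\<Sum>n=1..M. (cmod (T n))\<^sup>2 * (u n - u (Suc n))) + (cmod (T M))\<^sup>2 * u (Suc M)))"
      unfolding sum_square_max_kernel T_def by (simp only: of_real_mult)
    finally have "J M = pi / \<sigma> * ((\<Sum>n=1..M. (cmod (T n))\<^sup>2 * (u n - u (Suc n))) + (cmod (T M))\<^sup>2 * u (Suc M))"
      by (simp only: of_real_eq_iff)
    then have "\<sigma> / pi * J M = (\<Sum>n=1..M. (cmod (T n))\<^sup>2 * (u n - u (Suc n))) + (cmod (T M))\<^sup>2 * u (Suc M)" using \<sigma> by simp
    moreover have "(\<Sum>n=1..N. (cmod (T n))\<^sup>2 * (u n - u (Suc n))) \<le> (\<Sum>n=1..M. (cmod (T n))\<^sup>2 * (u n - u (Suc n)))"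
      using nonneg[of _ M] NM by (intro sum_mono2) auto
    moreover have "0 \<le> (cmod (T M))\<^sup>2 * u (Suc M)" unfolding u_def by simp
    ultimately show ?thesis by linarith
  qed
  have "(\<lambda>M. \<sigma> / pi * J M) \<longlonglongrightarrow> \<sigma> / pi * (\<integral>t. (cmod (dser c (Complex \<sigma> t)))\<^sup>2 / (\<sigma>\<^sup>2 + t\<^sup>2) \<partial>lborel)"
    unfolding J_def by (intro tendsto_mult_left dser_mean_square c \<sigma>)
  then have "(\<Sum>n=1..N. (cmod (T n))\<^sup>2 * (u n - u (Suc n))) \<le> \<sigma> / pi * (\<integral>t. (cmod (dser c (Complex \<sigma> t)))\<^sup>2 / (\<sigma>\<^sup>2 + t\<^sup>2) \<partial>lborel)"
    by (rule LIMSEQ_le_const) (use le in blast)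
  then show ?thesis unfolding u_def T_def .
qed

section \<open>The Brun-Titchmarsh inequality on a logarithmic grid\<close>

definition bt_const :: real where
  "bt_const = (SOME C. C > 0 \<and> (\<forall>t h. t \<ge> 1 \<longrightarrow> h \<ge> t powr (3/4) \<longrightarrow> (\<Sum>n | t < real n \<and> real n \<le> t + h. mangoldt n) \<le> C * h))"

lemma bt_const:
  "bt_const > 0"
  "t \<ge> 1 \<Longrightarrow> h \<ge> t powr (3/4) \<Longrightarrow> (\<Sum>n | t < real n \<and> real n \<le> t + h. mangoldt n) \<le> bt_const * h"
proof -
  obtain C :: real where C: "C > 0" "\<And>t h. t \<ge> 1 \<Longrightarrow> h \<ge> t powr (3/4) \<Longrightarrow> (\<Sum>n | t < real n \<and> real n \<le> t + h. mangoldt n) \<le> C * h"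
    using brun_titchmarsh by blast
  have "bt_const > 0 \<and> (\<forall>t h. t \<ge> 1 \<longrightarrow> h \<ge> t powr (3/4) \<longrightarrow> (\<Sum>n | t < real n \<and> real n \<le> t + h. mangoldt n) \<le> bt_const * h)"
    unfolding bt_const_def by (rule someI[of _ C]) (use C in blast)
  then show "bt_const > 0"
    "t \<ge> 1 \<Longrightarrow> h \<ge> t powr (3/4) \<Longrightarrow> (\<Sum>n | t < real n \<and> real n \<le> t + h. mangoldt n) \<le> bt_const * h" by blast+
qed

definition grid :: "real \<Rightarrow> real \<Rightarrow> nat \<Rightarrow> real" where "grid y T k = y * exp (real k / T)"

text \<open>The index k with \<open>grid y T k < n \<le> grid y T (Suc k)\<close>, for n > y.
  Subtracting 1 from the ceiling closes the cells on the right, as in the intervals of the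
  Brun-Titchmarsh inequality.\<close>

definition bin :: "real \<Rightarrow> real \<Rightarrow> nat \<Rightarrow> nat" where "bin y T n = nat (\<lceil>T * ln (real n / y)\<rceil> - 1)"

lemma bin_bounds:
  assumes "y > 0" "T > 0" "real n > y"
  shows "real (bin y T n) < T * ln (real n / y)" "T * ln (real n / y) \<le> real (bin y T n) + 1"
    "grid y T (bin y T n) < real n" "real n \<le> grid y T (Suc (bin y T n))"
proof -
  have pos: "T * ln (real n / y) > 0" using assms by simp
  then have "\<lceil>T * ln (real n / y)\<rceil> \<ge> 1" by simp
  then have b: "real (bin y T n) = of_int \<lceil>T * ln (real n / y)\<rceil> - 1" unfolding bin_def by simp
  show 1: "real (bin y T n) < T * ln (real n / y)" unfolding b by linarith
  show 2: "T * ln (real n / y) \<le> real (bin y T n) + 1" unfolding b by linarith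
  have e: "y * exp (ln (real n / y)) = real n" using assms by simp
  have "real (bin y T n) / T < ln (real n / y)" using 1 assms by (simp add: field_simps)
  then have "exp (real (bin y T n) / T) < exp (ln (real n / y))" by (simp only: exp_less_cancel_iff)
  then have "y * exp (real (bin y T n) / T) < y * exp (ln (real n / y))" using assms(1) by (rule mult_strict_left_mono)
  then show "grid y T (bin y T n) < real n" unfolding e grid_def .
  have "ln (real n / y) \<le> real (Suc (bin y T n)) / T" using 2 assms by (simp add: field_simps)
  then have "exp (ln (real n / y)) \<le> exp (real (Suc (bin y T n)) / T)" by (simp only: exp_le_cancel_iff)
  then have "y * exp (ln (real n / y)) \<le> y * exp (real (Suc (bin y T n)) / T)"
    by (rule mult_left_mono) (use assms(1) in simp)
  then show "real n \<le> grid y T (Suc (bin y T n))" unfolding e grid_def .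
qed

text \<open>A cell starting at g has length between g / T and 2 g / T. From g >= y >= T^4 follows T
  <= g^(1/4), so the length is at least g^(3/4) and the Brun-Titchmarsh inequality applies.\<close>

lemma bin_mass:
  assumes T: "T \<ge> 1" and y: "y \<ge> T ^ 4"
  shows "(\<Sum>n | n \<in> A \<and> real n > y \<and> bin y T n = k. mangoldt n) \<le> 2 * bt_const * grid y T k / T"
proof -
  define g where "g = grid y T k"
  define h where "h = grid y T (Suc k) - g"
  have "T ^ 4 \<ge> 1" using T by simp
  then have y1: "y \<ge> 1" using y by linarith
  have "exp (real k / T) \<ge> 1" using T by simp
  then have gy: "g \<ge> y" unfolding g_def grid_def using y1 mult_left_mono[of 1 "exp (real k / T)" y] by simp
  have h: "h = g * (exp (1 / T) - 1)"
    unfolding h_def g_def grid_def using T by (simp add: add_divide_distrib exp_add algebra_simps)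
  have "exp (1 / T) \<le> 1 + 1 / T + (1 / T)\<^sup>2" using T by (intro exp_bound) auto
  also have "(1 / T)\<^sup>2 \<le> 1 / T" using T by (simp add: power2_eq_square mult_left_le field_simps)
  finally have "exp (1 / T) - 1 \<le> 2 / T" by simp
  then have h_le: "h \<le> g * (2 / T)" unfolding h using gy y1 by (intro mult_left_mono) auto
  have "exp (1 / T) - 1 \<ge> 1 / T" using exp_ge_add_one_self[of "1 / T"] by linarith
  then have h_ge: "h \<ge> g * (1 / T)" unfolding h using gy y1 by (intro mult_left_mono) auto
  have "T = (T powr 4) powr (1/4)" by (simp only: powr_powr) (use T in simp)
  also have "\<dots> \<le> g powr (1/4)" using y gy T by (intro powr_mono2) (auto simp: powr_realpow)
  finally have Tg: "T \<le> g powr (1/4)" .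
  have "g powr (3/4) * T \<le> g powr (3/4) * g powr (1/4)" using Tg by (intro mult_left_mono) auto
  also have "\<dots> = g" using gy y1 by (simp flip: powr_add)
  finally have "g powr (3/4) \<le> g * (1 / T)" using T by (simp add: field_simps)
  then have hh: "h \<ge> g powr (3/4)" using h_ge by linarith
  have "(\<Sum>n | n \<in> A \<and> real n > y \<and> bin y T n = k. mangoldt n) \<le> (\<Sum>n | g < real n \<and> real n \<le> g + h. mangoldt n :: real)"
  proof (rule sum_mono2)
    show "finite {n. g < real n \<and> real n \<le> g + h}" using finite_nat_le_real by (rule rev_finite_subset) auto
    show "{n. n \<in> A \<and> real n > y \<and> bin y T n = k} \<subseteq> {n. g < real n \<and> real n \<le> g + h}"
      using bin_bounds(3,4)[of y T] y1 T unfolding h_def g_def by auto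
  qed (auto simp: mangoldt_nonneg)
  also have "\<dots> \<le> bt_const * h" using gy y1 hh by (intro bt_const) auto
  also have "\<dots> \<le> bt_const * (g * (2 / T))" using h_le bt_const(1) by (intro mult_left_mono) auto
  finally show ?thesis unfolding g_def by (simp add: mult_ac)
qed

lemma sum_half_powers_le:
  fixes K :: "nat set"
  assumes "finite K"
  shows "(\<Sum>k\<in>K. (1/2::real) ^ nat \<bar>int k - int l\<bar>) \<le> 4"
proof -
  obtain M where M: "K \<subseteq> {..l + M}" using assms
    by (metis finite_nat_iff_bounded_le order_trans atMost_subset_iff le_add2)
  have A: "(\<Sum>k\<le>l. (1/2::real) ^ (l - k)) = 2 - (1/2) ^ l" for l
  proof (induction l)
    case (Suc l)
    have "(\<Sum>k\<le>Suc l. (1/2::real) ^ (Suc l - k)) = (\<Sum>k\<le>l. (1/2) * (1/2) ^ (l - k)) + 1"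
      by (simp add: Suc_diff_le)
    also have "(\<Sum>k\<le>l. (1/2::real) * (1/2) ^ (l - k)) = (1/2) * (2 - (1/2) ^ l)"
      unfolding sum_distrib_left[symmetric] Suc ..
    finally show ?case by simp
  qed simp
  have B: "(\<Sum>k\<in>{l<..l + M}. (1/2::real) ^ (k - l)) = 1 - (1/2) ^ M" for M
  proof (induction M)
    case (Suc M)
    have "{l<..l + Suc M} = insert (l + Suc M) {l<..l + M}" by auto
    then show ?case using Suc by simp
  qed simp
  have "(\<Sum>k\<in>K. (1/2::real) ^ nat \<bar>int k - int l\<bar>) \<le> (\<Sum>k\<in>{..l} \<union> {l<..l + M}. (1/2::real) ^ nat \<bar>int k - int l\<bar>)"
    using M by (intro sum_mono2) auto
  also have "\<dots> = (\<Sum>k\<le>l. (1/2::real) ^ nat \<bar>int k - int l\<bar>) + (\<Sum>k\<in>{l<..l + M}. (1/2::real) ^ nat \<bar>int k - int l\<bar>)"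
    by (intro sum.union_disjoint) auto
  also have "(\<Sum>k\<le>l. (1/2::real) ^ nat \<bar>int k - int l\<bar>) = (\<Sum>k\<le>l. (1/2::real) ^ (l - k))"
    by (intro sum.cong refl arg_cong[of _ _ "\<lambda>j. (1/2) ^ j"]) auto
  also have "(\<Sum>k\<in>{l<..l + M}. (1/2::real) ^ nat \<bar>int k - int l\<bar>) = (\<Sum>k\<in>{l<..l + M}. (1/2::real) ^ (k - l))"
    by (intro sum.cong refl arg_cong[of _ _ "\<lambda>j. (1/2) ^ j"]) auto
  finally show ?thesis unfolding A B
    by (smt (verit) zero_le_power half_gt_zero_iff)
qed

text \<open>Up to a rounding error of 1, T |log n - log m| is at least the distance of the two bins,
  so the kernel decays geometrically with that distance, while each bin carries at most
  \<open>2 * bt_const / T\<close> of the mass of \<Lambda>(m) / m. The 24 is 2 * 3 * 4, with 3 for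
  exp 1 and 4 for the geometric sum.\<close>

lemma mangoldt_kernel_sum:
  assumes T: "T \<ge> 1" and y: "y \<ge> T ^ 4" and A: "finite A" "\<And>m. m \<in> A \<Longrightarrow> real m > y" and n: "real n > y"
  shows "(\<Sum>m\<in>A. mangoldt m / real m * exp (- T * \<bar>ln (real n) - ln (real m)\<bar>)) \<le> 24 * bt_const / T"
proof -
  have "T ^ 4 \<ge> 1" using T by simp
  then have y1: "y \<ge> 1" using y by linarith
  define l where "l = bin y T n"
  have kernel: "exp (- T * \<bar>ln (real n) - ln (real m)\<bar>) \<le> 3 * (1/2) ^ nat \<bar>int (bin y T m) - int l\<bar>" if m: "real m > y" for m
  proof -
    define d where "d = nat \<bar>int (bin y T m) - int l\<bar>"
    have d: "real d = \<bar>real (bin y T m) - real l\<bar>" unfolding d_def by (simp add: of_nat_nat)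
    have yp: "y > 0" "T > 0" using y1 T by auto
    have "T * \<bar>ln (real n) - ln (real m)\<bar> = \<bar>T * ln (real n / y) - T * ln (real m / y)\<bar>"
      using T n m y1 by (simp add: ln_div abs_mult right_diff_distrib[symmetric])
    also have "\<dots> \<ge> real d - 1"
      using bin_bounds(1,2)[OF yp m] bin_bounds(1,2)[OF yp n] unfolding d l_def by linarith
    finally have "exp (- T * \<bar>ln (real n) - ln (real m)\<bar>) \<le> exp (1 + - real d)" by simp
    also have "\<dots> = exp 1 * exp (- 1) ^ d" unfolding exp_add exp_of_nat_mult[symmetric] by simp
    also have "\<dots> \<le> 3 * (1/2) ^ d"
    proof (intro mult_mono power_mono)
      show "exp (- 1 :: real) \<le> 1/2" using exp_ge_add_one_self[of "1::real"] by (simp add: exp_minus field_simps)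
    qed (auto simp: exp_le)
    finally show ?thesis unfolding d_def .
  qed
  have "(\<Sum>m\<in>A. mangoldt m / real m * exp (- T * \<bar>ln (real n) - ln (real m)\<bar>))
     \<le> (\<Sum>m\<in>A. mangoldt m / real m * (3 * (1/2) ^ nat \<bar>int (bin y T m) - int l\<bar>))"
    using kernel A(2) by (intro sum_mono mult_left_mono) (auto simp: mangoldt_nonneg)
  also have "\<dots> = (\<Sum>k\<in>bin y T ` A. \<Sum>m | m \<in> A \<and> bin y T m = k. mangoldt m / real m * (3 * (1/2) ^ nat \<bar>int (bin y T m) - int l\<bar>))"
    using A(1) by (rule sum.image_gen)
  also have "\<dots> \<le> (\<Sum>k\<in>bin y T ` A. (2 * bt_const / T) * (3 * (1/2) ^ nat \<bar>int k - int l\<bar>))"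
  proof (rule sum_mono)
    fix k
    define g where "g = grid y T k"
    have g: "g > 0" unfolding g_def grid_def using y1 by simp
    have "(\<Sum>m | m \<in> A \<and> bin y T m = k. mangoldt m / real m * (3 * (1/2) ^ nat \<bar>int (bin y T m) - int l\<bar>))
       \<le> (\<Sum>m | m \<in> A \<and> real m > y \<and> bin y T m = k. mangoldt m / g * (3 * (1/2) ^ nat \<bar>int k - int l\<bar>))"
    proof (rule order_trans[OF eq_refl sum_mono])
      show "(\<Sum>m | m \<in> A \<and> bin y T m = k. mangoldt m / real m * (3 * (1/2) ^ nat \<bar>int (bin y T m) - int l\<bar>))
        = (\<Sum>m | m \<in> A \<and> real m > y \<and> bin y T m = k. mangoldt m / real m * (3 * (1/2) ^ nat \<bar>int k - int l\<bar>))"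
        using A(2) by (intro sum.cong) auto
      fix m assume "m \<in> {m. m \<in> A \<and> real m > y \<and> bin y T m = k}"
      then have "g < real m" using bin_bounds(3)[of y T m] y1 T unfolding g_def by auto
      then have "mangoldt m / real m \<le> mangoldt m / g" using g by (intro divide_left_mono mangoldt_nonneg) auto
      then show "mangoldt m / real m * (3 * (1/2) ^ nat \<bar>int k - int l\<bar>) \<le> mangoldt m / g * (3 * (1/2) ^ nat \<bar>int k - int l\<bar>)"
        by (intro mult_right_mono) auto
    qed
    also have "\<dots> = (\<Sum>m | m \<in> A \<and> real m > y \<and> bin y T m = k. mangoldt m) / g * (3 * (1/2) ^ nat \<bar>int k - int l\<bar>)"
      by (simp only: sum_distrib_right sum_divide_distrib)
    also have "\<dots> \<le> (2 * bt_const * g / T) / g * (3 * (1/2) ^ nat \<bar>int k - int l\<bar>)"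
      using g bin_mass[OF T y, of A k] unfolding g_def[symmetric] by (intro mult_right_mono divide_right_mono) auto
    also have "\<dots> = (2 * bt_const / T) * (3 * (1/2) ^ nat \<bar>int k - int l\<bar>)" using g by simp
    finally show "(\<Sum>m | m \<in> A \<and> bin y T m = k. mangoldt m / real m * (3 * (1/2) ^ nat \<bar>int (bin y T m) - int l\<bar>))
       \<le> (2 * bt_const / T) * (3 * (1/2) ^ nat \<bar>int k - int l\<bar>)" .
  qed
  also have "\<dots> = (6 * bt_const / T) * (\<Sum>k\<in>bin y T ` A. (1/2) ^ nat \<bar>int k - int l\<bar>)"
    unfolding sum_distrib_left by (intro sum.cong refl) simp
  also have "\<dots> \<le> (6 * bt_const / T) * 4"
    using A(1) bt_const(1) T by (intro mult_left_mono sum_half_powers_le) auto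
  finally show ?thesis by simp
qed

text \<open>The transform of the kernel contributes pi / T, the inner sum over m another 1 / T, and
  the outer sum of |l(n)| n^(- 1 - \<alpha>) is of order 1 / \<alpha>. The gain over squaring the
  trivial bound comes from the even spread of the mass of \<Lambda> over the cells. The constant is
  144 pi, estimated through pi < 4.\<close>

lemma dser_mangoldt_mean_square:
  assumes T: "T \<ge> 1" and y: "y \<ge> T ^ 4" and \<alpha>: "\<alpha> > 0" "\<alpha> \<le> 1" and B: "B \<ge> 0"
    and l: "\<And>n. cmod (l n) \<le> B * mangoldt n" and l0: "\<And>n. real n \<le> y \<Longrightarrow> l n = 0"
  shows "(\<integral>t. (cmod (dser l (Complex (1 + \<alpha>) t)))\<^sup>2 / (T\<^sup>2 + t\<^sup>2) \<partial>lborel) \<le> 600 * B\<^sup>2 * bt_const / (T\<^sup>2 * \<alpha>)"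
proof -
  have Tp: "T > 0" using T by simp
  have dm: "dabs mangoldt (1 + \<alpha>)" using \<alpha> by (intro dabs_mangoldt) auto
  have dl: "dabs l (1 + \<alpha>)"
    using dabs_cmult[OF dm, of "of_real B"] by (rule dabs_comparison) (use l B in \<open>auto simp: norm_mult mangoldt_nonneg\<close>)
  define c where "c n = l n * of_real (real n powr - (1 + \<alpha>))" for n
  have fin: "(\<integral>t. (cmod (dpoly {1..N} c t))\<^sup>2 / (T\<^sup>2 + t\<^sup>2) \<partial>lborel) \<le> 600 * B\<^sup>2 * bt_const / (T\<^sup>2 * \<alpha>)" for N
  proof -
    define A where "A = {n \<in> {1..N}. real n > y}"
    have fA: "finite A" by (simp add: A_def)
    have "dpoly {1..N} c = dpoly A c"
      unfolding dpoly_def A_def by (rule ext, rule sum.mono_neutral_right) (auto simp: c_def, metis l0 not_le)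
    then have "(\<integral>t. (cmod (dpoly {1..N} c t))\<^sup>2 / (T\<^sup>2 + t\<^sup>2) \<partial>lborel)
       \<le> pi / T * (\<Sum>n\<in>A. \<Sum>m\<in>A. cmod (c n) * cmod (c m) * exp (- T * \<bar>ln (real n) - ln (real m)\<bar>))"
      using dpoly_mean_square_le[OF Tp fA, of c] by simp
    also have "\<dots> \<le> pi / T * (\<Sum>n\<in>A. cmod (c n) * (B * (24 * bt_const / T)))"
    proof (intro mult_left_mono sum_mono)
      fix n assume n: "n \<in> A"
      have "(\<Sum>m\<in>A. cmod (c n) * cmod (c m) * exp (- T * \<bar>ln (real n) - ln (real m)\<bar>))
         = cmod (c n) * (\<Sum>m\<in>A. cmod (c m) * exp (- T * \<bar>ln (real n) - ln (real m)\<bar>))"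
        by (simp only: sum_distrib_left mult.assoc)
      also have "\<dots> \<le> cmod (c n) * (\<Sum>m\<in>A. B * (mangoldt m / real m * exp (- T * \<bar>ln (real n) - ln (real m)\<bar>)))"
      proof (intro mult_left_mono sum_mono)
        fix m assume m: "m \<in> A"
        have "real m powr - (1 + \<alpha>) \<le> real m powr - 1" using m \<alpha> by (intro powr_mono) (auto simp: A_def)
        also have "\<dots> = 1 / real m" using m by (simp add: A_def powr_minus_divide)
        finally have p: "real m powr - (1 + \<alpha>) \<le> 1 / real m" .
        have "cmod (c m) = cmod (l m) * real m powr - (1 + \<alpha>)" by (simp add: c_def norm_mult)
        also have "\<dots> \<le> (B * mangoldt m) * (1 / real m)"
          using p l[of m] B by (intro mult_mono mult_nonneg_nonneg) (auto simp: mangoldt_nonneg)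
        finally have "cmod (c m) \<le> B * (mangoldt m / real m)" by simp
        then have "cmod (c m) * exp (- T * \<bar>ln (real n) - ln (real m)\<bar>) \<le> B * (mangoldt m / real m) * exp (- T * \<bar>ln (real n) - ln (real m)\<bar>)"
          by (rule mult_right_mono) simp
        then show "cmod (c m) * exp (- T * \<bar>ln (real n) - ln (real m)\<bar>) \<le> B * (mangoldt m / real m * exp (- T * \<bar>ln (real n) - ln (real m)\<bar>))"
          by (simp only: mult.assoc)
      qed simp
      also have "\<dots> \<le> cmod (c n) * (B * (24 * bt_const / T))"
        unfolding sum_distrib_left[symmetric]
        using mangoldt_kernel_sum[OF T y fA, of n] n B by (intro mult_left_mono) (auto simp: A_def)
      finally show "(\<Sum>m\<in>A. cmod (c n) * cmod (c m) * exp (- T * \<bar>ln (real n) - ln (real m)\<bar>)) \<le> cmod (c n) * (B * (24 * bt_const / T))" .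
    qed (use Tp in simp)
    also have "\<dots> = pi / T * (B * (24 * bt_const / T)) * (\<Sum>n\<in>A. cmod (c n))"
      unfolding sum_distrib_right[symmetric] by (simp only: mult_ac)
    also have "\<dots> \<le> pi / T * (B * (24 * bt_const / T)) * (B * (6 / \<alpha>))"
    proof (rule mult_left_mono)
      have "(\<Sum>n\<in>A. cmod (c n)) = (\<Sum>n\<in>A. cmod (l n) * real n powr - (1 + \<alpha>))" by (simp add: c_def norm_mult)
      also have "\<dots> \<le> (\<Sum>n\<in>A. B * (cmod (mangoldt n) * real n powr - (1 + \<alpha>)))"
        using l unfolding mult.assoc[symmetric] by (intro sum_mono mult_right_mono) auto
      also have "\<dots> \<le> B * dnorm mangoldt (1 + \<alpha>)"
        unfolding sum_distrib_left[symmetric] using B by (intro mult_left_mono sum_le_dnorm dm fA)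
      also have "\<dots> \<le> B * (2 + 4 / \<alpha>)" using B \<alpha> by (intro mult_left_mono dnorm_mangoldt_le) auto
      also have "\<dots> \<le> B * (6 / \<alpha>)" using B \<alpha> by (intro mult_left_mono) (auto simp: field_simps)
      finally show "(\<Sum>n\<in>A. cmod (c n)) \<le> B * (6 / \<alpha>)" .
      show "0 \<le> pi / T * (B * (24 * bt_const / T))" using Tp B bt_const(1) by simp
    qed
    also have "\<dots> = (144 * pi) * (B\<^sup>2 * bt_const / (T\<^sup>2 * \<alpha>))" by (simp add: power2_eq_square)
    also have "\<dots> \<le> 600 * (B\<^sup>2 * bt_const / (T\<^sup>2 * \<alpha>))"
      using bt_const(1) \<alpha> pi_less_4 by (intro mult_right_mono) auto
    finally show ?thesis by simp
  qed
  have "(\<lambda>N. \<integral>t. (cmod (dpoly {1..N} c t))\<^sup>2 / (T\<^sup>2 + t\<^sup>2) \<partial>lborel) \<longlonglongrightarrow> (\<integral>t. (cmod (dser l (Complex (1 + \<alpha>) t)))\<^sup>2 / (T\<^sup>2 + t\<^sup>2) \<partial>lborel)"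
    unfolding c_def by (rule dser_mean_square(2)[OF dl Tp])
  then show ?thesis by (rule LIMSEQ_le_const2) (use fin in blast)
qed

section \<open>Partial sums of convolutions, and Abel summation\<close>

lemma sum_dconv:
  fixes c e :: "nat \<Rightarrow> complex"
  shows "(\<Sum>k=1..n. dconv c e k) = (\<Sum>d=1..n. c d * (\<Sum>j=1..n div d. e j))"
proof -
  have "(\<Sum>k=1..n. dconv c e k) = (\<Sum>(k, d)\<in>(SIGMA k:{1..n}. {d. d dvd k}). c d * e (k div d))"
    unfolding dconv_def by (rule sum.Sigma) auto
  also have "\<dots> = (\<Sum>(d, j)\<in>(SIGMA d:{1..n}. {1..n div d}). c d * e j)"
  proof (rule sum.reindex_bij_witness[where i = "\<lambda>(d, j). (d * j, d)" and j = "\<lambda>(k, d). (d, k div d)"])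
    fix p assume p: "p \<in> (SIGMA k:{1..n}. {d. d dvd k})"
    obtain k d where kd: "p = (k, d)" by (cases p)
    with p have h: "1 \<le> k" "k \<le> n" "d dvd k" by auto
    then have "d \<ge> 1" "d \<le> n" "k div d \<ge> 1" "k div d \<le> n div d"
      by (auto simp: div_le_mono div_greater_zero_iff dvd_imp_le Suc_le_eq intro: Nat.gr0I dest: dvd_imp_le)
    then show "(case p of (k, d) \<Rightarrow> (d, k div d)) \<in> (SIGMA d:{1..n}. {1..n div d})" using kd by simp
    show "(case case p of (k, d) \<Rightarrow> (d, k div d) of (d, j) \<Rightarrow> (d * j, d)) = p" using kd h by simp
    show "(case case p of (k, d) \<Rightarrow> (d, k div d) of (d, j) \<Rightarrow> c d * e j) = (case p of (k, d) \<Rightarrow> c d * e (k div d))"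
      using kd by simp
  next
    fix p assume p: "p \<in> (SIGMA d:{1..n}. {1..n div d})"
    obtain d j where dj: "p = (d, j)" by (cases p)
    with p have h: "1 \<le> d" "d \<le> n" "1 \<le> j" "j \<le> n div d" by auto
    have "d * j \<le> d * (n div d)" using h by simp
    also have "\<dots> \<le> n" by simp
    finally have "d * j \<le> n" .
    moreover have "1 \<le> d * j" using h by simp
    ultimately show "(case p of (d, j) \<Rightarrow> (d * j, d)) \<in> (SIGMA k:{1..n}. {d. d dvd k})" using dj by simp
    show "(case case p of (d, j) \<Rightarrow> (d * j, d) of (k, d) \<Rightarrow> (d, k div d)) = p" using dj h by simp
  qed
  also have "\<dots> = (\<Sum>d=1..n. \<Sum>j=1..n div d. c d * e j)"
    by (rule sum.Sigma[symmetric]) auto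
  finally show ?thesis by (simp only: sum_distrib_left)
qed

lemma sum_abel_ln:
  fixes a :: "nat \<Rightarrow> complex"
  shows "of_real (ln (real (Suc n))) * (\<Sum>k=1..Suc n. a k) =
    (\<Sum>k=1..Suc n. of_real (ln (real k)) * a k) + (\<Sum>m=1..n. of_real (ln (real (Suc m)) - ln (real m)) * (\<Sum>k=1..m. a k))"
proof (induction n)
  case (Suc n)
  define S where "S = (\<Sum>k=1..Suc n. a k)"
  have "of_real (ln (real (Suc (Suc n)))) * (\<Sum>k=1..Suc (Suc n). a k)
     = of_real (ln (real (Suc (Suc n)))) * S + of_real (ln (real (Suc (Suc n)))) * a (Suc (Suc n))"
    by (simp add: S_def algebra_simps)
  also have "of_real (ln (real (Suc (Suc n)))) * S
     = of_real (ln (real (Suc n))) * S + of_real (ln (real (Suc (Suc n))) - ln (real (Suc n))) * S"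
    by (simp only: of_real_diff left_diff_distrib) simp
  also have "of_real (ln (real (Suc n))) * S =
    (\<Sum>k=1..Suc n. of_real (ln (real k)) * a k) + (\<Sum>m=1..n. of_real (ln (real (Suc m)) - ln (real m)) * (\<Sum>k=1..m. a k))"
    unfolding S_def by (rule Suc)
  finally show ?case by (simp add: S_def del: of_nat_Suc)
qed simp

text \<open>Abel summation moves the logarithm out of the sum; its increments log (m + 1) - log m
  are at most 1 / m.\<close>

lemma cmod_abel_ln_le:
  fixes a :: "nat \<Rightarrow> complex"
  assumes "n \<ge> 1"
  shows "cmod (\<Sum>k=1..n. a k) * ln (real n) \<le> cmod (\<Sum>k=1..n. of_real (ln (real k)) * a k)
     + (\<Sum>m=1..n - 1. cmod (\<Sum>k=1..m. a k) / real m)"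
proof -
  obtain n' where n: "n = Suc n'" using assms by (cases n) auto
  have "cmod (\<Sum>k=1..n. a k) * ln (real n) = cmod (of_real (ln (real n)) * (\<Sum>k=1..n. a k))"
    using assms by (simp add: norm_mult)
  also have "\<dots> \<le> cmod (\<Sum>k=1..n. of_real (ln (real k)) * a k)
     + cmod (\<Sum>m=1..n'. of_real (ln (real (Suc m)) - ln (real m)) * (\<Sum>k=1..m. a k))"
    unfolding n sum_abel_ln by (rule norm_triangle_ineq)
  also have "cmod (\<Sum>m=1..n'. of_real (ln (real (Suc m)) - ln (real m)) * (\<Sum>k=1..m. a k))
     \<le> (\<Sum>m=1..n'. cmod (\<Sum>k=1..m. a k) / real m)"
  proof (rule order_trans[OF norm_sum sum_mono])
    fix m assume "m \<in> {1..n'}"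
    then have m: "real m > 0" by simp
    have "ln (real (Suc m)) - ln (real m) = ln (1 + 1 / real m)"
    proof -
      have "ln (real (Suc m)) - ln (real m) = ln (real (Suc m) / real m)"
        using m by (simp add: ln_div)
      also have "real (Suc m) / real m = 1 + 1 / real m" using m by (simp add: field_simps)
      finally show ?thesis .
    qed
    then have "ln (real (Suc m)) - ln (real m) \<le> 1 / real m" "0 \<le> ln (real (Suc m)) - ln (real m)"
      using m ln_add_one_self_le_self[of "1 / real m"] by auto
    then have "\<bar>ln (real (Suc m)) - ln (real m)\<bar> * cmod (\<Sum>k=1..m. a k) \<le> 1 / real m * cmod (\<Sum>k=1..m. a k)"
      by (intro mult_right_mono) auto
    then show "cmod (of_real (ln (real (Suc m)) - ln (real m)) * (\<Sum>k=1..m. a k)) \<le> cmod (\<Sum>k=1..m. a k) / real m"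
      by (simp only: norm_mult norm_of_real) simp
  qed
  finally show ?thesis by (simp add: n)
qed

lemma sum_inverse_squares_le:
  assumes "k \<ge> 1"
  shows "(\<Sum>n=k..N. 1 / (real n)\<^sup>2) \<le> 2 / real k"
proof (cases "k \<le> N")
  case True
  have "(\<Sum>n=k..M. 1 / (real n)\<^sup>2) \<le> 2 / real k - 1 / real M" if "k \<le> M" for M
    using that
  proof (induction M rule: dec_induct)
    case base
    have "1 / (real k)\<^sup>2 \<le> 1 / real k" using assms by (simp add: power2_eq_square field_simps)
    then show ?case by simp
  next
    case (step M)
    have "1 / (real (Suc M))\<^sup>2 \<le> 1 / (real M * real (Suc M))"
      unfolding power2_eq_square using step assms by (intro divide_left_mono mult_right_mono mult_pos_pos) auto
    also have "\<dots> = 1 / real M - 1 / real (Suc M)" using step assms by (simp add: field_simps)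
    finally show ?case using step by simp
  qed
  from this[OF True] show ?thesis by (smt (verit) divide_nonneg_nonneg of_nat_0_le_iff)
qed simp

lemma sum_inverse_squares_after_le:
  assumes "m \<ge> 1"
  shows "(\<Sum>n=Suc m..N. 1 / (real n)\<^sup>2) \<le> 1 / real m"
proof (cases "m \<le> N")
  case True
  have "(\<Sum>n=Suc m..M. 1 / (real n)\<^sup>2) \<le> 1 / real m - 1 / real M" if "m \<le> M" for M
    using that
  proof (induction M rule: dec_induct)
    case (step M)
    have "1 / (real (Suc M))\<^sup>2 \<le> 1 / (real M * real (Suc M))"
      unfolding power2_eq_square using step assms by (intro divide_left_mono mult_right_mono mult_pos_pos) auto
    also have "\<dots> = 1 / real M - 1 / real (Suc M)" using step assms by (simp add: field_simps)
    finally show ?case using step by simp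
  qed simp
  from this[OF True] show ?thesis by (smt (verit) divide_nonneg_nonneg of_nat_0_le_iff)
qed simp

section \<open>The method of Halasz\<close>

text \<open>From here on only sequences indexed by the norm occur, and x is fixed. The condition log
  log x >= 1 makes all iterated logarithms usable as factors; the smaller x are left to the final
  constant.\<close>

locale halasz =
  fixes \<kappa> :: real and a l :: "nat \<Rightarrow> complex" and x :: real
  assumes \<kappa>: "\<kappa> \<ge> 1" and a_dabs: "\<And>\<sigma>. \<sigma> > 1 \<Longrightarrow> dabs a \<sigma>" and a1: "a 1 = 1"
    and l_le: "\<And>n. cmod (l n) \<le> \<kappa> * gauss_mangoldt n"
    and conv: "\<And>n. n > 0 \<Longrightarrow> of_real (ln (real n)) * a n = dconv l a n"
    and lnlnx: "ln (ln x) \<ge> 1" and x_pos: "ln x > 0" "x > 0"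
begin

definition X where "X = ln x"
definition Y where "Y = ln X"
definition T where "T = X powr \<kappa>"
definition y where "y = T ^ 4"
text \<open>Arises from 1 + u <= 2 u for u >= 1 in the trivial bound (1 + u)^\<kappa> at \<sigma> =
  1 + 1 / u, and is itself that bound at \<sigma> = 2.\<close>

definition K where "K = 2 powr \<kappa>"
definition S where "S n = (\<Sum>k=1..n. a k)"
definition N where "N = nat \<lfloor>x\<rfloor>"
definition J where "J = (\<Sum>m=1..N. cmod (S m) / (real m)\<^sup>2)"

lemma Y_ge: "Y \<ge> 1" using lnlnx unfolding Y_def X_def .

lemma X_ge: "X \<ge> 2"
proof -
  have "exp 1 \<le> X" using Y_ge x_pos unfolding Y_def X_def by (subst (asm) ln_ge_iff) auto
  moreover have "2 \<le> exp (1::real)" using exp_ge_add_one_self[of "1::real"] by simp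
  ultimately show ?thesis by linarith
qed

lemma x_ge: "x \<ge> 3"
proof -
  have "exp 2 \<le> exp X" using X_ge by simp
  moreover have "exp X = x" unfolding X_def using x_pos by simp
  moreover have "3 \<le> exp (2::real)" using exp_ge_add_one_self[of "2::real"] by simp
  ultimately show ?thesis by linarith
qed

lemma N_le: "n \<le> N \<longleftrightarrow> real n \<le> x"
  unfolding N_def using x_pos by (simp add: le_nat_iff le_floor_iff)

lemma T_ge: "T \<ge> X" "T \<ge> 2"
proof -
  have "X powr 1 \<le> X powr \<kappa>" using X_ge \<kappa> by (intro powr_mono) auto
  then show "T \<ge> X" unfolding T_def using X_ge by simp
  then show "T \<ge> 2" using X_ge by simp
qed

lemma K_ge: "K \<ge> 2"
proof -
  have "2 powr 1 \<le> K" unfolding K_def using \<kappa> by (intro powr_mono) auto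
  then show ?thesis by simp
qed

lemma y_ge: "y \<ge> 16" "y \<ge> T ^ 4"
proof -
  have "(2::real) ^ 4 \<le> T ^ 4" using T_ge by (intro power_mono) auto
  then show "y \<ge> 16" unfolding y_def by simp
qed (simp add: y_def)

lemma ln_y: "ln y = 4 * \<kappa> * Y"
  unfolding y_def T_def Y_def using X_ge by (simp add: ln_realpow ln_powr)

lemma ln_y_ge: "ln y \<ge> 4"
proof -
  have "1 * 1 \<le> \<kappa> * Y" using \<kappa> Y_ge by (intro mult_mono) auto
  then show ?thesis unfolding ln_y by simp
qed

lemma J_nonneg: "J \<ge> 0" unfolding J_def by (intro sum_nonneg) auto

lemma dnorm_a_le: "\<sigma> > 1 \<Longrightarrow> dnorm a \<sigma> \<le> (1 + 1 / (\<sigma> - 1)) powr \<kappa>"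
  using dnorm_le_powr[OF a_dabs a1 l_le _ conv] \<kappa> by simp

lemma l_le2: "cmod (l n) \<le> 2 * \<kappa> * mangoldt n"
proof -
  have "\<kappa> * gauss_mangoldt n \<le> \<kappa> * (2 * mangoldt n)" using gauss_mangoldt_le \<kappa> by (intro mult_left_mono) auto
  then show ?thesis using l_le[of n] by linarith
qed

text \<open>Rankin's trick: for log n <= L the weight 1 / n is at most 3 n^(- \<sigma>) with
  \<sigma> = 1 + 1 / L, because exp 1 <= 3, and the complete series at \<sigma> is at most (1 +
  L)^\<kappa>.\<close>

lemma sum_abs_a_div_le:
  assumes L: "L \<ge> 1" and A: "finite A" "\<And>n. n \<in> A \<Longrightarrow> n \<ge> 1 \<and> ln (real n) \<le> L"
  shows "(\<Sum>n\<in>A. cmod (a n) / real n) \<le> 3 * K * L powr \<kappa>"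
proof -
  define \<sigma> where "\<sigma> = 1 + 1 / L"
  have \<sigma>: "\<sigma> > 1" using L by (simp add: \<sigma>_def)
  have "(\<Sum>n\<in>A. cmod (a n) / real n) \<le> (\<Sum>n\<in>A. 3 * (cmod (a n) * real n powr - \<sigma>))"
  proof (rule sum_mono)
    fix n assume n: "n \<in> A"
    have "ln (real n) / L \<le> 1" using A(2)[OF n] L by simp
    then have "exp (ln (real n) / L) \<le> 3" using exp_le by (meson exp_le_cancel_iff order_trans)
    then have e: "1 \<le> 3 * exp (- (ln (real n) / L))" by (simp add: exp_minus field_simps)
    have "real n powr - \<sigma> = exp (- ln (real n) + - (ln (real n) / L))"
      using A(2)[OF n] by (simp add: powr_def \<sigma>_def algebra_simps)
    also have "\<dots> = 1 / real n * exp (- (ln (real n) / L))"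
      unfolding exp_add using A(2)[OF n] by (simp add: exp_minus field_simps)
    finally have p: "real n powr - \<sigma> = 1 / real n * exp (- (ln (real n) / L))" .
    have "1 / real n * 1 \<le> 1 / real n * (3 * exp (- (ln (real n) / L)))" using e by (intro mult_left_mono) auto
    then have "1 / real n \<le> 3 * real n powr - \<sigma>" unfolding p by simp
    then have "cmod (a n) * (1 / real n) \<le> cmod (a n) * (3 * real n powr - \<sigma>)" by (intro mult_left_mono) auto
    then show "cmod (a n) / real n \<le> 3 * (cmod (a n) * real n powr - \<sigma>)" by simp
  qed
  also have "\<dots> = 3 * (\<Sum>n\<in>A. cmod (a n) * real n powr - \<sigma>)" by (simp only: sum_distrib_left)
  also have "\<dots> \<le> 3 * dnorm a \<sigma>" by (intro mult_left_mono sum_le_dnorm a_dabs \<sigma> A) auto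
  also have "\<dots> \<le> 3 * (1 + L) powr \<kappa>" using dnorm_a_le[OF \<sigma>] L by (simp add: \<sigma>_def)
  also have "\<dots> \<le> 3 * (2 * L) powr \<kappa>" using L \<kappa> by (intro mult_left_mono powr_mono2) auto
  also have "\<dots> = 3 * K * L powr \<kappa>" using L by (simp add: K_def powr_mult)
  finally show ?thesis .
qed

lemma ln_le_X: "n \<ge> 1 \<Longrightarrow> n \<le> N \<Longrightarrow> ln (real n) \<le> X"
  unfolding X_def N_le by (intro ln_mono) auto

lemma sum_abs_a_div_N: "w \<le> N \<Longrightarrow> (\<Sum>n=1..w. cmod (a n) / real n) \<le> 3 * K * T"
  unfolding T_def using X_ge ln_le_X by (intro sum_abs_a_div_le) auto

text \<open>Rankin's trick at \<sigma> = 1 + 1 / log y. The order log y, small compared with log x,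
  is what allows the prime powers up to y to be absorbed later.\<close>

lemma sum_small_mangoldt: "(\<Sum>d | 1 \<le> d \<and> real d \<le> y. mangoldt d / real d) \<le> 18 * ln y"
proof -
  define \<sigma> where "\<sigma> = 1 + 1 / ln y"
  have \<sigma>: "\<sigma> > 1" using ln_y_ge by (simp add: \<sigma>_def)
  have fin: "finite {d. 1 \<le> d \<and> real d \<le> y}" using finite_nat_le_real by (rule rev_finite_subset) auto
  have "(\<Sum>d | 1 \<le> d \<and> real d \<le> y. mangoldt d / real d) \<le> (\<Sum>d | 1 \<le> d \<and> real d \<le> y. 3 * (cmod (mangoldt d) * real d powr - \<sigma>))"
  proof (rule sum_mono)
    fix n assume "n \<in> {d. 1 \<le> d \<and> real d \<le> y}"
    then have n: "n \<ge> 1" "real n \<le> y" by auto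
    have "ln (real n) \<le> ln y" using n by (intro ln_mono) auto
    then have "ln (real n) / ln y \<le> 1" using ln_y_ge by simp
    then have "exp (ln (real n) / ln y) \<le> 3" using exp_le by (meson exp_le_cancel_iff order_trans)
    then have e: "1 \<le> 3 * exp (- (ln (real n) / ln y))" by (simp add: exp_minus field_simps)
    have "real n powr - \<sigma> = exp (- ln (real n) + - (ln (real n) / ln y))"
      using n by (simp add: powr_def \<sigma>_def algebra_simps)
    also have "\<dots> = 1 / real n * exp (- (ln (real n) / ln y))"
      unfolding exp_add using n by (simp add: exp_minus field_simps)
    finally have p: "real n powr - \<sigma> = 1 / real n * exp (- (ln (real n) / ln y))" .
    have "1 / real n * 1 \<le> 1 / real n * (3 * exp (- (ln (real n) / ln y)))" using e by (intro mult_left_mono) auto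
    then have "1 / real n \<le> 3 * real n powr - \<sigma>" unfolding p by simp
    then have "mangoldt n * (1 / real n) \<le> mangoldt n * (3 * real n powr - \<sigma>)" by (intro mult_left_mono mangoldt_nonneg)
    then show "mangoldt n / real n \<le> 3 * (cmod (mangoldt n) * real n powr - \<sigma>)" by simp
  qed
  also have "\<dots> = 3 * (\<Sum>d | 1 \<le> d \<and> real d \<le> y. cmod (mangoldt d) * real d powr - \<sigma>)" by (simp only: sum_distrib_left)
  also have "\<dots> \<le> 3 * dnorm mangoldt \<sigma>" by (intro mult_left_mono sum_le_dnorm dabs_mangoldt \<sigma> fin) auto
  also have "\<dots> \<le> 3 * (2 + 4 * ln y)" using dnorm_mangoldt_le[of "1 / ln y"] ln_y_ge by (simp add: \<sigma>_def)
  also have "\<dots> \<le> 18 * ln y" using ln_y_ge by simp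
  finally show ?thesis .
qed

text \<open>The length of the part of [m, m + 1) that lies below b.\<close>

definition hm :: "nat \<Rightarrow> real \<Rightarrow> real" where "hm m b = min (real m + 1) b - min (real m) b"

lemma hm_mono: "b \<le> b' \<Longrightarrow> hm m b \<le> hm m b'" unfolding hm_def by linarith
lemma hm_bounds: "0 \<le> hm m b" "hm m b \<le> 1" unfolding hm_def by linarith+

lemma hm_sum: "0 \<le> b \<Longrightarrow> b \<le> real (Suc w) \<Longrightarrow> (\<Sum>m=0..w. hm m b) = b"
proof -
  assume b: "0 \<le> b" "b \<le> real (Suc w)"
  have "(\<Sum>m=0..w. hm m b) = min (real (Suc w)) b - min 0 b" for w
    by (induction w) (auto simp: hm_def)
  then show ?thesis using b by simp
qed

lemma hm_diff_pos:
  assumes "b' \<le> b" "hm m b - hm m b' \<noteq> 0"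
  shows "real m < b" "b' < real m + 1"
  using assms unfolding hm_def by linarith+

text \<open>On the \<open>k\<close>-th bin \<open>w / d\<close> ranges over an interval \<open>[b', b)\<close> that is short enough for
  \<open>|S(w div d)|\<close> to be replaced by its average over \<open>[b', b)\<close>; \<open>hm m b - hm m b'\<close> is the length of
  \<open>[m, m + 1) \<inter> [b', b)\<close>.\<close>

lemma bin_average:
  assumes w: "b \<le> real w" "0 \<le> b'" "b' < b" and q: "real q < b" "b' < real q + 1"
  shows "cmod (S q) * (b - b') \<le> (\<Sum>m=1..w. (hm m b - hm m b') * cmod (S m))
      + (b - b') * (\<Sum>n | n \<in> {1..w} \<and> b' < real n \<and> real n < b. cmod (a n))"
proof -
  define V where "V = (\<Sum>n | n \<in> {1..w} \<and> b' < real n \<and> real n < b. cmod (a n))"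
  \<comment> \<open>Two integers whose unit cells meet [b', b) differ in S only by coefficients with
    index strictly between b' and b.\<close>
  have diff: "cmod (S q) \<le> cmod (S m) + V" if m: "real m < b" "b' < real m + 1" for m
  proof -
    have gap: "cmod (S j - S i) \<le> V" if ij: "i \<le> j" "b' < real i + 1" "real j < b" for i j
    proof -
      have "S j - S i = (\<Sum>k=Suc i..j. a k)"
      proof -
        have "{1..j} = {1..i} \<union> {Suc i..j}" using ij by auto
        then have "S j = S i + (\<Sum>k=Suc i..j. a k)" unfolding S_def by (simp add: sum.union_disjoint)
        then show ?thesis by simp
      qed
      then have "cmod (S j - S i) \<le> (\<Sum>k=Suc i..j. cmod (a k))" by (simp add: norm_sum)
      also have "\<dots> \<le> V" unfolding V_def
      proof (rule sum_mono2)
        show "{Suc i..j} \<subseteq> {n. n \<in> {1..w} \<and> b' < real n \<and> real n < b}"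
        proof
          fix n assume "n \<in> {Suc i..j}"
          then have n: "real i + 1 \<le> real n" "real n \<le> real j" "1 \<le> n" by auto
          then have "real n \<le> real w" using ij w by linarith
          then show "n \<in> {n. n \<in> {1..w} \<and> b' < real n \<and> real n < b}" using n ij by auto
        qed
      qed auto
      finally show ?thesis .
    qed
    have "cmod (S q - S m) \<le> V"
    proof (cases "m \<le> q")
      case True
      then show ?thesis using gap[of m q] m q by simp
    next
      case False
      then show ?thesis using gap[of q m] m q by (simp add: norm_minus_commute)
    qed
    then show ?thesis using norm_triangle_ineq2[of "S q" "S m"] by linarith
  qed
  have tot: "(\<Sum>m=0..w. hm m b - hm m b') = b - b'"
    unfolding sum_subtractf using w by (subst (1 2) hm_sum) auto
  have "cmod (S q) * (b - b') = (\<Sum>m=0..w. (hm m b - hm m b') * cmod (S q))"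
    unfolding tot[symmetric] sum_distrib_left by (rule sum.cong[OF refl]) (rule mult.commute)
  also have "\<dots> \<le> (\<Sum>m=0..w. (hm m b - hm m b') * (cmod (S m) + V))"
  proof (rule sum_mono)
    fix m
    show "(hm m b - hm m b') * cmod (S q) \<le> (hm m b - hm m b') * (cmod (S m) + V)"
    proof (cases "hm m b - hm m b' = 0")
      case False
      have "b' \<le> b" using w by simp
      from hm_diff_pos[OF this False] have "cmod (S q) \<le> cmod (S m) + V" by (rule diff)
      then show ?thesis using hm_mono[OF \<open>b' \<le> b\<close>, of m] by (intro mult_left_mono) auto
    qed simp
  qed
  also have "\<dots> = (\<Sum>m=0..w. (hm m b - hm m b') * cmod (S m)) + (\<Sum>m=0..w. hm m b - hm m b') * V"
    by (simp only: distrib_left sum.distrib sum_distrib_right)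
  also have "(\<Sum>m=0..w. (hm m b - hm m b') * cmod (S m)) = (\<Sum>m=1..w. (hm m b - hm m b') * cmod (S m))"
    by (rule sum.mono_neutral_right) (auto simp: S_def Suc_le_eq)
  finally show ?thesis unfolding tot V_def .
qed

text \<open>For d in the k-th bin, the mass of \<Lambda> is at most
  \<open>2 * bt_const * g k / T\<close>, and w / d ranges over an interval of length at least
  \<open>b k / (2 * T)\<close> on which S is averaged. The averages add up to w J because the bins
  together cover each [m, m + 1) at most once. The errors \<open>V k\<close> add up to a multiple of
  w K, since their factor 1 / T cancels the trivial bound T for the sum of |a(n)| / n.\<close>

lemma large_primes_bound:
  assumes w: "w \<le> N"
  shows "(\<Sum>d | d \<in> {1..w} \<and> real d > y. mangoldt d * cmod (S (w div d))) \<le> real w * (4 * bt_const * J + 6 * bt_const * K)"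
proof (cases "w = 0")
  case False
  define D where "D = {d. d \<in> {1..w} \<and> real d > y}"
  define g where "g = grid y T"
  define b where "b k = real w / g k" for k
  define A where "A k = (\<Sum>m=1..w. (hm m (b k) - hm m (b (Suc k))) * cmod (S m))" for k
  define V where "V k = (\<Sum>n | n \<in> {1..w} \<and> b (Suc k) < real n \<and> real n < b k. cmod (a n))" for k
  have Tp: "T \<ge> 1" "T > 0" using T_ge by auto
  have yp: "y > 0" using y_ge by simp
  have fD: "finite D" by (simp add: D_def)
  have w0: "real w > 0" using False by simp
  have g1: "g k \<ge> 1" for k
  proof -
    have "y * 1 \<le> g k" unfolding g_def grid_def using yp Tp by (intro mult_left_mono) auto
    then show ?thesis using y_ge by simp
  qed
  have gS: "g (Suc k) = g k * exp (1 / T)" for k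
    unfolding g_def grid_def by (simp add: add_divide_distrib exp_add mult_ac)
  have bS: "b (Suc k) = b k * exp (- (1 / T))" for k
    unfolding b_def gS by (simp add: exp_minus field_simps)
  have bpos: "b k > 0" for k unfolding b_def using w0 g1[of k] by (intro divide_pos_pos) auto
  have bw: "b k \<le> real w" for k unfolding b_def using w0 g1[of k] by (simp add: divide_le_eq mult_le_cancel_left1)
  have blt: "b (Suc k) < b k" for k unfolding bS using bpos[of k] Tp by (simp add: mult_less_cancel_left1)
  have blen: "b k - b (Suc k) \<ge> b k / (2 * T)" for k
  proof -
    have "exp (- (1 / T)) \<le> 1 / (1 + 1 / T)"
      unfolding exp_minus inverse_eq_divide using exp_ge_add_one_self[of "1 / T"] Tp by (intro divide_left_mono) (auto simp: add_pos_pos)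
    also have "\<dots> = 1 - 1 / (T + 1)" using Tp by (simp add: field_simps)
    also have "\<dots> \<le> 1 - 1 / (2 * T)" using Tp by (intro diff_left_mono divide_left_mono) auto
    finally have "1 / (2 * T) \<le> 1 - exp (- (1 / T))" by simp
    then have "b k * (1 / (2 * T)) \<le> b k * (1 - exp (- (1 / T)))" using bpos[of k] by (intro mult_left_mono) auto
    then show ?thesis unfolding bS by (simp add: right_diff_distrib)
  qed
  have bmono: "b j \<le> b i" if "i \<le> j" for i j
    using that by (induction j rule: dec_induct) (auto intro: order_trans less_imp_le[OF blt])
  have Aneg: "0 \<le> A k" for k unfolding A_def
    using hm_mono[OF less_imp_le[OF blt]] by (intro sum_nonneg mult_nonneg_nonneg) auto
  have Vneg: "0 \<le> V k" for k unfolding V_def by (intro sum_nonneg) auto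
  have each: "cmod (S (w div d)) \<le> A k * (2 * T * g k / real w) + V k" if dD: "d \<in> D" "bin y T d = k" for d k
  proof -
    have dy: "real d > y" "d \<ge> 1" using dD by (auto simp: D_def)
    have gd: "g k < real d" "real d \<le> g (Suc k)"
      using bin_bounds(3,4)[OF yp Tp(2) dy(1)] dD(2) unfolding g_def by auto
    define q where "q = w div d"
    have "real q \<le> real w / real d" unfolding q_def by (rule of_nat_div_le_of_nat)
    also have "\<dots> < b k" unfolding b_def using gd w0 g1[of k] by (intro divide_strict_left_mono) auto
    finally have q1: "real q < b k" .
    have "b (Suc k) \<le> real w / real d" unfolding b_def using gd w0 g1[of "Suc k"] dy by (intro divide_left_mono mult_pos_pos) auto
    also have "real w / real d < real q + 1"
    proof -
      have "w < d * (q + 1)" unfolding q_def using dy(2) by (metis add.commute div_less_iff_less_mult lessI less_le_trans mult.commute plus_1_eq_Suc zero_less_one)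
      then have "real w < real d * (real q + 1)" by (metis of_nat_1 of_nat_add of_nat_less_iff of_nat_mult)
      then show ?thesis using dy by (simp add: divide_less_eq mult.commute)
    qed
    finally have q2: "b (Suc k) < real q + 1" .
    have av: "cmod (S q) * (b k - b (Suc k)) \<le> A k + (b k - b (Suc k)) * V k"
      unfolding A_def V_def by (rule bin_average[OF bw less_imp_le[OF bpos] blt q1 q2])
    have len: "b k - b (Suc k) > 0" using blt by simp
    have "cmod (S q) \<le> A k / (b k - b (Suc k)) + V k" using av len by (simp add: field_simps)
    also have "A k / (b k - b (Suc k)) \<le> A k / (b k / (2 * T))"
      using blen[of k] Aneg[of k] bpos[of k] Tp len by (intro divide_left_mono) auto
    also have "A k / (b k / (2 * T)) = A k * (2 * T * g k / real w)" unfolding b_def by simp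
    finally show ?thesis unfolding q_def by simp
  qed
  define Ks where "Ks = bin y T ` D"
  have fK: "finite Ks" using fD by (simp add: Ks_def)
  have "(\<Sum>d\<in>D. mangoldt d * cmod (S (w div d))) = (\<Sum>k\<in>Ks. \<Sum>d | d \<in> D \<and> bin y T d = k. mangoldt d * cmod (S (w div d)))"
    unfolding Ks_def using fD by (rule sum.image_gen)
  also have "\<dots> \<le> (\<Sum>k\<in>Ks. (2 * bt_const * g k / T) * (A k * (2 * T * g k / real w) + V k))"
  proof (rule sum_mono)
    fix k
    have "(\<Sum>d | d \<in> D \<and> bin y T d = k. mangoldt d * cmod (S (w div d)))
       \<le> (\<Sum>d | d \<in> D \<and> bin y T d = k. mangoldt d * (A k * (2 * T * g k / real w) + V k))"
      using each by (intro sum_mono mult_left_mono) (auto simp: mangoldt_nonneg)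
    also have "\<dots> = (\<Sum>d | d \<in> D \<and> real d > y \<and> bin y T d = k. mangoldt d) * (A k * (2 * T * g k / real w) + V k)"
      unfolding sum_distrib_right by (rule sum.cong) (auto simp: D_def)
    also have "\<dots> \<le> (2 * bt_const * g k / T) * (A k * (2 * T * g k / real w) + V k)"
      unfolding g_def using bin_mass[OF Tp(1) y_ge(2), of D k] Aneg[of k] Vneg[of k] Tp w0 g1[of k]
      by (intro mult_right_mono add_nonneg_nonneg mult_nonneg_nonneg) (auto simp: g_def)
    finally show "(\<Sum>d | d \<in> D \<and> bin y T d = k. mangoldt d * cmod (S (w div d)))
       \<le> (2 * bt_const * g k / T) * (A k * (2 * T * g k / real w) + V k)" .
  qed
  also have "\<dots> = 4 * bt_const * (\<Sum>k\<in>Ks. A k * ((g k)\<^sup>2 / real w)) + (2 * bt_const / T) * (\<Sum>k\<in>Ks. g k * V k)"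
    unfolding sum_distrib_left sum.distrib[symmetric] using Tp
    by (intro sum.cong refl) (simp add: field_simps power2_eq_square)
  finally have main: "(\<Sum>d\<in>D. mangoldt d * cmod (S (w div d)))
    \<le> 4 * bt_const * (\<Sum>k\<in>Ks. A k * ((g k)\<^sup>2 / real w)) + (2 * bt_const / T) * (\<Sum>k\<in>Ks. g k * V k)" .
  \<comment> \<open>An overlap with [m, m + 1) occurs only if m is below \<open>b k\<close>, that is
    w / \<open>g k\<close>, and this turns the factor \<open>(g k)\<^sup>2 / w\<close> into at most
    w / m^2. For fixed m the overlaps then telescope to at most 1.\<close>
  have 1: "(\<Sum>k\<in>Ks. A k * ((g k)\<^sup>2 / real w)) \<le> real w * J"
  proof -
    have "A k * ((g k)\<^sup>2 / real w) \<le> (\<Sum>m=1..w. (hm m (b k) - hm m (b (Suc k))) * (real w * (cmod (S m) / (real m)\<^sup>2)))" for k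
      unfolding A_def sum_distrib_right
    proof (rule sum_mono)
      fix m assume m: "m \<in> {1..w}"
      define om where "om = hm m (b k) - hm m (b (Suc k))"
      have om0: "om \<ge> 0" unfolding om_def using hm_mono[OF less_imp_le[OF blt]] by simp
      have "om * ((g k)\<^sup>2 / real w) \<le> om * (real w / (real m)\<^sup>2)"
      proof (cases "om = 0")
        case False
        then have "real m < b k" using hm_diff_pos(1)[OF less_imp_le[OF blt]] unfolding om_def by blast
        then have "real m * g k \<le> real w" unfolding b_def using g1[of k] by (simp add: less_divide_eq)
        then have "(real m * g k)\<^sup>2 \<le> (real w)\<^sup>2" using g1[of k] by (intro power_mono) auto
        then have "(g k)\<^sup>2 / real w \<le> real w / (real m)\<^sup>2"
          using m w0 by (simp add: power_mult_distrib divide_le_eq le_divide_eq power2_eq_square mult_ac)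
        then show ?thesis using om0 by (rule mult_left_mono)
      qed simp
      then have "om * ((g k)\<^sup>2 / real w) * cmod (S m) \<le> om * (real w / (real m)\<^sup>2) * cmod (S m)" by (rule mult_right_mono) simp
      then show "(hm m (b k) - hm m (b (Suc k))) * cmod (S m) * ((g k)\<^sup>2 / real w) \<le>
        (hm m (b k) - hm m (b (Suc k))) * (real w * (cmod (S m) / (real m)\<^sup>2))" unfolding om_def by (simp add: mult_ac)
    qed
    then have "(\<Sum>k\<in>Ks. A k * ((g k)\<^sup>2 / real w)) \<le> (\<Sum>k\<in>Ks. \<Sum>m=1..w. (hm m (b k) - hm m (b (Suc k))) * (real w * (cmod (S m) / (real m)\<^sup>2)))"
      by (intro sum_mono)
    also have "\<dots> = (\<Sum>m=1..w. (\<Sum>k\<in>Ks. hm m (b k) - hm m (b (Suc k))) * (real w * (cmod (S m) / (real m)\<^sup>2)))"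
      unfolding sum_distrib_right by (rule sum.swap)
    also have "\<dots> \<le> (\<Sum>m=1..w. 1 * (real w * (cmod (S m) / (real m)\<^sup>2)))"
    proof (intro sum_mono mult_right_mono)
      fix m
      obtain M where M: "Ks \<subseteq> {..<M}" using fK by (metis finite_nat_iff_bounded)
      have "(\<Sum>k\<in>Ks. hm m (b k) - hm m (b (Suc k))) \<le> (\<Sum>k<M. hm m (b k) - hm m (b (Suc k)))"
        using M hm_mono[OF less_imp_le[OF blt]] by (intro sum_mono2) auto
      also have "\<dots> = hm m (b 0) - hm m (b M)" by (rule sum_lessThan_telescope')
      also have "\<dots> \<le> 1" using hm_bounds[of m "b 0"] hm_bounds[of m "b M"] by linarith
      finally show "(\<Sum>k\<in>Ks. hm m (b k) - hm m (b (Suc k))) \<le> 1" .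
    qed (use w0 in simp)
    also have "\<dots> = real w * (\<Sum>m=1..w. cmod (S m) / (real m)\<^sup>2)" by (simp add: sum_distrib_left)
    also have "\<dots> \<le> real w * J" unfolding J_def using w by (intro mult_left_mono sum_mono2) auto
    finally show ?thesis .
  qed
  \<comment> \<open>The open intervals between consecutive values of \<open>b\<close> are disjoint,
    so each n is counted for at most one k, and there \<open>g k\<close> is at most w / n.\<close>
  have 2: "(\<Sum>k\<in>Ks. g k * V k) \<le> real w * (3 * K * T)"
  proof -
    have "(\<Sum>k\<in>Ks. g k * V k) = (\<Sum>k\<in>Ks. \<Sum>n=1..w. cmod (a n) * (if b (Suc k) < real n \<and> real n < b k then g k else 0))"
    proof (rule sum.cong[OF refl])
      fix k
      have "V k = (\<Sum>n=1..w. if b (Suc k) < real n \<and> real n < b k then cmod (a n) else 0)"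
        unfolding V_def by (rule sum.mono_neutral_cong_left) auto
      then show "g k * V k = (\<Sum>n=1..w. cmod (a n) * (if b (Suc k) < real n \<and> real n < b k then g k else 0))"
        unfolding sum_distrib_left by (simp add: sum_distrib_left if_distrib mult.commute cong: if_cong)
    qed
    also have "\<dots> = (\<Sum>n=1..w. cmod (a n) * (\<Sum>k\<in>Ks. if b (Suc k) < real n \<and> real n < b k then g k else 0))"
      unfolding sum_distrib_left by (rule sum.swap)
    also have "\<dots> \<le> (\<Sum>n=1..w. cmod (a n) * (real w / real n))"
    proof (intro sum_mono mult_left_mono)
      fix n assume n: "n \<in> {1..w}"
      define H where "H = {k \<in> Ks. b (Suc k) < real n \<and> real n < b k}"
      have "(\<Sum>k\<in>Ks. if b (Suc k) < real n \<and> real n < b k then g k else 0) = (\<Sum>k\<in>H. g k)"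
        unfolding H_def using fK by (intro sum.mono_neutral_cong_right) auto
      also have "\<dots> \<le> real w / real n"
      proof (cases "H = {}")
        case True
        then show ?thesis by simp
      next
        case False
        then obtain k where k: "k \<in> H" by blast
        have "j = k" if j: "j \<in> H" for j
        proof (rule ccontr)
          assume "j \<noteq> k"
          then consider "Suc j \<le> k" | "Suc k \<le> j" by linarith
          then show False
          proof cases
            case 1
            then show False using bmono[OF 1] j k unfolding H_def by auto
          next
            case 2
            then show False using bmono[OF 2] j k unfolding H_def by auto
          qed
        qed
        then have "H = {k}" using k by blast
        then have "(\<Sum>k\<in>H. g k) = g k" by simp
        also have "\<dots> \<le> real w / real n"
        proof -
          have "real n < real w / g k" using k unfolding H_def b_def by simp
          then have "real n * g k < real w" using g1[of k] by (simp add: less_divide_eq)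
          then show ?thesis using n by (simp add: le_divide_eq mult.commute)
        qed
        finally show ?thesis .
      qed
      finally show "(\<Sum>k\<in>Ks. if b (Suc k) < real n \<and> real n < b k then g k else 0) \<le> real w / real n" .
    qed simp
    also have "\<dots> = real w * (\<Sum>n=1..w. cmod (a n) / real n)" by (simp add: sum_distrib_left mult.commute)
    also have "\<dots> \<le> real w * (3 * K * T)" using sum_abs_a_div_N[OF w] by (intro mult_left_mono) auto
    finally show ?thesis .
  qed
  have "4 * bt_const * (\<Sum>k\<in>Ks. A k * ((g k)\<^sup>2 / real w)) + (2 * bt_const / T) * (\<Sum>k\<in>Ks. g k * V k)
     \<le> 4 * bt_const * (real w * J) + (2 * bt_const / T) * (real w * (3 * K * T))"
    using bt_const(1) Tp by (intro add_mono mult_left_mono 1 2) auto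
  with main have "(\<Sum>d\<in>D. mangoldt d * cmod (S (w div d)))
     \<le> 4 * bt_const * (real w * J) + (2 * bt_const / T) * (real w * (3 * K * T))" by (rule order_trans)
  also have "\<dots> = real w * (4 * bt_const * J + 6 * bt_const * K)" using Tp by (simp add: field_simps)
  finally show ?thesis unfolding D_def .
qed simp

end

lemma sum_recip_le:
  assumes "finite B" "\<And>n. n \<in> B \<Longrightarrow> n \<ge> 1 \<and> ln (real n) \<le> Z" "Z \<ge> 0"
  shows "(\<Sum>n\<in>B. 1 / real n) \<le> 1 + Z"
proof (cases "B = {}")
  case False
  define M where "M = Max B"
  have MB: "M \<in> B" unfolding M_def using assms(1) False by (rule Max_in)
  have har: "(\<Sum>n=1..k. 1 / real n) \<le> 1 + ln (real k)" if "k \<ge> 1" for k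
    using that
  proof (induction k rule: nat_induct_at_least)
    case (Suc k)
    have "ln (real k / real (Suc k)) \<le> real k / real (Suc k) - 1" using Suc.hyps by (intro ln_le_minus_one) auto
    moreover have "ln (real k / real (Suc k)) = ln (real k) - ln (real (Suc k))" using Suc.hyps by (simp add: ln_div)
    moreover have "real k / real (Suc k) - 1 = - (1 / real (Suc k))" by (simp add: field_simps)
    ultimately have "1 / real (Suc k) \<le> ln (real (Suc k)) - ln (real k)" by linarith
    then show ?case using Suc.IH by simp
  qed simp
  have "(\<Sum>n\<in>B. 1 / real n) \<le> (\<Sum>n=1..M. 1 / real n)"
  proof (rule sum_mono2)
    show "B \<subseteq> {1..M}" unfolding M_def using assms by auto
  qed auto
  also have "\<dots> \<le> 1 + ln (real M)" using assms(2)[OF MB] by (intro har) simp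
  also have "\<dots> \<le> 1 + Z" using assms(2)[OF MB] by simp
  finally show ?thesis .
qed (use assms in simp)

text \<open>At most d values of n share the quotient m, and each of them is at least d m, so the
  fibre over m has weight at most d / (d m)^2 = 1 / (d m^2).\<close>

lemma sum_div_fibre_le:
  fixes s :: "nat \<Rightarrow> real"
  assumes d: "d \<ge> 1" and s: "\<And>m. s m \<ge> 0"
  shows "(\<Sum>n=d..N. s (n div d) / (real n)\<^sup>2) \<le> (\<Sum>m=1..N. s m / (real m)\<^sup>2) / real d"
proof -
  have "(\<Sum>n=d..N. s (n div d) / (real n)\<^sup>2) = (\<Sum>m\<in>(\<lambda>n. n div d) ` {d..N}. \<Sum>n | n \<in> {d..N} \<and> n div d = m. s (n div d) / (real n)\<^sup>2)"
    by (rule sum.image_gen) simp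
  also have "\<dots> \<le> (\<Sum>m\<in>(\<lambda>n. n div d) ` {d..N}. s m / (real m)\<^sup>2 / real d)"
  proof (rule sum_mono)
    fix m assume "m \<in> (\<lambda>n. n div d) ` {d..N}"
    then obtain n0 where "n0 \<ge> d" "m = n0 div d" by auto
    then have m: "m \<ge> 1" using d by (simp add: div_greater_zero_iff Suc_le_eq)
    have sub: "{n. n \<in> {d..N} \<and> n div d = m} \<subseteq> {d * m..<d * m + d}"
    proof
      fix n assume "n \<in> {n. n \<in> {d..N} \<and> n div d = m}"
      then have nm: "n div d = m" by simp
      have "n = d * (n div d) + n mod d" by simp
      moreover have "n mod d < d" using d by simp
      ultimately show "n \<in> {d * m..<d * m + d}" unfolding nm by simp
    qed
    have "(\<Sum>n | n \<in> {d..N} \<and> n div d = m. s (n div d) / (real n)\<^sup>2) \<le> (\<Sum>n | n \<in> {d..N} \<and> n div d = m. s m / (real (d * m))\<^sup>2)"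
    proof (rule sum_mono)
      fix n assume n: "n \<in> {n. n \<in> {d..N} \<and> n div d = m}"
      then have "d * m \<le> n" using sub by auto
      then have "real (d * m) \<le> real n" by (simp only: of_nat_le_iff)
      then have "(real (d * m))\<^sup>2 \<le> (real n)\<^sup>2" by (rule power_mono) simp
      moreover have "0 < (real (d * m))\<^sup>2" using d m by simp
      ultimately show "s (n div d) / (real n)\<^sup>2 \<le> s m / (real (d * m))\<^sup>2"
        using n s[of m] by (intro frac_le) auto
    qed
    also have "\<dots> = real (card {n. n \<in> {d..N} \<and> n div d = m}) * (s m / (real (d * m))\<^sup>2)" by simp
    also have "\<dots> \<le> real d * (s m / (real (d * m))\<^sup>2)"
      using card_mono[OF _ sub] s[of m] by (intro mult_right_mono) auto
    also have "\<dots> = s m / (real m)\<^sup>2 / real d" using d by (simp add: power2_eq_square)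
    finally show "(\<Sum>n | n \<in> {d..N} \<and> n div d = m. s (n div d) / (real n)\<^sup>2) \<le> s m / (real m)\<^sup>2 / real d" .
  qed
  also have "\<dots> \<le> (\<Sum>m=1..N. s m / (real m)\<^sup>2 / real d)"
  proof (rule sum_mono2)
    show "(\<lambda>n. n div d) ` {d..N} \<subseteq> {1..N}"
    proof
      fix m assume "m \<in> (\<lambda>n. n div d) ` {d..N}"
      then obtain n where n: "d \<le> n" "n \<le> N" "m = n div d" by auto
      have "m \<ge> 1" using d n by (simp add: div_greater_zero_iff Suc_le_eq)
      moreover have "m \<le> N" using n div_le_dividend[of n d] by linarith
      ultimately show "m \<in> {1..N}" by simp
    qed
  qed (use s in auto)
  finally show ?thesis by (simp only: sum_divide_distrib)
qed

text \<open>The difference is at least 2 \<sigma> (n + 1)^(- 1 - 2 \<sigma>). With n + 1 <= 2 n and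
  1 + 2 \<sigma> <= 5 the shift costs at most 2^5, of which 2 \<sigma> >= 2 regains a factor
  2.\<close>

lemma kernel_weight_ge:
  assumes "1 \<le> \<sigma>" "\<sigma> \<le> 2" "n \<ge> 1"
  shows "real n powr (- 1 - 2 * \<sigma>) / 16 \<le> real n powr (- 2 * \<sigma>) - real (Suc n) powr (- 2 * \<sigma>)"
proof -
  have "real (Suc n) powr - (2 * \<sigma> + 1) \<le> (real n powr (1 - (2 * \<sigma> + 1)) - real (Suc n) powr (1 - (2 * \<sigma> + 1))) / (2 * \<sigma> + 1 - 1)"
    using assms by (intro powr_telescope_bounds) auto
  then have "2 * \<sigma> * real (Suc n) powr - (2 * \<sigma> + 1) \<le> real n powr (- 2 * \<sigma>) - real (Suc n) powr (- 2 * \<sigma>)"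
    using assms by (simp add: field_simps)
  moreover have "real n powr (- 1 - 2 * \<sigma>) / 16 \<le> 2 * \<sigma> * real (Suc n) powr - (2 * \<sigma> + 1)"
  proof -
    have "1 / 32 = 2 powr (- 5 :: real)" by (simp add: powr_minus powr_numeral)
    also have "\<dots> \<le> 2 powr - (2 * \<sigma> + 1)" using assms by (intro powr_mono) auto
    finally have "1 / 32 * real n powr - (2 * \<sigma> + 1) \<le> 2 powr - (2 * \<sigma> + 1) * real n powr - (2 * \<sigma> + 1)"
      by (rule mult_right_mono) simp
    also have "\<dots> = (2 * real n) powr - (2 * \<sigma> + 1)" by (simp add: powr_mult)
    also have "\<dots> \<le> real (Suc n) powr - (2 * \<sigma> + 1)" using assms by (intro powr_mono2') auto
    finally have "1 / 32 * real n powr - (2 * \<sigma> + 1) \<le> real (Suc n) powr - (2 * \<sigma> + 1)" .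
    then have *: "2 * (1 / 32 * real n powr - (2 * \<sigma> + 1)) \<le> 2 * \<sigma> * real (Suc n) powr - (2 * \<sigma> + 1)"
      using assms by (intro mult_mono) auto
    have e: "- (2 * \<sigma> + 1) = - 1 - 2 * \<sigma>" by simp
    show ?thesis using * unfolding e by simp
  qed
  ultimately show ?thesis by linarith
qed

section \<open>Separating d up to y from d above y, and the mean square of the large part\<close>

context halasz
begin

text \<open>Truncating \<open>l\<close> instead of the sum over d keeps \<open>Tl\<close> a sequence
  of partial sums of a Dirichlet convolution, whose generating series factors as
  \<open>dser l'\<close> times \<open>dser a\<close>.\<close>

definition l' where "l' d = (if real d \<le> y then 0 else l d)"
definition Tl where "Tl n = (\<Sum>k=1..n. dconv l' a k)"
definition Ts where "Ts n = (\<Sum>d | d \<in> {1..n} \<and> real d \<le> y. mangoldt d * cmod (S (n div d)))"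
definition R where "R n = (\<Sum>m=1..n - 1. cmod (S m) / real m)"

lemma Tl_eq: "Tl n = (\<Sum>d | d \<in> {1..n} \<and> real d > y. l d * S (n div d))"
  unfolding Tl_def sum_dconv S_def[symmetric] by (rule sum.mono_neutral_cong_right) (auto simp: l'_def)

lemma S_ln_le:
  assumes n: "n \<ge> 1"
  shows "cmod (S n) * ln (real n) \<le> cmod (Tl n) + 2 * \<kappa> * Ts n + R n"
proof -
  have "(\<Sum>k=1..n. of_real (ln (real k)) * a k) = (\<Sum>k=1..n. dconv l a k)"
    by (intro sum.cong refl conv) auto
  also have "\<dots> = (\<Sum>d=1..n. l d * S (n div d))" unfolding sum_dconv S_def ..
  also have "\<dots> = (\<Sum>d\<in>{d. d \<in> {1..n} \<and> real d > y} \<union> {d. d \<in> {1..n} \<and> real d \<le> y}. l d * S (n div d))"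
    by (rule sum.cong) auto
  also have "\<dots> = Tl n + (\<Sum>d | d \<in> {1..n} \<and> real d \<le> y. l d * S (n div d))"
    unfolding Tl_eq by (rule sum.union_disjoint) auto
  finally have eq: "(\<Sum>k=1..n. of_real (ln (real k)) * a k) = Tl n + (\<Sum>d | d \<in> {1..n} \<and> real d \<le> y. l d * S (n div d))" .
  have "cmod (\<Sum>d | d \<in> {1..n} \<and> real d \<le> y. l d * S (n div d)) \<le> (\<Sum>d | d \<in> {1..n} \<and> real d \<le> y. 2 * \<kappa> * (mangoldt d * cmod (S (n div d))))"
  proof (rule order_trans[OF norm_sum sum_mono])
    fix d
    have "cmod (l d) * cmod (S (n div d)) \<le> (2 * \<kappa> * mangoldt d) * cmod (S (n div d))"
      using l_le2 by (rule mult_right_mono) simp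
    then show "cmod (l d * S (n div d)) \<le> 2 * \<kappa> * (mangoldt d * cmod (S (n div d)))"
      by (simp only: norm_mult mult.assoc)
  qed
  also have "\<dots> = 2 * \<kappa> * Ts n" unfolding Ts_def by (simp only: sum_distrib_left)
  finally have "cmod (\<Sum>k=1..n. of_real (ln (real k)) * a k) \<le> cmod (Tl n) + 2 * \<kappa> * Ts n"
    unfolding eq using norm_triangle_ineq[of "Tl n"] by (meson add_left_mono order_trans)
  then show ?thesis using cmod_abel_ln_le[OF n, of a] unfolding R_def S_def by linarith
qed

text \<open>After exchanging the sums, the fibre bound for n div d turns each d into J / d, and the
  weights \<Lambda>(d) / d with d <= y add up to O(log y).\<close>

lemma sum_Ts_le: "(\<Sum>n=1..N. Ts n / (real n)\<^sup>2) \<le> 18 * ln y * J"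
proof -
  define D where "D = {d. d \<in> {1..N} \<and> real d \<le> y}"
  have fD: "finite D" by (simp add: D_def)
  have "(\<Sum>n=1..N. Ts n / (real n)\<^sup>2) = (\<Sum>n=1..N. \<Sum>d\<in>D. if d \<le> n then mangoldt d * (cmod (S (n div d)) / (real n)\<^sup>2) else 0)"
  proof (rule sum.cong[OF refl])
    fix n assume n: "n \<in> {1..N}"
    have "Ts n / (real n)\<^sup>2 = (\<Sum>d | d \<in> {1..n} \<and> real d \<le> y. mangoldt d * (cmod (S (n div d)) / (real n)\<^sup>2))"
      unfolding Ts_def sum_divide_distrib by simp
    also have "\<dots> = (\<Sum>d\<in>D. if d \<le> n then mangoldt d * (cmod (S (n div d)) / (real n)\<^sup>2) else 0)"
      using n by (intro sum.mono_neutral_cong_left) (auto simp: D_def)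
    finally show "Ts n / (real n)\<^sup>2 = \<dots>" .
  qed
  also have "\<dots> = (\<Sum>d\<in>D. \<Sum>n=1..N. if d \<le> n then mangoldt d * (cmod (S (n div d)) / (real n)\<^sup>2) else 0)"
    by (rule sum.swap)
  also have "\<dots> = (\<Sum>d\<in>D. mangoldt d * (\<Sum>n=d..N. cmod (S (n div d)) / (real n)\<^sup>2))"
    unfolding sum_distrib_left by (intro sum.cong refl sum.mono_neutral_cong_right) (auto simp: D_def)
  also have "\<dots> \<le> (\<Sum>d\<in>D. mangoldt d * (J / real d))"
    unfolding J_def by (intro sum_mono mult_left_mono sum_div_fibre_le mangoldt_nonneg) (auto simp: D_def)
  also have "\<dots> = J * (\<Sum>d\<in>D. mangoldt d / real d)" by (simp add: sum_distrib_left mult.commute)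
  also have "\<dots> \<le> J * (18 * ln y)"
  proof (rule mult_left_mono[OF _ J_nonneg])
    have "(\<Sum>d\<in>D. mangoldt d / real d) \<le> (\<Sum>d | 1 \<le> d \<and> real d \<le> y. mangoldt d / real d)"
    proof (rule sum_mono2)
      show "finite {d. 1 \<le> d \<and> real d \<le> y}" using finite_nat_le_real by (rule rev_finite_subset) auto
    qed (auto simp: D_def mangoldt_nonneg)
    then show "(\<Sum>d\<in>D. mangoldt d / real d) \<le> 18 * ln y" using sum_small_mangoldt by linarith
  qed
  finally show ?thesis by (simp add: mult.commute)
qed

lemma sum_R_le: "(\<Sum>n=1..N. R n / (real n)\<^sup>2) \<le> J"
proof -
  have "(\<Sum>n=1..N. R n / (real n)\<^sup>2) = (\<Sum>n=1..N. \<Sum>m=1..N. if m < n then cmod (S m) / real m * (1 / (real n)\<^sup>2) else 0)"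
  proof (rule sum.cong[OF refl])
    fix n assume n: "n \<in> {1..N}"
    have "R n / (real n)\<^sup>2 = (\<Sum>m=1..n - 1. cmod (S m) / real m * (1 / (real n)\<^sup>2))"
      unfolding R_def sum_divide_distrib by simp
    also have "\<dots> = (\<Sum>m=1..N. if m < n then cmod (S m) / real m * (1 / (real n)\<^sup>2) else 0)"
      using n by (intro sum.mono_neutral_cong_left) auto
    finally show "R n / (real n)\<^sup>2 = \<dots>" .
  qed
  also have "\<dots> = (\<Sum>m=1..N. \<Sum>n=1..N. if m < n then cmod (S m) / real m * (1 / (real n)\<^sup>2) else 0)" by (rule sum.swap)
  also have "\<dots> = (\<Sum>m=1..N. cmod (S m) / real m * (\<Sum>n=Suc m..N. 1 / (real n)\<^sup>2))"
    unfolding sum_distrib_left by (intro sum.cong refl sum.mono_neutral_cong_right) auto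
  also have "\<dots> \<le> (\<Sum>m=1..N. cmod (S m) / real m * (1 / real m))"
    by (intro sum_mono mult_left_mono sum_inverse_squares_after_le) auto
  also have "\<dots> = J" unfolding J_def by (simp add: power2_eq_square)
  finally show ?thesis .
qed

lemma S_abs_le: "cmod (S n) \<le> (\<Sum>k=1..n. cmod (a k))" unfolding S_def by (rule norm_sum)

text \<open>Each |a(k)| is counted for the n >= k with total weight at most 2 / k, after which
  Rankin's bound applies with the same L.\<close>

lemma sum_small_n_le:
  assumes L: "L \<ge> 1"
  shows "(\<Sum>n | n \<in> {1..N} \<and> ln (real n) \<le> L. cmod (S n) / (real n)\<^sup>2) \<le> 6 * K * L powr \<kappa>"
proof -
  define B where "B = {n. n \<in> {1..N} \<and> ln (real n) \<le> L}"
  have fB: "finite B" by (simp add: B_def)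
  have "(\<Sum>n\<in>B. cmod (S n) / (real n)\<^sup>2) \<le> (\<Sum>n\<in>B. (\<Sum>k=1..n. cmod (a k)) / (real n)\<^sup>2)"
    by (intro sum_mono divide_right_mono S_abs_le) auto
  also have "\<dots> = (\<Sum>n\<in>B. \<Sum>k\<in>B. if k \<le> n then cmod (a k) * (1 / (real n)\<^sup>2) else 0)"
  proof (rule sum.cong[OF refl])
    fix n assume n: "n \<in> B"
    have "ln (real k) \<le> L" if "1 \<le> k" "k \<le> n" for k
    proof -
      have "ln (real k) \<le> ln (real n)" using that by (intro ln_mono) auto
      then show ?thesis using n by (simp add: B_def)
    qed
    then have "(\<Sum>k=1..n. cmod (a k) * (1 / (real n)\<^sup>2)) = (\<Sum>k\<in>B. if k \<le> n then cmod (a k) * (1 / (real n)\<^sup>2) else 0)"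
      using n fB by (intro sum.mono_neutral_cong_left) (auto simp: B_def)
    then show "(\<Sum>k=1..n. cmod (a k)) / (real n)\<^sup>2 = (\<Sum>k\<in>B. if k \<le> n then cmod (a k) * (1 / (real n)\<^sup>2) else 0)"
      by (simp add: sum_divide_distrib)
  qed
  also have "\<dots> = (\<Sum>k\<in>B. \<Sum>n\<in>B. if k \<le> n then cmod (a k) * (1 / (real n)\<^sup>2) else 0)" by (rule sum.swap)
  also have "\<dots> \<le> (\<Sum>k\<in>B. cmod (a k) * (2 / real k))"
  proof (rule sum_mono)
    fix k assume k: "k \<in> B"
    have "(\<Sum>n\<in>B. if k \<le> n then cmod (a k) * (1 / (real n)\<^sup>2) else 0) \<le> (\<Sum>n=k..N. cmod (a k) * (1 / (real n)\<^sup>2))"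
    proof -
      have "(\<Sum>n\<in>B. if k \<le> n then cmod (a k) * (1 / (real n)\<^sup>2) else 0) = (\<Sum>n | n \<in> B \<and> k \<le> n. cmod (a k) * (1 / (real n)\<^sup>2))"
        using fB by (intro sum.mono_neutral_cong_right) auto
      also have "\<dots> \<le> (\<Sum>n=k..N. cmod (a k) * (1 / (real n)\<^sup>2))" by (intro sum_mono2) (auto simp: B_def)
      finally show ?thesis .
    qed
    also have "\<dots> = cmod (a k) * (\<Sum>n=k..N. 1 / (real n)\<^sup>2)" by (simp only: sum_distrib_left)
    also have "\<dots> \<le> cmod (a k) * (2 / real k)" using k by (intro mult_left_mono sum_inverse_squares_le) (auto simp: B_def)
    finally show "(\<Sum>n\<in>B. if k \<le> n then cmod (a k) * (1 / (real n)\<^sup>2) else 0) \<le> cmod (a k) * (2 / real k)" .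
  qed
  also have "\<dots> = 2 * (\<Sum>k\<in>B. cmod (a k) / real k)" by (simp add: sum_distrib_left mult.commute)
  also have "\<dots> \<le> 2 * (3 * K * L powr \<kappa>)" using L fB by (intro mult_left_mono sum_abs_a_div_le) (auto simp: B_def)
  finally show ?thesis unfolding B_def by simp
qed

text \<open>Chosen so that, after division by log n > L, the d <= y and the error of Abel summation
  contribute at most J / 2. Since log y = 4 \<kappa> log log x, it has the order of log log
  x.\<close>

definition L where "L = 2 * (36 * \<kappa> + 1) * ln y"

lemma L_ge: "L \<ge> 1"
proof -
  have "74 * 4 \<le> 2 * (36 * \<kappa> + 1) * ln y" using \<kappa> ln_y_ge by (intro mult_mono) auto
  then show ?thesis unfolding L_def by simp
qed

text \<open>J occurs on both sides: the n with log n <= L are estimated trivially, and for the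
  others \<open>Ts\<close> and \<open>R\<close> reproduce at most half of J, which is moved to the
  left.\<close>

lemma J_le: "J \<le> 12 * K * L powr \<kappa> + 2 * (\<Sum>n | n \<in> {1..N} \<and> ln (real n) > L. cmod (Tl n) / ((real n)\<^sup>2 * ln (real n)))"
proof -
  define B where "B = {n. n \<in> {1..N} \<and> ln (real n) > L}"
  define B' where "B' = {n. n \<in> {1..N} \<and> ln (real n) \<le> L}"
  define Q where "Q = (\<Sum>n\<in>B. cmod (Tl n) / ((real n)\<^sup>2 * ln (real n)))"
  have "J = (\<Sum>n\<in>B' \<union> B. cmod (S n) / (real n)\<^sup>2)" unfolding J_def by (rule sum.cong) (auto simp: B_def B'_def)
  also have "\<dots> = (\<Sum>n\<in>B'. cmod (S n) / (real n)\<^sup>2) + (\<Sum>n\<in>B. cmod (S n) / (real n)\<^sup>2)"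
    by (rule sum.union_disjoint) (auto simp: B_def B'_def)
  finally have J1: "J = (\<Sum>n\<in>B'. cmod (S n) / (real n)\<^sup>2) + (\<Sum>n\<in>B. cmod (S n) / (real n)\<^sup>2)" .
  have J2: "(\<Sum>n\<in>B'. cmod (S n) / (real n)\<^sup>2) \<le> 6 * K * L powr \<kappa>" unfolding B'_def by (rule sum_small_n_le[OF L_ge])
  have Rn: "R n \<ge> 0" and Tn: "Ts n \<ge> 0" for n
    unfolding R_def Ts_def by (auto intro!: sum_nonneg mult_nonneg_nonneg mangoldt_nonneg)
  have "(\<Sum>n\<in>B. cmod (S n) / (real n)\<^sup>2) \<le> (\<Sum>n\<in>B. cmod (Tl n) / ((real n)\<^sup>2 * ln (real n)) + (2 * \<kappa> * (Ts n / (real n)\<^sup>2) + R n / (real n)\<^sup>2) / L)"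
  proof (rule sum_mono)
    fix n assume "n \<in> B"
    then have n12: "n \<ge> 1" "ln (real n) > L" by (auto simp: B_def)
    have n3: "ln (real n) > 0" using n12 L_ge by linarith
    note n = n12 n3
    have "cmod (S n) \<le> (cmod (Tl n) + 2 * \<kappa> * Ts n + R n) / ln (real n)"
      using S_ln_le[OF n(1)] n(3) by (simp add: le_divide_eq)
    also have "\<dots> = cmod (Tl n) / ln (real n) + (2 * \<kappa> * Ts n + R n) / ln (real n)" by (simp add: add_divide_distrib)
    also have "\<dots> \<le> cmod (Tl n) / ln (real n) + (2 * \<kappa> * Ts n + R n) / L"
      using n L_ge Rn[of n] Tn[of n] \<kappa> by (intro add_left_mono divide_left_mono) auto
    finally have "cmod (S n) / (real n)\<^sup>2 \<le> (cmod (Tl n) / ln (real n) + (2 * \<kappa> * Ts n + R n) / L) / (real n)\<^sup>2"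
      by (rule divide_right_mono) simp
    also have "\<dots> = cmod (Tl n) / ((real n)\<^sup>2 * ln (real n)) + (2 * \<kappa> * (Ts n / (real n)\<^sup>2) + R n / (real n)\<^sup>2) / L"
      by (simp add: add_divide_distrib mult.commute)
    finally show "cmod (S n) / (real n)\<^sup>2 \<le> \<dots>" .
  qed
  also have "\<dots> = Q + (2 * \<kappa> * (\<Sum>n\<in>B. Ts n / (real n)\<^sup>2) + (\<Sum>n\<in>B. R n / (real n)\<^sup>2)) / L"
    unfolding Q_def by (simp add: sum.distrib sum_divide_distrib sum_distrib_left add_divide_distrib)
  also have "\<dots> \<le> Q + (2 * \<kappa> * (18 * ln y * J) + J) / L"
  proof -
    have "(\<Sum>n\<in>B. Ts n / (real n)\<^sup>2) \<le> (\<Sum>n=1..N. Ts n / (real n)\<^sup>2)" using Tn by (intro sum_mono2) (auto simp: B_def)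
    then have A1: "(\<Sum>n\<in>B. Ts n / (real n)\<^sup>2) \<le> 18 * ln y * J" using sum_Ts_le by linarith
    have "(\<Sum>n\<in>B. R n / (real n)\<^sup>2) \<le> (\<Sum>n=1..N. R n / (real n)\<^sup>2)" using Rn by (intro sum_mono2) (auto simp: B_def)
    then have A2: "(\<Sum>n\<in>B. R n / (real n)\<^sup>2) \<le> J" using sum_R_le by linarith
    show ?thesis using A1 A2 L_ge \<kappa> by (intro add_left_mono divide_right_mono add_mono mult_left_mono) auto
  qed
  also have "(2 * \<kappa> * (18 * ln y * J) + J) / L \<le> J / 2"
  proof -
    have "(36 * \<kappa> * ln y + 1) * J \<le> (L / 2) * J"
      unfolding L_def using ln_y_ge J_nonneg by (intro mult_right_mono) (auto simp: algebra_simps)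
    then have "(36 * \<kappa> * ln y + 1) * J / L \<le> (L / 2) * J / L" using L_ge by (intro divide_right_mono) auto
    also have "\<dots> = J / 2" using L_ge by simp
    finally show ?thesis by (simp add: algebra_simps)
  qed
  finally show ?thesis using J1 J2 unfolding Q_def B_def by linarith
qed

lemma norm_dser_a_le:
  assumes "\<alpha> \<ge> 1 / X" "\<alpha> > 0"
  shows "cmod (dser a (Complex (1 + \<alpha>) t)) \<le> K * T" "dnorm a (1 + \<alpha>) \<le> (1 + 1 / \<alpha>) powr \<kappa>"
proof -
  show 1: "dnorm a (1 + \<alpha>) \<le> (1 + 1 / \<alpha>) powr \<kappa>" using dnorm_a_le[of "1 + \<alpha>"] assms by simp
  have "1 / \<alpha> \<le> X" using assms X_ge by (simp add: field_simps)
  then have "(1 + 1 / \<alpha>) powr \<kappa> \<le> (2 * X) powr \<kappa>" using X_ge \<kappa> assms by (intro powr_mono2) auto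
  also have "\<dots> = K * T" unfolding K_def T_def using X_ge by (simp add: powr_mult)
  finally show "cmod (dser a (Complex (1 + \<alpha>) t)) \<le> K * T"
    using norm_dser_le[of a "Complex (1 + \<alpha>) t"] a_dabs[of "1 + \<alpha>"] assms 1 by simp
qed

text \<open>By Parseval the sum becomes the mean square of F(s) / s times \<open>dser l'\<close>.
  The square of |F(s) / s| is at most \<open>2 * (M\<^sup>2 + K\<^sup>2) * T\<^sup>2 / (T\<^sup>2 +
  t\<^sup>2)\<close> for every t: up to |t| = T the factor beside M^2 is at least 1, and beyond it
  the trivial bound K T for F is divided by |t|. What remains is the mean square of
  \<open>dser l'\<close> against a kernel of width T, whose factor 1 / T^2 cancels T^2.\<close>

lemma dyadic_mean_square:
  assumes \<alpha>: "\<alpha> \<ge> 1 / X" "\<alpha> > 0" "\<alpha> \<le> 1" and M: "M \<ge> 0"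
    and bound: "\<And>t. \<bar>t\<bar> \<le> T \<Longrightarrow> cmod (dser a (Complex (1 + \<alpha>) t) / Complex (1 + \<alpha>) t) \<le> M"
  shows "(\<Sum>n=1..N. (cmod (Tl n))\<^sup>2 * real n powr (- 3 - 2 * \<alpha>)) \<le> 51200 * \<kappa>\<^sup>2 * bt_const * (M\<^sup>2 + K\<^sup>2) / \<alpha>"
proof -
  define \<sigma> where "\<sigma> = 1 + \<alpha>"
  have \<sigma>: "\<sigma> > 1" "\<sigma> \<le> 2" "\<sigma> > 0" using \<alpha> by (auto simp: \<sigma>_def)
  have Tp: "T > 0" using T_ge by simp
  have l'_le: "cmod (l' n) \<le> 2 * \<kappa> * mangoldt n" for n
    using l_le2[of n] \<kappa> by (auto simp: l'_def mangoldt_nonneg)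
  have dl: "dabs l' \<sigma>"
    using dabs_cmult[OF dabs_mangoldt[OF \<sigma>(1)], of "of_real (2 * \<kappa>)"]
    by (rule dabs_comparison) (use l'_le \<kappa> in \<open>auto simp: norm_mult mangoldt_nonneg\<close>)
  have da: "dabs a \<sigma>" using a_dabs \<sigma> by simp
  have dc: "dabs (dconv l' a) \<sigma>" using dl da by (rule dabs_dconv)
  have pt: "(cmod (dser (dconv l' a) (Complex \<sigma> t)))\<^sup>2 / (\<sigma>\<^sup>2 + t\<^sup>2)
     \<le> 2 * (M\<^sup>2 + K\<^sup>2) * T\<^sup>2 * ((cmod (dser l' (Complex \<sigma> t)))\<^sup>2 / (T\<^sup>2 + t\<^sup>2))" for t
  proof -
    define F where "F = cmod (dser a (Complex \<sigma> t))"
    have k1: "\<sigma>\<^sup>2 + t\<^sup>2 > 0" "T\<^sup>2 + t\<^sup>2 > 0" using cauchy_kernel_pos \<sigma> Tp by auto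
    have ns: "(cmod (Complex \<sigma> t))\<^sup>2 = \<sigma>\<^sup>2 + t\<^sup>2" by (simp add: cmod_power2)
    have main: "F\<^sup>2 / (\<sigma>\<^sup>2 + t\<^sup>2) \<le> 2 * (M\<^sup>2 + K\<^sup>2) * T\<^sup>2 / (T\<^sup>2 + t\<^sup>2)"
    proof (cases "\<bar>t\<bar> \<le> T")
      case True
      have "(cmod (dser a (Complex \<sigma> t) / Complex \<sigma> t))\<^sup>2 \<le> M\<^sup>2"
        using bound[OF True] unfolding \<sigma>_def by (intro power_mono) auto
      then have "F\<^sup>2 / (\<sigma>\<^sup>2 + t\<^sup>2) \<le> M\<^sup>2" by (simp add: norm_divide power_divide ns F_def)
      also have "\<dots> \<le> M\<^sup>2 * (2 * T\<^sup>2 / (T\<^sup>2 + t\<^sup>2))"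
      proof -
        have "t\<^sup>2 \<le> T\<^sup>2" using True Tp by (simp add: abs_le_square_iff[symmetric])
        then have "1 \<le> 2 * T\<^sup>2 / (T\<^sup>2 + t\<^sup>2)" using k1 by (simp add: le_divide_eq)
        then have "M\<^sup>2 * 1 \<le> M\<^sup>2 * (2 * T\<^sup>2 / (T\<^sup>2 + t\<^sup>2))" by (rule mult_left_mono) simp
        then show ?thesis by simp
      qed
      also have "\<dots> \<le> (M\<^sup>2 + K\<^sup>2) * (2 * T\<^sup>2 / (T\<^sup>2 + t\<^sup>2))" using k1 by (intro mult_right_mono) auto
      finally show ?thesis by (simp only: times_divide_eq_right mult_ac)
    next
      case False
      have t2: "T\<^sup>2 \<le> t\<^sup>2" using False Tp by (simp add: abs_le_square_iff[symmetric])
      have tp: "t\<^sup>2 > 0" using t2 Tp by (meson less_le_trans zero_less_power)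
      have "F \<le> K * T" unfolding F_def \<sigma>_def by (rule norm_dser_a_le[OF \<alpha>(1,2)])
      then have "F\<^sup>2 \<le> (K * T)\<^sup>2" unfolding F_def by (intro power_mono) auto
      then have "F\<^sup>2 / (\<sigma>\<^sup>2 + t\<^sup>2) \<le> (K * T)\<^sup>2 / t\<^sup>2" using tp by (intro frac_le) auto
      also have "\<dots> = K\<^sup>2 * T\<^sup>2 * (1 / t\<^sup>2)" by (simp add: power_mult_distrib)
      also have "\<dots> \<le> K\<^sup>2 * T\<^sup>2 * (2 / (T\<^sup>2 + t\<^sup>2))"
        using t2 tp k1 by (intro mult_left_mono) (auto simp: field_simps)
      also have "\<dots> \<le> (M\<^sup>2 + K\<^sup>2) * T\<^sup>2 * (2 / (T\<^sup>2 + t\<^sup>2))" using k1 by (intro mult_right_mono) auto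
      finally show ?thesis by (simp add: mult_ac)
    qed
    have "dser (dconv l' a) (Complex \<sigma> t) = dser l' (Complex \<sigma> t) * dser a (Complex \<sigma> t)"
      using dl da by (intro dser_dconv) auto
    then have "(cmod (dser (dconv l' a) (Complex \<sigma> t)))\<^sup>2 / (\<sigma>\<^sup>2 + t\<^sup>2) = (cmod (dser l' (Complex \<sigma> t)))\<^sup>2 * (F\<^sup>2 / (\<sigma>\<^sup>2 + t\<^sup>2))"
      by (simp add: norm_mult power_mult_distrib F_def)
    also have "\<dots> \<le> (cmod (dser l' (Complex \<sigma> t)))\<^sup>2 * (2 * (M\<^sup>2 + K\<^sup>2) * T\<^sup>2 / (T\<^sup>2 + t\<^sup>2))"
      using main by (rule mult_left_mono) simp
    finally show ?thesis by (simp add: mult_ac)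
  qed
  have "(\<integral>t. (cmod (dser (dconv l' a) (Complex \<sigma> t)))\<^sup>2 / (\<sigma>\<^sup>2 + t\<^sup>2) \<partial>lborel)
     \<le> (\<integral>t. 2 * (M\<^sup>2 + K\<^sup>2) * T\<^sup>2 * ((cmod (dser l' (Complex \<sigma> t)))\<^sup>2 / (T\<^sup>2 + t\<^sup>2)) \<partial>lborel)"
    by (intro integral_mono integrable_mult_right dser_mean_square dc dl \<sigma> Tp pt)
  also have "\<dots> = 2 * (M\<^sup>2 + K\<^sup>2) * T\<^sup>2 * (\<integral>t. (cmod (dser l' (Complex \<sigma> t)))\<^sup>2 / (T\<^sup>2 + t\<^sup>2) \<partial>lborel)"
    by (rule integral_mult_right_zero)
  also have "\<dots> \<le> 2 * (M\<^sup>2 + K\<^sup>2) * T\<^sup>2 * (600 * (2 * \<kappa>)\<^sup>2 * bt_const / (T\<^sup>2 * \<alpha>))"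
    unfolding \<sigma>_def using T_ge \<kappa> l'_le
    by (intro mult_left_mono dser_mangoldt_mean_square[OF _ y_ge(2) \<alpha>(2,3)]) (auto simp: l'_def)
  also have "\<dots> = 4800 * \<kappa>\<^sup>2 * bt_const * (M\<^sup>2 + K\<^sup>2) / \<alpha>"
  proof -
    have key: "u \<noteq> 0 \<Longrightarrow> 2 * m * u * (600 * (2 * k)\<^sup>2 * b / (u * d)) = 4800 * k\<^sup>2 * b * m / d" for m u k b d :: real
      by simp
    show ?thesis by (rule key) (use Tp in simp)
  qed
  finally have I: "(\<integral>t. (cmod (dser (dconv l' a) (Complex \<sigma> t)))\<^sup>2 / (\<sigma>\<^sup>2 + t\<^sup>2) \<partial>lborel) \<le> 4800 * \<kappa>\<^sup>2 * bt_const * (M\<^sup>2 + K\<^sup>2) / \<alpha>" .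
  have "(\<Sum>n=1..N. (cmod (Tl n))\<^sup>2 * real n powr (- 3 - 2 * \<alpha>))
     \<le> (\<Sum>n=1..N. 16 * ((cmod (Tl n))\<^sup>2 * (real n powr (- 2 * \<sigma>) - real (Suc n) powr (- 2 * \<sigma>))))"
  proof (rule sum_mono)
    fix n assume "n \<in> {1..N}"
    then have "real n powr (- 1 - 2 * \<sigma>) / 16 \<le> real n powr (- 2 * \<sigma>) - real (Suc n) powr (- 2 * \<sigma>)"
      using \<sigma> by (intro kernel_weight_ge) auto
    moreover have "- 1 - 2 * \<sigma> = - 3 - 2 * \<alpha>" by (simp add: \<sigma>_def)
    ultimately have "real n powr (- 3 - 2 * \<alpha>) \<le> 16 * (real n powr (- 2 * \<sigma>) - real (Suc n) powr (- 2 * \<sigma>))" by simp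
    then have "(cmod (Tl n))\<^sup>2 * real n powr (- 3 - 2 * \<alpha>) \<le> (cmod (Tl n))\<^sup>2 * (16 * (real n powr (- 2 * \<sigma>) - real (Suc n) powr (- 2 * \<sigma>)))"
      by (rule mult_left_mono) simp
    then show "(cmod (Tl n))\<^sup>2 * real n powr (- 3 - 2 * \<alpha>) \<le> 16 * ((cmod (Tl n))\<^sup>2 * (real n powr (- 2 * \<sigma>) - real (Suc n) powr (- 2 * \<sigma>)))"
      by (simp only: mult.left_commute)
  qed
  also have "\<dots> = 16 * (\<Sum>n=1..N. (cmod (Tl n))\<^sup>2 * (real n powr (- 2 * \<sigma>) - real (Suc n) powr (- 2 * \<sigma>)))"
    by (simp only: sum_distrib_left)
  also have "\<dots> \<le> 16 * (\<sigma> / pi * (\<integral>t. (cmod (dser (dconv l' a) (Complex \<sigma> t)))\<^sup>2 / (\<sigma>\<^sup>2 + t\<^sup>2) \<partial>lborel))"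
    unfolding Tl_def by (intro mult_left_mono dser_parseval_le dc \<sigma>) auto
  also have "\<dots> \<le> 16 * (2 / 3 * (4800 * \<kappa>\<^sup>2 * bt_const * (M\<^sup>2 + K\<^sup>2) / \<alpha>))"
  proof (intro mult_left_mono mult_mono I)
    show "\<sigma> / pi \<le> 2 / 3" using \<sigma> pi_gt3 by (intro frac_le) auto
  qed (auto intro!: integral_nonneg_AE AE_I2)
  also have "\<dots> = 51200 * \<kappa>\<^sup>2 * bt_const * (M\<^sup>2 + K\<^sup>2) / \<alpha>"
  proof -
    have "e * a * b * c / d = e * (a * b * c / d)" for a b c d e :: real by (simp only: times_divide_eq_right mult.assoc)
    note this[of 4800 "\<kappa>\<^sup>2" bt_const "M\<^sup>2 + K\<^sup>2" \<alpha>] this[of 51200 "\<kappa>\<^sup>2" bt_const "M\<^sup>2 + K\<^sup>2" \<alpha>]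
    moreover have "16 * (2 / 3 * (4800 * v)) = 51200 * v" for v :: real by simp
    ultimately show ?thesis by (simp only:)
  qed
  finally show ?thesis .
qed

text \<open>With \<alpha> = 2^(- j) one has \<alpha> log n <= 2 on the block, so inserting n^(- 2
  \<alpha>) costs at most exp 4 <= 81. In the Cauchy-Schwarz inequality both the mean square and the
  sum of 1 / n are of order 2^j; their geometric mean cancels the factor 1 / log n, and every block
  costs O(M + K).\<close>

lemma dyadic_block:
  assumes j: "2 ^ j \<le> X" and M: "M \<ge> 0"
    and bound: "\<And>t. \<bar>t\<bar> \<le> T \<Longrightarrow> cmod (dser a (Complex (1 + 1 / 2 ^ j) t) / Complex (1 + 1 / 2 ^ j) t) \<le> M"
  shows "(\<Sum>n | n \<in> {1..N} \<and> 2 ^ j < ln (real n) \<and> ln (real n) \<le> 2 ^ Suc j. cmod (Tl n) / ((real n)\<^sup>2 * ln (real n)))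
     \<le> 3600 * \<kappa> * sqrt bt_const * (M + K)"
proof -
  define B where "B = {n. n \<in> {1..N} \<and> 2 ^ j < ln (real n) \<and> ln (real n) \<le> 2 ^ Suc j}"
  define q where "q = (2::real) ^ j"
  have q: "q \<ge> 1" unfolding q_def by simp
  define \<alpha> where "\<alpha> = 1 / q"
  have \<alpha>: "\<alpha> \<ge> 1 / X" "\<alpha> > 0" "\<alpha> \<le> 1"
    using q j X_ge unfolding \<alpha>_def q_def by (auto simp: field_simps)
  have Bn: "n \<ge> 1" "n \<le> N" "q < ln (real n)" "ln (real n) \<le> 2 * q" if "n \<in> B" for n
    using that by (auto simp: B_def q_def)
  have fB: "finite B" by (simp add: B_def)
  have "(\<Sum>n\<in>B. (cmod (Tl n) / (real n * sqrt (real n)))\<^sup>2) \<le> (\<Sum>n\<in>B. 81 * ((cmod (Tl n))\<^sup>2 * real n powr (- 3 - 2 * \<alpha>)))"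
  proof (rule sum_mono)
    fix n assume n: "n \<in> B"
    have r: "real n > 0" using Bn(1)[OF n] by simp
    have "\<alpha> * ln (real n) \<le> \<alpha> * (2 * q)" using Bn(4)[OF n] \<alpha> by (intro mult_left_mono) auto
    also have "\<dots> = 2" using q by (simp add: \<alpha>_def)
    finally have e: "exp (2 * \<alpha> * ln (real n)) \<le> exp 4" by simp
    have "exp (4::real) = exp 1 ^ 4" by (simp flip: exp_of_nat_mult)
    also have "\<dots> \<le> 3 ^ 4" by (intro power_mono exp_le) auto
    finally have e81: "exp (4::real) \<le> 81" by simp
    have e4: "exp (2 * \<alpha> * ln (real n)) \<le> 81" by (rule order_trans[OF e e81])
    have "1 = exp (2 * \<alpha> * ln (real n)) * exp (- (2 * \<alpha> * ln (real n)))" by (simp flip: exp_add)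
    also have "\<dots> \<le> 81 * exp (- (2 * \<alpha> * ln (real n)))" using e4 by (intro mult_right_mono) auto
    finally have "real n powr (- 3) * 1 \<le> real n powr (- 3) * (81 * exp (- (2 * \<alpha> * ln (real n))))" by (intro mult_left_mono) auto
    also have "exp (- (2 * \<alpha> * ln (real n))) = real n powr (- 2 * \<alpha>)" using r by (simp add: powr_def)
    also have "real n powr (- 3) * (81 * real n powr (- 2 * \<alpha>)) = 81 * real n powr (- 3 + - 2 * \<alpha>)" unfolding powr_add by simp
    finally have p3: "real n powr (- 3) \<le> 81 * real n powr (- 3 - 2 * \<alpha>)" by simp
    have "(cmod (Tl n) / (real n * sqrt (real n)))\<^sup>2 = (cmod (Tl n))\<^sup>2 * real n powr (- 3)"
      using r by (simp add: power_divide power_mult_distrib powr_minus powr_numeral power2_eq_square power3_eq_cube field_simps)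
    also have "\<dots> \<le> (cmod (Tl n))\<^sup>2 * (81 * real n powr (- 3 - 2 * \<alpha>))" using p3 by (rule mult_left_mono) simp
    finally show "(cmod (Tl n) / (real n * sqrt (real n)))\<^sup>2 \<le> 81 * ((cmod (Tl n))\<^sup>2 * real n powr (- 3 - 2 * \<alpha>))"
      by (simp only: mult.left_commute)
  qed
  also have "\<dots> = 81 * (\<Sum>n\<in>B. (cmod (Tl n))\<^sup>2 * real n powr (- 3 - 2 * \<alpha>))" by (simp only: sum_distrib_left)
  also have "\<dots> \<le> 81 * (\<Sum>n=1..N. (cmod (Tl n))\<^sup>2 * real n powr (- 3 - 2 * \<alpha>))"
    by (intro mult_left_mono sum_mono2) (auto simp: B_def)
  also have "\<dots> \<le> 81 * (51200 * \<kappa>\<^sup>2 * bt_const * (M\<^sup>2 + K\<^sup>2) / \<alpha>)"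
    using bound by (intro mult_left_mono dyadic_mean_square[OF \<alpha> M]) (auto simp: \<alpha>_def q_def)
  also have "\<dots> = 4147200 * \<kappa>\<^sup>2 * bt_const * (M\<^sup>2 + K\<^sup>2) * q" by (simp add: \<alpha>_def)
  finally have A: "(\<Sum>n\<in>B. (cmod (Tl n) / (real n * sqrt (real n)))\<^sup>2) \<le> 4147200 * \<kappa>\<^sup>2 * bt_const * (M\<^sup>2 + K\<^sup>2) * q" .
  have "(\<Sum>n\<in>B. (1 / sqrt (real n))\<^sup>2) = (\<Sum>n\<in>B. 1 / real n)" by (intro sum.cong refl) (simp add: power_divide)
  also have "\<dots> \<le> 1 + 2 * q" using Bn q by (intro sum_recip_le fB) auto
  also have "\<dots> \<le> 3 * q" using q by simp
  finally have H: "(\<Sum>n\<in>B. (1 / sqrt (real n))\<^sup>2) \<le> 3 * q" .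
  define W where "W = (\<Sum>n\<in>B. (cmod (Tl n) / (real n * sqrt (real n))) * (1 / sqrt (real n)))"
  have "W\<^sup>2 \<le> (\<Sum>n\<in>B. (cmod (Tl n) / (real n * sqrt (real n)))\<^sup>2) * (\<Sum>n\<in>B. (1 / sqrt (real n))\<^sup>2)"
    unfolding W_def by (rule Cauchy_Schwarz_ineq_sum)
  also have "\<dots> \<le> (4147200 * \<kappa>\<^sup>2 * bt_const * (M\<^sup>2 + K\<^sup>2) * q) * (3 * q)"
    using A H bt_const(1) q by (intro mult_mono) (auto intro!: sum_nonneg)
  also have "\<dots> \<le> (3600 * \<kappa> * sqrt bt_const * (M + K) * q)\<^sup>2"
  proof -
    have "M\<^sup>2 + K\<^sup>2 \<le> (M + K)\<^sup>2" using M K_ge by (simp add: power2_sum)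
    \<comment> \<open>The left constant is 81 * 51200 * 3, and the right one is 3600^2.\<close>
    then have "12441600 * (M\<^sup>2 + K\<^sup>2) \<le> 12960000 * (M + K)\<^sup>2" by (intro mult_mono) auto
    then have "(\<kappa>\<^sup>2 * bt_const * q\<^sup>2) * (12441600 * (M\<^sup>2 + K\<^sup>2)) \<le> (\<kappa>\<^sup>2 * bt_const * q\<^sup>2) * (12960000 * (M + K)\<^sup>2)"
      using bt_const(1) by (intro mult_left_mono) auto
    moreover have "(4147200 * \<kappa>\<^sup>2 * bt_const * (M\<^sup>2 + K\<^sup>2) * q) * (3 * q) = (\<kappa>\<^sup>2 * bt_const * q\<^sup>2) * (12441600 * (M\<^sup>2 + K\<^sup>2))"
      by (simp add: power2_eq_square)
    moreover have "(3600 * \<kappa> * sqrt bt_const * (M + K) * q)\<^sup>2 = (\<kappa>\<^sup>2 * (sqrt bt_const)\<^sup>2 * q\<^sup>2) * (12960000 * (M + K)\<^sup>2)"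
      by (simp only: power_mult_distrib) simp
    moreover have "(sqrt bt_const)\<^sup>2 = bt_const" using bt_const(1) by simp
    ultimately show ?thesis by (simp only:)
  qed
  finally have W: "W \<le> 3600 * \<kappa> * sqrt bt_const * (M + K) * q"
    by (rule power2_le_imp_le) (use \<kappa> bt_const(1) M K_ge q in auto)
  have "(\<Sum>n\<in>B. cmod (Tl n) / ((real n)\<^sup>2 * ln (real n))) \<le> (\<Sum>n\<in>B. (cmod (Tl n) / (real n * sqrt (real n))) * (1 / sqrt (real n)) / q)"
  proof (rule sum_mono)
    fix n assume n: "n \<in> B"
    have r: "real n > 0" using Bn(1)[OF n] by simp
    have lp: "ln (real n) > 0" using Bn(3)[OF n] q by linarith
    have "cmod (Tl n) / ((real n)\<^sup>2 * ln (real n)) \<le> cmod (Tl n) / ((real n)\<^sup>2 * q)"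
      using lp Bn(3)[OF n] q r by (intro divide_left_mono mult_left_mono mult_pos_pos) auto
    also have "(real n)\<^sup>2 * q = (real n * sqrt (real n)) * sqrt (real n) * q" using r by (simp add: power2_eq_square)
    also have "cmod (Tl n) / ((real n * sqrt (real n)) * sqrt (real n) * q) = (cmod (Tl n) / (real n * sqrt (real n))) * (1 / sqrt (real n)) / q"
      by simp
    finally show "cmod (Tl n) / ((real n)\<^sup>2 * ln (real n)) \<le> (cmod (Tl n) / (real n * sqrt (real n))) * (1 / sqrt (real n)) / q" .
  qed
  also have "\<dots> = W / q" unfolding W_def by (simp only: sum_divide_distrib)
  also have "\<dots> \<le> (3600 * \<kappa> * sqrt bt_const * (M + K) * q) / q" using W q by (intro divide_right_mono) auto
  also have "\<dots> = 3600 * \<kappa> * sqrt bt_const * (M + K)" using q by simp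
  finally show ?thesis unfolding B_def .
qed

text \<open>Maximum modulus on the rectangle \<open>[1 + 1 / log x, 2] \<times> [- T, T]\<close>: on the horizontal sides \<open>|F| / |s| \<le> K\<close>
  because \<open>T\<close> is as large as the trivial bound for \<open>F\<close>.\<close>

lemma rectangle_bound:
  assumes N0: "\<And>t. \<bar>t\<bar> \<le> T \<Longrightarrow> cmod (dser a (Complex (1 + 1 / X) t) / Complex (1 + 1 / X) t) \<le> N0" "N0 \<ge> 0"
    and \<alpha>: "1 / X \<le> \<alpha>" "\<alpha> \<le> 1" and t: "\<bar>t\<bar> \<le> T"
  shows "cmod (dser a (Complex (1 + \<alpha>) t) / Complex (1 + \<alpha>) t) \<le> N0 + K"
proof -
  define c where "c = 1 + 1 / X"
  have Xp: "X > 0" using X_ge by simp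
  have c: "c > 1" "c \<le> 2" using X_ge by (auto simp: c_def field_simps)
  have Tp: "T > 0" using T_ge by simp
  define Rc where "Rc = cbox (Complex c (- T)) (Complex 2 T)"
  define G where "G = (\<lambda>s. dser a s / s)"
  have hol: "G holomorphic_on {s. Re s > 1}"
    unfolding G_def holomorphic_on_def
  proof
    fix s :: complex assume s: "s \<in> {s. Re s > 1}"
    then have "dser a field_differentiable (at s)"
      using has_field_derivative_dser[OF a_dabs] by (auto simp: field_differentiable_def)
    moreover have "s \<noteq> 0" using s by auto
    ultimately have "(\<lambda>s. dser a s / s) field_differentiable (at s)"
      by (intro field_differentiable_divide field_differentiable_ident)
    then show "(\<lambda>s. dser a s / s) field_differentiable (at s within {s. Re s > 1})"
      by (rule field_differentiable_at_within)
  qed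
  have sub: "Rc \<subseteq> {s. Re s > 1}" unfolding Rc_def using c by (auto simp: in_cbox_complex_iff)
  have "norm (G (Complex (1 + \<alpha>) t)) \<le> N0 + K"
  proof (rule maximum_modulus_frontier[of G Rc])
    show "G holomorphic_on interior Rc" using hol sub interior_subset[of Rc] by (meson holomorphic_on_subset order_trans)
    show "continuous_on (closure Rc) G"
      using holomorphic_on_imp_continuous_on[OF holomorphic_on_subset[OF hol sub]] by (simp add: Rc_def)
    show "bounded Rc" unfolding Rc_def by (rule bounded_cbox)
    show "Complex (1 + \<alpha>) t \<in> Rc" unfolding Rc_def using \<alpha> t by (auto simp: in_cbox_complex_iff c_def)
    fix z assume z: "z \<in> frontier Rc"
    then have zR: "z \<in> Rc" "z \<notin> interior Rc" by (auto simp: frontier_def Rc_def)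
    obtain u v where uv: "z = Complex u v" by (cases z)
    have b: "c \<le> u" "u \<le> 2" "\<bar>v\<bar> \<le> T" using zR(1) unfolding Rc_def uv by (auto simp: in_cbox_complex_iff)
    have nb: "\<not> (c < u \<and> u < 2 \<and> - T < v \<and> v < T)"
      using zR(2) unfolding Rc_def uv interior_cbox by (auto simp: in_box_complex_iff)
    have "u > 1" using b(1) c(1) by linarith
    then have Fb: "cmod (dser a z) \<le> dnorm a u" using norm_dser_le[of a z] a_dabs[of u] unfolding uv by simp
    have z1: "1 \<le> cmod z" using b c abs_Re_le_cmod[of z] unfolding uv by simp
    consider "u = c" | "u = 2" | "\<bar>v\<bar> = T" using nb b by linarith
    then show "norm (G z) \<le> N0 + K"
    proof cases
      case 1
      then have "norm (G z) \<le> N0" unfolding G_def uv c_def using N0(1)[OF b(3)] by simp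
      then show ?thesis using K_ge by simp
    next
      case 2
      have "dnorm a 2 \<le> (1 + 1 / (2 - 1)) powr \<kappa>" by (rule dnorm_a_le) simp
      then have "cmod (dser a z) \<le> K" using Fb 2 by (simp add: K_def)
      then have "cmod (dser a z) / cmod z \<le> K / 1" using z1 K_ge by (intro frac_le) auto
      then show ?thesis using N0(2) by (simp add: G_def norm_divide)
    next
      case 3
      have "1 / X \<le> u - 1" using b by (simp add: c_def)
      moreover have "u - 1 > 0" using b(1) c(1) by linarith
      ultimately have "cmod (dser a (Complex (1 + (u - 1)) v)) \<le> K * T" by (rule norm_dser_a_le)
      then have F: "cmod (dser a z) \<le> K * T" unfolding uv by simp
      have "T \<le> cmod z" using 3 abs_Im_le_cmod[of z] unfolding uv by simp
      then have "cmod (dser a z) / cmod z \<le> K * T / T" using F Tp K_ge by (intro frac_le) auto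
      then show ?thesis using N0(2) Tp by (simp add: G_def norm_divide)
    qed
  qed
  then show ?thesis by (simp add: G_def)
qed

end

text \<open>The first k terms are bounded by E and the others by a geometric series. The induction
  drops the first term and halves c, which is why c is arbitrary.\<close>

lemma sum_min_halving_le:
  fixes E c :: real
  assumes "E \<ge> 0" "c \<ge> 0"
  shows "(\<Sum>i\<le>m. min E (c * (1 / 2) ^ i)) \<le> real k * E + 2 * c * (1 / 2) ^ k"
  using assms(2)
proof (induction k arbitrary: m c)
  case 0
  have "(\<Sum>i\<le>m. min E (c * (1 / 2) ^ i)) \<le> (\<Sum>i\<le>m. c * (1 / 2) ^ i)" by (intro sum_mono) simp
  also have "\<dots> = c * (\<Sum>i\<le>m. (1 / 2) ^ i)" by (simp only: sum_distrib_left)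
  also have "\<dots> \<le> c * 2"
  proof (rule mult_left_mono)
    have "(\<Sum>i\<le>m. (1 / 2 :: real) ^ i) = 2 - (1 / 2) ^ m" by (induction m) simp_all
    then show "(\<Sum>i\<le>m. (1 / 2 :: real) ^ i) \<le> 2" by simp
  qed (rule 0)
  finally show ?case by simp
next
  case (Suc k)
  show ?case
  proof (cases m)
    case 0
    have "0 \<le> real k * E + 2 * c * (1 / 2) ^ Suc k" using assms(1) Suc.prems by (intro add_nonneg_nonneg mult_nonneg_nonneg) auto
    moreover have "min E c \<le> E" by simp
    ultimately show ?thesis by (simp add: 0 algebra_simps)
  next
    case (Suc m')
    have "(\<Sum>i\<le>m'. min E (c / 2 * (1 / 2) ^ i)) \<le> real k * E + 2 * (c / 2) * (1 / 2) ^ k"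
      using Suc.prems by (intro Suc.IH) simp
    moreover have "(\<Sum>i\<le>m. min E (c * (1 / 2) ^ i)) = min E c + (\<Sum>i\<le>m'. min E (c / 2 * (1 / 2) ^ i))"
      unfolding Suc sum.atMost_Suc_shift by simp
    moreover have "min E c \<le> E" by simp
    ultimately show ?thesis by (simp add: algebra_simps)
  qed
qed

text \<open>The sum is split at k, about M / log 2, where (1/2)^k falls below exp (- M). The k terms
  before it produce the factor M, the geometric tail a multiple of exp (- M).\<close>

lemma sum_min_exp_le:
  assumes M: "M \<ge> (0::real)"
  shows "(\<Sum>i\<le>m. min (exp (- M)) ((1 / 2) ^ i)) \<le> 4 * ((1 + M) * exp (- M))"
proof -
  define k where "k = nat \<lceil>M / ln 2\<rceil>"
  have l2: "ln (2::real) \<ge> 1 / 2" using ln2_ge_two_thirds by simp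
  have k1: "M / ln 2 \<le> real k" unfolding k_def by (rule real_nat_ceiling_ge)
  have "real k \<le> M / ln 2 + 1" unfolding k_def using M by (simp add: of_nat_nat ceiling_correct)
  also have "M / ln 2 \<le> M / (1 / 2)" using M l2 by (intro divide_left_mono) auto
  finally have k2: "real k \<le> 2 * M + 1" by simp
  have "M \<le> real k * ln 2" using k1 by (simp add: divide_le_eq)
  then have "exp (- (real k * ln 2)) \<le> exp (- M)" by simp
  moreover have "exp (- (real k * ln 2)) = (1 / 2) ^ k"
    by (simp add: exp_minus exp_of_nat_mult power_one_over inverse_eq_divide)
  ultimately have k3: "(1 / 2) ^ k \<le> exp (- M)" by simp
  have "(\<Sum>i\<le>m. min (exp (- M)) ((1 / 2) ^ i)) \<le> real k * exp (- M) + 2 * (1 / 2) ^ k"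
    using sum_min_halving_le[of "exp (- M)" 1 m k] by simp
  also have "\<dots> \<le> (2 * M + 1) * exp (- M) + 2 * exp (- M)" using k2 k3 by (intro add_mono mult_right_mono) auto
  also have "\<dots> \<le> 4 * ((1 + M) * exp (- M))"
  proof -
    have "(2 * M + 3) * exp (- M) \<le> (4 + 4 * M) * exp (- M)" using M by (intro mult_right_mono) auto
    then show ?thesis by (simp add: algebra_simps)
  qed
  finally show ?thesis .
qed

lemma ex_dyadic: "v > (1::real) \<Longrightarrow> \<exists>j. 2 ^ j < v \<and> v \<le> 2 ^ Suc j"
proof -
  assume v: "v > 1"
  obtain n where n: "v < 2 ^ n" using real_arch_pow[of 2 v] by auto
  define j where "j = (LEAST j. v \<le> 2 ^ Suc j)"
  have "(2::real) ^ n \<le> 2 ^ Suc n" by simp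
  then have "v \<le> 2 ^ Suc n" using n by linarith
  then have j: "v \<le> 2 ^ Suc j" unfolding j_def by (rule LeastI)
  have "2 ^ j < v"
  proof (cases j)
    case (Suc i)
    then have "\<not> v \<le> 2 ^ Suc i" using not_less_Least[of i "\<lambda>j. v \<le> 2 ^ Suc j"] unfolding j_def by simp
    then show ?thesis using Suc by simp
  qed (use v in simp)
  then show ?thesis using j by blast
qed

context halasz
begin

text \<open>Two bounds for F(s) / s on Re s = 1 + 2^(- j) are combined. The trivial one, (2 *
  2^j)^\<kappa>, is smaller than K T at least by the factor 2^j / X, because \<kappa> >= 1 and 2^j
  <= X. The other one carries the maximum on Re s = 1 + 1 / X to the right. For M <= 0 the minimum
  is the trivial bound, so M may be replaced by max M 0.\<close>

lemma dyadic_block_le: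
  assumes N0: "\<And>t. \<bar>t\<bar> \<le> T \<Longrightarrow> cmod (dser a (Complex (1 + 1 / X) t) / Complex (1 + 1 / X) t) \<le> exp (- M) * T"
    and j: "2 ^ jm \<le> X" "X \<le> 2 ^ Suc jm" "j \<le> jm"
  defines "Mp \<equiv> max M 0"
  shows "(\<Sum>n | n \<in> {1..N} \<and> 2 ^ j < ln (real n) \<and> ln (real n) \<le> 2 ^ Suc j. cmod (Tl n) / ((real n)\<^sup>2 * ln (real n)))
     \<le> 3600 * \<kappa> * sqrt bt_const * (K * T * min (exp (- Mp)) ((1 / 2) ^ (jm - j)) + 2 * K)"
proof -
  define r where "r = (1 / 2 :: real) ^ (jm - j)"
  have r: "0 < r" "r \<le> 1" unfolding r_def by (auto simp: power_le_one)
  have Tp: "T > 0" using T_ge by simp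
  have Kp: "K > 0" using K_ge by simp
  have jj: "(2::real) ^ j \<le> 2 ^ jm" using j(3) by (intro power_increasing) auto
  then have jX: "2 ^ j \<le> X" using j(1) by linarith
  have q: "(2::real) ^ j \<ge> 1" by simp
  have Xp: "X > 0" using X_ge by simp
  define \<alpha> where "\<alpha> = (1 / 2 ^ j :: real)"
  have \<alpha>: "1 / X \<le> \<alpha>" "\<alpha> \<le> 1" "\<alpha> > 0" using jX Xp q unfolding \<alpha>_def by (auto simp: frac_le)
  have triv: "(1 + 1 / \<alpha>) powr \<kappa> \<le> K * T * r"
  proof -
    have "(1 + 1 / \<alpha>) powr \<kappa> \<le> (2 * 2 ^ j) powr \<kappa>" using q \<kappa> by (intro powr_mono2) (auto simp: \<alpha>_def)
    also have "\<dots> = K * (2 ^ j) powr \<kappa>" unfolding K_def by (simp add: powr_mult)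
    also have "(2 ^ j) powr \<kappa> = (X * (2 ^ j / X)) powr \<kappa>" using Xp by simp
    also have "\<dots> = T * (2 ^ j / X) powr \<kappa>" unfolding T_def using Xp by (subst powr_mult) auto
    also have "(2 ^ j / X) powr \<kappa> \<le> (2 ^ j / X) powr 1"
      using jX Xp \<kappa> by (intro powr_mono') auto
    also have "\<dots> = 2 ^ j / X" using Xp by simp
    also have "\<dots> \<le> 2 ^ j / 2 ^ jm" using j(1) Xp by (intro divide_left_mono) auto
    also have "\<dots> = r" unfolding r_def using j(3) by (simp add: power_diff power_one_over)
    finally show ?thesis using Tp Kp by simp
  qed
  have b: "cmod (dser a (Complex (1 + \<alpha>) t) / Complex (1 + \<alpha>) t) \<le> K * T * min (exp (- Mp)) r + K" if t: "\<bar>t\<bar> \<le> T" for t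
  proof -
    have "cmod (dser a (Complex (1 + \<alpha>) t) / Complex (1 + \<alpha>) t) \<le> dnorm a (1 + \<alpha>) / 1"
      unfolding norm_divide
    proof (rule frac_le)
      show "cmod (dser a (Complex (1 + \<alpha>) t)) \<le> dnorm a (1 + \<alpha>)"
        using norm_dser_le[of a "Complex (1 + \<alpha>) t"] a_dabs[of "1 + \<alpha>"] \<alpha> by simp
      then show "0 \<le> dnorm a (1 + \<alpha>)" by (meson norm_ge_zero order_trans)
      show "1 \<le> cmod (Complex (1 + \<alpha>) t)" using abs_Re_le_cmod[of "Complex (1 + \<alpha>) t"] \<alpha> by simp
    qed auto
    also have "\<dots> \<le> K * T * r" using norm_dser_a_le(2)[OF \<alpha>(1,3)] triv by simp
    finally have b1: "cmod (dser a (Complex (1 + \<alpha>) t) / Complex (1 + \<alpha>) t) \<le> K * T * r" .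
    have b2: "cmod (dser a (Complex (1 + \<alpha>) t) / Complex (1 + \<alpha>) t) \<le> exp (- M) * T + K"
      using N0 t \<alpha> Tp by (intro rectangle_bound) auto
    show ?thesis
    proof (cases "r \<le> exp (- Mp)")
      case True
      then show ?thesis using b1 Kp by (simp add: min_def)
    next
      case False
      moreover have "Mp \<ge> 0" unfolding Mp_def by simp
      ultimately have "Mp > 0" using r(2) by (cases "Mp = 0") auto
      then have "Mp = M" unfolding Mp_def by auto
      moreover have "exp (- M) * T * 1 \<le> exp (- M) * T * K" using K_ge Tp by (intro mult_left_mono) auto
      ultimately show ?thesis using b2 False by (simp add: min_def mult_ac)
    qed
  qed
  have m0: "0 \<le> K * T * min (exp (- Mp)) r" using Kp Tp r by simp
  then have "0 \<le> K * T * min (exp (- Mp)) r + K" using Kp by linarith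
  from dyadic_block[OF jX this] b
  show ?thesis unfolding \<alpha>_def r_def by (simp add: algebra_simps)
qed

text \<open>The number of dyadic blocks up to X is at most 3 Y, so the constant part 2 K of each
  block bound adds up to 6 K Y; the minima add up to a multiple of (1 + M) exp (- M), with M cut off
  at 0.\<close>

lemma large_part_le:
  assumes N0: "\<And>t. \<bar>t\<bar> \<le> T \<Longrightarrow> cmod (dser a (Complex (1 + 1 / X) t) / Complex (1 + 1 / X) t) \<le> exp (- M) * T"
  defines "Mp \<equiv> max M 0"
  shows "(\<Sum>n | n \<in> {1..N} \<and> ln (real n) > L. cmod (Tl n) / ((real n)\<^sup>2 * ln (real n)))
     \<le> 3600 * \<kappa> * sqrt bt_const * (4 * K * (T * ((1 + Mp) * exp (- Mp))) + 6 * K * Y)"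
proof -
  define g where "g n = cmod (Tl n) / ((real n)\<^sup>2 * ln (real n))" for n
  have g0: "g n \<ge> 0" for n unfolding g_def by (cases "n = 0") auto
  define B where "B j = {n. n \<in> {1..N} \<and> 2 ^ j < ln (real n) \<and> ln (real n) \<le> 2 ^ Suc j}" for j
  define A where "A = {n. n \<in> {1..N} \<and> ln (real n) > L}"
  define c where "c = 3600 * \<kappa> * sqrt bt_const"
  have c0: "c \<ge> 0" unfolding c_def using \<kappa> bt_const(1) by simp
  obtain jm where jm: "2 ^ jm < X" "X \<le> 2 ^ Suc jm" using ex_dyadic[of X] X_ge by auto
  have "ln (2 ^ jm) \<le> ln X" using jm(1) by (intro ln_mono) auto
  then have "real jm * ln 2 \<le> Y" by (simp add: ln_realpow Y_def)
  moreover have "ln (2::real) \<ge> 1 / 2" using ln2_ge_two_thirds by simp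
  then have "real jm * (1 / 2) \<le> real jm * ln 2" by (intro mult_left_mono) auto
  ultimately have jmY: "real jm + 1 \<le> 3 * Y" using Y_ge by linarith
  have "(\<Sum>n\<in>A. g n) \<le> (\<Sum>n\<in>A. \<Sum>j\<le>jm. if n \<in> B j then g n else 0)"
  proof (rule sum_mono)
    fix n assume n: "n \<in> A"
    then have "ln (real n) > 1" using L_ge by (auto simp: A_def)
    then obtain j where j: "2 ^ j < ln (real n)" "ln (real n) \<le> 2 ^ Suc j" using ex_dyadic by blast
    then have nB: "n \<in> B j" using n by (auto simp: A_def B_def)
    have "(2::real) ^ j < 2 ^ Suc jm" using j(1) jm(2) ln_le_X[of n] n by (simp add: A_def)
    then have "j < Suc jm" by (rule power_less_imp_less_exp[rotated]) simp
    then have "(if n \<in> B j then g n else 0) \<le> (\<Sum>j\<le>jm. if n \<in> B j then g n else 0)"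
      using g0 by (intro member_le_sum) auto
    then show "g n \<le> (\<Sum>j\<le>jm. if n \<in> B j then g n else 0)" using nB by simp
  qed
  also have "\<dots> = (\<Sum>j\<le>jm. \<Sum>n\<in>A. if n \<in> B j then g n else 0)" by (rule sum.swap)
  also have "\<dots> \<le> (\<Sum>j\<le>jm. c * (K * T * min (exp (- Mp)) ((1 / 2) ^ (jm - j)) + 2 * K))"
  proof (rule sum_mono)
    fix j assume j: "j \<in> {..jm}"
    have "(\<Sum>n\<in>A. if n \<in> B j then g n else 0) = (\<Sum>n\<in>A \<inter> B j. g n)"
      by (rule sum.inter_restrict[symmetric]) (simp add: A_def)
    also have "\<dots> \<le> (\<Sum>n\<in>B j. g n)" using g0 by (intro sum_mono2) (auto simp: B_def)
    also have "\<dots> \<le> c * (K * T * min (exp (- Mp)) ((1 / 2) ^ (jm - j)) + 2 * K)"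
      unfolding g_def B_def c_def Mp_def using j jm by (intro dyadic_block_le N0) auto
    finally show "(\<Sum>n\<in>A. if n \<in> B j then g n else 0) \<le> c * (K * T * min (exp (- Mp)) ((1 / 2) ^ (jm - j)) + 2 * K)" .
  qed
  also have "\<dots> = c * (K * T * (\<Sum>j\<le>jm. min (exp (- Mp)) ((1 / 2) ^ (jm - j))) + 2 * K * (real jm + 1))"
    by (simp add: sum_distrib_left sum.distrib algebra_simps)
  also have "(\<Sum>j\<le>jm. min (exp (- Mp)) ((1 / 2) ^ (jm - j))) = (\<Sum>i\<le>jm. min (exp (- Mp)) ((1 / 2 :: real) ^ i))"
    by (rule sum.reindex_bij_witness[of _ "\<lambda>i. jm - i" "\<lambda>i. jm - i"]) auto
  also have "c * (K * T * (\<Sum>i\<le>jm. min (exp (- Mp)) ((1 / 2) ^ i)) + 2 * K * (real jm + 1))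
      \<le> c * (K * T * (4 * ((1 + Mp) * exp (- Mp))) + 2 * K * (3 * Y))"
    using c0 K_ge T_ge jmY by (intro mult_left_mono add_mono sum_min_exp_le) (auto simp: Mp_def)
  also have "\<dots> = c * (4 * K * (T * ((1 + Mp) * exp (- Mp))) + 6 * K * Y)" by simp
  finally show ?thesis unfolding g_def A_def c_def .
qed

lemma J_bound:
  assumes N0: "\<And>t. \<bar>t\<bar> \<le> T \<Longrightarrow> cmod (dser a (Complex (1 + 1 / X) t) / Complex (1 + 1 / X) t) \<le> exp (- M) * T"
  defines "Mp \<equiv> max M 0"
  shows "J \<le> (12 * K * (8 * \<kappa> * (36 * \<kappa> + 1)) powr \<kappa> + 43200 * \<kappa> * sqrt bt_const * K) * (T * ((1 + Mp) * exp (- Mp)) + Y powr \<kappa>)"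
proof -
  define W where "W = T * ((1 + Mp) * exp (- Mp))"
  have W0: "W \<ge> 0" unfolding W_def Mp_def using T_ge by simp
  define A where "A = 12 * K * (8 * \<kappa> * (36 * \<kappa> + 1)) powr \<kappa>"
  define c where "c = \<kappa> * sqrt bt_const * K"
  have A0: "A \<ge> 0" unfolding A_def using K_ge by simp
  have c0: "c \<ge> 0" unfolding c_def using K_ge \<kappa> bt_const(1) by simp
  have YY: "Y \<le> Y powr \<kappa>" using powr_mono[of 1 \<kappa> Y] \<kappa> Y_ge by simp
  have Lk: "L powr \<kappa> = (8 * \<kappa> * (36 * \<kappa> + 1)) powr \<kappa> * Y powr \<kappa>"
  proof -
    have "L = 8 * \<kappa> * (36 * \<kappa> + 1) * Y" unfolding L_def ln_y by simp
    then show ?thesis using \<kappa> Y_ge by (simp only: powr_mult)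
  qed
  have "J \<le> A * Y powr \<kappa> + 2 * (3600 * \<kappa> * sqrt bt_const * (4 * K * W + 6 * K * Y))"
    using J_le large_part_le[OF N0] unfolding Lk A_def W_def Mp_def by simp
  also have "\<dots> = A * Y powr \<kappa> + c * (28800 * W + 43200 * Y)" unfolding c_def by (simp add: algebra_simps)
  also have "\<dots> \<le> A * (W + Y powr \<kappa>) + c * (43200 * (W + Y powr \<kappa>))"
    using A0 c0 W0 YY by (intro add_mono mult_left_mono) auto
  also have "\<dots> = (A + 43200 * \<kappa> * sqrt bt_const * K) * (W + Y powr \<kappa>)" unfolding c_def by (simp add: algebra_simps)
  finally show ?thesis unfolding A_def W_def .
qed

text \<open>A maximum over all n is taken because the recursion for S(n) involves S(n div d). The
  weight is 1 at n = x, changes by at most a factor 3 under division by d <= y, and makes the n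
  below sqrt x negligible when x is large.\<close>

definition Q where "Q = Max ((\<lambda>n. cmod (S n) / real n * (real n / x) powr (1 / ln y)) ` {1..N})"

lemma N_ge: "N \<ge> 1"
proof -
  have "x \<ge> 1" using x_ge by simp
  then show ?thesis unfolding N_def by linarith
qed

lemma Q_ge: "n \<in> {1..N} \<Longrightarrow> cmod (S n) / real n * (real n / x) powr (1 / ln y) \<le> Q"
  unfolding Q_def by (rule Max_ge) auto

lemma Q_nonneg: "Q \<ge> 0"
  using Q_ge[of 1] N_ge by (intro order_trans[OF _ Q_ge[of 1]]) auto

lemma S_le_Q:
  assumes n: "n \<in> {1..N}"
  shows "cmod (S n) \<le> Q * (real n * (x / real n) powr (1 / ln y))"
proof -
  define \<theta> where "\<theta> = 1 / ln y"
  have p: "real n / x > 0" "x / real n > 0" using n x_pos by auto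
  have "cmod (S n) = (cmod (S n) / real n * (real n / x) powr \<theta>) * (real n * (x / real n) powr \<theta>)"
  proof -
    have "(real n / x) powr \<theta> * (x / real n) powr \<theta> = ((real n / x) * (x / real n)) powr \<theta>"
      using p by (simp only: powr_mult)
    also have "\<dots> = 1" using n x_pos by simp
    finally have 1: "(real n / x) powr \<theta> * (x / real n) powr \<theta> = 1" .
    have "cmod (S n) = cmod (S n) / real n * real n * ((real n / x) powr \<theta> * (x / real n) powr \<theta>)"
      unfolding 1 using n by simp
    then show ?thesis by (simp only: mult_ac)
  qed
  also have "\<dots> \<le> Q * (real n * (x / real n) powr \<theta>)"
    using Q_ge[OF n] unfolding \<theta>_def by (intro mult_right_mono) auto
  finally show ?thesis unfolding \<theta>_def .
qed

text \<open>Passing from n to n div d changes the bound given by Q by 1 / d times d^(1 / log y), and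
  the last factor is at most exp 1 <= 3 for d <= y. Summing \<Lambda>(d) / d gives the constant 3 *
  18.\<close>

lemma Ts_le_Q:
  assumes n: "n \<in> {1..N}"
  shows "Ts n * (real n / x) powr (1 / ln y) \<le> 54 * ln y * Q * real n"
proof -
  define \<theta> where "\<theta> = 1 / ln y"
  have \<theta>: "0 < \<theta>" "\<theta> \<le> 1" using ln_y_ge by (auto simp: \<theta>_def)
  have np: "real n > 0" using n by simp
  have yp: "y > 0" using y_ge by simp
  have yt: "y powr \<theta> \<le> 3" using exp_le ln_y_ge yp by (simp add: powr_def \<theta>_def)
  have summand: "cmod (S (n div d)) * (real n / x) powr \<theta> \<le> 3 * Q * real n * (1 / real d)" if d: "d \<in> {1..n}" "real d \<le> y" for d
  proof -
    define m where "m = n div d"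
    have m: "m \<in> {1..N}" using d n by (auto simp: m_def div_greater_zero_iff Suc_le_eq intro: order_trans[OF div_le_dividend])
    have mp: "real m > 0" using m by simp
    have dp: "real d > 0" using d by simp
    have md: "real m \<le> real n / real d" unfolding m_def by (rule of_nat_div_le_of_nat)
    have "cmod (S m) * (real n / x) powr \<theta> \<le> (Q * (real m * (x / real m) powr \<theta>)) * (real n / x) powr \<theta>"
      using S_le_Q[OF m] unfolding \<theta>_def by (intro mult_right_mono) auto
    also have "\<dots> = Q * (real m powr (1 - \<theta>) * real n powr \<theta>)"
    proof -
      have "(x / real m) powr \<theta> * (real n / x) powr \<theta> = ((x / real m) * (real n / x)) powr \<theta>"
        using mp np x_pos by (simp only: powr_mult)
      also have "(x / real m) * (real n / x) = real n / real m" using x_pos by simp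
      also have "(real n / real m) powr \<theta> = real n powr \<theta> / real m powr \<theta>" using np mp by (simp add: powr_divide)
      finally have "(Q * (real m * (x / real m) powr \<theta>)) * (real n / x) powr \<theta> = Q * (real m * (real n powr \<theta> / real m powr \<theta>))"
        by (simp only: mult.assoc)
      moreover have "real m powr (1 - \<theta>) = real m / real m powr \<theta>" using mp by (simp add: powr_diff)
      ultimately show ?thesis by simp
    qed
    \<comment> \<open>The exponent 1 - \<theta> is nonnegative, so rounding n / d down to m only
      decreases the power.\<close>
    also have "\<dots> \<le> Q * ((real n / real d) powr (1 - \<theta>) * real n powr \<theta>)"
      using md \<theta> mp Q_nonneg by (intro mult_left_mono mult_right_mono powr_mono2) auto
    also have "(real n / real d) powr (1 - \<theta>) = (real n / real d) / (real n powr \<theta> / real d powr \<theta>)"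
      using np dp by (simp add: powr_diff powr_divide)
    also have "Q * ((real n / real d) / (real n powr \<theta> / real d powr \<theta>) * real n powr \<theta>) = Q * (real n * (1 / real d)) * real d powr \<theta>"
      using np dp by simp
    also have "\<dots> \<le> Q * (real n * (1 / real d)) * 3"
    proof (rule mult_left_mono)
      have "real d powr \<theta> \<le> y powr \<theta>" using d dp \<theta> by (intro powr_mono2) auto
      then show "real d powr \<theta> \<le> 3" using yt by linarith
    qed (use Q_nonneg in simp)
    finally show ?thesis unfolding m_def by (simp add: mult_ac)
  qed
  have "Ts n * (real n / x) powr \<theta> = (\<Sum>d | d \<in> {1..n} \<and> real d \<le> y. mangoldt d * (cmod (S (n div d)) * (real n / x) powr \<theta>))"
    unfolding Ts_def sum_distrib_right by (simp only: mult.assoc)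
  also have "\<dots> \<le> (\<Sum>d | d \<in> {1..n} \<and> real d \<le> y. mangoldt d * (3 * Q * real n * (1 / real d)))"
    using summand by (intro sum_mono mult_left_mono mangoldt_nonneg) auto
  also have "\<dots> = 3 * Q * real n * (\<Sum>d | d \<in> {1..n} \<and> real d \<le> y. mangoldt d / real d)"
    by (simp add: sum_distrib_left mult_ac)
  also have "\<dots> \<le> 3 * Q * real n * (\<Sum>d | 1 \<le> d \<and> real d \<le> y. mangoldt d / real d)"
  proof (intro mult_left_mono sum_mono2)
    show "finite {d. 1 \<le> d \<and> real d \<le> y}" using finite_nat_le_real by (rule rev_finite_subset) auto
  qed (use Q_nonneg mangoldt_nonneg in auto)
  also have "\<dots> \<le> 3 * Q * real n * (18 * ln y)" using Q_nonneg by (intro mult_left_mono sum_small_mangoldt) auto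
  finally show ?thesis unfolding \<theta>_def by (simp add: mult_ac)
qed

lemma Tl_R_le:
  assumes n: "n \<in> {1..N}"
  shows "cmod (Tl n) + R n \<le> real n * ((8 * \<kappa> * bt_const + 12 * \<kappa> * bt_const * K + 1) * (J + 1))"
proof -
  have "cmod (Tl n) \<le> (\<Sum>d | d \<in> {1..n} \<and> real d > y. 2 * \<kappa> * (mangoldt d * cmod (S (n div d))))"
    unfolding Tl_eq
  proof (rule sum_norm_le)
    fix d
    have "cmod (l d) * cmod (S (n div d)) \<le> 2 * \<kappa> * mangoldt d * cmod (S (n div d))" by (intro mult_right_mono l_le2) auto
    then show "cmod (l d * S (n div d)) \<le> 2 * \<kappa> * (mangoldt d * cmod (S (n div d)))" by (simp add: norm_mult mult_ac)
  qed
  also have "\<dots> = 2 * \<kappa> * (\<Sum>d | d \<in> {1..n} \<and> real d > y. mangoldt d * cmod (S (n div d)))" by (simp only: sum_distrib_left)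
  also have "\<dots> \<le> 2 * \<kappa> * (real n * (4 * bt_const * J + 6 * bt_const * K))"
    using \<kappa> n by (intro mult_left_mono large_primes_bound) auto
  finally have 1: "cmod (Tl n) \<le> real n * (8 * \<kappa> * bt_const * J + 12 * \<kappa> * bt_const * K)" by (simp add: algebra_simps)
  have "R n \<le> (\<Sum>m=1..n - 1. real n * (cmod (S m) / (real m)\<^sup>2))"
    unfolding R_def
  proof (rule sum_mono)
    fix m assume m: "m \<in> {1..n - 1}"
    have "cmod (S m) / real m * 1 \<le> cmod (S m) / real m * (real n / real m)" using m by (intro mult_left_mono) auto
    then show "cmod (S m) / real m \<le> real n * (cmod (S m) / (real m)\<^sup>2)" by (simp add: power2_eq_square mult_ac)
  qed
  also have "\<dots> \<le> (\<Sum>m=1..N. real n * (cmod (S m) / (real m)\<^sup>2))" using n by (intro sum_mono2) auto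
  also have "\<dots> = real n * J" unfolding J_def by (simp only: sum_distrib_left)
  finally have "cmod (Tl n) + R n \<le> real n * (8 * \<kappa> * bt_const * J + 12 * \<kappa> * bt_const * K) + real n * J" using 1 by linarith
  also have "\<dots> = real n * (8 * \<kappa> * bt_const * J + 12 * \<kappa> * bt_const * K + J)" by (simp add: algebra_simps)
  also have "\<dots> \<le> real n * ((8 * \<kappa> * bt_const + 12 * \<kappa> * bt_const * K + 1) * (J + 1))"
  proof (rule mult_left_mono)
    have "0 \<le> 8 * \<kappa> * bt_const" "0 \<le> 12 * \<kappa> * bt_const * K * J" using \<kappa> bt_const(1) K_ge J_nonneg by auto
    then show "8 * \<kappa> * bt_const * J + 12 * \<kappa> * bt_const * K + J \<le> (8 * \<kappa> * bt_const + 12 * \<kappa> * bt_const * K + 1) * (J + 1)"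
      by (simp add: algebra_simps)
  qed simp
  finally show ?thesis .
qed

text \<open>The maximum defining \<open>Q\<close> reproduces itself: the primes \<open>\<le> y\<close> contribute at most \<open>Q / 2\<close> because
  \<open>log y\<close> is small compared with \<open>log x\<close>.\<close>

lemma Q_le:
  assumes big: "X \<ge> 1728 * \<kappa>\<^sup>2 * Y" "X \<ge> 8 * \<kappa> * (\<kappa> + 1) * Y\<^sup>2"
  shows "Q \<le> (4 * (8 * \<kappa> * bt_const + 12 * \<kappa> * bt_const * K + 1) + 3 * K) * (J + 1) / X"
proof -
  define C where "C = 8 * \<kappa> * bt_const + 12 * \<kappa> * bt_const * K + 1"
  define \<theta> where "\<theta> = 1 / ln y"
  have C0: "C \<ge> 0" unfolding C_def using \<kappa> bt_const(1) K_ge by simp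
  have Xp: "X > 0" using X_ge by simp
  have Kp: "K > 0" using K_ge by simp
  have \<theta>: "\<theta> > 0" using ln_y_ge by (simp add: \<theta>_def)
  have "Q \<in> (\<lambda>n. cmod (S n) / real n * (real n / x) powr (1 / ln y)) ` {1..N}"
    unfolding Q_def using N_ge by (intro Max_in) auto
  then obtain n where n: "n \<in> {1..N}" and Qn: "Q = cmod (S n) / real n * (real n / x) powr \<theta>"
    unfolding \<theta>_def by blast
  have np: "real n > 0" using n by simp
  have nx: "real n \<le> x" using n N_le by simp
  show ?thesis
  proof (cases "ln (real n) \<ge> X / 2")
    case True
    define p where "p = (real n / x) powr \<theta>"
    have p: "0 \<le> p" "p \<le> 1" unfolding p_def using np nx x_pos \<theta> by (auto intro!: powr_le1)
    \<comment> \<open>The d <= y will return \<open>432 * \<kappa>\<^sup>2 * Y * Q\<close>, which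
      the first condition on X makes at most half of this left-hand side.\<close>
    have "Q * (X / 2) \<le> Q * ln (real n)" using True Q_nonneg by (rule mult_left_mono)
    also have "\<dots> = cmod (S n) * ln (real n) * p / real n" unfolding Qn p_def by simp
    also have "\<dots> \<le> (cmod (Tl n) + 2 * \<kappa> * Ts n + R n) * p / real n"
      using S_ln_le[of n] n p by (intro divide_right_mono mult_right_mono) auto
    also have "\<dots> = ((cmod (Tl n) + R n) * p + 2 * \<kappa> * (Ts n * p)) / real n" by (simp add: algebra_simps)
    also have "\<dots> \<le> (real n * (C * (J + 1)) * 1 + 2 * \<kappa> * (54 * ln y * Q * real n)) / real n"
    proof (intro divide_right_mono add_mono mult_left_mono)
      have "(cmod (Tl n) + R n) * p \<le> (real n * (C * (J + 1))) * p"
        using Tl_R_le[OF n] p unfolding C_def by (intro mult_right_mono) auto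
      also have "\<dots> \<le> (real n * (C * (J + 1))) * 1" using p C0 J_nonneg by (intro mult_left_mono) auto
      finally show "(cmod (Tl n) + R n) * p \<le> real n * (C * (J + 1)) * 1" .
      show "Ts n * p \<le> 54 * ln y * Q * real n" using Ts_le_Q[OF n] unfolding p_def \<theta>_def .
    qed (use \<kappa> in auto)
    also have "\<dots> = C * (J + 1) + 108 * \<kappa> * ln y * Q" using np by (simp add: field_simps)
    also have "108 * \<kappa> * ln y * Q = Q * (432 * \<kappa>\<^sup>2 * Y)" unfolding ln_y by (simp add: power2_eq_square)
    also have "\<dots> \<le> Q * (X / 4)" using big(1) Q_nonneg by (intro mult_left_mono) auto
    finally have "Q * X \<le> 4 * C * (J + 1)" by (simp add: algebra_simps)
    also have "\<dots> \<le> (4 * C + 3 * K) * (J + 1)" using Kp J_nonneg by (intro mult_right_mono) auto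
    finally show ?thesis unfolding C_def using Xp by (simp add: le_divide_eq)
  next
    case False
    \<comment> \<open>For n below sqrt x the weight is at most exp (- X / (2 log y)). The second
      condition on X makes this at most 1 / (T X), enough to reduce the trivial bound 3 K T to 3 K /
      X.\<close>
    have "cmod (S n) / real n \<le> (\<Sum>k=1..n. cmod (a k)) / real n" by (intro divide_right_mono S_abs_le) simp
    also have "\<dots> \<le> (\<Sum>k=1..n. cmod (a k) / real k)"
      unfolding sum_divide_distrib by (intro sum_mono divide_left_mono) auto
    also have "\<dots> \<le> 3 * K * T" using n by (intro sum_abs_a_div_N) auto
    finally have E: "cmod (S n) / real n \<le> 3 * K * T" .
    have "(real n / x) powr \<theta> = exp (\<theta> * (ln (real n) - X))"
      using np x_pos by (simp add: powr_def ln_div X_def)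
    also have "\<dots> \<le> exp (\<theta> * (- X / 2))" using False \<theta> by (intro exp_le_cancel_iff[THEN iffD2] mult_left_mono) auto
    also have "\<dots> \<le> exp (- ((\<kappa> + 1) * Y))"
    proof -
      have kY: "8 * \<kappa> * Y > 0" using \<kappa> Y_ge by simp
      have "8 * \<kappa> * Y * ((\<kappa> + 1) * Y) \<le> X" using big(2) by (simp add: power2_eq_square mult_ac)
      then have "(\<kappa> + 1) * Y \<le> X / (8 * \<kappa> * Y)" using kY by (simp add: le_divide_eq mult.commute)
      also have "\<dots> = - (\<theta> * (- X / 2))" unfolding \<theta>_def ln_y by simp
      finally show ?thesis by simp
    qed
    also have "\<dots> = 1 / (T * X)"
    proof -
      have "T * X = exp (\<kappa> * Y) * exp Y" unfolding T_def Y_def using Xp by (simp add: powr_def)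
      also have "\<dots> = exp ((\<kappa> + 1) * Y)" by (simp add: algebra_simps flip: exp_add)
      finally show ?thesis by (simp add: exp_minus inverse_eq_divide)
    qed
    finally have pw: "(real n / x) powr \<theta> \<le> 1 / (T * X)" .
    have "Q \<le> 3 * K * T * (1 / (T * X))" unfolding Qn using E pw Kp T_ge by (intro mult_mono) auto
    also have "\<dots> = 3 * K / X" using T_ge by simp
    also have "\<dots> \<le> (4 * C + 3 * K) * (J + 1) / X"
    proof (rule divide_right_mono)
      have "3 * K * 1 \<le> (4 * C + 3 * K) * (J + 1)" using C0 J_nonneg Kp by (intro mult_mono) auto
      then show "3 * K \<le> (4 * C + 3 * K) * (J + 1)" by simp
    qed (use Xp in simp)
    finally show ?thesis unfolding C_def .
  qed
qed

lemma halasz_bound: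
  assumes N0: "\<And>t. \<bar>t\<bar> \<le> T \<Longrightarrow> cmod (dser a (Complex (1 + 1 / X) t) / Complex (1 + 1 / X) t) \<le> exp (- M) * T"
    and big: "X \<ge> 1728 * \<kappa>\<^sup>2 * Y" "X \<ge> 8 * \<kappa> * (\<kappa> + 1) * Y\<^sup>2"
  defines "Mp \<equiv> max M 0"
  shows "cmod (S N) \<le> (4 * (8 * \<kappa> * bt_const + 12 * \<kappa> * bt_const * K + 1) + 3 * K)
      * (12 * K * (8 * \<kappa> * (36 * \<kappa> + 1)) powr \<kappa> + 43200 * \<kappa> * sqrt bt_const * K + 1)
      * ((1 + Mp) * exp (- Mp) * x * X powr (\<kappa> - 1) + x / X * Y powr \<kappa>)"
proof -
  define C where "C = 4 * (8 * \<kappa> * bt_const + 12 * \<kappa> * bt_const * K + 1) + 3 * K"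
  define D where "D = 12 * K * (8 * \<kappa> * (36 * \<kappa> + 1)) powr \<kappa> + 43200 * \<kappa> * sqrt bt_const * K"
  define W where "W = (1 + Mp) * exp (- Mp)"
  have C0: "C \<ge> 0" unfolding C_def using \<kappa> bt_const(1) K_ge by simp
  have W0: "W \<ge> 0" unfolding W_def Mp_def by simp
  have Xp: "X > 0" using X_ge by simp
  have Np: "N \<in> {1..N}" using N_ge by simp
  have Nx: "real N \<le> x" using N_le[of N] by simp
  \<comment> \<open>Rounding x down to N loses nothing: the exponent 1 / log y is at most 1, so N (x
    / N)^(1 / log y) <= x.\<close>
  have "(x / real N) powr (1 / ln y) \<le> (x / real N) powr 1"
    using Nx Np ln_y_ge by (intro powr_mono) auto
  then have "real N * (x / real N) powr (1 / ln y) \<le> real N * (x / real N)" using Nx Np x_pos by (intro mult_left_mono) auto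
  also have "\<dots> = x" using Np by simp
  finally have "Q * (real N * (x / real N) powr (1 / ln y)) \<le> Q * x" using Q_nonneg by (rule mult_left_mono)
  then have "cmod (S N) \<le> Q * x" using S_le_Q[OF Np] by linarith
  also have "\<dots> \<le> C * (J + 1) / X * x" using Q_le[OF big] x_pos unfolding C_def by (intro mult_right_mono) auto
  also have "\<dots> = C * (x / X) * (J + 1)" by simp
  also have "\<dots> \<le> C * (x / X) * ((D + 1) * (T * W + Y powr \<kappa>))"
  proof (rule mult_left_mono)
    have "J \<le> D * (T * W + Y powr \<kappa>)" using J_bound[OF N0] unfolding D_def W_def Mp_def .
    moreover have "1 \<le> Y powr \<kappa>" using Y_ge \<kappa> by (intro ge_one_powr_ge_zero) auto
    moreover have "0 \<le> T * W" using W0 T_ge by simp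
    ultimately show "J + 1 \<le> (D + 1) * (T * W + Y powr \<kappa>)" by (simp add: algebra_simps)
  qed (use C0 x_pos Xp in simp)
  also have "\<dots> = C * (D + 1) * (W * x * (T / X) + x / X * Y powr \<kappa>)" by (simp add: algebra_simps add_divide_distrib)
  also have "T / X = X powr (\<kappa> - 1)" unfolding T_def using Xp by (simp add: powr_diff)
  finally show ?thesis unfolding C_def D_def W_def .
qed

end

section \<open>Grouping ideals by norm\<close>

text \<open>The value type is general because the grouping is applied to complex coefficients as
  well as to real absolute values.\<close>

definition norm_coeff :: "(complex set \<Rightarrow> 'a::comm_monoid_add) \<Rightarrow> nat \<Rightarrow> 'a" where
  "norm_coeff g n = (\<Sum>\<aa> | \<aa> \<in> nonzero_ideals \<and> ideal_norm \<aa> = n. g \<aa>)"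

lemma finite_ideals_norm_eq: "finite {\<aa>. \<aa> \<in> nonzero_ideals \<and> ideal_norm \<aa> = n}"
  by (rule finite_subset[OF _ finite_ideals_norm_le[of "real n"]]) auto

lemma has_sum_norm_coeff:
  fixes g :: "complex set \<Rightarrow> 'a::{topological_comm_monoid_add,t3_space}"
  assumes "(g has_sum v) nonzero_ideals"
  shows "(norm_coeff g has_sum v) UNIV"
proof (rule has_sum_SigmaD)
  show "((\<lambda>(n, \<aa>). g \<aa>) has_sum v) (SIGMA n:UNIV. {\<aa>. \<aa> \<in> nonzero_ideals \<and> ideal_norm \<aa> = n})"
    using assms
    by (subst has_sum_reindex_bij_witness[where j = snd and i = "\<lambda>\<aa>. (ideal_norm \<aa>, \<aa>)" and T = nonzero_ideals and h = g and s' = v]) auto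
  show "((\<lambda>\<aa>. (\<lambda>(n, \<aa>). g \<aa>) (n, \<aa>)) has_sum norm_coeff g n) {\<aa>. \<aa> \<in> nonzero_ideals \<and> ideal_norm \<aa> = n}" for n
    unfolding norm_coeff_def using finite_ideals_norm_eq by (intro has_sum_finiteI) auto
qed

lemma norm_coeff_dirichlet_term: "norm_coeff (dirichlet_term f s) n = norm_coeff f n * of_nat n powr (- s)"
  unfolding norm_coeff_def sum_distrib_right by (rule sum.cong) (auto simp: dirichlet_term_def)

lemma dabs_norm_coeff:
  assumes "(\<lambda>\<aa>. cmod (dirichlet_term f s \<aa>)) summable_on nonzero_ideals"
  shows "dabs (norm_coeff f) (Re s)"
  unfolding dabs_abs_summable
proof (rule summable_on_comparison_test)
  show "norm_coeff (\<lambda>\<aa>. cmod (dirichlet_term f s \<aa>)) summable_on UNIV"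
    using has_sum_norm_coeff[OF has_sum_infsum[OF assms]] by (rule has_sum_imp_summable)
  show "cmod (norm_coeff f n * of_nat n powr (- s)) \<le> norm_coeff (\<lambda>\<aa>. cmod (dirichlet_term f s \<aa>)) n" for n
    unfolding norm_coeff_dirichlet_term[symmetric] unfolding norm_coeff_def by (rule norm_sum)
qed simp

lemma has_sum_imp_dser_norm_coeff:
  assumes "(dirichlet_term f s has_sum v) nonzero_ideals"
  shows "dser (norm_coeff f) s = v"
  using has_sum_norm_coeff[OF assms] unfolding dser_def norm_coeff_dirichlet_term by (rule infsumI)

lemma sum_ideals_norm_le:
  "(\<Sum>\<aa> | \<aa> \<in> nonzero_ideals \<and> real (ideal_norm \<aa>) \<le> x. g \<aa>) = (\<Sum>n=1..nat \<lfloor>x\<rfloor>. norm_coeff g n)"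
proof -
  define A where "A = {\<aa>. \<aa> \<in> nonzero_ideals \<and> real (ideal_norm \<aa>) \<le> x}"
  have le: "real n \<le> x \<longleftrightarrow> n \<le> nat \<lfloor>x\<rfloor>" if "n > 0" for n
  proof -
    have "n \<le> nat \<lfloor>x\<rfloor> \<longleftrightarrow> int n \<le> \<lfloor>x\<rfloor>" using that by linarith
    then show ?thesis by (simp add: le_floor_iff)
  qed
  have "ideal_norm ` A \<subseteq> {1..nat \<lfloor>x\<rfloor>}"
    using ideal_norm_pos le by (fastforce simp: A_def Suc_le_eq)
  then have "sum g A = (\<Sum>n=1..nat \<lfloor>x\<rfloor>. \<Sum>\<aa> | \<aa> \<in> A \<and> ideal_norm \<aa> = n. g \<aa>)"
    using finite_ideals_norm_le[of x] by (intro sum.group[symmetric]) (auto simp: A_def)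
  also have "\<dots> = (\<Sum>n=1..nat \<lfloor>x\<rfloor>. norm_coeff g n)"
  proof (intro sum.cong refl)
    fix n assume "n \<in> {1..nat \<lfloor>x\<rfloor>}"
    then have "{\<aa>. \<aa> \<in> A \<and> ideal_norm \<aa> = n} = {\<aa>. \<aa> \<in> nonzero_ideals \<and> ideal_norm \<aa> = n}"
      using le by (auto simp: A_def)
    then show "(\<Sum>\<aa> | \<aa> \<in> A \<and> ideal_norm \<aa> = n. g \<aa>) = norm_coeff g n" unfolding norm_coeff_def by simp
  qed
  finally show ?thesis unfolding A_def .
qed

lemma norm_coeff_1:
  assumes "multiplicative_on_ideals f"
  shows "norm_coeff f 1 = 1"
proof -
  have "gauss_ints \<in> nonzero_ideals"
    unfolding nonzero_ideals_eq by (rule image_eqI[of _ _ 1]) (auto simp: gmult_def gauss_ints_def)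
  then have "{\<aa>. \<aa> \<in> nonzero_ideals \<and> ideal_norm \<aa> = 1} = {gauss_ints}"
    using ideal_norm_eq_1 by blast
  then show ?thesis using assms by (simp add: norm_coeff_def multiplicative_on_ideals_def)
qed

locale mangoldt_bounded =
  fixes \<kappa> :: real and f \<Lambda>\<^sub>f :: "complex set \<Rightarrow> complex"
  assumes \<kappa>: "\<kappa> \<ge> 1" and mult: "multiplicative_on_ideals f" and abs_conv: "dirichlet_abs_conv f"
    and coeffs: "mangoldt_coeffs f \<Lambda>\<^sub>f"
    and \<Lambda>_le: "\<And>\<aa>. \<aa> \<in> nonzero_ideals \<Longrightarrow> cmod (\<Lambda>\<^sub>f \<aa>) \<le> \<kappa> * ideal_mangoldt \<aa>"
begin

definition a where "a = norm_coeff f"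
definition l where "l = norm_coeff \<Lambda>\<^sub>f"

lemma a_dabs: "\<sigma> > 1 \<Longrightarrow> dabs a \<sigma>"
  using abs_conv dabs_norm_coeff[of f "of_real \<sigma>"] by (simp add: a_def dirichlet_abs_conv_def)

lemma dirichlet_series_eq: "Re s > 1 \<Longrightarrow> dirichlet_series f s = dser a s"
proof -
  assume s: "Re s > 1"
  have "(\<lambda>\<aa>. cmod (dirichlet_term f s \<aa>)) summable_on nonzero_ideals"
    using abs_conv s unfolding dirichlet_abs_conv_def by blast
  then have "(dirichlet_term f s has_sum dirichlet_series f s) nonzero_ideals"
    unfolding dirichlet_series_def by (rule has_sum_infsum[OF abs_summable_summable])
  then show ?thesis unfolding a_def by (rule has_sum_imp_dser_norm_coeff[symmetric])
qed

lemma l_le: "cmod (l n) \<le> \<kappa> * gauss_mangoldt n"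
proof -
  have "cmod (l n) \<le> (\<Sum>\<aa> | \<aa> \<in> nonzero_ideals \<and> ideal_norm \<aa> = n. \<kappa> * ideal_mangoldt \<aa>)"
    unfolding l_def norm_coeff_def using \<Lambda>_le by (intro sum_norm_le) auto
  also have "\<dots> \<le> \<kappa> * gauss_mangoldt n"
    unfolding sum_distrib_left[symmetric] using \<kappa> by (intro mult_left_mono sum_ideal_mangoldt_le) auto
  finally show ?thesis .
qed

lemma l_dabs: "\<sigma> > 1 \<Longrightarrow> dabs l \<sigma>"
proof (rule dabs_comparison[OF dabs_cmult[OF dabs_gauss_mangoldt, of \<sigma> "of_real \<kappa>"]])
  show "cmod (l n) \<le> cmod (of_real \<kappa> * of_real (gauss_mangoldt n))" for n
    using l_le[of n] \<kappa> gauss_mangoldt_nonneg[of n] by (simp add: norm_mult)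
qed

lemma a1: "a 1 = 1" unfolding a_def by (rule norm_coeff_1[OF mult])

lemma l1: "l 1 = 0" using l_le[of 1] by (simp add: gauss_mangoldt_def)

lemma dser_l:
  assumes s: "Re s > 1"
  shows "dser l s = dser (\<lambda>n. of_real (ln (real n)) * a n) s / dser a s"
proof -
  have "(dirichlet_series f has_field_derivative - dser (\<lambda>n. of_real (ln (real n)) * a n) s) (at s)"
  proof (rule has_field_derivative_transform_within_open)
    show "(dser a has_field_derivative - dser (\<lambda>n. of_real (ln (real n)) * a n) s) (at s)"
      using a_dabs s by (rule has_field_derivative_dser)
    show "open {s. Re s > 1}" by (rule open_halfspace_Re_gt)
  qed (use s in \<open>auto simp: dirichlet_series_eq\<close>)
  then have "deriv (dirichlet_series f) s = - dser (\<lambda>n. of_real (ln (real n)) * a n) s" by (rule DERIV_imp_deriv)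
  moreover have "dser l s = - (deriv (dirichlet_series f) s / dirichlet_series f s)"
    unfolding l_def using coeffs s by (intro has_sum_imp_dser_norm_coeff) (auto simp: mangoldt_coeffs_def)
  ultimately show ?thesis using s by (simp add: dirichlet_series_eq)
qed

text \<open>By \<open>dser_l\<close> both sides have the same Dirichlet series wherever F does not
  vanish. At this stage that is known only for large real \<sigma>, where F is close to a(1) = 1; at
  a zero of F the quotient F' / F would be 0 by the convention for division. Uniqueness from a
  half-line is enough, and nonvanishing for Re s > 1 follows afterwards.\<close>

lemma conv:
  assumes n: "n > 0"
  shows "of_real (ln (real n)) * a n = dconv l a n"
proof -
  define c where "c n = of_real (ln (real n)) * a n + (- 1) * dconv l a n" for n
  have dl: "dabs (\<lambda>n. of_real (ln (real n)) * a n) \<sigma>" if "\<sigma> > 1" for \<sigma> using a_dabs that by (rule dabs_ln)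
  have dc: "dabs (\<lambda>n. (- 1) * dconv l a n) \<sigma>" if "\<sigma> > 1" for \<sigma>
    using that by (intro dabs_cmult dabs_dconv a_dabs l_dabs)
  have "((\<lambda>\<sigma>. dser a (of_real \<sigma>)) \<longlongrightarrow> 1) at_top" using dser_at_top[OF a_dabs[of 2]] a1 by simp
  then have "eventually (\<lambda>\<sigma>. dser a (of_real \<sigma>) \<noteq> 0) at_top" by (rule tendsto_imp_eventually_ne) simp
  then obtain \<sigma>1 where \<sigma>1: "\<And>\<sigma>. \<sigma> \<ge> \<sigma>1 \<Longrightarrow> dser a (of_real \<sigma>) \<noteq> 0" unfolding eventually_at_top_linorder by blast
  define \<sigma>0 where "\<sigma>0 = max 2 \<sigma>1"
  have "c n = 0"
  proof (rule dser_unique[of c \<sigma>0, OF _ _ n])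
    show "dabs c \<sigma>0" unfolding c_def by (rule dabs_add[OF dl dc]) (auto simp: \<sigma>0_def)
    fix \<sigma> assume \<sigma>: "\<sigma> \<ge> \<sigma>0"
    then have s: "\<sigma> > 1" "dser a (of_real \<sigma>) \<noteq> 0" using \<sigma>1 by (auto simp: \<sigma>0_def)
    have "dser c (of_real \<sigma>) = dser (\<lambda>n. of_real (ln (real n)) * a n) (of_real \<sigma>) + (- 1) * dser (dconv l a) (of_real \<sigma>)"
      unfolding c_def using dl dc s by (subst dser_add) (auto simp only: dser_cmult Re_complex_of_real)
    also have "dser (dconv l a) (of_real \<sigma>) = dser l (of_real \<sigma>) * dser a (of_real \<sigma>)"
      using l_dabs a_dabs s by (intro dser_dconv) auto
    also have "\<dots> = dser (\<lambda>n. of_real (ln (real n)) * a n) (of_real \<sigma>)"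
      using s by (subst dser_l) auto
    finally show "dser c (of_real \<sigma>) = 0" by simp
  qed
  then show ?thesis unfolding c_def by simp
qed

text \<open>The supremum is finite by absolute convergence, and positive because F is an exponential
  and hence nonzero at t = 0. So the equation for M has exactly one solution, and the description in
  \<open>halasz_M\<close> denotes it.\<close>

lemma halasz_max_ge:
  assumes x: "ln x > 0"
  shows "\<bar>t\<bar> \<le> ln x powr \<kappa> \<Longrightarrow>
      cmod (dser a (Complex (1 + 1 / ln x) t) / Complex (1 + 1 / ln x) t) \<le> exp (- halasz_M \<kappa> f x) * ln x powr \<kappa>"
proof -
  define c where "c = 1 + 1 / ln x"
  have c: "c > 1" using x by (simp add: c_def)
  define g where "g t = cmod (dirichlet_series f (Complex c t) / Complex c t)" for t
  have g: "g t = cmod (dser a (Complex c t) / Complex c t)" for t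
    unfolding g_def using c by (subst dirichlet_series_eq) auto
  have "g t \<le> dnorm a c / 1" for t
    unfolding g norm_divide
  proof (rule frac_le)
    show "cmod (dser a (Complex c t)) \<le> dnorm a c"
      using norm_dser_le[of a "Complex c t"] a_dabs[OF c] by simp
    show "1 \<le> cmod (Complex c t)" using abs_Re_le_cmod[of "Complex c t"] c by simp
  qed (auto simp: dnorm_nonneg)
  then have bdd: "bdd_above (g ` {t. \<bar>t\<bar> \<le> ln x powr \<kappa>})" by (intro bdd_aboveI2[of _ _ "dnorm a c"]) auto
  have H: "halasz_max \<kappa> f x = (SUP t\<in>{t. \<bar>t\<bar> \<le> ln x powr \<kappa>}. g t)" unfolding halasz_max_def g_def c_def ..
  have ge: "g t \<le> halasz_max \<kappa> f x" if "\<bar>t\<bar> \<le> ln x powr \<kappa>" for t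
    unfolding H using that by (intro cSUP_upper bdd) auto
  have "dser a (Complex c 0) \<noteq> 0" using c by (subst dser_eq_exp[OF a_dabs l_dabs a1 l1 conv]) auto
  moreover have "Complex c 0 \<noteq> 0" using c by (simp add: complex_eq_iff)
  ultimately have "g 0 > 0" unfolding g by simp
  then have pos: "halasz_max \<kappa> f x > 0" using ge[of 0] by simp
  have Tp: "ln x powr \<kappa> > 0" using x by simp
  define M where "M = - ln (halasz_max \<kappa> f x / ln x powr \<kappa>)"
  have M: "halasz_max \<kappa> f x = exp (- M) * ln x powr \<kappa>" unfolding M_def using pos Tp by simp
  have "halasz_M \<kappa> f x = M"
    unfolding halasz_M_def
  proof (rule the_equality[where P = "\<lambda>M. halasz_max \<kappa> f x = exp (- M) * ln x powr \<kappa>", OF M])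
    fix M' assume "halasz_max \<kappa> f x = exp (- M') * ln x powr \<kappa>"
    then have "exp (- M') = exp (- M)" using M Tp by simp
    then show "M' = M" by simp
  qed
  then show "\<bar>t\<bar> \<le> ln x powr \<kappa> \<Longrightarrow>
      cmod (dser a (Complex (1 + 1 / ln x) t) / Complex (1 + 1 / ln x) t) \<le> exp (- halasz_M \<kappa> f x) * ln x powr \<kappa>"
    using ge[of t] M unfolding g c_def by simp
qed

text \<open>Rankin's trick at \<sigma> = 2, meant for the x below a bound that depends only on
  \<kappa>.\<close>

lemma sum_trivial_bound:
  assumes x: "x \<ge> 3"
  shows "cmod (\<Sum>n=1..nat \<lfloor>x\<rfloor>. a n) \<le> x\<^sup>2 * 2 powr \<kappa>"
proof -
  have "cmod (\<Sum>n=1..nat \<lfloor>x\<rfloor>. a n) \<le> (\<Sum>n=1..nat \<lfloor>x\<rfloor>. x\<^sup>2 * (cmod (a n) * real n powr - 2))"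
  proof (rule sum_norm_le)
    fix n assume n: "n \<in> {1..nat \<lfloor>x\<rfloor>}"
    then have nx: "real n \<le> x" "real n > 0" using x by (auto simp: le_nat_iff le_floor_iff)
    have "1 \<le> x\<^sup>2 / (real n)\<^sup>2" using nx by (simp add: power_mono)
    then have "cmod (a n) * 1 \<le> cmod (a n) * (x\<^sup>2 / (real n)\<^sup>2)" by (intro mult_left_mono) auto
    then show "cmod (a n) \<le> x\<^sup>2 * (cmod (a n) * real n powr - 2)"
      using nx by (simp add: powr_minus powr_numeral field_simps)
  qed
  also have "\<dots> = x\<^sup>2 * (\<Sum>n=1..nat \<lfloor>x\<rfloor>. cmod (a n) * real n powr - 2)" by (simp only: sum_distrib_left)
  also have "\<dots> \<le> x\<^sup>2 * dnorm a 2" by (intro mult_left_mono sum_le_dnorm a_dabs) auto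
  also have "\<dots> \<le> x\<^sup>2 * 2 powr \<kappa>"
    using dnorm_le_powr[OF a_dabs a1 l_le _ conv, of 2] \<kappa> by (intro mult_left_mono) auto
  finally show ?thesis .
qed

end

section \<open>Conclusion for all x\<close>

lemma eventually_parameters:
  fixes \<kappa> :: real
  shows "\<exists>X0\<ge>1. \<forall>X\<ge>X0. ln X \<ge> 1 \<and> X \<ge> 1728 * \<kappa>\<^sup>2 * ln X \<and> X \<ge> 8 * \<kappa> * (\<kappa> + 1) * (ln X)\<^sup>2"
proof -
  have "eventually (\<lambda>X. ln X \<ge> (1::real)) at_top"
    using eventually_ge_at_top[of "exp 1"]
  proof eventually_elim
    case (elim X)
    moreover have "X > 0" using elim exp_gt_zero[of 1] by linarith
    ultimately show ?case by (simp add: ln_ge_iff)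
  qed
  moreover have "eventually (\<lambda>X. X \<ge> c * ln X) at_top" for c :: real
  proof -
    have "((\<lambda>X. c * ln X / X) \<longlongrightarrow> 0) at_top" by real_asymp
    then have "eventually (\<lambda>X. c * ln X / X < 1) at_top" by (rule order_tendstoD) simp
    then show ?thesis using eventually_gt_at_top[of 0] by eventually_elim (simp add: divide_less_eq)
  qed
  moreover have "eventually (\<lambda>X. X \<ge> c * (ln X)\<^sup>2) at_top" for c :: real
  proof -
    have "((\<lambda>X. c * (ln X)\<^sup>2 / X) \<longlongrightarrow> 0) at_top" by real_asymp
    then have "eventually (\<lambda>X. c * (ln X)\<^sup>2 / X < 1) at_top" by (rule order_tendstoD) simp
    then show ?thesis using eventually_gt_at_top[of 0] by eventually_elim (simp add: divide_less_eq)
  qed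
  ultimately have "eventually (\<lambda>X. ln X \<ge> 1 \<and> X \<ge> 1728 * \<kappa>\<^sup>2 * ln X \<and> X \<ge> 8 * \<kappa> * (\<kappa> + 1) * (ln X)\<^sup>2) at_top"
    by (intro eventually_conj)
  then obtain X1 where "\<forall>X\<ge>X1. ln X \<ge> 1 \<and> X \<ge> 1728 * \<kappa>\<^sup>2 * ln X \<and> X \<ge> 8 * \<kappa> * (\<kappa> + 1) * (ln X)\<^sup>2"
    unfolding eventually_at_top_linorder by blast
  then show ?thesis by (intro exI[of _ "max 1 X1"]) simp
qed

theorem theorem1p4:
  fixes \<kappa> :: real
  assumes "\<kappa> \<ge> 1"
  shows "\<exists>C::real. \<forall>(f :: complex set \<Rightarrow> complex) (\<Lambda>\<^sub>f :: complex set \<Rightarrow> complex).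
    multiplicative_on_ideals f \<longrightarrow>
    dirichlet_abs_conv f \<longrightarrow>
    mangoldt_coeffs f \<Lambda>\<^sub>f \<longrightarrow>
    (\<forall>\<aa>\<in>nonzero_ideals. cmod (\<Lambda>\<^sub>f \<aa>) \<le> \<kappa> * ideal_mangoldt \<aa>) \<longrightarrow>
    (\<forall>x::real. x \<ge> 3 \<longrightarrow>
       cmod (\<Sum>\<aa> | \<aa> \<in> nonzero_ideals \<and> real (ideal_norm \<aa>) \<le> x. f \<aa>)
         \<le> C * ((1 + halasz_M_plus \<kappa> f x) * exp (- halasz_M_plus \<kappa> f x) * x * ln x powr (\<kappa> - 1)
                 + x / ln x * ln (ln x) powr \<kappa>))"
proof -
  obtain X0 where X0: "X0 \<ge> 1" and big: "\<And>X. X \<ge> X0 \<Longrightarrow> ln X \<ge> 1"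
      "\<And>X. X \<ge> X0 \<Longrightarrow> X \<ge> 1728 * \<kappa>\<^sup>2 * ln X" "\<And>X. X \<ge> X0 \<Longrightarrow> X \<ge> 8 * \<kappa> * (\<kappa> + 1) * (ln X)\<^sup>2"
    using eventually_parameters[of \<kappa>] by blast
  define K :: real where "K = 2 powr \<kappa>"
  define C1 where "C1 = (4 * (8 * \<kappa> * bt_const + 12 * \<kappa> * bt_const * K + 1) + 3 * K)
      * (12 * K * (8 * \<kappa> * (36 * \<kappa> + 1)) powr \<kappa> + 43200 * \<kappa> * sqrt bt_const * K + 1)"
  \<comment> \<open>Covers the x with log x < X0, where X0 depends only on \<kappa>: there the sum
    is at most (exp X0)^2 K, while the second term of the bound is at least (log log 3)^\<kappa>,
    which is positive because log 3 > 1.\<close>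
  define C2 where "C2 = (exp X0)\<^sup>2 * K / ln (ln 3) powr \<kappa>"
  note ln3 = ln3_gt_1
  show ?thesis
  proof (intro exI[of _ "max C1 C2"] allI impI)
    fix f \<Lambda>\<^sub>f :: "complex set \<Rightarrow> complex" and x :: real
    assume f: "multiplicative_on_ideals f" "dirichlet_abs_conv f" "mangoldt_coeffs f \<Lambda>\<^sub>f"
        "\<forall>\<aa>\<in>nonzero_ideals. cmod (\<Lambda>\<^sub>f \<aa>) \<le> \<kappa> * ideal_mangoldt \<aa>" and x: "x \<ge> 3"
    interpret F: mangoldt_bounded \<kappa> f \<Lambda>\<^sub>f by unfold_locales (use f assms in auto)
    define Mp where "Mp = halasz_M_plus \<kappa> f x"
    have lnx: "ln 3 \<le> ln x" using x by simp
    then have lnx1: "ln x > 1" using ln3 by linarith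
    have lnlnx: "ln (ln 3) \<le> ln (ln x)" using lnx ln3 by simp
    have lnln3: "ln (ln (3::real)) > 0" using ln3 by simp
    define E1 where "E1 = (1 + Mp) * exp (- Mp) * x * ln x powr (\<kappa> - 1)"
    define E2 where "E2 = x / ln x * ln (ln x) powr \<kappa>"
    have E1: "E1 \<ge> 0" unfolding E1_def Mp_def halasz_M_plus_def using x by simp
    have E2: "E2 \<ge> ln (ln 3) powr \<kappa>"
    proof -
      have "1 \<le> x / ln x" using lnx1 x ln_le_minus_one[of x] by (simp add: le_divide_eq)
      moreover have "ln (ln 3) powr \<kappa> \<le> ln (ln x) powr \<kappa>" using lnlnx lnln3 assms by (intro powr_mono2) auto
      ultimately have "1 * ln (ln 3) powr \<kappa> \<le> x / ln x * ln (ln x) powr \<kappa>" by (intro mult_mono) auto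
      then show ?thesis unfolding E2_def by simp
    qed
    moreover have "ln (ln (3::real)) powr \<kappa> > 0" using lnln3 by simp
    ultimately have E2p: "E2 > 0" by linarith
    have "cmod (\<Sum>n=1..nat \<lfloor>x\<rfloor>. F.a n) \<le> max C1 C2 * (E1 + E2)"
    proof (cases "ln x \<ge> X0")
      case True
      interpret H: halasz \<kappa> F.a F.l x
        by unfold_locales (use assms F.a_dabs F.a1 F.l_le F.conv big(1)[OF True] lnx1 x in auto)
      have "cmod (H.S H.N) \<le> C1 * (E1 + E2)"
        using H.halasz_bound[of "halasz_M \<kappa> f x"] F.halasz_max_ge[of x] lnx1 big(2,3)[OF True]
        unfolding H.X_def H.T_def H.Y_def H.K_def C1_def K_def E1_def E2_def Mp_def halasz_M_plus_def by simp
      also have "\<dots> \<le> max C1 C2 * (E1 + E2)" using E1 E2p by (intro mult_right_mono) auto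
      finally show ?thesis unfolding H.S_def H.N_def .
    next
      case False
      have "x = exp (ln x)" using x by simp
      also have "\<dots> \<le> exp X0" using False by simp
      finally have xX: "x\<^sup>2 \<le> (exp X0)\<^sup>2" using x by (intro power_mono) auto
      have "cmod (\<Sum>n=1..nat \<lfloor>x\<rfloor>. F.a n) \<le> x\<^sup>2 * K" unfolding K_def by (rule F.sum_trivial_bound[OF x])
      also have "\<dots> \<le> (exp X0)\<^sup>2 * K" using xX by (intro mult_right_mono) (auto simp: K_def)
      also have "\<dots> = C2 * ln (ln 3) powr \<kappa>" unfolding C2_def using lnln3 by simp
      also have "\<dots> \<le> max C1 C2 * (E1 + E2)"
        using E1 E2 by (intro mult_mono) (auto simp: C2_def K_def le_max_iff_disj)
      finally show ?thesis .
    qed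
    then show "cmod (\<Sum>\<aa> | \<aa> \<in> nonzero_ideals \<and> real (ideal_norm \<aa>) \<le> x. f \<aa>)
         \<le> max C1 C2 * ((1 + halasz_M_plus \<kappa> f x) * exp (- halasz_M_plus \<kappa> f x) * x * ln x powr (\<kappa> - 1)
                 + x / ln x * ln (ln x) powr \<kappa>)"
      unfolding sum_ideals_norm_le E1_def E2_def Mp_def F.a_def .
  qed
qed

end
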